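(* Let $A$ be a standard graded ring that is finitely generated over a field $k:=A_0$. Set $n:=\dim A$ and $e:=\operatorname{edim} A$, and let $\mathfrak{m}$ denote the homogeneous maximal ideal of $A$. Suppose there exists an integer $d$ such that for each integer $j$ with $j<n$, one has $$H^j_{\mathfrak{m}}(A)=[H^j_{\mathfrak{m}}(A)]_d.$$ Set $s_j:=\operatorname{rank}_k\,[H^j_{\mathfrak{m}}(A)]_d$. Then: (1) The kernel of the natural map $\phi^n_{\mathfrak{m}}\colon H^n(\mathfrak{m};\,A)\to H^n_{\mathfrak{m}}(A)$ has Hilbert series $$\sum_i \operatorname{rank}_k\big[\ker\phi^n_{\mathfrak{m}}\big]_i\,T^i = s_{n-1}\binom{e}{1}T^{d-1}+s_{n-2}\binom{e}{2}T^{d-2}+\cdots+s_0\binom{e}{n}T^{d-n}.$$ (2) If $\mathfrak{a}$ is an $\mathfrak{m}$-primary ideal that is minimally generated by $r$ homogeneous elements, each of degree $t$, then the kernel of the natural map $H^n(\mathfrak{a};\,A)\to H^n_{\mathfrak{m}}(A)$ has Hilbert series $$s_{n-1}\binom{r}{1}T^{d-t}+s_{n-2}\binom{r}{2}T^{d-2t}+\cdots+s_0\binom{r}{n}T^{d-nt}.$$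
   Context: Standard graded means $\mathbb{N}$-graded and generated as an $A_0$-algebra by elements of degree $1$; $\operatorname{edim}A$ is the minimal number of generators of $\mathfrak{m}$, equivalently $\operatorname{rank}_k A_1$. For a graded module $M$, $[M]_i$ is its degree $i$ component, $M(s)$ is the shifted module with $[M(s)]_i=[M]_{s+i}$, and $\operatorname{rank}$ means dimension as a $k$-vector space. Local cohomology modules carry their natural $\mathbb{Z}$-grading, so the hypothesis says that $H^j_{\mathfrak{m}}(A)$ is concentrated in the single degree $d$ for all $j<n$. For a homogeneous element $z\in A$, let $K^\bullet(z;A)$ be the complex $0\to A\xrightarrow{\,z\,}A(\deg z)\to 0$ and $C^\bullet(z;A)$ the Čech complex $0\to A\to A_z\to 0$, both in cohomological degrees $0,1$. There is a degree-preserving map of complexes $K^\bullet(z;A)\to C^\bullet(z;A)$ given by the identity in cohomological degree $0$ and by $a\mapsto a/z$ in cohomological degree $1$. For a sequence of homogeneous elements $\boldsymbol{z}=z_1,\dots,z_t$ put $K^\bullet(\boldsymbol{z};A):=\bigotimes_i K^\bullet(z_i;A)$ (the graded cohomological Koszul complex) and $C^\bullet(\boldsymbol{z};A):=\bigotimes_i C^\bullet(z_i;A)$ (the Čech complex, whose cohomology is $H^\bullet_{\boldsymbol{z}A}(A)$). The tensor product of the maps $K^\bullet(z_i;A)\to C^\bullet(z_i;A)$ induces degree-preserving maps $H^m(\boldsymbol{z};A)\to H^m_{\boldsymbol{z}A}(A)$ on cohomology, called the natural maps. For a homogeneous ideal $\mathfrak{a}$ of $A$, $H^\bullet(\mathfrak{a};A)$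 denotes the cohomology of the Koszul complex $K^\bullet(\boldsymbol{z};A)$ on a minimal set $\boldsymbol{z}$ of homogeneous generators of $\mathfrak{a}$, and the natural map $H^m(\mathfrak{a};A)\to H^m_{\mathfrak{a}}(A)$ is the natural map $H^m(\boldsymbol{z};A)\to H^m_{\boldsymbol{z}A}(A)$ for this $\boldsymbol{z}$; when $\mathfrak{a}$ is $\mathfrak{m}$-primary, $H^m_{\mathfrak{a}}(A)=H^m_{\mathfrak{m}}(A)$. *)

theory Defs
  imports
    "HOL-Algebra.Ideal"
    "HOL-Algebra.Generated_Rings"
    "HOL-Library.Extended_Nat"
    "HOL-Computational_Algebra.Formal_Laurent_Series"
    "Jordan_Normal_Form.Missing_VectorSpace"
begin

section \<open>Standard graded algebras\<close>

locale graded_ring = cring A for A (structure) +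
  fixes G :: "nat \<Rightarrow> 'a set"
  assumes component_subgroup: "additive_subgroup (G i) A"
    and component_mult: "\<lbrakk> a \<in> G i; b \<in> G j \<rbrakk> \<Longrightarrow> a \<otimes> b \<in> G (i + j)"
    and decomposition: "a \<in> carrier A \<Longrightarrow>
      \<exists>!f. (\<forall>i. f i \<in> G i) \<and> finite {i. f i \<noteq> \<zero>} \<and> a = (\<Oplus>i\<in>{i. f i \<noteq> \<zero>}. f i)"

definition base_field :: "('a, 'm) ring_scheme \<Rightarrow> (nat \<Rightarrow> 'a set) \<Rightarrow> ('a, 'm) ring_scheme" where
  "base_field A G = A\<lparr>carrier := G 0\<rparr>"

text \<open>A standard graded ring that is finitely generated over the field \<open>k = A\<^sub>0\<close>.\<close>

locale standard_graded_algebra = graded_ring +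
  assumes field_base: "field (base_field A G)"
    and finitely_generated:
      "\<exists>S. finite S \<and> S \<subseteq> carrier A \<and> generate_ring A (G 0 \<union> S) = carrier A"
    and generated_in_degree_one: "generate_ring A (G 0 \<union> G 1) = carrier A"

definition irrelevant_ideal :: "('a, 'm) ring_scheme \<Rightarrow> (nat \<Rightarrow> 'a set) \<Rightarrow> 'a set" where
  "irrelevant_ideal A G = Idl\<^bsub>A\<^esub> (\<Union>i\<in>{1..}. G i)"

definition krull_dim :: "('a, 'm) ring_scheme \<Rightarrow> enat" where
  "krull_dim A = Sup {enat m | m. \<exists>P :: nat \<Rightarrow> 'a set.
     (\<forall>i\<le>m. primeideal (P i) A) \<and> (\<forall>i<m. P i \<subset> P (Suc i))}"

definition edim :: "('a, 'm) ring_scheme \<Rightarrow> (nat \<Rightarrow> 'a set) \<Rightarrow> nat" where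
  "edim A G = (LEAST e. \<exists>S. finite S \<and> card S = e \<and> S \<subseteq> carrier A
     \<and> Idl\<^bsub>A\<^esub> S = irrelevant_ideal A G)"

definition homogeneous_generators ::
    "('a, 'm) ring_scheme \<Rightarrow> (nat \<Rightarrow> 'a set) \<Rightarrow> 'a list \<Rightarrow> 'a set \<Rightarrow> bool" where
  "homogeneous_generators A G zs \<aa> \<longleftrightarrow> set zs \<subseteq> (\<Union>i. G i) \<and> Idl\<^bsub>A\<^esub> (set zs) = \<aa>"

definition minimal_homogeneous_generators ::
    "('a, 'm) ring_scheme \<Rightarrow> (nat \<Rightarrow> 'a set) \<Rightarrow> 'a list \<Rightarrow> 'a set \<Rightarrow> bool" where
  "minimal_homogeneous_generators A G zs \<aa> \<longleftrightarrow>
     homogeneous_generators A G zs \<aa> \<and> distinct zs \<and> (\<forall>S. S \<subset> set zs \<longrightarrow> Idl\<^bsub>A\<^esub> S \<noteq> \<aa>)"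

definition primary_to :: "('a, 'm) ring_scheme \<Rightarrow> 'a set \<Rightarrow> 'a set \<Rightarrow> bool" where
  "primary_to A \<pp> \<aa> \<longleftrightarrow> ideal \<aa> A \<and> \<aa> \<noteq> carrier A
     \<and> (\<forall>a\<in>carrier A. \<forall>b\<in>carrier A.
          a \<otimes>\<^bsub>A\<^esub> b \<in> \<aa> \<longrightarrow> a \<in> \<aa> \<or> (\<exists>m::nat. b [^]\<^bsub>A\<^esub> m \<in> \<aa>))
     \<and> {a \<in> carrier A. \<exists>m::nat. a [^]\<^bsub>A\<^esub> m \<in> \<aa>} = \<pp>"

text \<open>The degree of a homogeneous element; the choice of \<open>LEAST\<close> matters only for \<open>\<zero>\<close>.\<close>

definition hdeg :: "(nat \<Rightarrow> 'a set) \<Rightarrow> 'a \<Rightarrow> nat" where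
  "hdeg G z = (LEAST p. z \<in> G p)"

definition int_component :: "('a, 'm) ring_scheme \<Rightarrow> (nat \<Rightarrow> 'a set) \<Rightarrow> int \<Rightarrow> 'a set" where
  "int_component A G i = (if i < 0 then {\<zero>\<^bsub>A\<^esub>} else G (nat i))"


section \<open>Localization\<close>

text \<open>The fraction \<open>a / s\<close> is the class of all pairs equivalent to \<open>(a, s)\<close>, and \<open>localization A S\<close>
  is \<open>S\<^sup>-\<^sup>1A\<close> for a multiplicative set \<open>S\<close>, with its ring structure and its \<open>A\<close>-module structure.
  The unions below are unions of copies of one and the same fraction, one for each choice of
  representatives.\<close>

definition fraction :: "('a, 'm) ring_scheme \<Rightarrow> 'a set \<Rightarrow> 'a \<Rightarrow> 'a \<Rightarrow> ('a \<times> 'a) set" where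
  "fraction A S a s = {(b, t). b \<in> carrier A \<and> t \<in> S
     \<and> (\<exists>u\<in>S. u \<otimes>\<^bsub>A\<^esub> (t \<otimes>\<^bsub>A\<^esub> a) = u \<otimes>\<^bsub>A\<^esub> (s \<otimes>\<^bsub>A\<^esub> b))}"

definition localization ::
    "('a, 'm) ring_scheme \<Rightarrow> 'a set \<Rightarrow> ('a, ('a \<times> 'a) set) module" where
  "localization A S =
    \<lparr> carrier = {fraction A S a s | a s. a \<in> carrier A \<and> s \<in> S},
      monoid.mult = (\<lambda>X Y. \<Union>(a, s)\<in>X. \<Union>(b, t)\<in>Y. fraction A S (a \<otimes>\<^bsub>A\<^esub> b) (s \<otimes>\<^bsub>A\<^esub> t)),
      one = fraction A S \<one>\<^bsub>A\<^esub> \<one>\<^bsub>A\<^esub>,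
      zero = fraction A S \<zero>\<^bsub>A\<^esub> \<one>\<^bsub>A\<^esub>,
      add = (\<lambda>X Y. \<Union>(a, s)\<in>X. \<Union>(b, t)\<in>Y.
               fraction A S ((t \<otimes>\<^bsub>A\<^esub> a) \<oplus>\<^bsub>A\<^esub> (s \<otimes>\<^bsub>A\<^esub> b)) (s \<otimes>\<^bsub>A\<^esub> t)),
      module.smult = (\<lambda>c X. \<Union>(a, s)\<in>X. fraction A S (c \<otimes>\<^bsub>A\<^esub> a) s) \<rparr>"

text \<open>The canonical map to \<open>T\<^sup>-\<^sup>1A\<close> from \<open>S\<^sup>-\<^sup>1A\<close> with \<open>S \<subseteq> T\<close>.\<close>

definition localization_map ::
    "('a, 'm) ring_scheme \<Rightarrow> 'a set \<Rightarrow> ('a \<times> 'a) set \<Rightarrow> ('a \<times> 'a) set" where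
  "localization_map A T X = (\<Union>(a, s)\<in>X. fraction A T a s)"

text \<open>Degree \<open>i\<close> component of \<open>S\<^sup>-\<^sup>1A\<close> when \<open>S\<close> consists of homogeneous elements.\<close>

definition localization_component ::
    "('a, 'm) ring_scheme \<Rightarrow> (nat \<Rightarrow> 'a set) \<Rightarrow> 'a set \<Rightarrow> int \<Rightarrow> ('a \<times> 'a) set set" where
  "localization_component A G S i =
     {fraction A S a s | a s p. s \<in> S \<inter> G p \<and> a \<in> int_component A G (i + int p)}"


section \<open>Graded cochain complexes and their cohomology\<close>

text \<open>The record type of modules extends that of rings; its fields \<open>mult\<close> and \<open>one\<close> play no role for
  modules. They are filled with zeros wherever there is no ring structure.\<close>

definition self_module :: "('a, 'm) ring_scheme \<Rightarrow> ('a, 'a) module" where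
  "self_module A =
    \<lparr> carrier = carrier A, monoid.mult = monoid.mult A, one = \<one>\<^bsub>A\<^esub>, zero = \<zero>\<^bsub>A\<^esub>, add = add A,
      module.smult = monoid.mult A \<rparr>"

definition direct_sum :: "'i set \<Rightarrow> ('i \<Rightarrow> ('a, 'b) module) \<Rightarrow> ('a, 'i \<Rightarrow> 'b) module" where
  "direct_sum X M =
    \<lparr> carrier = (\<Pi>\<^sub>E I\<in>X. carrier (M I)),
      monoid.mult = (\<lambda>f g. \<lambda>I\<in>X. \<zero>\<^bsub>M I\<^esub>),
      one = (\<lambda>I\<in>X. \<zero>\<^bsub>M I\<^esub>),
      zero = (\<lambda>I\<in>X. \<zero>\<^bsub>M I\<^esub>),
      add = (\<lambda>f g. \<lambda>I\<in>X. f I \<oplus>\<^bsub>M I\<^esub> g I),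
      module.smult = (\<lambda>c f. \<lambda>I\<in>X. c \<odot>\<^bsub>M I\<^esub> f I) \<rparr>"

text \<open>\<open>piece C m i\<close> is the set of homogeneous elements of (internal) degree \<open>i\<close> in the module
  \<open>cochains C m\<close>, which sits in cohomological degree \<open>m\<close>.\<close>

record ('a, 'c) graded_complex =
  cochains :: "nat \<Rightarrow> ('a, 'c) module"
  differential :: "nat \<Rightarrow> 'c \<Rightarrow> 'c"
  piece :: "nat \<Rightarrow> int \<Rightarrow> 'c set"

definition cocycles :: "('a, 'c) graded_complex \<Rightarrow> nat \<Rightarrow> 'c set" where
  "cocycles C m =
     {x \<in> carrier (cochains C m). differential C m x = \<zero>\<^bsub>cochains C (Suc m)\<^esub>}"

definition coboundaries :: "('a, 'c) graded_complex \<Rightarrow> nat \<Rightarrow> 'c set" where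
  "coboundaries C m =
     (case m of 0 \<Rightarrow> {\<zero>\<^bsub>cochains C 0\<^esub>} | Suc l \<Rightarrow> differential C l ` carrier (cochains C l))"

definition coh_class :: "('a, 'c) graded_complex \<Rightarrow> nat \<Rightarrow> 'c \<Rightarrow> 'c set" where
  "coh_class C m x = coboundaries C m +>\<^bsub>cochains C m\<^esub> x"

definition cohomology :: "('a, 'c) graded_complex \<Rightarrow> nat \<Rightarrow> ('a, 'c set) module" where
  "cohomology C m =
    \<lparr> carrier = coh_class C m ` cocycles C m,
      monoid.mult = (\<lambda>X Y. coboundaries C m),
      one = coboundaries C m,
      zero = coboundaries C m,
      add = (\<lambda>X Y. X <+>\<^bsub>cochains C m\<^esub> Y),
      module.smult = (\<lambda>c X. \<Union>x\<in>X. coh_class C m (c \<odot>\<^bsub>cochains C m\<^esub> x)) \<rparr>"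

definition cohomology_piece :: "('a, 'c) graded_complex \<Rightarrow> nat \<Rightarrow> int \<Rightarrow> 'c set set" where
  "cohomology_piece C m i = coh_class C m ` (cocycles C m \<inter> piece C m i)"

definition induced_map ::
    "('a, 'c) graded_complex \<Rightarrow> nat \<Rightarrow> ('b \<Rightarrow> 'c) \<Rightarrow> 'b set \<Rightarrow> 'c set" where
  "induced_map C m h X = (\<Union>x\<in>X. coh_class C m (h x))"


section \<open>Koszul and Cech complexes of a sequence of homogeneous elements\<close>

text \<open>Both complexes are the tensor products, over the members \<open>z\<close> of the list \<open>zs\<close>, of two-term
  complexes \<open>A \<rightarrow> N(z)\<close> in cohomological degrees 0 and 1, where \<open>N(z)\<close> is \<open>A(deg z)\<close>
  respectively \<open>A\<^sub>z\<close>. With positions as indices, the summand of the tensor product in which the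
  positions in \<open>I\<close> contribute cohomological degree 1 is \<open>A(\<Sum>i\<in>I. deg (zs ! i))\<close>,
  respectively the localization of \<open>A\<close> at the multiplicative set generated by the \<open>zs ! i\<close> with
  \<open>i \<in> I\<close>. The component of the differential from \<open>J - {i}\<close> to \<open>J\<close> carries the sign
  \<open>(-1)^p\<close>, where \<open>p\<close> is the number of tensor factors of cohomological degree 1 in front of
  position \<open>i\<close>.\<close>

definition positions :: "'a list \<Rightarrow> nat \<Rightarrow> nat set set" where
  "positions zs m = {I. I \<subseteq> {..<length zs} \<and> card I = m}"

definition signed_sum ::
    "(nat set \<Rightarrow> ('a, 'b) module) \<Rightarrow> (nat \<Rightarrow> nat set \<Rightarrow> 'b \<Rightarrow> 'b) \<Rightarrow> nat set set
      \<Rightarrow> (nat set \<Rightarrow> 'b) \<Rightarrow> (nat set \<Rightarrow> 'b)" where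
  "signed_sum M \<rho> X f = (\<lambda>J\<in>X. \<Oplus>\<^bsub>M J\<^esub>i\<in>J.
     (if even (card {k \<in> J. k < i}) then \<rho> i J (f (J - {i})) else \<ominus>\<^bsub>M J\<^esub> (\<rho> i J (f (J - {i})))))"

definition koszul ::
    "('a, 'm) ring_scheme \<Rightarrow> (nat \<Rightarrow> 'a set) \<Rightarrow> 'a list \<Rightarrow> ('a, nat set \<Rightarrow> 'a) graded_complex" where
  "koszul A G zs =
    \<lparr> cochains = (\<lambda>m. direct_sum (positions zs m) (\<lambda>I. self_module A)),
      differential = (\<lambda>m. signed_sum (\<lambda>I. self_module A) (\<lambda>i J a. zs ! i \<otimes>\<^bsub>A\<^esub> a)
                            (positions zs (Suc m))),
      piece = (\<lambda>m i. \<Pi>\<^sub>E I\<in>positions zs m.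
                 int_component A G (i + int (\<Sum>l\<in>I. hdeg G (zs ! l)))) \<rparr>"

definition denominators :: "('a, 'm) ring_scheme \<Rightarrow> 'a list \<Rightarrow> nat set \<Rightarrow> 'a set" where
  "denominators A zs I = {\<Otimes>\<^bsub>A\<^esub>i\<in>I. (zs ! i) [^]\<^bsub>A\<^esub> \<alpha> i | \<alpha> :: nat \<Rightarrow> nat. True}"

definition cech ::
    "('a, 'm) ring_scheme \<Rightarrow> (nat \<Rightarrow> 'a set) \<Rightarrow> 'a list
      \<Rightarrow> ('a, nat set \<Rightarrow> ('a \<times> 'a) set) graded_complex" where
  "cech A G zs =
    \<lparr> cochains = (\<lambda>m. direct_sum (positions zs m) (\<lambda>I. localization A (denominators A zs I))),
      differential = (\<lambda>m. signed_sum (\<lambda>I. localization A (denominators A zs I))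
                            (\<lambda>i J. localization_map A (denominators A zs J))
                            (positions zs (Suc m))),
      piece = (\<lambda>m i. \<Pi>\<^sub>E I\<in>positions zs m.
                 localization_component A G (denominators A zs I) i) \<rparr>"

text \<open>The tensor product of the maps of two-term complexes that are the identity in cohomological
  degree 0 and \<open>a \<mapsto> a / z\<close> in cohomological degree 1.\<close>

definition koszul_to_cech ::
    "('a, 'm) ring_scheme \<Rightarrow> 'a list \<Rightarrow> nat \<Rightarrow> (nat set \<Rightarrow> 'a) \<Rightarrow> (nat set \<Rightarrow> ('a \<times> 'a) set)" where
  "koszul_to_cech A zs m f =
     (\<lambda>I\<in>positions zs m. fraction A (denominators A zs I) (f I) (\<Otimes>\<^bsub>A\<^esub>i\<in>I. zs ! i))"

text \<open>For homogeneous \<open>zs\<close> generating the ideal \<open>\<aa>\<close>, this is \<open>H\<^sup>j\<^sub>\<aa>(A)\<close>. Up to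
  isomorphism it depends only on the radical of \<open>\<aa>\<close>.\<close>

definition local_cohomology ::
    "('a, 'm) ring_scheme \<Rightarrow> (nat \<Rightarrow> 'a set) \<Rightarrow> 'a list \<Rightarrow> nat
      \<Rightarrow> ('a, (nat set \<Rightarrow> ('a \<times> 'a) set) set) module" where
  "local_cohomology A G zs j = cohomology (cech A G zs) j"

definition local_cohomology_piece ::
    "('a, 'm) ring_scheme \<Rightarrow> (nat \<Rightarrow> 'a set) \<Rightarrow> 'a list \<Rightarrow> nat \<Rightarrow> int
      \<Rightarrow> (nat set \<Rightarrow> ('a \<times> 'a) set) set set" where
  "local_cohomology_piece A G zs j i = cohomology_piece (cech A G zs) j i"

definition natural_map ::
    "('a, 'm) ring_scheme \<Rightarrow> (nat \<Rightarrow> 'a set) \<Rightarrow> 'a list \<Rightarrow> nat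
      \<Rightarrow> (nat set \<Rightarrow> 'a) set \<Rightarrow> (nat set \<Rightarrow> ('a \<times> 'a) set) set" where
  "natural_map A G zs m = induced_map (cech A G zs) m (koszul_to_cech A zs m)"

definition natural_map_kernel ::
    "('a, 'm) ring_scheme \<Rightarrow> (nat \<Rightarrow> 'a set) \<Rightarrow> 'a list \<Rightarrow> nat \<Rightarrow> (nat set \<Rightarrow> 'a) set set" where
  "natural_map_kernel A G zs m =
     a_kernel (cohomology (koszul A G zs) m) (local_cohomology A G zs m) (natural_map A G zs m)"

text \<open>\<open>[ker \<phi>\<^sup>m]\<^sub>i\<close> as a vector space (over \<open>base_field A G\<close>).\<close>

definition kernel_piece ::
    "('a, 'm) ring_scheme \<Rightarrow> (nat \<Rightarrow> 'a set) \<Rightarrow> 'a list \<Rightarrow> nat \<Rightarrow> int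
      \<Rightarrow> ('a, (nat set \<Rightarrow> 'a) set) module" where
  "kernel_piece A G zs m i = (cohomology (koszul A G zs) m)
     \<lparr>carrier := natural_map_kernel A G zs m \<inter> cohomology_piece (koszul A G zs) m i\<rparr>"

text \<open>\<open>V i\<close> is the component of degree \<open>i\<close> of a graded vector space over \<open>K\<close>.
  Finiteness is stated explicitly, since \<open>vectorspace.dim\<close> has no meaningful value otherwise.\<close>

definition has_hilbert_series ::
    "('a, 'm) ring_scheme \<Rightarrow> (int \<Rightarrow> ('a, 'b) module) \<Rightarrow> int fls \<Rightarrow> bool" where
  "has_hilbert_series K V F \<longleftrightarrow>
     (\<forall>i. vectorspace.fin_dim K (V i) \<and> fls_nth F i = int (vectorspace.dim K (V i)))"

end

theory Submission
  imports Defs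
begin

text \<open>
  Let \<open>r\<close> be the length of the sequence \<open>zs\<close> generating \<open>\<aa>\<close>, and let \<open>xs\<close> generate the irrelevant
  ideal \<open>\<mm>\<close>. Both claims come from the double complex \<open>K(zs) \<otimes> C(xs)\<close>, the tensor product of the
  Koszul complex of \<open>zs\<close> and the Cech complex of \<open>xs\<close>. It can be read in two ways.

  Fix a nonempty set of positions of \<open>xs\<close>. The summands over it form a Koszul complex of \<open>zs\<close> over a
  localization of \<open>A\<close> in which some member \<open>x\<close> of \<open>xs\<close> is invertible. Koszul cohomology of \<open>zs\<close> is
  killed by powers of the members of \<open>zs\<close>, hence by a power of \<open>x\<close>, because \<open>\<aa>\<close> and \<open>\<mm>\<close> have the same
  radical. So these rows are exact (\<open>slice_exact_of_unit\<close>), and the total complex has the cohomology of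
  the remaining row, which is \<open>K(zs)\<close>.

  Now fix a set \<open>I\<close> of positions of \<open>zs\<close>. The summands over it form a Cech complex of \<open>xs\<close>, with
  degrees shifted by \<open>t |I|\<close> if all members of \<open>zs\<close> have degree \<open>t\<close>. Filtering by the level \<open>|I|\<close> thus
  gives a spectral sequence whose term of level \<open>p\<close> is a sum of \<open>r choose p\<close> copies of the local
  cohomology of \<open>A\<close>, shifted by \<open>p t\<close>, and which converges to Koszul cohomology. The natural map
  to local cohomology corresponds to the projection to level 0. To see this, map \<open>K(zs) \<otimes> C(xs)\<close> to the double
  complex \<open>C(zs) \<otimes> C(xs)\<close>: it is the natural map on the row of \<open>zs\<close> and the identity on the column of
  \<open>xs\<close>, and in the target all other rows and columns are exact by the same argument. So the kernel of the
  natural map consists of the classes that are represented by total cocycles of positive level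
  (\<open>kernel_lift\<close> and \<open>positive_level_kernel\<close>).

  In total degree \<open>n\<close>, level \<open>p \<ge> 1\<close> involves the local cohomology in degree \<open>n - p\<close>. The terms that a
  differential could link to it, namely those of lower level in total degree \<open>n - 1\<close> and those of higher
  level in total degree \<open>n + 1\<close>, also involve local cohomology in degrees below \<open>n\<close>. In this range local
  cohomology lives in the single internal degree \<open>d\<close>. So in internal degree \<open>i\<close> all these terms vanish,
  except for that of level \<open>p\<close> if \<open>i + p t = d\<close>. Therefore the kernel in degree \<open>d - p t\<close> is a sum of \<open>r choose p\<close> copies of the
  component of degree \<open>d\<close> of local cohomology in degree \<open>n - p\<close> (\<open>kernel_piece_dim\<close>), and the
  kernel vanishes in all other degrees (\<open>kernel_piece_zero\<close>). In place of a spectral sequence, the proof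
  uses that a total element may be changed by coboundaries so as to raise its level past exact slices
  (\<open>level_chain\<close>). The isomorphism is the relation between a Koszul class and the classes of the
  lowest-level part of a total cocycle lifting it.

  If \<open>\<aa> = \<mm>\<close>, a minimal homogeneous generating sequence consists of linear forms that are a basis of
  the component of degree 1, and their number is the embedding dimension.
\<close>


section \<open>Modules of cochains and of cohomology classes\<close>

text \<open>The components of a graded module are modules only over the component of degree 0 of the ring, and
  this lemma turns them into vector spaces over the base field. Negatives stay in \<open>U\<close> because \<open>-1 \<in> F\<close>.\<close>

lemma submodule_over_subring:
  assumes N: "module A N" and F: "cring (A\<lparr>carrier := F\<rparr>)" "F \<subseteq> carrier A"
    and U: "U \<subseteq> carrier N" "\<zero>\<^bsub>N\<^esub> \<in> U" "\<And>x y. x \<in> U \<Longrightarrow> y \<in> U \<Longrightarrow> x \<oplus>\<^bsub>N\<^esub> y \<in> U"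
      "\<And>c x. c \<in> F \<Longrightarrow> x \<in> U \<Longrightarrow> c \<odot>\<^bsub>N\<^esub> x \<in> U"
  shows "module (A\<lparr>carrier := F\<rparr>) (N\<lparr>carrier := U\<rparr>)"
proof -
  interpret N: module A N by fact
  interpret F: cring "A\<lparr>carrier := F\<rparr>" by fact
  have neg: "\<ominus>\<^bsub>N\<^esub> x \<in> U" if "x \<in> U" for x
  proof -
    have o: "\<one>\<^bsub>A\<^esub> \<in> F" using F.one_closed by simp
    have z: "\<zero>\<^bsub>A\<^esub> \<in> F" using F.zero_closed by simp
    obtain a where a: "a \<in> F" "\<one>\<^bsub>A\<^esub> \<oplus>\<^bsub>A\<^esub> a = \<zero>\<^bsub>A\<^esub>"
      using F.add.r_inv_ex[of "\<one>\<^bsub>A\<^esub>"] o by auto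
    have "\<ominus>\<^bsub>A\<^esub> \<one>\<^bsub>A\<^esub> = a" using a F(2) by (metis N.R.add.inv_equality N.R.add.m_comm N.R.one_closed subsetD)
    hence "(\<ominus>\<^bsub>A\<^esub> \<one>\<^bsub>A\<^esub>) \<odot>\<^bsub>N\<^esub> x \<in> U" using a U(4) that by simp
    moreover have "(\<ominus>\<^bsub>A\<^esub> \<one>\<^bsub>A\<^esub>) \<odot>\<^bsub>N\<^esub> x = \<ominus>\<^bsub>N\<^esub> x"
      using that U(1) by (simp add: N.smult_l_minus subsetD)
    ultimately show ?thesis by simp
  qed
  show ?thesis
  proof (rule moduleI)
    show "cring (A\<lparr>carrier := F\<rparr>)" by fact
    show "abelian_group (N\<lparr>carrier := U\<rparr>)"
    proof (rule abelian_groupI)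
      fix x assume "x \<in> carrier (N\<lparr>carrier := U\<rparr>)"
      thus "\<exists>y\<in>carrier (N\<lparr>carrier := U\<rparr>). y \<oplus>\<^bsub>N\<lparr>carrier := U\<rparr>\<^esub> x = \<zero>\<^bsub>N\<lparr>carrier := U\<rparr>\<^esub>"
        using neg U(1) by (auto intro!: bexI[of _ "\<ominus>\<^bsub>N\<^esub> x"] simp: N.l_neg subsetD)
    qed (use U in \<open>auto simp: N.a_ac subsetD\<close>)
  qed (use U F(2) in \<open>auto simp: N.smult_l_distr N.smult_r_distr N.smult_assoc1 subsetD\<close>)
qed

lemma direct_sum_simps [simp]:
  "carrier (direct_sum X M) = (\<Pi>\<^sub>E I\<in>X. carrier (M I))"
  "\<zero>\<^bsub>direct_sum X M\<^esub> = (\<lambda>I\<in>X. \<zero>\<^bsub>M I\<^esub>)"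
  "f \<oplus>\<^bsub>direct_sum X M\<^esub> g = (\<lambda>I\<in>X. f I \<oplus>\<^bsub>M I\<^esub> g I)"
  "c \<odot>\<^bsub>direct_sum X M\<^esub> f = (\<lambda>I\<in>X. c \<odot>\<^bsub>M I\<^esub> f I)"
  by (simp_all add: direct_sum_def)

lemma direct_sum_module:
  assumes "cring A" and M: "\<And>I. I \<in> X \<Longrightarrow> module A (M I)"
  shows "module A (direct_sum X M)"
proof (rule moduleI)
  note ag = module.axioms(2)[OF M]
  show "abelian_group (direct_sum X M)"
  proof (rule abelian_groupI)
    fix f assume f: "f \<in> carrier (direct_sum X M)"
    show "\<exists>g\<in>carrier (direct_sum X M). g \<oplus>\<^bsub>direct_sum X M\<^esub> f = \<zero>\<^bsub>direct_sum X M\<^esub>"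
      using f ag by (intro bexI[of _ "\<lambda>I\<in>X. \<ominus>\<^bsub>M I\<^esub> f I"])
        (auto simp: PiE_iff intro!: restrict_ext abelian_group.l_neg abelian_group.a_inv_closed)
  next
    fix f g h assume "f \<in> carrier (direct_sum X M)" "g \<in> carrier (direct_sum X M)" "h \<in> carrier (direct_sum X M)"
    thus "f \<oplus>\<^bsub>direct_sum X M\<^esub> g \<oplus>\<^bsub>direct_sum X M\<^esub> h = f \<oplus>\<^bsub>direct_sum X M\<^esub> (g \<oplus>\<^bsub>direct_sum X M\<^esub> h)"
      by (auto simp: PiE_iff intro!: restrict_ext abelian_monoid.a_assoc[OF abelian_group.axioms(1)[OF ag]])
  next
    fix f g assume "f \<in> carrier (direct_sum X M)" "g \<in> carrier (direct_sum X M)"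
    thus "f \<oplus>\<^bsub>direct_sum X M\<^esub> g = g \<oplus>\<^bsub>direct_sum X M\<^esub> f"
      by (auto simp: PiE_iff intro!: restrict_ext abelian_monoid.a_comm[OF abelian_group.axioms(1)[OF ag]])
  next
    fix f assume f: "f \<in> carrier (direct_sum X M)"
    show "\<zero>\<^bsub>direct_sum X M\<^esub> \<oplus>\<^bsub>direct_sum X M\<^esub> f = f"
    proof (rule extensionalityI[of _ X])
      fix I assume I: "I \<in> X"
      then interpret module A "M I" using M by simp
      show "(\<zero>\<^bsub>direct_sum X M\<^esub> \<oplus>\<^bsub>direct_sum X M\<^esub> f) I = f I" using I f PiE_mem[of f X "\<lambda>I. carrier (M I)" I] by simp
    qed (use f in \<open>auto simp: PiE_iff\<close>)
  qed (auto intro!: abelian_monoid.a_closed[OF abelian_group.axioms(1)[OF ag]] abelian_monoid.zero_closed[OF abelian_group.axioms(1)[OF ag]])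
next
  fix f assume f: "f \<in> carrier (direct_sum X M)"
  show "\<one>\<^bsub>A\<^esub> \<odot>\<^bsub>direct_sum X M\<^esub> f = f"
  proof (rule extensionalityI[of _ X])
    fix I assume I: "I \<in> X"
    then interpret module A "M I" using M by simp
    show "(\<one>\<^bsub>A\<^esub> \<odot>\<^bsub>direct_sum X M\<^esub> f) I = f I" using I f PiE_mem[of f X "\<lambda>I. carrier (M I)" I] by simp
  qed (use f in \<open>auto simp: PiE_iff\<close>)
qed (use assms in \<open>auto simp: PiE_iff intro!: restrict_ext module.smult_l_distr module.smult_r_distr
       module.smult_assoc1 module.smult_closed\<close>)

lemma direct_sum_minus:
  assumes A: "cring A" and M: "\<And>I. I \<in> X \<Longrightarrow> module A (M I)"
    and f: "f \<in> carrier (direct_sum X M)" and g: "g \<in> carrier (direct_sum X M)"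
  shows "\<ominus>\<^bsub>direct_sum X M\<^esub> f = (\<lambda>I\<in>X. \<ominus>\<^bsub>M I\<^esub> f I)"
    and "f \<ominus>\<^bsub>direct_sum X M\<^esub> g = (\<lambda>I\<in>X. f I \<ominus>\<^bsub>M I\<^esub> g I)"
proof -
  interpret T: module A "direct_sum X M" by (rule direct_sum_module[OF A M])
  note ag = module.axioms(2)[OF M]
  have neg: "\<ominus>\<^bsub>direct_sum X M\<^esub> f = (\<lambda>I\<in>X. \<ominus>\<^bsub>M I\<^esub> f I)" if f: "f \<in> carrier (direct_sum X M)" for f
  proof (rule T.add.inv_equality[unfolded a_inv_def[symmetric]])
    show "(\<lambda>I\<in>X. \<ominus>\<^bsub>M I\<^esub> f I) \<oplus>\<^bsub>direct_sum X M\<^esub> f = \<zero>\<^bsub>direct_sum X M\<^esub>"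
      using f by (auto intro!: restrict_ext abelian_group.l_neg[OF ag])
    show "f \<in> carrier (direct_sum X M)" by fact
    show "(\<lambda>I\<in>X. \<ominus>\<^bsub>M I\<^esub> f I) \<in> carrier (direct_sum X M)"
      using f ag by (auto simp: PiE_iff intro!: abelian_group.a_inv_closed)
  qed
  show "\<ominus>\<^bsub>direct_sum X M\<^esub> f = (\<lambda>I\<in>X. \<ominus>\<^bsub>M I\<^esub> f I)" using neg f .
  show "f \<ominus>\<^bsub>direct_sum X M\<^esub> g = (\<lambda>I\<in>X. f I \<ominus>\<^bsub>M I\<^esub> g I)"
    unfolding a_minus_def by (simp add: neg[OF g] cong: restrict_cong)
qed

lemma self_module_simps [simp]:
  "carrier (self_module A) = carrier A" "\<zero>\<^bsub>self_module A\<^esub> = \<zero>\<^bsub>A\<^esub>"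
  "x \<oplus>\<^bsub>self_module A\<^esub> y = x \<oplus>\<^bsub>A\<^esub> y" "c \<odot>\<^bsub>self_module A\<^esub> x = c \<otimes>\<^bsub>A\<^esub> x"
  by (simp_all add: self_module_def)

lemma self_module_module: "cring A \<Longrightarrow> module A (self_module A)"
proof -
  assume "cring A"
  then interpret cring A .
  show ?thesis
  proof (rule moduleI)
    show "abelian_group (self_module A)"
    proof (rule abelian_groupI)
      fix x assume "x \<in> carrier (self_module A)"
      thus "\<exists>y\<in>carrier (self_module A). y \<oplus>\<^bsub>self_module A\<^esub> x = \<zero>\<^bsub>self_module A\<^esub>"
        by (intro bexI[of _ "\<ominus>\<^bsub>A\<^esub> x"]) (auto simp: l_neg)
    qed (auto simp: a_ac)
  qed (auto simp: l_distr r_distr m_assoc \<open>cring A\<close>)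
qed

lemma self_module_minus:
  assumes "cring A" "x \<in> carrier A"
  shows "\<ominus>\<^bsub>self_module A\<^esub> x = \<ominus>\<^bsub>A\<^esub> x"
proof -
  interpret cring A by fact
  interpret S: module A "self_module A" by (rule self_module_module) fact
  show ?thesis using assms
    by (intro S.add.inv_equality[unfolded a_inv_def[symmetric]]) (auto simp: l_neg)
qed

locale module_complex = cring A for A (structure) +
  fixes C :: "('a, 'c) graded_complex"
  assumes cochains_module: "module A (cochains C m)"
    and d_closed: "x \<in> carrier (cochains C m) \<Longrightarrow> differential C m x \<in> carrier (cochains C (Suc m))"
    and d_add: "x \<in> carrier (cochains C m) \<Longrightarrow> y \<in> carrier (cochains C m) \<Longrightarrow>
      differential C m (x \<oplus>\<^bsub>cochains C m\<^esub> y) = differential C m x \<oplus>\<^bsub>cochains C (Suc m)\<^esub> differential C m y"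
    and d_smult: "c \<in> carrier A \<Longrightarrow> x \<in> carrier (cochains C m) \<Longrightarrow>
      differential C m (c \<odot>\<^bsub>cochains C m\<^esub> x) = c \<odot>\<^bsub>cochains C (Suc m)\<^esub> differential C m x"
    and d_d: "x \<in> carrier (cochains C m) \<Longrightarrow>
      differential C (Suc m) (differential C m x) = \<zero>\<^bsub>cochains C (Suc (Suc m))\<^esub>"
begin

lemma d_zero: "differential C m \<zero>\<^bsub>cochains C m\<^esub> = \<zero>\<^bsub>cochains C (Suc m)\<^esub>"
proof -
  interpret M: module A "cochains C m" by (rule cochains_module)
  interpret N: module A "cochains C (Suc m)" by (rule cochains_module)
  show ?thesis
    using d_smult[of \<zero> "\<zero>\<^bsub>cochains C m\<^esub>" m] d_closed[of "\<zero>\<^bsub>cochains C m\<^esub>" m] by simp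
qed

lemma coboundaries_submodule:
  shows coboundaries_subset: "coboundaries C m \<subseteq> carrier (cochains C m)"
    and coboundaries_zero: "\<zero>\<^bsub>cochains C m\<^esub> \<in> coboundaries C m"
    and coboundaries_add: "x \<in> coboundaries C m \<Longrightarrow> y \<in> coboundaries C m \<Longrightarrow> x \<oplus>\<^bsub>cochains C m\<^esub> y \<in> coboundaries C m"
    and coboundaries_smult: "c \<in> carrier A \<Longrightarrow> x \<in> coboundaries C m \<Longrightarrow> c \<odot>\<^bsub>cochains C m\<^esub> x \<in> coboundaries C m"
    and coboundaries_cocycles: "coboundaries C m \<subseteq> cocycles C m"
proof -
  interpret M: module A "cochains C m" by (rule cochains_module)
  have im: "x \<in> coboundaries C m \<longleftrightarrow> (m = 0 \<and> x = \<zero>\<^bsub>cochains C m\<^esub>) \<or>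
      (\<exists>l y. m = Suc l \<and> y \<in> carrier (cochains C l) \<and> x = differential C l y)" for x
    by (cases m) (auto simp: coboundaries_def)
  show sub: "coboundaries C m \<subseteq> cocycles C m"
  proof
    fix x assume "x \<in> coboundaries C m"
    then consider "x = \<zero>\<^bsub>cochains C m\<^esub>" | l y where "m = Suc l" "y \<in> carrier (cochains C l)" "x = differential C l y"
      unfolding im by auto
    thus "x \<in> cocycles C m" by cases (simp_all add: cocycles_def d_closed d_d d_zero)
  qed
  show "coboundaries C m \<subseteq> carrier (cochains C m)" using sub by (auto simp: cocycles_def)
  show "\<zero>\<^bsub>cochains C m\<^esub> \<in> coboundaries C m"
  proof (cases m)
    case (Suc l)
    interpret L: module A "cochains C l" by (rule cochains_module)
    show ?thesis unfolding im using Suc d_zero[of l] by (metis L.zero_closed)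
  qed (simp add: coboundaries_def)
  show "x \<oplus>\<^bsub>cochains C m\<^esub> y \<in> coboundaries C m" if x: "x \<in> coboundaries C m" and y: "y \<in> coboundaries C m" for x y
  proof (cases m)
    case (Suc l)
    interpret L: module A "cochains C l" by (rule cochains_module)
    from x y Suc obtain u v where "u \<in> carrier (cochains C l)" "v \<in> carrier (cochains C l)"
      "x = differential C l u" "y = differential C l v" unfolding im by blast
    thus ?thesis unfolding im using Suc d_add[of u l v] by (metis L.a_closed)
  next
    case 0
    hence "x = \<zero>\<^bsub>cochains C m\<^esub>" "y = \<zero>\<^bsub>cochains C m\<^esub>" using x y unfolding im by blast+
    hence "x \<oplus>\<^bsub>cochains C m\<^esub> y = \<zero>\<^bsub>cochains C m\<^esub>" by simp
    thus ?thesis unfolding im using 0 by blast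
  qed
  show "c \<odot>\<^bsub>cochains C m\<^esub> x \<in> coboundaries C m" if c: "c \<in> carrier A" and x: "x \<in> coboundaries C m" for c x
  proof (cases m)
    case (Suc l)
    interpret L: module A "cochains C l" by (rule cochains_module)
    from x Suc obtain u where "u \<in> carrier (cochains C l)" "x = differential C l u" unfolding im by blast
    thus ?thesis unfolding im using Suc d_smult[of c u l] c by (metis L.smult_closed)
  next
    case 0
    hence "x = \<zero>\<^bsub>cochains C m\<^esub>" using x unfolding im by blast
    hence "c \<odot>\<^bsub>cochains C m\<^esub> x = \<zero>\<^bsub>cochains C m\<^esub>" using c by simp
    thus ?thesis unfolding im using 0 by blast
  qed
qed

lemma cocycles_submodule:
  shows cocycles_subset: "cocycles C m \<subseteq> carrier (cochains C m)"
    and cocycles_zero: "\<zero>\<^bsub>cochains C m\<^esub> \<in> cocycles C m"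
    and cocycles_add: "x \<in> cocycles C m \<Longrightarrow> y \<in> cocycles C m \<Longrightarrow> x \<oplus>\<^bsub>cochains C m\<^esub> y \<in> cocycles C m"
    and cocycles_smult: "c \<in> carrier A \<Longrightarrow> x \<in> cocycles C m \<Longrightarrow> c \<odot>\<^bsub>cochains C m\<^esub> x \<in> cocycles C m"
proof -
  interpret M: module A "cochains C m" by (rule cochains_module)
  interpret N: module A "cochains C (Suc m)" by (rule cochains_module)
  show "cocycles C m \<subseteq> carrier (cochains C m)" by (auto simp: cocycles_def)
  show "\<zero>\<^bsub>cochains C m\<^esub> \<in> cocycles C m" by (auto simp: cocycles_def d_zero)
  show "x \<in> cocycles C m \<Longrightarrow> y \<in> cocycles C m \<Longrightarrow> x \<oplus>\<^bsub>cochains C m\<^esub> y \<in> cocycles C m"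
    by (auto simp: cocycles_def d_add)
  show "c \<in> carrier A \<Longrightarrow> x \<in> cocycles C m \<Longrightarrow> c \<odot>\<^bsub>cochains C m\<^esub> x \<in> cocycles C m"
    by (auto simp: cocycles_def d_smult)
qed

lemma coboundaries_neg: "x \<in> coboundaries C m \<Longrightarrow> \<ominus>\<^bsub>cochains C m\<^esub> x \<in> coboundaries C m"
proof -
  interpret M: module A "cochains C m" by (rule cochains_module)
  assume x: "x \<in> coboundaries C m"
  hence xc: "x \<in> carrier (cochains C m)" using coboundaries_subset by auto
  have "(\<ominus> \<one>) \<odot>\<^bsub>cochains C m\<^esub> x = \<ominus>\<^bsub>cochains C m\<^esub> x" using xc by (simp add: M.smult_l_minus)
  thus ?thesis using coboundaries_smult[of "\<ominus> \<one>" x m] x by simp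
qed

lemma coboundaries_subgroup: "abelian_subgroup (coboundaries C m) (cochains C m)"
proof -
  interpret M: module A "cochains C m" by (rule cochains_module)
  have "subgroup (coboundaries C m) (add_monoid (cochains C m))"
    using coboundaries_subset coboundaries_zero coboundaries_add coboundaries_neg
    by (intro subgroup.intro) (auto simp: a_inv_def[symmetric])
  thus ?thesis by (intro abelian_subgroupI3 additive_subgroupI M.abelian_group_axioms)
qed

lemma coh_class_eq_iff:
  assumes "x \<in> carrier (cochains C m)" "y \<in> carrier (cochains C m)"
  shows "coh_class C m x = coh_class C m y \<longleftrightarrow> x \<ominus>\<^bsub>cochains C m\<^esub> y \<in> coboundaries C m"
proof -
  interpret M: module A "cochains C m" by (rule cochains_module)
  interpret B: abelian_subgroup "coboundaries C m" "cochains C m" by (rule coboundaries_subgroup)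
  have "coh_class C m x = coh_class C m y \<longleftrightarrow> x \<in> coboundaries C m +>\<^bsub>cochains C m\<^esub> y"
    unfolding coh_class_def using assms B.a_rcos_self B.a_repr_independence'
    by (metis)
  also have "\<dots> \<longleftrightarrow> x \<ominus>\<^bsub>cochains C m\<^esub> y \<in> coboundaries C m"
    using B.a_rcos_module assms unfolding a_minus_def by auto
  finally show ?thesis .
qed

lemma coh_class_self: "x \<in> carrier (cochains C m) \<Longrightarrow> x \<in> coh_class C m x"
proof -
  interpret B: abelian_subgroup "coboundaries C m" "cochains C m" by (rule coboundaries_subgroup)
  assume "x \<in> carrier (cochains C m)" thus ?thesis
    unfolding coh_class_def by (rule B.a_rcos_self)
qed

lemma coh_class_memD:
  assumes "x \<in> carrier (cochains C m)" "y \<in> coh_class C m x"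
  shows "y \<in> carrier (cochains C m)" "coh_class C m y = coh_class C m x"
proof -
  interpret B: abelian_subgroup "coboundaries C m" "cochains C m" by (rule coboundaries_subgroup)
  show "y \<in> carrier (cochains C m)" using assms unfolding coh_class_def by (rule B.a_elemrcos_carrier)
  show "coh_class C m y = coh_class C m x" using assms unfolding coh_class_def
    by (metis B.a_repr_independence')
qed

lemma coh_class_zero: "coh_class C m \<zero>\<^bsub>cochains C m\<^esub> = coboundaries C m"
proof -
  interpret M: module A "cochains C m" by (rule cochains_module)
  show ?thesis unfolding coh_class_def using coboundaries_subset by (rule M.a_coset_add_zero)
qed

lemma coh_class_zero_iff:
  "x \<in> carrier (cochains C m) \<Longrightarrow> coh_class C m x = coboundaries C m \<longleftrightarrow> x \<in> coboundaries C m"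
proof -
  interpret M: module A "cochains C m" by (rule cochains_module)
  assume x: "x \<in> carrier (cochains C m)"
  hence "x \<ominus>\<^bsub>cochains C m\<^esub> \<zero>\<^bsub>cochains C m\<^esub> = x" by (simp add: a_minus_def)
  thus ?thesis using coh_class_eq_iff[OF x M.zero_closed] coh_class_zero by simp
qed

lemma coh_class_add:
  assumes "x \<in> carrier (cochains C m)" "y \<in> carrier (cochains C m)"
  shows "coh_class C m x \<oplus>\<^bsub>cohomology C m\<^esub> coh_class C m y = coh_class C m (x \<oplus>\<^bsub>cochains C m\<^esub> y)"
proof -
  interpret B: abelian_subgroup "coboundaries C m" "cochains C m" by (rule coboundaries_subgroup)
  show ?thesis unfolding cohomology_def coh_class_def using B.a_rcos_sum[OF assms] by simp
qed

lemma coh_class_smult: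
  assumes c: "c \<in> carrier A" and x: "x \<in> carrier (cochains C m)"
  shows "c \<odot>\<^bsub>cohomology C m\<^esub> coh_class C m x = coh_class C m (c \<odot>\<^bsub>cochains C m\<^esub> x)"
proof -
  interpret M: module A "cochains C m" by (rule cochains_module)
  have "coh_class C m (c \<odot>\<^bsub>cochains C m\<^esub> y) = coh_class C m (c \<odot>\<^bsub>cochains C m\<^esub> x)" if y: "y \<in> coh_class C m x" for y
  proof -
    have yc: "y \<in> carrier (cochains C m)" and e: "coh_class C m y = coh_class C m x"
      using coh_class_memD[OF x y] by auto
    have "y \<ominus>\<^bsub>cochains C m\<^esub> x \<in> coboundaries C m" using coh_class_eq_iff[OF yc x] e by simp
    hence "c \<odot>\<^bsub>cochains C m\<^esub> (y \<ominus>\<^bsub>cochains C m\<^esub> x) \<in> coboundaries C m" using c by (rule coboundaries_smult[rotated])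
    moreover have "c \<odot>\<^bsub>cochains C m\<^esub> (y \<ominus>\<^bsub>cochains C m\<^esub> x) = c \<odot>\<^bsub>cochains C m\<^esub> y \<ominus>\<^bsub>cochains C m\<^esub> c \<odot>\<^bsub>cochains C m\<^esub> x"
      using c x yc by (simp add: a_minus_def M.smult_r_distr M.smult_r_minus)
    ultimately show ?thesis using coh_class_eq_iff c x yc by simp
  qed
  moreover have "x \<in> coh_class C m x" using coh_class_self x .
  ultimately have "(\<Union>y\<in>coh_class C m x. coh_class C m (c \<odot>\<^bsub>cochains C m\<^esub> y)) = coh_class C m (c \<odot>\<^bsub>cochains C m\<^esub> x)"
    by blast
  thus ?thesis by (simp add: cohomology_def)
qed

lemma cohomology_simps:
  "carrier (cohomology C m) = coh_class C m ` cocycles C m"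
  "\<zero>\<^bsub>cohomology C m\<^esub> = coboundaries C m"
  by (simp_all add: cohomology_def)

lemma cohomology_module: "module A (cohomology C m)"
proof -
  interpret M: module A "cochains C m" by (rule cochains_module)
  let ?N = "cohomology C m"
  have rep: "\<exists>x. X = coh_class C m x \<and> x \<in> cocycles C m \<and> x \<in> carrier (cochains C m)" if "X \<in> carrier ?N" for X
    using that cocycles_subset[of m] by (auto simp: cohomology_simps)
  show ?thesis
  proof (rule moduleI)
    show "cring A" by (rule is_cring)
    show "abelian_group ?N"
    proof (rule abelian_groupI)
      show "\<zero>\<^bsub>?N\<^esub> \<in> carrier ?N"
        using coh_class_zero cocycles_zero by (metis cohomology_simps(1,2) image_eqI)
    next
      fix X assume "X \<in> carrier ?N"
      then obtain x where x: "X = coh_class C m x" "x \<in> cocycles C m" "x \<in> carrier (cochains C m)" using rep by blast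
      show "\<zero>\<^bsub>?N\<^esub> \<oplus>\<^bsub>?N\<^esub> X = X"
        using x coh_class_add[of "\<zero>\<^bsub>cochains C m\<^esub>" m x] coh_class_zero by (simp add: cohomology_simps)
      have "(\<ominus> \<one>) \<odot>\<^bsub>cochains C m\<^esub> x \<in> cocycles C m" using x by (intro cocycles_smult) auto
      moreover have "(\<ominus> \<one>) \<odot>\<^bsub>cochains C m\<^esub> x \<oplus>\<^bsub>cochains C m\<^esub> x = \<zero>\<^bsub>cochains C m\<^esub>"
        using x by (simp add: M.smult_l_minus M.l_neg)
      ultimately show "\<exists>Y\<in>carrier ?N. Y \<oplus>\<^bsub>?N\<^esub> X = \<zero>\<^bsub>?N\<^esub>"
        using x coh_class_add[of "(\<ominus> \<one>) \<odot>\<^bsub>cochains C m\<^esub> x" m x] coh_class_zero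
        by (intro bexI[of _ "coh_class C m ((\<ominus> \<one>) \<odot>\<^bsub>cochains C m\<^esub> x)"]) (simp_all add: cohomology_simps)
    next
      fix X Y assume "X \<in> carrier ?N" "Y \<in> carrier ?N"
      then obtain x y where x: "X = coh_class C m x" "x \<in> cocycles C m" "x \<in> carrier (cochains C m)"
        and y: "Y = coh_class C m y" "y \<in> cocycles C m" "y \<in> carrier (cochains C m)" using rep by meson
      show "X \<oplus>\<^bsub>?N\<^esub> Y \<in> carrier ?N"
        using x y cocycles_add[of x m y] by (simp add: coh_class_add) (simp add: cohomology_simps)
      show "X \<oplus>\<^bsub>?N\<^esub> Y = Y \<oplus>\<^bsub>?N\<^esub> X"
        using x y M.a_comm[of x y] by (simp add: coh_class_add)
      fix Z assume "Z \<in> carrier ?N"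
      then obtain z where z: "Z = coh_class C m z" "z \<in> cocycles C m" "z \<in> carrier (cochains C m)" using rep by meson
      show "X \<oplus>\<^bsub>?N\<^esub> Y \<oplus>\<^bsub>?N\<^esub> Z = X \<oplus>\<^bsub>?N\<^esub> (Y \<oplus>\<^bsub>?N\<^esub> Z)"
        using x y z M.a_assoc[of x y z] by (simp add: coh_class_add)
    qed
  next
    fix a X assume a: "a \<in> carrier A" and "X \<in> carrier ?N"
    then obtain x where x: "X = coh_class C m x" "x \<in> cocycles C m" "x \<in> carrier (cochains C m)" using rep by meson
    show "a \<odot>\<^bsub>?N\<^esub> X \<in> carrier ?N"
      using x a cocycles_smult[of a x m] by (simp add: coh_class_smult) (simp add: cohomology_simps)
    fix b assume b: "b \<in> carrier A"
    show "(a \<oplus> b) \<odot>\<^bsub>?N\<^esub> X = a \<odot>\<^bsub>?N\<^esub> X \<oplus>\<^bsub>?N\<^esub> b \<odot>\<^bsub>?N\<^esub> X"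
      using a b x by (simp add: coh_class_smult coh_class_add M.smult_l_distr)
    show "(a \<otimes> b) \<odot>\<^bsub>?N\<^esub> X = a \<odot>\<^bsub>?N\<^esub> (b \<odot>\<^bsub>?N\<^esub> X)"
      using a b x by (simp add: coh_class_smult M.smult_assoc1)
  next
    fix X assume "X \<in> carrier ?N"
    then obtain x where x: "X = coh_class C m x" "x \<in> carrier (cochains C m)" using rep by meson
    show "\<one> \<odot>\<^bsub>?N\<^esub> X = X" using x by (simp add: coh_class_smult)
  next
    fix a X Y assume a: "a \<in> carrier A" and "X \<in> carrier ?N" "Y \<in> carrier ?N"
    then obtain x y where x: "X = coh_class C m x" "x \<in> carrier (cochains C m)"
      and y: "Y = coh_class C m y" "y \<in> carrier (cochains C m)" using rep by meson
    show "a \<odot>\<^bsub>?N\<^esub> (X \<oplus>\<^bsub>?N\<^esub> Y) = a \<odot>\<^bsub>?N\<^esub> X \<oplus>\<^bsub>?N\<^esub> a \<odot>\<^bsub>?N\<^esub> Y"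
      using a x y by (simp add: coh_class_smult coh_class_add M.smult_r_distr)
  qed
qed

end

section \<open>Radicals of ideals\<close>

context cring begin

text \<open>A binomial expansion is avoided by induction on \<open>k + l\<close>: one factor of the power of \<open>a \<oplus> b\<close> is
  distributed, and its summand \<open>a\<close> or \<open>b\<close> is moved into the auxiliary factor \<open>c\<close>.\<close>

lemma power_sum_mem_ideal:
  assumes J: "ideal J R" and a: "a \<in> carrier R" and b: "b \<in> carrier R"
  shows "c \<in> carrier R \<Longrightarrow> a [^] (k::nat) \<otimes> c \<in> J \<Longrightarrow> b [^] (l::nat) \<otimes> c \<in> J \<Longrightarrow> (a \<oplus> b) [^] (k + l) \<otimes> c \<in> J"
proof (induction "k + l" arbitrary: k l c)
  case 0
  thus ?case by simp
next
  case (Suc N)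
  interpret J: ideal J R by fact
  show ?case
  proof (cases "k = 0 \<or> l = 0")
    case True
    hence "c \<in> J" using Suc by auto
    thus ?thesis using a b by (simp add: J.I_l_closed)
  next
    case False
    then obtain k' l' where kl: "k = Suc k'" "l = Suc l'" by (meson not0_implies_Suc)
    have "(a \<oplus> b) [^] (k' + l) \<otimes> (a \<otimes> c) \<in> J"
    proof (rule Suc(1))
      show "N = k' + l" using Suc(2) kl by simp
      show "a [^] k' \<otimes> (a \<otimes> c) \<in> J" using Suc(4) kl a Suc(3) by (simp add: m_assoc)
      have "b [^] l \<otimes> (a \<otimes> c) = a \<otimes> (b [^] l \<otimes> c)" using a b Suc(3) by (simp add: m_ac)
      thus "b [^] l \<otimes> (a \<otimes> c) \<in> J" using Suc(5) a by (simp add: J.I_l_closed)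
    qed (use a Suc in auto)
    moreover have "(a \<oplus> b) [^] (k + l') \<otimes> (b \<otimes> c) \<in> J"
    proof (rule Suc(1))
      show "N = k + l'" using Suc(2) kl by simp
      show "b [^] l' \<otimes> (b \<otimes> c) \<in> J" using Suc(5) kl b Suc(3) by (simp add: m_assoc)
      have "a [^] k \<otimes> (b \<otimes> c) = b \<otimes> (a [^] k \<otimes> c)" using a b Suc(3) by (simp add: m_ac)
      thus "a [^] k \<otimes> (b \<otimes> c) \<in> J" using Suc(4) b by (simp add: J.I_l_closed)
    qed (use b Suc in auto)
    ultimately have "(a \<oplus> b) [^] N \<otimes> (a \<otimes> c) \<oplus> (a \<oplus> b) [^] N \<otimes> (b \<otimes> c) \<in> J"
      using kl Suc(2) by (simp add: J.a_closed)
    moreover have "(a \<oplus> b) [^] N \<otimes> (a \<otimes> c) \<oplus> (a \<oplus> b) [^] N \<otimes> (b \<otimes> c) = (a \<oplus> b) [^] (k + l) \<otimes> c"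
      unfolding Suc(2)[symmetric] using a b Suc(3) by (simp add: l_distr r_distr m_assoc)
    ultimately show ?thesis by simp
  qed
qed

definition radical :: "'a set \<Rightarrow> 'a set" where
  "radical J = {a \<in> carrier R. \<exists>N::nat. a [^] N \<in> J}"

lemma radical_ideal:
  assumes J: "ideal J R"
  shows "ideal (radical J) R"
proof -
  interpret J: ideal J R by fact
  have sm: "b \<otimes> a \<in> radical J" if ab: "a \<in> radical J" "b \<in> carrier R" for a b
  proof -
    from ab obtain N :: nat where N: "a \<in> carrier R" "a [^] N \<in> J" by (auto simp: radical_def)
    have "(b \<otimes> a) [^] N = b [^] N \<otimes> a [^] N" using N ab by (simp add: nat_pow_distrib)
    thus ?thesis using N ab by (auto simp: radical_def J.I_l_closed intro!: exI[of _ N])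
  qed
  show ?thesis
  proof (rule idealI)
    show "ring R" ..
    show "subgroup (radical J) (add_monoid R)"
    proof (rule add.subgroupI)
      have "\<zero> [^] (1::nat) \<in> J" by simp
      thus "radical J \<noteq> {}" unfolding radical_def by blast
    next
      fix a assume a: "a \<in> radical J"
      hence "\<ominus> \<one> \<otimes> a \<in> radical J" using sm by simp
      moreover have "\<ominus> \<one> \<otimes> a = \<ominus> a" using a by (simp add: radical_def l_minus)
      ultimately show "\<ominus> a \<in> radical J" by simp
    next
      fix a b assume "a \<in> radical J" "b \<in> radical J"
      then obtain k l :: nat where "a \<in> carrier R" "b \<in> carrier R" "a [^] k \<in> J" "b [^] l \<in> J"
        by (auto simp: radical_def)
      moreover from this have "(a \<oplus> b) [^] (k + l) \<in> J"
        using power_sum_mem_ideal[OF J, of a b \<one> k l] by simp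
      ultimately show "a \<oplus> b \<in> radical J" by (auto simp: radical_def)
    qed (auto simp: radical_def)
    show "a \<otimes> x \<in> radical J" if "a \<in> radical J" "x \<in> carrier R" for a x
      using sm[OF that] that by (simp add: m_comm radical_def)
    show "x \<otimes> a \<in> radical J" if "a \<in> radical J" "x \<in> carrier R" for a x
      using sm[OF that] .
  qed
qed

lemma power_mem_of_generators:
  assumes J: "ideal J R" and u: "u \<in> radical (Idl W)" and W: "W \<subseteq> radical J"
  shows "\<exists>N::nat. u [^] N \<in> J"
proof -
  have "Idl W \<subseteq> radical J" using radical_ideal[OF J] W by (rule genideal_minimal)
  then obtain N :: nat where N: "u \<in> carrier R" "u [^] N \<in> radical J"
    using u unfolding radical_def[of "Idl W"] by blast
  then obtain L :: nat where "(u [^] N) [^] L \<in> J" by (auto simp: radical_def)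
  thus ?thesis using N(1) by (auto simp: nat_pow_pow)
qed

end


section \<open>Cubes of modules\<close>

text \<open>A cube of modules is a commutative diagram on the subsets of \<open>P\<close>, ordered by inclusion. A tensor product
  of \<open>|P|\<close> two-term complexes is the total complex of such a cube, so that cubes cover Koszul complexes,
  Cech complexes and the tensor products of the two. An element of the total module \<open>T\<close> has
  components in all cohomological degrees \<open>|K|\<close>. This permits differentials \<open>dif S\<close> in the directions of a
  subset \<open>S\<close> only. The splitting \<open>dif P = dif S + dif (P - S)\<close> is the double complex structure.\<close>

locale cube = cring A for A :: "('a, 'm) ring_scheme" (structure) +
  fixes P :: "nat set" and M :: "nat set \<Rightarrow> ('a, 'b) module" and \<rho> :: "nat \<Rightarrow> nat set \<Rightarrow> 'b \<Rightarrow> 'b"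
  assumes finite_P: "finite P"
    and M_module: "K \<subseteq> P \<Longrightarrow> module A (M K)"
    and rho_closed: "\<lbrakk> K \<subseteq> P; j \<in> K; y \<in> carrier (M (K - {j})) \<rbrakk> \<Longrightarrow> \<rho> j K y \<in> carrier (M K)"
    and rho_add: "\<lbrakk> K \<subseteq> P; j \<in> K; x \<in> carrier (M (K - {j})); y \<in> carrier (M (K - {j})) \<rbrakk> \<Longrightarrow>
      \<rho> j K (x \<oplus>\<^bsub>M (K - {j})\<^esub> y) = \<rho> j K x \<oplus>\<^bsub>M K\<^esub> \<rho> j K y"
    and rho_smult: "\<lbrakk> K \<subseteq> P; j \<in> K; c \<in> carrier A; y \<in> carrier (M (K - {j})) \<rbrakk> \<Longrightarrow>
      \<rho> j K (c \<odot>\<^bsub>M (K - {j})\<^esub> y) = c \<odot>\<^bsub>M K\<^esub> \<rho> j K y"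
    and rho_comm: "\<lbrakk> K \<subseteq> P; i \<in> K; j \<in> K; i \<noteq> j; y \<in> carrier (M (K - {i, j})) \<rbrakk> \<Longrightarrow>
      \<rho> i K (\<rho> j (K - {i}) y) = \<rho> j K (\<rho> i (K - {j}) y)"
begin

abbreviation T :: "('a, nat set \<Rightarrow> 'b) module" where
  "T \<equiv> direct_sum (Pow P) M"

lemma M_group: "K \<subseteq> P \<Longrightarrow> abelian_group (M K)"
  using M_module by (rule module.axioms)

lemma M_monoid: "K \<subseteq> P \<Longrightarrow> abelian_monoid (M K)"
  using M_group by (rule abelian_group.axioms)

lemma M_closed [simp, intro]:
  assumes "K \<subseteq> P"
  shows "\<zero>\<^bsub>M K\<^esub> \<in> carrier (M K)"
    and "x \<in> carrier (M K) \<Longrightarrow> y \<in> carrier (M K) \<Longrightarrow> x \<oplus>\<^bsub>M K\<^esub> y \<in> carrier (M K)"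
    and "x \<in> carrier (M K) \<Longrightarrow> \<ominus>\<^bsub>M K\<^esub> x \<in> carrier (M K)"
    and "c \<in> carrier A \<Longrightarrow> x \<in> carrier (M K) \<Longrightarrow> c \<odot>\<^bsub>M K\<^esub> x \<in> carrier (M K)"
    and "x \<in> carrier (M K) \<Longrightarrow> y \<in> carrier (M K) \<Longrightarrow> x \<ominus>\<^bsub>M K\<^esub> y \<in> carrier (M K)"
proof -
  interpret module A "M K" using M_module assms .
  show "\<zero>\<^bsub>M K\<^esub> \<in> carrier (M K)"
    and "x \<in> carrier (M K) \<Longrightarrow> y \<in> carrier (M K) \<Longrightarrow> x \<oplus>\<^bsub>M K\<^esub> y \<in> carrier (M K)"
    and "x \<in> carrier (M K) \<Longrightarrow> \<ominus>\<^bsub>M K\<^esub> x \<in> carrier (M K)"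
    and "c \<in> carrier A \<Longrightarrow> x \<in> carrier (M K) \<Longrightarrow> c \<odot>\<^bsub>M K\<^esub> x \<in> carrier (M K)"
    and "x \<in> carrier (M K) \<Longrightarrow> y \<in> carrier (M K) \<Longrightarrow> x \<ominus>\<^bsub>M K\<^esub> y \<in> carrier (M K)"
    by auto
qed

sublocale T: module A T
  by (rule direct_sum_module) (auto intro: is_cring M_module)

lemma T_in: "f \<in> carrier T \<Longrightarrow> K \<subseteq> P \<Longrightarrow> f K \<in> carrier (M K)"
  by (auto simp: PiE_iff)

lemma T_I: "(\<And>K. K \<subseteq> P \<Longrightarrow> f K \<in> carrier (M K)) \<Longrightarrow> (\<lambda>K\<in>Pow P. f K) \<in> carrier T"
  by auto

lemma T_eqI: "f \<in> carrier T \<Longrightarrow> g \<in> carrier T \<Longrightarrow> (\<And>K. K \<subseteq> P \<Longrightarrow> f K = g K) \<Longrightarrow> f = g"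
  by (rule extensionalityI[of _ "Pow P"]) (auto simp: PiE_iff)

lemma T_apply:
  assumes "K \<subseteq> P"
  shows "\<zero>\<^bsub>T\<^esub> K = \<zero>\<^bsub>M K\<^esub>" "(f \<oplus>\<^bsub>T\<^esub> g) K = f K \<oplus>\<^bsub>M K\<^esub> g K" "(c \<odot>\<^bsub>T\<^esub> f) K = c \<odot>\<^bsub>M K\<^esub> f K"
    "f \<in> carrier T \<Longrightarrow> g \<in> carrier T \<Longrightarrow> (f \<ominus>\<^bsub>T\<^esub> g) K = f K \<ominus>\<^bsub>M K\<^esub> g K"
    "f \<in> carrier T \<Longrightarrow> (\<ominus>\<^bsub>T\<^esub> f) K = \<ominus>\<^bsub>M K\<^esub> f K"
  using assms direct_sum_minus[OF is_cring, of "Pow P" M f g]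
    direct_sum_minus(1)[OF is_cring, of "Pow P" M f f] M_module by auto

definition sr :: "nat \<Rightarrow> nat set \<Rightarrow> 'b \<Rightarrow> 'b" where
  "sr j K y = (if even (card {k \<in> K. k < j}) then \<rho> j K y else \<ominus>\<^bsub>M K\<^esub> \<rho> j K y)"

lemma rho_zero: "K \<subseteq> P \<Longrightarrow> j \<in> K \<Longrightarrow> \<rho> j K \<zero>\<^bsub>M (K - {j})\<^esub> = \<zero>\<^bsub>M K\<^esub>"
proof -
  assume K: "K \<subseteq> P" "j \<in> K"
  interpret K: module A "M K" using M_module K(1) .
  interpret L: module A "M (K - {j})" using M_module[of "K - {j}"] K(1) by blast
  show ?thesis using rho_smult[OF K, of \<zero> "\<zero>\<^bsub>M (K - {j})\<^esub>"] rho_closed[OF K, of "\<zero>\<^bsub>M (K - {j})\<^esub>"] by simp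
qed

lemma rho_neg: "K \<subseteq> P \<Longrightarrow> j \<in> K \<Longrightarrow> y \<in> carrier (M (K - {j})) \<Longrightarrow> \<rho> j K (\<ominus>\<^bsub>M (K - {j})\<^esub> y) = \<ominus>\<^bsub>M K\<^esub> \<rho> j K y"
proof -
  assume K: "K \<subseteq> P" "j \<in> K" and y: "y \<in> carrier (M (K - {j}))"
  interpret K: module A "M K" using M_module K(1) .
  interpret L: module A "M (K - {j})" using M_module[of "K - {j}"] K(1) by blast
  have "\<rho> j K (\<ominus>\<^bsub>M (K - {j})\<^esub> y) = \<rho> j K ((\<ominus> \<one>) \<odot>\<^bsub>M (K - {j})\<^esub> y)" using y by (simp add: L.smult_l_minus)
  also have "\<dots> = \<ominus>\<^bsub>M K\<^esub> \<rho> j K y" using rho_smult[OF K _ y] rho_closed[OF K y] by (simp add: K.smult_l_minus)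
  finally show ?thesis .
qed

lemma sr_closed: "K \<subseteq> P \<Longrightarrow> j \<in> K \<Longrightarrow> y \<in> carrier (M (K - {j})) \<Longrightarrow> sr j K y \<in> carrier (M K)"
  by (simp add: sr_def rho_closed)

lemma sr_add:
  assumes K: "K \<subseteq> P" "j \<in> K" and x: "x \<in> carrier (M (K - {j}))" and y: "y \<in> carrier (M (K - {j}))"
  shows "sr j K (x \<oplus>\<^bsub>M (K - {j})\<^esub> y) = sr j K x \<oplus>\<^bsub>M K\<^esub> sr j K y"
proof -
  interpret K: module A "M K" using M_module K(1) .
  show ?thesis unfolding sr_def using K x y by (simp add: rho_add rho_closed K.minus_add)
qed

lemma sr_smult:
  assumes K: "K \<subseteq> P" "j \<in> K" and c: "c \<in> carrier A" and y: "y \<in> carrier (M (K - {j}))"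
  shows "sr j K (c \<odot>\<^bsub>M (K - {j})\<^esub> y) = c \<odot>\<^bsub>M K\<^esub> sr j K y"
proof -
  interpret K: module A "M K" using M_module K(1) .
  show ?thesis unfolding sr_def using K c y by (simp add: rho_smult rho_closed K.smult_r_minus)
qed

lemma sr_zero: "K \<subseteq> P \<Longrightarrow> j \<in> K \<Longrightarrow> sr j K \<zero>\<^bsub>M (K - {j})\<^esub> = \<zero>\<^bsub>M K\<^esub>"
proof -
  assume K: "K \<subseteq> P" "j \<in> K"
  interpret K: module A "M K" using M_module K(1) .
  show ?thesis unfolding sr_def using K by (simp add: rho_zero)
qed

lemma sr_eq_zero_iff:
  assumes K: "K \<subseteq> P" "j \<in> K" and y: "y \<in> carrier (M (K - {j}))"
  shows "sr j K y = \<zero>\<^bsub>M K\<^esub> \<longleftrightarrow> \<rho> j K y = \<zero>\<^bsub>M K\<^esub>"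
proof -
  interpret K: module A "M K" using M_module K(1) .
  show ?thesis unfolding sr_def using rho_closed[OF K y] by (metis K.M.add.inv_eq_1_iff a_inv_def)
qed

text \<open>Removing the smaller of two directions \<open>i < j\<close> changes the number of directions in front of \<open>j\<close> by one;
  removing \<open>j\<close> does not change the number of directions in front of \<open>i\<close>.\<close>

lemma sr_anticommute:
  assumes K: "K \<subseteq> P" "i \<in> K" "j \<in> K" "i < j" and y: "y \<in> carrier (M (K - {i, j}))"
  shows "sr i K (sr j (K - {i}) y) = \<ominus>\<^bsub>M K\<^esub> sr j K (sr i (K - {j}) y)"
proof -
  interpret K: module A "M K" using M_module K(1) .
  have fin: "finite K" using K finite_P finite_subset by blast
  have sub: "K - {i} \<subseteq> P" "K - {j} \<subseteq> P" "j \<in> K - {i}" "i \<in> K - {j}" using K by auto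
  have e: "K - {i} - {j} = K - {i, j}" "K - {j} - {i} = K - {i, j}" by auto
  have "{k \<in> K. k < j} = insert i {k \<in> K - {i}. k < j}" using K by auto
  hence c1: "card {k \<in> K. k < j} = Suc (card {k \<in> K - {i}. k < j})" using fin by simp
  have c2: "{k \<in> K - {j}. k < i} = {k \<in> K. k < i}" using K by auto
  have r1: "\<rho> j (K - {i}) y \<in> carrier (M (K - {i}))" and r2: "\<rho> i (K - {j}) y \<in> carrier (M (K - {j}))"
    using rho_closed sub y e by metis+
  have r3: "\<rho> i K (\<rho> j (K - {i}) y) \<in> carrier (M K)" using rho_closed[OF K(1,2) r1] .
  show ?thesis unfolding sr_def c1 c2
    using rho_comm[OF K(1-3) _ y] K(4) r1 r2 r3 rho_neg[OF K(1,2) r1] rho_neg[OF K(1,3) r2]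
    by (auto simp: K.M.minus_minus)
qed

definition dif :: "nat set \<Rightarrow> (nat set \<Rightarrow> 'b) \<Rightarrow> (nat set \<Rightarrow> 'b)" where
  "dif S f = (\<lambda>K\<in>Pow P. \<Oplus>\<^bsub>M K\<^esub>j\<in>K \<inter> S. sr j K (f (K - {j})))"

lemma dif_apply: "K \<subseteq> P \<Longrightarrow> dif S f K = (\<Oplus>\<^bsub>M K\<^esub>j\<in>K \<inter> S. sr j K (f (K - {j})))"
  by (simp add: dif_def)

lemma summand_closed: "f \<in> carrier T \<Longrightarrow> K \<subseteq> P \<Longrightarrow> j \<in> K \<Longrightarrow> sr j K (f (K - {j})) \<in> carrier (M K)"
  by (rule sr_closed) (auto intro: T_in)

lemma dif_closed: "f \<in> carrier T \<Longrightarrow> dif S f \<in> carrier T"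
  unfolding dif_def
  by (intro T_I abelian_monoid.finsum_closed[OF M_monoid]) (auto intro: summand_closed)

lemma dif_add:
  assumes f: "f \<in> carrier T" and g: "g \<in> carrier T"
  shows "dif S (f \<oplus>\<^bsub>T\<^esub> g) = dif S f \<oplus>\<^bsub>T\<^esub> dif S g"
proof (rule T_eqI)
  fix K assume K: "K \<subseteq> P"
  interpret K: module A "M K" using M_module K .
  have "dif S (f \<oplus>\<^bsub>T\<^esub> g) K = (\<Oplus>\<^bsub>M K\<^esub>j\<in>K \<inter> S. sr j K (f (K - {j})) \<oplus>\<^bsub>M K\<^esub> sr j K (g (K - {j})))"
    unfolding dif_apply[OF K]
  proof (rule K.M.finsum_cong')
    fix j assume j: "j \<in> K \<inter> S"
    have K': "K - {j} \<subseteq> P" using K by auto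
    show "sr j K ((f \<oplus>\<^bsub>T\<^esub> g) (K - {j})) = sr j K (f (K - {j})) \<oplus>\<^bsub>M K\<^esub> sr j K (g (K - {j}))"
      unfolding T_apply(2)[OF K'] using j K K' f g by (intro sr_add T_in) auto
  qed (use f g K in \<open>auto intro!: summand_closed K.M.a_closed simp del: direct_sum_simps\<close>)
  also have "\<dots> = (dif S f \<oplus>\<^bsub>T\<^esub> dif S g) K"
    unfolding T_apply(2)[OF K] dif_apply[OF K]
    using f g K by (intro K.M.finsum_addf) (auto intro!: summand_closed simp del: direct_sum_simps)
  finally show "dif S (f \<oplus>\<^bsub>T\<^esub> g) K = (dif S f \<oplus>\<^bsub>T\<^esub> dif S g) K" .
qed (use f g in \<open>auto intro!: dif_closed T.M.a_closed simp del: direct_sum_simps\<close>)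

lemma dif_smult:
  assumes f: "f \<in> carrier T" and c: "c \<in> carrier A"
  shows "dif S (c \<odot>\<^bsub>T\<^esub> f) = c \<odot>\<^bsub>T\<^esub> dif S f"
proof (rule T_eqI)
  fix K assume K: "K \<subseteq> P"
  interpret K: module A "M K" using M_module K .
  have fin: "finite (K \<inter> S)" using K finite_P finite_subset by blast
  have "dif S (c \<odot>\<^bsub>T\<^esub> f) K = (\<Oplus>\<^bsub>M K\<^esub>j\<in>K \<inter> S. c \<odot>\<^bsub>M K\<^esub> sr j K (f (K - {j})))"
    unfolding dif_apply[OF K]
  proof (rule K.M.finsum_cong')
    fix j assume j: "j \<in> K \<inter> S"
    have K': "K - {j} \<subseteq> P" using K by auto
    show "sr j K ((c \<odot>\<^bsub>T\<^esub> f) (K - {j})) = c \<odot>\<^bsub>M K\<^esub> sr j K (f (K - {j}))"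
      unfolding T_apply(3)[OF K'] using j K K' f c by (intro sr_smult T_in) auto
  qed (use f c K in \<open>auto intro!: summand_closed K.smult_closed simp del: direct_sum_simps\<close>)
  also have "\<dots> = (c \<odot>\<^bsub>T\<^esub> dif S f) K"
    unfolding T_apply(3)[OF K] dif_apply[OF K]
    using f c K fin by (intro K.finsum_smult_ldistr[symmetric]) (auto intro!: summand_closed simp del: direct_sum_simps)
  finally show "dif S (c \<odot>\<^bsub>T\<^esub> f) K = (c \<odot>\<^bsub>T\<^esub> dif S f) K" .
qed (use f c in \<open>auto intro!: dif_closed T.smult_closed simp del: direct_sum_simps\<close>)

lemma dif_zero: "dif S \<zero>\<^bsub>T\<^esub> = \<zero>\<^bsub>T\<^esub>"
  using dif_smult[of "\<zero>\<^bsub>T\<^esub>" \<zero> S] dif_closed[of "\<zero>\<^bsub>T\<^esub>" S] T.M.zero_closed T.smult_l_null by (metis zero_closed)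

lemma dif_neg: "f \<in> carrier T \<Longrightarrow> dif S (\<ominus>\<^bsub>T\<^esub> f) = \<ominus>\<^bsub>T\<^esub> dif S f"
  using dif_smult[of f "\<ominus> \<one>" S] dif_closed[of f S]
  by (simp add: T.smult_l_minus del: direct_sum_simps)

lemma dif_minus: "f \<in> carrier T \<Longrightarrow> g \<in> carrier T \<Longrightarrow> dif S (f \<ominus>\<^bsub>T\<^esub> g) = dif S f \<ominus>\<^bsub>T\<^esub> dif S g"
  unfolding a_minus_def by (simp add: dif_add dif_neg del: direct_sum_simps)

lemma dif_local:
  assumes "K \<subseteq> P" "\<And>j. j \<in> K \<Longrightarrow> j \<in> S \<Longrightarrow> f (K - {j}) = g (K - {j})" "g \<in> carrier T"
  shows "dif S f K = dif S g K"
  unfolding dif_apply[OF assms(1)]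
  by (rule abelian_monoid.finsum_cong'[OF M_monoid]) (use assms in \<open>auto intro!: summand_closed simp del: direct_sum_simps\<close>)

lemma dif_zero_at:
  assumes K: "K \<subseteq> P" "\<And>j. j \<in> K \<Longrightarrow> j \<in> S \<Longrightarrow> f (K - {j}) = \<zero>\<^bsub>M (K - {j})\<^esub>"
  shows "dif S f K = \<zero>\<^bsub>M K\<^esub>"
proof -
  have "dif S f K = dif S \<zero>\<^bsub>T\<^esub> K"
    by (rule dif_local[OF K(1)]) (use K T.M.zero_closed in auto)
  thus ?thesis unfolding dif_zero T_apply(1)[OF K(1)] .
qed

lemma dif_Un:
  assumes f: "f \<in> carrier T" and S: "S \<inter> S' = {}"
  shows "dif (S \<union> S') f = dif S f \<oplus>\<^bsub>T\<^esub> dif S' f"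
proof (rule T_eqI)
  fix K assume K: "K \<subseteq> P"
  interpret K: module A "M K" using M_module K .
  have fin: "finite K" using K finite_P finite_subset by blast
  have "K \<inter> (S \<union> S') = (K \<inter> S) \<union> (K \<inter> S')" by auto
  thus "dif (S \<union> S') f K = (dif S f \<oplus>\<^bsub>T\<^esub> dif S' f) K"
    unfolding T_apply(2)[OF K] dif_apply[OF K] using fin K f S
    by (simp only:) (rule K.M.finsum_Un_disjoint, auto intro!: summand_closed simp del: direct_sum_simps)
qed (use f in \<open>auto intro!: dif_closed T.M.a_closed simp del: direct_sum_simps\<close>)

lemma dif_empty: "dif {} f = \<zero>\<^bsub>T\<^esub>"
  by (auto simp: dif_def intro!: restrict_ext abelian_monoid.finsum_empty[OF M_monoid])

lemma dif_single:
  assumes f: "f \<in> carrier T" and K: "K \<subseteq> P"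
  shows "dif {l} f K = (if l \<in> K then sr l K (f (K - {l})) else \<zero>\<^bsub>M K\<^esub>)"
proof -
  interpret K: module A "M K" using M_module K .
  show ?thesis
  proof (cases "l \<in> K")
    case True
    hence "K \<inter> {l} = {l}" by auto
    thus ?thesis unfolding dif_apply[OF K] using True summand_closed[OF f K True] by simp
  qed (simp add: dif_apply[OF K])
qed

lemma dif_single_single:
  assumes f: "f \<in> carrier T"
  shows "dif {l} (dif {l} f) = \<zero>\<^bsub>T\<^esub>"
proof (rule T_eqI)
  fix K assume K: "K \<subseteq> P"
  hence K': "K - {l} \<subseteq> P" by auto
  show "dif {l} (dif {l} f) K = \<zero>\<^bsub>T\<^esub> K"
    unfolding dif_single[OF dif_closed[OF f] K] dif_single[OF f K'] T_apply(1)[OF K]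
    using sr_zero[OF K] by simp
qed (use f in \<open>auto intro!: dif_closed simp del: direct_sum_simps\<close>)

lemma dif_single_anticommute:
  assumes f: "f \<in> carrier T" and "l \<noteq> m"
  shows "dif {l} (dif {m} f) = \<ominus>\<^bsub>T\<^esub> dif {m} (dif {l} f)"
proof (rule T_eqI)
  fix K assume K: "K \<subseteq> P"
  interpret K: module A "M K" using M_module K .
  have c: "dif {l} (dif {m} f) \<in> carrier T" for l m using f by (intro dif_closed)
  have K': "K - {l} \<subseteq> P" "K - {m} \<subseteq> P" using K by auto
  have e: "K - {m} - {l} = K - {l, m}" "K - {l} - {m} = K - {l, m}" by auto
  have y: "f (K - {l, m}) \<in> carrier (M (K - {l, m}))" using f K by (intro T_in) auto
  have y': "f (K - {l, m}) \<in> carrier (M (K - {m, l}))" using y by (simp add: insert_commute)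
  show "dif {l} (dif {m} f) K = (\<ominus>\<^bsub>T\<^esub> dif {m} (dif {l} f)) K"
  proof (cases "l \<in> K \<and> m \<in> K")
    case True
    have i: "sr l K (sr m (K - {l}) (f (K - {l, m}))) \<in> carrier (M K)"
      by (rule sr_closed[OF K], use True in simp, rule sr_closed[OF K'(1)], use True assms in simp, simp add: e y)
    have j: "sr m K (sr l (K - {m}) (f (K - {l, m}))) \<in> carrier (M K)"
      by (rule sr_closed[OF K], use True in simp, rule sr_closed[OF K'(2)], use True assms in simp, simp add: e y)
    have "sr l K (sr m (K - {l}) (f (K - {l, m}))) = \<ominus>\<^bsub>M K\<^esub> sr m K (sr l (K - {m}) (f (K - {l, m})))"
    proof (cases "l < m")
      case True
      thus ?thesis using sr_anticommute[OF K, of l m "f (K - {l, m})"] \<open>l \<in> K \<and> m \<in> K\<close> y by simp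
    next
      case False
      thus ?thesis using sr_anticommute[OF K, of m l "f (K - {l, m})"] \<open>l \<in> K \<and> m \<in> K\<close> assms y' i
        by (simp add: K.M.minus_minus)
    qed
    thus ?thesis unfolding T_apply(5)[OF K c]
      unfolding dif_single[OF dif_closed[OF f] K] dif_single[OF f K'(1)] dif_single[OF f K'(2)]
      using True assms by (simp add: e)
  next
    case False
    thus ?thesis unfolding T_apply(5)[OF K c]
      unfolding dif_single[OF dif_closed[OF f] K] dif_single[OF f K'(1)] dif_single[OF f K'(2)]
      using sr_zero[OF K] assms K.M.add.inv_one by (auto simp: e a_inv_def)
  qed
qed (use f in \<open>auto intro!: dif_closed simp del: direct_sum_simps\<close>)

lemma dif_single_dif:
  assumes f: "f \<in> carrier T" and "finite S" "l \<notin> S"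
  shows "dif {l} (dif S f) = \<ominus>\<^bsub>T\<^esub> dif S (dif {l} f)"
  using assms(2,3)
proof (induction S)
  case empty
  thus ?case using T.M.add.inv_one by (simp add: dif_empty dif_zero a_inv_def del: direct_sum_simps)
next
  case (insert m S)
  have u: "dif (insert m S) g = dif {m} g \<oplus>\<^bsub>T\<^esub> dif S g" if "g \<in> carrier T" for g
    using dif_Un[OF that, of "{m}" S] insert by simp
  show ?case
    using insert dif_single_anticommute[OF f, of l m] f
    by (simp add: u dif_closed dif_add T.M.minus_add del: direct_sum_simps)
qed

lemma dif_dif:
  assumes f: "f \<in> carrier T"
  shows "dif S (dif S f) = \<zero>\<^bsub>T\<^esub>"
proof -
  have *: "dif S (dif S f) = \<zero>\<^bsub>T\<^esub>" if "finite S" for S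
    using that
  proof (induction S)
    case empty
    thus ?case by (simp add: dif_empty dif_zero del: direct_sum_simps)
  next
    case (insert m S)
    have u: "dif (insert m S) g = dif {m} g \<oplus>\<^bsub>T\<^esub> dif S g" if "g \<in> carrier T" for g
      using dif_Un[OF that, of "{m}" S] insert by simp
    show ?case
      using insert f dif_single_dif[OF f insert(1,2)]
      by (simp add: u dif_closed dif_add dif_single_single T.M.r_neg del: direct_sum_simps)
  qed
  have e: "dif S = dif (S \<inter> P)"
    by (intro ext) (auto simp: dif_def Int_assoc[symmetric] intro!: restrict_ext arg_cong[where f = "\<lambda>X. finsum _ _ X"])
  show ?thesis unfolding e using finite_P by (intro *) simp
qed

text \<open>Cohomological degrees and filtrations of total elements are expressed by conditions on the index sets at
  which an element may be nonzero.\<close>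

definition supp :: "(nat set \<Rightarrow> bool) \<Rightarrow> (nat set \<Rightarrow> 'b) \<Rightarrow> bool" where
  "supp Q f \<longleftrightarrow> (\<forall>K \<subseteq> P. \<not> Q K \<longrightarrow> f K = \<zero>\<^bsub>M K\<^esub>)"

definition cut :: "(nat set \<Rightarrow> bool) \<Rightarrow> (nat set \<Rightarrow> 'b) \<Rightarrow> (nat set \<Rightarrow> 'b)" where
  "cut Q f = (\<lambda>K\<in>Pow P. if Q K then f K else \<zero>\<^bsub>M K\<^esub>)"

lemma card_Diff1: "K \<subseteq> P \<Longrightarrow> j \<in> K \<Longrightarrow> card K = Suc (card (K - {j}))"
  using finite_P finite_subset by (metis card_Suc_Diff1)

lemma cut_closed: "f \<in> carrier T \<Longrightarrow> cut Q f \<in> carrier T"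
  unfolding cut_def by (rule T_I) (auto intro!: T_in simp del: direct_sum_simps)

lemma cut_apply: "K \<subseteq> P \<Longrightarrow> cut Q f K = (if Q K then f K else \<zero>\<^bsub>M K\<^esub>)"
  by (simp add: cut_def)

lemma supp_cut: "supp Q (cut Q f)"
  by (simp add: supp_def cut_def)

lemma cut_supp: "f \<in> carrier T \<Longrightarrow> supp Q f \<Longrightarrow> cut Q f = f"
  by (rule T_eqI) (auto simp: supp_def cut_apply intro!: cut_closed simp del: direct_sum_simps)

lemma supp_mono: "supp Q f \<Longrightarrow> (\<And>K. K \<subseteq> P \<Longrightarrow> Q K \<Longrightarrow> R K) \<Longrightarrow> supp R f"
  by (auto simp: supp_def)

lemma supp_add: "supp Q f \<Longrightarrow> supp Q g \<Longrightarrow> supp Q (f \<oplus>\<^bsub>T\<^esub> g)"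
  unfolding supp_def using M_monoid M_closed
  by (auto simp: abelian_monoid.l_zero)

lemma supp_minus: "f \<in> carrier T \<Longrightarrow> g \<in> carrier T \<Longrightarrow> supp Q f \<Longrightarrow> supp Q g \<Longrightarrow> supp Q (f \<ominus>\<^bsub>T\<^esub> g)"
  unfolding supp_def
proof (intro allI impI)
  fix K assume *: "f \<in> carrier T" "g \<in> carrier T" "\<forall>K\<subseteq>P. \<not> Q K \<longrightarrow> f K = \<zero>\<^bsub>M K\<^esub>"
    "\<forall>K\<subseteq>P. \<not> Q K \<longrightarrow> g K = \<zero>\<^bsub>M K\<^esub>" and K: "K \<subseteq> P" "\<not> Q K"
  interpret K: module A "M K" using M_module K(1) .
  show "(f \<ominus>\<^bsub>T\<^esub> g) K = \<zero>\<^bsub>M K\<^esub>" unfolding T_apply(4)[OF K(1) *(1,2)] using * K by (simp add: a_minus_def)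
qed

lemma supp_zero_false: "f \<in> carrier T \<Longrightarrow> supp (\<lambda>K. False) f \<Longrightarrow> f = \<zero>\<^bsub>T\<^esub>"
  by (rule T_eqI) (auto simp: supp_def T.M.zero_closed simp del: direct_sum_simps intro: T_apply(1)[symmetric])

lemma supp_dif:
  assumes "supp Q f" and "\<And>K j. K \<subseteq> P \<Longrightarrow> j \<in> K \<Longrightarrow> j \<in> S \<Longrightarrow> Q (K - {j}) \<Longrightarrow> R K"
  shows "supp R (dif S f)"
  unfolding supp_def
proof (intro allI impI)
  fix K assume K: "K \<subseteq> P" "\<not> R K"
  show "dif S f K = \<zero>\<^bsub>M K\<^esub>"
  proof (rule dif_zero_at[OF K(1)])
    fix j assume j: "j \<in> K" "j \<in> S"
    hence "\<not> Q (K - {j})" using assms(2)[OF K(1) j] K by auto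
    thus "f (K - {j}) = \<zero>\<^bsub>M (K - {j})\<^esub>" using assms(1) K unfolding supp_def by blast
  qed
qed

lemma dif_cut:
  assumes f: "f \<in> carrier T" and Q: "\<And>K j. K \<subseteq> P \<Longrightarrow> j \<in> K \<Longrightarrow> j \<in> S \<Longrightarrow> Q (K - {j}) \<longleftrightarrow> R K"
  shows "dif S (cut Q f) = cut R (dif S f)"
proof (rule T_eqI)
  fix K assume K: "K \<subseteq> P"
  show "dif S (cut Q f) K = cut R (dif S f) K"
  proof (cases "R K")
    case True
    hence "dif S (cut Q f) K = dif S f K"
      using K Q f by (intro dif_local) (auto simp: cut_apply[OF order_trans[OF Diff_subset]] simp del: direct_sum_simps)
    thus ?thesis using True K by (simp add: cut_apply)
  next
    case False
    hence "dif S (cut Q f) K = \<zero>\<^bsub>M K\<^esub>"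
      using K Q by (intro dif_zero_at) (auto simp: cut_apply[OF order_trans[OF Diff_subset]])
    thus ?thesis using False K by (simp add: cut_apply)
  qed
qed (use f in \<open>auto intro!: dif_closed cut_closed simp del: direct_sum_simps\<close>)

end

section \<open>Exact slices\<close>

lemma uniform_exponent:
  assumes "finite F" and ex: "\<And>x. x \<in> F \<Longrightarrow> \<exists>N::nat. Q x N"
    and mono: "\<And>x N k. x \<in> F \<Longrightarrow> Q x N \<Longrightarrow> Q x (N + k)"
  shows "\<exists>N. \<forall>x\<in>F. Q x N"
proof -
  obtain N where N: "\<And>x. x \<in> F \<Longrightarrow> Q x (N x)" using ex by metis
  have "Q x (Max (N ` F))" if "x \<in> F" for x
  proof -
    have "N x \<le> Max (N ` F)" using that assms(1) by simp
    thus ?thesis using mono[OF that N[OF that], of "Max (N ` F) - N x"] by simp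
  qed
  thus ?thesis by blast
qed

context cube
begin

lemma supp_zero: "supp Q \<zero>\<^bsub>T\<^esub>"
  unfolding supp_def using T_apply(1) by blast

lemma T_minus_zero: "f \<in> carrier T \<Longrightarrow> f \<ominus>\<^bsub>T\<^esub> \<zero>\<^bsub>T\<^esub> = f"
  unfolding a_minus_def a_inv_def using T.M.add.inv_one T.M.r_zero by (metis T.M.add.inv_one a_inv_def monoid.select_convs(2))

text \<open>The total complex in the directions \<open>S\<close> is, up to a shift, the cone of the maps \<open>\<rho> l\<close>. If the kernel and the cokernel of
  these maps are \<open>w\<close>-power torsion, then so is the cohomology of the cone. This covers Koszul directions,
  where \<open>\<rho> l\<close> is multiplication by \<open>w\<close>, as well as Cech directions, where it is localization at \<open>w\<close>.\<close>

lemma torsion: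
  assumes l: "l \<in> S" "l \<in> P" and w: "w \<in> carrier A"
    and ker: "\<And>K y. \<lbrakk> K \<subseteq> P; l \<in> K; y \<in> carrier (M (K - {l})); \<rho> l K y = \<zero>\<^bsub>M K\<^esub> \<rbrakk> \<Longrightarrow>
      \<exists>N::nat. w [^] N \<odot>\<^bsub>M (K - {l})\<^esub> y = \<zero>\<^bsub>M (K - {l})\<^esub>"
    and coker: "\<And>K y. \<lbrakk> K \<subseteq> P; l \<in> K; y \<in> carrier (M K) \<rbrakk> \<Longrightarrow>
      \<exists>N::nat. \<exists>x \<in> carrier (M (K - {l})). \<rho> l K x = w [^] N \<odot>\<^bsub>M K\<^esub> y"
    and f: "f \<in> carrier T" "dif S f = \<zero>\<^bsub>T\<^esub>"
  shows "\<exists>N::nat. \<exists>g \<in> carrier T. w [^] N \<odot>\<^bsub>T\<^esub> f = dif S g"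
proof -
  have wN: "w [^] (N::nat) \<in> carrier A" for N using w by simp
  define F where "F = {K. K \<subseteq> P \<and> l \<notin> K}"
  have finF: "finite F" using finite_P unfolding F_def by simp
  have FD: "K \<subseteq> P" "insert l K \<subseteq> P" "l \<in> insert l K" "insert l K - {l} = K" if "K \<in> F" for K
    using that l unfolding F_def by auto
  have "\<exists>N::nat. \<forall>K\<in>F. \<exists>x \<in> carrier (M K). sr l (insert l K) x = w [^] N \<odot>\<^bsub>M (insert l K)\<^esub> f (insert l K)"
  proof (rule uniform_exponent[OF finF])
    fix K assume K: "K \<in> F"
    interpret K': module A "M (insert l K)" using M_module FD(2)[OF K] .
    have fK: "f (insert l K) \<in> carrier (M (insert l K))" using f(1) FD(2)[OF K] by (rule T_in)
    obtain N :: nat and x where x: "x \<in> carrier (M K)" "\<rho> l (insert l K) x = w [^] N \<odot>\<^bsub>M (insert l K)\<^esub> f (insert l K)"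
      using coker[OF FD(2,3)[OF K] fK] FD(4)[OF K] by auto
    show "\<exists>N. \<exists>x \<in> carrier (M K). sr l (insert l K) x = w [^] (N::nat) \<odot>\<^bsub>M (insert l K)\<^esub> f (insert l K)"
    proof (cases "even (card {k \<in> insert l K. k < l})")
      case True
      thus ?thesis using x unfolding sr_def by auto
    next
      case False
      have "\<rho> l (insert l K) (\<ominus>\<^bsub>M K\<^esub> x) = \<ominus>\<^bsub>M (insert l K)\<^esub> \<rho> l (insert l K) x"
        using rho_neg[OF FD(2,3)[OF K], of x] x(1) FD(4)[OF K] by simp
      hence "sr l (insert l K) (\<ominus>\<^bsub>M K\<^esub> x) = w [^] N \<odot>\<^bsub>M (insert l K)\<^esub> f (insert l K)"
        unfolding sr_def using False x(2) fK wN by (simp add: K'.M.minus_minus)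
      thus ?thesis using x(1) FD(1)[OF K] by (intro exI[of _ N] bexI[of _ "\<ominus>\<^bsub>M K\<^esub> x"]) auto
    qed
  next
    fix K and N k :: nat assume K: "K \<in> F"
    interpret K': module A "M (insert l K)" using M_module FD(2)[OF K] .
    assume "\<exists>x \<in> carrier (M K). sr l (insert l K) x = w [^] N \<odot>\<^bsub>M (insert l K)\<^esub> f (insert l K)"
    then obtain x where x: "x \<in> carrier (M K)" "sr l (insert l K) x = w [^] N \<odot>\<^bsub>M (insert l K)\<^esub> f (insert l K)" by blast
    have fK: "f (insert l K) \<in> carrier (M (insert l K))" using f(1) FD(2)[OF K] by (rule T_in)
    have "sr l (insert l K) (w [^] k \<odot>\<^bsub>M K\<^esub> x) = w [^] k \<odot>\<^bsub>M (insert l K)\<^esub> sr l (insert l K) x"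
      using sr_smult[OF FD(2,3)[OF K] wN, of x] x(1) FD(4)[OF K] by simp
    also have "\<dots> = w [^] (N + k) \<odot>\<^bsub>M (insert l K)\<^esub> f (insert l K)"
      unfolding x(2) using fK w by (simp add: K'.smult_assoc1[symmetric] nat_pow_mult add.commute)
    finally show "\<exists>x \<in> carrier (M K). sr l (insert l K) x = w [^] (N + k) \<odot>\<^bsub>M (insert l K)\<^esub> f (insert l K)"
      using x(1) FD(1)[OF K] wN by blast
  qed
  then obtain N :: nat where "\<forall>K\<in>F. \<exists>x \<in> carrier (M K). sr l (insert l K) x = w [^] N \<odot>\<^bsub>M (insert l K)\<^esub> f (insert l K)" ..
  then obtain x where x: "\<And>K. K \<in> F \<Longrightarrow> x K \<in> carrier (M K)"
      "\<And>K. K \<in> F \<Longrightarrow> sr l (insert l K) (x K) = w [^] N \<odot>\<^bsub>M (insert l K)\<^esub> f (insert l K)" by metis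
  define g where "g = (\<lambda>K\<in>Pow P. if l \<in> K then \<zero>\<^bsub>M K\<^esub> else x K)"
  have g: "g \<in> carrier T" unfolding g_def by (rule T_I) (auto simp: F_def intro!: x(1))
  have wf: "w [^] N \<odot>\<^bsub>T\<^esub> f \<in> carrier T" using f wN by (rule_tac T.smult_closed)
  define h where "h = w [^] N \<odot>\<^bsub>T\<^esub> f \<ominus>\<^bsub>T\<^esub> dif S g"
  have h: "h \<in> carrier T" unfolding h_def using wf g dif_closed T.M.minus_closed by blast
  have sgl: "dif S u = dif {l} u \<oplus>\<^bsub>T\<^esub> dif (S - {l}) u" if "u \<in> carrier T" for u
    using dif_Un[OF that, of "{l}" "S - {l}"] l by (simp add: insert_absorb)
  have off: "dif (S - {l}) u K = \<zero>\<^bsub>M K\<^esub>"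
    if "u \<in> carrier T" "\<And>K. K \<subseteq> P \<Longrightarrow> l \<in> K \<Longrightarrow> u K = \<zero>\<^bsub>M K\<^esub>" "K \<subseteq> P" "l \<in> K" for u K
    using that(3,4) by (intro dif_zero_at that(2)) auto
  \<comment> \<open>By the choice of \<open>g\<close>, the difference \<open>h\<close> vanishes wherever the direction \<open>l\<close> occurs.\<close>
  have h0: "h K = \<zero>\<^bsub>M K\<^esub>" if K: "K \<subseteq> P" "l \<in> K" for K
  proof -
    interpret K: module A "M K" using M_module K(1) .
    have KF: "K - {l} \<in> F" using K by (auto simp: F_def)
    have iK: "insert l (K - {l}) = K" using K by auto
    have "g (K - {l}) = x (K - {l})" using K by (simp add: g_def subset_eq)
    hence "dif {l} g K = w [^] N \<odot>\<^bsub>M K\<^esub> f K"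
      unfolding dif_single[OF g K(1)] using x(2)[OF KF] K iK by simp
    moreover have "dif (S - {l}) g K = \<zero>\<^bsub>M K\<^esub>" by (rule off[OF g _ K]) (simp add: g_def)
    ultimately have "dif S g K = w [^] N \<odot>\<^bsub>M K\<^esub> f K"
      unfolding sgl[OF g] T_apply(2)[OF K(1)] using wN T_in[OF f(1) K(1)] by simp
    thus ?thesis unfolding h_def T_apply(4)[OF K(1) wf dif_closed[OF g]] T_apply(3)[OF K(1)]
      using wN T_in[OF f(1) K(1)] by (simp add: a_minus_def K.M.r_neg)
  qed
  have dh: "dif S h = \<zero>\<^bsub>T\<^esub>"
    unfolding h_def dif_minus[OF wf dif_closed[OF g]] dif_smult[OF f(1) wN] f(2) dif_dif[OF g]
    using wN T.smult_r_null[OF wN] by (simp add: a_minus_def T.M.r_neg del: direct_sum_simps)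
  have rh: "\<rho> l (insert l K) (h K) = \<zero>\<^bsub>M (insert l K)\<^esub>" if K: "K \<in> F" for K
  proof -
    interpret K': module A "M (insert l K)" using M_module FD(2)[OF K] .
    have hK: "h K \<in> carrier (M (insert l K - {l}))" using T_in[OF h] FD[OF K] by simp
    have oh: "dif (S - {l}) h (insert l K) = \<zero>\<^bsub>M (insert l K)\<^esub>"
      by (rule off[OF h _ FD(2,3)[OF K]]) (rule h0)
    have "dif S h (insert l K) = dif {l} h (insert l K)"
      unfolding sgl[OF h] T_apply(2)[OF FD(2)[OF K]] oh
      using T_in[OF dif_closed[OF h] FD(2)[OF K]] by simp
    hence "sr l (insert l K) (h K) = \<zero>\<^bsub>M (insert l K)\<^esub>"
      unfolding dif_single[OF h FD(2)[OF K]] dh T_apply(1)[OF FD(2)[OF K]] using FD[OF K] by simp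
    thus ?thesis using sr_eq_zero_iff[OF FD(2,3)[OF K] hK] by simp
  qed
  have "\<exists>L::nat. \<forall>K\<in>F. w [^] L \<odot>\<^bsub>M K\<^esub> h K = \<zero>\<^bsub>M K\<^esub>"
  proof (rule uniform_exponent[OF finF])
    fix K assume K: "K \<in> F"
    show "\<exists>L::nat. w [^] L \<odot>\<^bsub>M K\<^esub> h K = \<zero>\<^bsub>M K\<^esub>"
      using ker[OF FD(2,3)[OF K], of "h K"] rh[OF K] FD(1,4)[OF K] T_in[OF h] by simp
  next
    fix K and L k :: nat assume K: "K \<in> F" and *: "w [^] L \<odot>\<^bsub>M K\<^esub> h K = \<zero>\<^bsub>M K\<^esub>"
    interpret K: module A "M K" using M_module FD(1)[OF K] .
    have "w [^] (L + k) \<odot>\<^bsub>M K\<^esub> h K = w [^] k \<odot>\<^bsub>M K\<^esub> (w [^] L \<odot>\<^bsub>M K\<^esub> h K)"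
      using T_in[OF h FD(1)[OF K]] w by (simp add: K.smult_assoc1[symmetric] nat_pow_mult add.commute)
    thus "w [^] (L + k) \<odot>\<^bsub>M K\<^esub> h K = \<zero>\<^bsub>M K\<^esub>" using * wN by simp
  qed
  then obtain L :: nat where L: "\<And>K. K \<in> F \<Longrightarrow> w [^] L \<odot>\<^bsub>M K\<^esub> h K = \<zero>\<^bsub>M K\<^esub>" by blast
  have "w [^] L \<odot>\<^bsub>T\<^esub> h = \<zero>\<^bsub>T\<^esub>"
  proof (rule T_eqI)
    fix K assume K: "K \<subseteq> P"
    interpret K: module A "M K" using M_module K .
    show "(w [^] L \<odot>\<^bsub>T\<^esub> h) K = \<zero>\<^bsub>T\<^esub> K" unfolding T_apply(1,3)[OF K]
      by (cases "l \<in> K") (use h0[OF K] L[of K] wN K in \<open>auto simp: F_def\<close>)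
  qed (use wN h T.smult_closed T.M.zero_closed in \<open>auto simp del: direct_sum_simps\<close>)
  moreover have "w [^] L \<odot>\<^bsub>T\<^esub> h = w [^] (L + N) \<odot>\<^bsub>T\<^esub> f \<ominus>\<^bsub>T\<^esub> dif S (w [^] L \<odot>\<^bsub>T\<^esub> g)"
    unfolding h_def using wN wf g dif_closed[OF g] f(1) w
    by (simp add: a_minus_def T.smult_r_distr T.smult_r_minus T.smult_assoc1[symmetric] nat_pow_mult dif_smult
        del: direct_sum_simps)
  ultimately have "w [^] (L + N) \<odot>\<^bsub>T\<^esub> f = dif S (w [^] L \<odot>\<^bsub>T\<^esub> g)"
    using T.M.minus_other_side T.smult_closed wN f(1) g dif_closed by metis
  moreover have "w [^] L \<odot>\<^bsub>T\<^esub> g \<in> carrier T" using wN g by (rule T.smult_closed)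
  ultimately show ?thesis by blast
qed

text \<open>The elements of \<open>A\<close> that turn the cocycle \<open>f\<close> into a coboundary form an ideal. It contains powers of all
  \<open>w l\<close> by torsion, hence a power of \<open>u\<close>. As \<open>u\<close> acts bijectively on the modules of the slice, \<open>f\<close> itself is
  a coboundary.\<close>

lemma slice_exact_of_unit:
  assumes S: "S \<subseteq> P" and w: "\<And>l. l \<in> S \<Longrightarrow> w l \<in> carrier A"
    and ker: "\<And>l K y. \<lbrakk> l \<in> S; K \<subseteq> P; l \<in> K; y \<in> carrier (M (K - {l})); \<rho> l K y = \<zero>\<^bsub>M K\<^esub> \<rbrakk> \<Longrightarrow>
      \<exists>N::nat. w l [^] N \<odot>\<^bsub>M (K - {l})\<^esub> y = \<zero>\<^bsub>M (K - {l})\<^esub>"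
    and coker: "\<And>l K y. \<lbrakk> l \<in> S; K \<subseteq> P; l \<in> K; y \<in> carrier (M K) \<rbrakk> \<Longrightarrow>
      \<exists>N::nat. \<exists>x \<in> carrier (M (K - {l})). \<rho> l K x = w l [^] N \<odot>\<^bsub>M K\<^esub> y"
    and u: "u \<in> radical (Idl (w ` S))"
    and inj: "\<And>K y. \<lbrakk> K \<subseteq> P; K - S = I; y \<in> carrier (M K); u \<odot>\<^bsub>M K\<^esub> y = \<zero>\<^bsub>M K\<^esub> \<rbrakk> \<Longrightarrow> y = \<zero>\<^bsub>M K\<^esub>"
    and surj: "\<And>K y. \<lbrakk> K \<subseteq> P; K - S = I; y \<in> carrier (M K) \<rbrakk> \<Longrightarrow> \<exists>x \<in> carrier (M K). u \<odot>\<^bsub>M K\<^esub> x = y"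
    and f: "f \<in> carrier T" "supp (\<lambda>K. K - S = I) f" "dif S f = \<zero>\<^bsub>T\<^esub>"
  shows "\<exists>g \<in> carrier T. supp (\<lambda>K. K - S = I) g \<and> dif S g = f"
proof -
  define J where "J = {a \<in> carrier A. \<exists>g \<in> carrier T. a \<odot>\<^bsub>T\<^esub> f = dif S g}"
  have uc: "u \<in> carrier A" using u by (simp add: radical_def)
  have J: "ideal J A"
  proof (rule idealI)
    show "ring A" ..
    have ml: "x \<otimes> a \<in> J" if "a \<in> J" "x \<in> carrier A" for a x
    proof -
      from that obtain g where g: "a \<in> carrier A" "g \<in> carrier T" "a \<odot>\<^bsub>T\<^esub> f = dif S g" by (auto simp: J_def)
      have "(x \<otimes> a) \<odot>\<^bsub>T\<^esub> f = dif S (x \<odot>\<^bsub>T\<^esub> g)"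
        using T.smult_assoc1[OF that(2) g(1) f(1)] g(3) dif_smult[OF g(2) that(2)] by metis
      thus ?thesis using g that T.smult_closed unfolding J_def by blast
    qed
    show "subgroup J (add_monoid A)"
    proof (rule add.subgroupI)
      have "\<zero> \<odot>\<^bsub>T\<^esub> f = dif S \<zero>\<^bsub>T\<^esub>" using T.smult_l_null[OF f(1)] dif_zero by metis
      thus "J \<noteq> {}" unfolding J_def using T.M.zero_closed by blast
    next
      fix a assume a: "a \<in> J"
      moreover have "\<ominus> \<one> \<otimes> a = \<ominus> a" using a by (simp add: J_def l_minus)
      ultimately show "\<ominus> a \<in> J" using ml[OF a, of "\<ominus> \<one>"] by simp
    next
      fix a b assume "a \<in> J" "b \<in> J"
      then obtain g h where g: "a \<in> carrier A" "g \<in> carrier T" "a \<odot>\<^bsub>T\<^esub> f = dif S g"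
        and h: "b \<in> carrier A" "h \<in> carrier T" "b \<odot>\<^bsub>T\<^esub> f = dif S h" by (auto simp: J_def)
      have "(a \<oplus> b) \<odot>\<^bsub>T\<^esub> f = dif S (g \<oplus>\<^bsub>T\<^esub> h)"
        using T.smult_l_distr[OF g(1) h(1) f(1)] g(3) h(3) dif_add[OF g(2) h(2)] by metis
      thus "a \<oplus> b \<in> J" unfolding J_def using g h T.M.a_closed by blast
    qed (auto simp: J_def)
    show "a \<otimes> x \<in> J" if "a \<in> J" "x \<in> carrier A" for a x
      using ml[OF that] that by (simp add: J_def m_comm)
    show "x \<otimes> a \<in> J" if "a \<in> J" "x \<in> carrier A" for a x
      using ml[OF that] .
  qed
  have "w ` S \<subseteq> radical J"
  proof
    fix v assume "v \<in> w ` S"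
    then obtain l where l: "l \<in> S" "v = w l" by auto
    have "\<exists>N::nat. \<exists>g \<in> carrier T. w l [^] N \<odot>\<^bsub>T\<^esub> f = dif S g"
      by (rule torsion[OF l(1) _ w[OF l(1)] ker[OF l(1)] coker[OF l(1)] f(1,3)]) (use l S in auto)
    thus "v \<in> radical J" using l w unfolding radical_def J_def by auto
  qed
  from power_mem_of_generators[OF J u this]
  obtain N :: nat and g0 where g0: "g0 \<in> carrier T" "u [^] N \<odot>\<^bsub>T\<^esub> f = dif S g0" by (auto simp: J_def)
  have uN: "u [^] N \<in> carrier A" using uc by simp
  let ?Q = "\<lambda>K. K - S = I"
  define g where "g = cut ?Q g0"
  have g: "g \<in> carrier T" "supp ?Q g" unfolding g_def using g0 by (auto intro: cut_closed supp_cut simp del: direct_sum_simps)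
  have "dif S g = cut ?Q (u [^] N \<odot>\<^bsub>T\<^esub> f)"
    unfolding g_def g0(2) by (rule dif_cut[OF g0(1)]) auto
  also have "\<dots> = u [^] N \<odot>\<^bsub>T\<^esub> f"
  proof (rule cut_supp)
    show "u [^] N \<odot>\<^bsub>T\<^esub> f \<in> carrier T" using uN f(1) by (rule T.smult_closed)
    show "supp ?Q (u [^] N \<odot>\<^bsub>T\<^esub> f)" unfolding supp_def
    proof (intro allI impI)
      fix K assume K: "K \<subseteq> P" "\<not> ?Q K"
      interpret K: module A "M K" using M_module K(1) .
      show "(u [^] N \<odot>\<^bsub>T\<^esub> f) K = \<zero>\<^bsub>M K\<^esub>" unfolding T_apply(3)[OF K(1)] using f(2) K uN by (simp add: supp_def)
    qed
  qed
  finally have dg: "dif S g = u [^] N \<odot>\<^bsub>T\<^esub> f" .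
  have injN: "y = \<zero>\<^bsub>M K\<^esub>" if "K \<subseteq> P" "?Q K" "y \<in> carrier (M K)" "u [^] (N::nat) \<odot>\<^bsub>M K\<^esub> y = \<zero>\<^bsub>M K\<^esub>" for K y N
    using that(3,4)
  proof (induction N)
    case 0
    interpret K: module A "M K" using M_module that(1) .
    from 0 show ?case by simp
  next
    case (Suc N)
    interpret K: module A "M K" using M_module that(1) .
    have "u [^] Suc N \<odot>\<^bsub>M K\<^esub> y = u \<odot>\<^bsub>M K\<^esub> (u [^] N \<odot>\<^bsub>M K\<^esub> y)"
      using uc Suc(2) by (simp add: K.smult_assoc1[symmetric] m_comm)
    hence "u \<odot>\<^bsub>M K\<^esub> (u [^] N \<odot>\<^bsub>M K\<^esub> y) = \<zero>\<^bsub>M K\<^esub>" using Suc(3) by simp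
    moreover have "u [^] N \<odot>\<^bsub>M K\<^esub> y \<in> carrier (M K)" using uc Suc(2) by simp
    ultimately have "u [^] N \<odot>\<^bsub>M K\<^esub> y = \<zero>\<^bsub>M K\<^esub>" by (rule inj[OF that(1,2), rotated])
    with Suc(2) show ?case by (rule Suc(1))
  qed
  have surjN: "\<exists>x \<in> carrier (M K). u [^] (N::nat) \<odot>\<^bsub>M K\<^esub> x = y" if Kp: "K \<subseteq> P" "?Q K" "y \<in> carrier (M K)" for K y N
    using Kp(3)
  proof (induction N arbitrary: y)
    case 0
    interpret K: module A "M K" using M_module Kp(1) .
    from 0 show ?case by auto
  next
    case (Suc N)
    interpret K: module A "M K" using M_module Kp(1) .
    obtain x where x: "x \<in> carrier (M K)" "u \<odot>\<^bsub>M K\<^esub> x = y" using surj[OF Kp(1,2) Suc(2)] by blast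
    obtain z where z: "z \<in> carrier (M K)" "u [^] N \<odot>\<^bsub>M K\<^esub> z = x" using Suc(1)[OF x(1)] by blast
    have "u [^] Suc N \<odot>\<^bsub>M K\<^esub> z = u \<odot>\<^bsub>M K\<^esub> (u [^] N \<odot>\<^bsub>M K\<^esub> z)"
      using uc z(1) by (simp add: K.smult_assoc1[symmetric] m_comm)
    hence "u [^] Suc N \<odot>\<^bsub>M K\<^esub> z = y" unfolding z(2) x(2) .
    thus ?case using z(1) by (rule bexI)
  qed
  have "\<forall>K\<in>{K. K \<subseteq> P \<and> ?Q K}. \<exists>x. x \<in> carrier (M K) \<and> u [^] N \<odot>\<^bsub>M K\<^esub> x = g K"
    using surjN T_in[OF g(1)] by blast
  from bchoice[OF this] obtain h0 where h0: "\<And>K. K \<subseteq> P \<Longrightarrow> ?Q K \<Longrightarrow> h0 K \<in> carrier (M K) \<and> u [^] N \<odot>\<^bsub>M K\<^esub> h0 K = g K" by blast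
  define h where "h = (\<lambda>K\<in>Pow P. if ?Q K then h0 K else \<zero>\<^bsub>M K\<^esub>)"
  have h: "h \<in> carrier T" unfolding h_def by (rule T_I) (use h0 in auto)
  have sh: "supp ?Q h" by (simp add: supp_def h_def)
  have uh: "u [^] N \<odot>\<^bsub>T\<^esub> h = g"
  proof (rule T_eqI)
    fix K assume K: "K \<subseteq> P"
    interpret K: module A "M K" using M_module K(1) .
    show "(u [^] N \<odot>\<^bsub>T\<^esub> h) K = g K" unfolding T_apply(3)[OF K]
      by (cases "?Q K") (use K h0[OF K] g(2) uN in \<open>auto simp: h_def supp_def\<close>)
  qed (use uN h g T.smult_closed in \<open>auto simp del: direct_sum_simps\<close>)
  have "dif S h = f"
  proof (rule T_eqI)
    fix K assume K: "K \<subseteq> P"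
    interpret K: module A "M K" using M_module K(1) .
    show "dif S h K = f K"
    proof (cases "?Q K")
      case True
      have "u [^] N \<odot>\<^bsub>T\<^esub> dif S h = u [^] N \<odot>\<^bsub>T\<^esub> f"
        using dif_smult[OF h uN] uh dg by metis
      hence "u [^] N \<odot>\<^bsub>M K\<^esub> dif S h K = u [^] N \<odot>\<^bsub>M K\<^esub> f K"
        using T_apply(3)[OF K] by metis
      moreover have c: "dif S h K \<in> carrier (M K)" "f K \<in> carrier (M K)"
        using T_in dif_closed h f(1) K by blast+
      ultimately have "u [^] N \<odot>\<^bsub>M K\<^esub> (dif S h K \<ominus>\<^bsub>M K\<^esub> f K) = \<zero>\<^bsub>M K\<^esub>"
        using uN by (simp add: a_minus_def K.smult_r_distr K.smult_r_minus K.M.r_neg)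
      hence "dif S h K \<ominus>\<^bsub>M K\<^esub> f K = \<zero>\<^bsub>M K\<^esub>" using injN[OF K True] c by simp
      thus ?thesis using c by simp
    next
      case False
      have "supp ?Q (dif S h)" by (rule supp_dif[OF sh]) auto
      thus ?thesis using False K f(2) by (simp add: supp_def)
    qed
  qed (use h f dif_closed in \<open>auto simp del: direct_sum_simps\<close>)
  thus ?thesis using h sh by blast
qed

end


section \<open>Cubes with a projection to a graded component\<close>

text \<open>The map \<open>\<pi> K\<close> is meant to be the projection of \<open>M K\<close> to one homogeneous component, and \<open>F\<close> to be the
  component of degree 0 of \<open>A\<close>, for which these projections are linear. The elements of the chosen
  component of the total module form \<open>T0\<close>. An ungraded cube is the case in which all \<open>\<pi> K\<close> are identities.\<close>

locale graded_cube = cube A P M \<rho>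
  for A :: "('a, 'm) ring_scheme" (structure) and P :: "nat set"
    and M :: "nat set \<Rightarrow> ('a, 'b) module" and \<rho> :: "nat \<Rightarrow> nat set \<Rightarrow> 'b \<Rightarrow> 'b" +
  fixes F :: "'a set" and \<pi> :: "nat set \<Rightarrow> 'b \<Rightarrow> 'b"
  assumes F_subset: "F \<subseteq> carrier A"
    and pi_closed: "\<lbrakk> K \<subseteq> P; y \<in> carrier (M K) \<rbrakk> \<Longrightarrow> \<pi> K y \<in> carrier (M K)"
    and pi_add: "\<lbrakk> K \<subseteq> P; x \<in> carrier (M K); y \<in> carrier (M K) \<rbrakk> \<Longrightarrow> \<pi> K (x \<oplus>\<^bsub>M K\<^esub> y) = \<pi> K x \<oplus>\<^bsub>M K\<^esub> \<pi> K y"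
    and pi_smult: "\<lbrakk> K \<subseteq> P; c \<in> F; y \<in> carrier (M K) \<rbrakk> \<Longrightarrow> \<pi> K (c \<odot>\<^bsub>M K\<^esub> y) = c \<odot>\<^bsub>M K\<^esub> \<pi> K y"
    and pi_idem: "\<lbrakk> K \<subseteq> P; y \<in> carrier (M K) \<rbrakk> \<Longrightarrow> \<pi> K (\<pi> K y) = \<pi> K y"
    and pi_rho: "\<lbrakk> K \<subseteq> P; j \<in> K; y \<in> carrier (M (K - {j})) \<rbrakk> \<Longrightarrow> \<pi> K (\<rho> j K y) = \<rho> j K (\<pi> (K - {j}) y)"
begin

lemma pi_zero: "K \<subseteq> P \<Longrightarrow> \<pi> K \<zero>\<^bsub>M K\<^esub> = \<zero>\<^bsub>M K\<^esub>"
proof -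
  assume K: "K \<subseteq> P"
  interpret K: module A "M K" using M_module K(1) .
  have "\<pi> K \<zero>\<^bsub>M K\<^esub> \<oplus>\<^bsub>M K\<^esub> \<pi> K \<zero>\<^bsub>M K\<^esub> = \<pi> K \<zero>\<^bsub>M K\<^esub>" using pi_add[OF K, of "\<zero>\<^bsub>M K\<^esub>" "\<zero>\<^bsub>M K\<^esub>"] by simp
  thus ?thesis using pi_closed[OF K, of "\<zero>\<^bsub>M K\<^esub>"] by simp
qed

lemma pi_neg: "K \<subseteq> P \<Longrightarrow> y \<in> carrier (M K) \<Longrightarrow> \<pi> K (\<ominus>\<^bsub>M K\<^esub> y) = \<ominus>\<^bsub>M K\<^esub> \<pi> K y"
proof -
  assume K: "K \<subseteq> P" and y: "y \<in> carrier (M K)"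
  interpret K: module A "M K" using M_module K(1) .
  have "\<pi> K (\<ominus>\<^bsub>M K\<^esub> y) \<oplus>\<^bsub>M K\<^esub> \<pi> K y = \<zero>\<^bsub>M K\<^esub>"
    using pi_add[OF K, of "\<ominus>\<^bsub>M K\<^esub> y" y] y pi_zero[OF K] by (simp add: K.M.l_neg)
  thus ?thesis using pi_closed[OF K] y by (simp add: K.M.minus_equality)
qed

lemma pi_sr: "K \<subseteq> P \<Longrightarrow> j \<in> K \<Longrightarrow> y \<in> carrier (M (K - {j})) \<Longrightarrow> \<pi> K (sr j K y) = sr j K (\<pi> (K - {j}) y)"
  by (simp add: sr_def pi_rho pi_neg rho_closed)

definition proj :: "(nat set \<Rightarrow> 'b) \<Rightarrow> (nat set \<Rightarrow> 'b)" where
  "proj f = (\<lambda>K\<in>Pow P. \<pi> K (f K))"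

definition T0 :: "(nat set \<Rightarrow> 'b) set" where
  "T0 = {f \<in> carrier T. \<forall>K \<subseteq> P. \<pi> K (f K) = f K}"

lemma proj_closed: "f \<in> carrier T \<Longrightarrow> proj f \<in> T0"
proof -
  assume f: "f \<in> carrier T"
  have "(\<lambda>K\<in>Pow P. \<pi> K (f K)) \<in> carrier T" by (intro T_I pi_closed T_in f)
  thus ?thesis unfolding proj_def T0_def by (auto simp: pi_idem[OF _ T_in[OF f]] simp del: direct_sum_simps)
qed

lemma T0_closed: "f \<in> T0 \<Longrightarrow> f \<in> carrier T"
  by (simp add: T0_def)

lemma proj_T0: "f \<in> T0 \<Longrightarrow> proj f = f"
proof -
  assume f: "f \<in> T0"
  show ?thesis
  proof (rule T_eqI)
    show "proj f \<in> carrier T" using f by (intro T0_closed[OF proj_closed] T0_closed[OF f])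
  qed (use f in \<open>auto simp: T0_def proj_def simp del: direct_sum_simps\<close>)
qed

lemma T0_iff: "f \<in> T0 \<longleftrightarrow> f \<in> carrier T \<and> proj f = f"
proof
  assume "f \<in> carrier T \<and> proj f = f"
  thus "f \<in> T0" using proj_closed[of f] by simp
qed (use proj_T0 T0_closed in blast)

lemma proj_add:
  assumes "f \<in> carrier T" "g \<in> carrier T"
  shows "proj (f \<oplus>\<^bsub>T\<^esub> g) = proj f \<oplus>\<^bsub>T\<^esub> proj g"
  using assms by (auto simp: proj_def pi_add[OF _ T_in T_in] intro!: restrict_ext)

lemma proj_smult:
  assumes "f \<in> carrier T" "c \<in> F"
  shows "proj (c \<odot>\<^bsub>T\<^esub> f) = c \<odot>\<^bsub>T\<^esub> proj f"
  using assms by (auto simp: proj_def pi_smult[OF _ _ T_in] intro!: restrict_ext)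

lemma proj_dif:
  assumes f: "f \<in> carrier T"
  shows "proj (dif S f) = dif S (proj f)"
proof (rule T_eqI)
  have pf: "proj f \<in> carrier T" using T0_closed[OF proj_closed[OF f]] .
  show "proj (dif S f) \<in> carrier T" using T0_closed[OF proj_closed[OF dif_closed[OF f]]] .
  show "dif S (proj f) \<in> carrier T" using pf by (rule dif_closed)
  fix K assume K: "K \<subseteq> P"
  interpret K: module A "M K" using M_module K(1) .
  have "\<pi> K (\<Oplus>\<^bsub>M K\<^esub>j\<in>B. sr j K (f (K - {j}))) = (\<Oplus>\<^bsub>M K\<^esub>j\<in>B. sr j K (\<pi> (K - {j}) (f (K - {j}))))"
    if "B \<subseteq> K" for B
  proof -
    have "finite B" using that K finite_P by (meson finite_subset)
    thus ?thesis using that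
    proof (induction B)
      case empty
      thus ?case by (simp add: pi_zero[OF K])
    next
      case (insert b B)
      have c: "j \<in> K \<Longrightarrow> f (K - {j}) \<in> carrier (M (K - {j}))" for j
        using f K by (intro T_in) auto
      have c': "j \<in> K \<Longrightarrow> \<pi> (K - {j}) (f (K - {j})) \<in> carrier (M (K - {j}))" for j
        using K by (intro pi_closed c) auto
      show ?case using insert K
        by (simp add: Pi_def subset_iff sr_closed c c' pi_add[OF K] K.M.finsum_closed pi_sr)
    qed
  qed
  note sum = this
  show "proj (dif S f) K = dif S (proj f) K"
  proof -
    have "proj f (K - {j}) = \<pi> (K - {j}) (f (K - {j}))" for j using K by (auto simp: proj_def)
    hence "dif S (proj f) K = (\<Oplus>\<^bsub>M K\<^esub>j\<in>K \<inter> S. sr j K (\<pi> (K - {j}) (f (K - {j}))))"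
      unfolding dif_apply[OF K] by simp
    moreover have "proj (dif S f) K = \<pi> K (\<Oplus>\<^bsub>M K\<^esub>j\<in>K \<inter> S. sr j K (f (K - {j})))"
      using K by (simp add: proj_def dif_apply)
    ultimately show ?thesis using sum[of "K \<inter> S"] by simp
  qed
qed

lemma T0_dif: "f \<in> T0 \<Longrightarrow> dif S f \<in> T0"
  using proj_dif dif_closed by (simp add: T0_iff del: direct_sum_simps)

lemma T0_add: "f \<in> T0 \<Longrightarrow> g \<in> T0 \<Longrightarrow> f \<oplus>\<^bsub>T\<^esub> g \<in> T0"
  using proj_add T.M.a_closed by (simp add: T0_iff del: direct_sum_simps)

lemma T0_smult: "f \<in> T0 \<Longrightarrow> c \<in> F \<Longrightarrow> c \<odot>\<^bsub>T\<^esub> f \<in> T0"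
  using proj_smult T.smult_closed F_subset by (auto simp add: T0_iff simp del: direct_sum_simps)

lemma T0_zero: "\<zero>\<^bsub>T\<^esub> \<in> T0"
  unfolding T0_def using T.M.zero_closed pi_zero T_apply(1) by auto

lemma T0_minus: "f \<in> T0 \<Longrightarrow> g \<in> T0 \<Longrightarrow> f \<ominus>\<^bsub>T\<^esub> g \<in> T0"
proof -
  assume f: "f \<in> T0" and g: "g \<in> T0"
  hence c: "f \<in> carrier T" "g \<in> carrier T" by (auto simp: T0_def)
  show ?thesis unfolding T0_def
  proof (intro CollectI conjI allI impI)
    show "f \<ominus>\<^bsub>T\<^esub> g \<in> carrier T" using c by (rule T.M.minus_closed)
    fix K assume K: "K \<subseteq> P"
    interpret K: module A "M K" using M_module K(1) .
    show "\<pi> K ((f \<ominus>\<^bsub>T\<^esub> g) K) = (f \<ominus>\<^bsub>T\<^esub> g) K" unfolding T_apply(4)[OF K c]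
      using f g K T_in[OF c(1) K] T_in[OF c(2) K]
      by (simp add: a_minus_def pi_add pi_neg T0_def)
  qed
qed

lemma T0_cut: "f \<in> T0 \<Longrightarrow> cut Q f \<in> T0"
  using cut_closed by (auto simp: T0_def cut_apply pi_zero simp del: direct_sum_simps)

lemma supp_proj: "supp Q f \<Longrightarrow> supp Q (proj f)"
  by (simp add: supp_def proj_def pi_zero)

text \<open>The slice over \<open>I\<close> consists of the index sets \<open>K\<close> with \<open>K - S = I\<close>; it is a complex for \<open>dif S\<close>. In the
  terms of a double complex it is a row or a column.\<close>

definition slice_exact :: "nat set \<Rightarrow> nat set \<Rightarrow> nat \<Rightarrow> bool" where
  "slice_exact S I m \<longleftrightarrow> (\<forall>f \<in> T0. supp (\<lambda>K. K - S = I \<and> card K = m) f \<longrightarrow> dif S f = \<zero>\<^bsub>T\<^esub> \<longrightarrow>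
     (\<exists>g \<in> T0. supp (\<lambda>K. K - S = I \<and> Suc (card K) = m) g \<and> dif S g = f))"

text \<open>Any primitive can be projected to the graded component and cut down to the index sets that matter.\<close>

lemma graded_primitive:
  assumes f: "f \<in> T0" "supp (\<lambda>K. K - S = I \<and> card K = m) f" and g: "g \<in> carrier T" "dif S g = f"
  shows "\<exists>h \<in> T0. supp (\<lambda>K. K - S = I \<and> Suc (card K) = m) h \<and> dif S h = f"
proof -
  have fT: "f \<in> carrier T" using f(1) by (rule T0_closed)
  let ?Q = "\<lambda>K. K - S = I \<and> Suc (card K) = m"
  define h where "h = cut ?Q (proj g)"
  have "dif S h = cut (\<lambda>K. K - S = I \<and> card K = m) (dif S (proj g))"
    unfolding h_def
  proof (rule dif_cut[OF T0_closed[OF proj_closed[OF g(1)]]])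
    fix K j assume K: "K \<subseteq> P" "j \<in> K" "j \<in> S"
    hence "K - {j} - S = K - S" by auto
    thus "K - {j} - S = I \<and> Suc (card (K - {j})) = m \<longleftrightarrow> K - S = I \<and> card K = m"
      using card_Diff1[OF K(1,2)] by simp
  qed
  also have "\<dots> = cut (\<lambda>K. K - S = I \<and> card K = m) f"
    using proj_dif[OF g(1), of S] g(2) proj_T0[OF f(1)] by simp
  also have "\<dots> = f" using fT f(2) by (rule cut_supp)
  finally have "dif S h = f" .
  moreover have "h \<in> T0" unfolding h_def using g(1) by (intro T0_cut proj_closed)
  moreover have "supp ?Q h" unfolding h_def by (rule supp_cut)
  ultimately show ?thesis by blast
qed

lemma slice_exactI:
  assumes ex: "\<And>f. \<lbrakk> f \<in> T0; supp (\<lambda>K. K - S = I \<and> card K = m) f; dif S f = \<zero>\<^bsub>T\<^esub> \<rbrakk> \<Longrightarrow>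
    \<exists>g \<in> carrier T. dif S g = f"
  shows "slice_exact S I m"
  unfolding slice_exact_def using ex graded_primitive by blast

text \<open>The level of \<open>K\<close> is \<open>card (K - S)\<close>. Directions outside \<open>S\<close> raise the level, so they contribute nothing
  to the lowest level.\<close>

lemma dif_at_level:
  assumes S: "S \<subseteq> P" and G: "G \<in> carrier T" "supp (\<lambda>K. l \<le> card (K - S)) G" and K: "K \<subseteq> P" "card (K - S) = l"
  shows "dif P G K = dif S G K"
proof -
  interpret K: module A "M K" using M_module K(1) .
  have "dif (P - S) G K = \<zero>\<^bsub>M K\<^esub>"
  proof (rule dif_zero_at[OF K(1)])
    fix j assume j: "j \<in> K" "j \<in> P - S"
    have "K - {j} - S = (K - S) - {j}" by auto
    moreover have "K - S \<subseteq> P" "j \<in> K - S" using j K(1) by auto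
    ultimately have "card (K - {j} - S) < l" using card_Diff1[of "K - S" j] K(2) by simp
    moreover have "K - {j} \<subseteq> P" using K(1) by auto
    ultimately show "G (K - {j}) = \<zero>\<^bsub>M (K - {j})\<^esub>" using G(2) unfolding supp_def by simp
  qed
  moreover have "dif P G = dif S G \<oplus>\<^bsub>T\<^esub> dif (P - S) G"
    using dif_Un[OF G(1), of S "P - S"] S by (simp add: Un_absorb1)
  ultimately show ?thesis using T_apply(2)[OF K(1)] T_in[OF dif_closed[OF G(1)] K(1)] by simp
qed

text \<open>The primitives of the slices of level \<open>k\<close> have pairwise disjoint supports. Glued together, they give a
  total element whose coboundary agrees with \<open>f\<close> on level \<open>k\<close> and otherwise only affects higher levels.\<close>

lemma level_step_of_primitives:
  assumes S: "S \<subseteq> P"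
    and f: "f \<in> T0" "supp (\<lambda>K. card K = m \<and> k \<le> card (K - S)) f"
    and ex: "\<And>I. I \<subseteq> P - S \<Longrightarrow> card I = k \<Longrightarrow>
      \<exists>g \<in> T0. supp (\<lambda>K. K - S = I \<and> Suc (card K) = m) g \<and> dif S g = cut (\<lambda>K. K - S = I) f"
  shows "\<exists>g \<in> T0. supp (\<lambda>K. Suc (card K) = m \<and> k \<le> card (K - S)) g \<and>
    supp (\<lambda>K. card K = m \<and> k < card (K - S)) (f \<ominus>\<^bsub>T\<^esub> dif P g)"
proof -
  have fT: "f \<in> carrier T" using f(1) by (rule T0_closed)
  have "\<forall>I\<in>{I. I \<subseteq> P - S \<and> card I = k}. \<exists>g. g \<in> T0 \<and> supp (\<lambda>K. K - S = I \<and> Suc (card K) = m) g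
      \<and> dif S g = cut (\<lambda>K. K - S = I) f"
    using ex by blast
  from bchoice[OF this] obtain g where g: "\<And>I. I \<subseteq> P - S \<Longrightarrow> card I = k \<Longrightarrow> g I \<in> T0"
      "\<And>I. I \<subseteq> P - S \<Longrightarrow> card I = k \<Longrightarrow> supp (\<lambda>K. K - S = I \<and> Suc (card K) = m) (g I)"
      "\<And>I. I \<subseteq> P - S \<Longrightarrow> card I = k \<Longrightarrow> dif S (g I) = cut (\<lambda>K. K - S = I) f" by blast
  define h where "h = (\<lambda>K\<in>Pow P. if card (K - S) = k then g (K - S) K else \<zero>\<^bsub>M K\<^esub>)"
  have KS: "K \<subseteq> P \<Longrightarrow> K - S \<subseteq> P - S" for K by auto
  have gK: "g (K - S) K \<in> carrier (M K)" "\<pi> K (g (K - S) K) = g (K - S) K"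
    if "K \<subseteq> P" "card (K - S) = k" for K
  proof -
    have *: "g (K - S) \<in> T0" using g(1) KS that by blast
    show "g (K - S) K \<in> carrier (M K)" using T_in[OF T0_closed[OF *] that(1)] .
    show "\<pi> K (g (K - S) K) = g (K - S) K" using * that(1) unfolding T0_def by blast
  qed
  have h: "h \<in> T0" unfolding T0_def
  proof (intro CollectI conjI allI impI)
    show "h \<in> carrier T" unfolding h_def by (rule T_I) (simp add: gK(1))
  qed (simp add: h_def gK(2) pi_zero)
  have hT: "h \<in> carrier T" using h by (rule T0_closed)
  have sh: "supp (\<lambda>K. Suc (card K) = m \<and> card (K - S) = k) h"
    unfolding supp_def h_def using g(2)[OF KS] by (auto simp: supp_def)
  have dh: "dif S h K = f K" if K: "K \<subseteq> P" "card (K - S) = k" for K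
  proof -
    have "dif S h K = dif S (g (K - S)) K"
    proof (rule dif_local[OF K(1)])
      fix j assume "j \<in> K" "j \<in> S"
      hence "K - {j} - S = K - S" by auto
      thus "h (K - {j}) = g (K - S) (K - {j})" using K unfolding h_def by auto
    qed (use g(1)[OF KS] K T0_closed in blast)
    thus ?thesis using g(3)[OF KS[OF K(1)] K(2)] K by (simp add: cut_apply)
  qed
  have dPh: "supp (\<lambda>K. card K = m \<and> k \<le> card (K - S)) (dif P h)"
  proof (rule supp_dif[OF sh])
    fix K j assume K: "K \<subseteq> P" "j \<in> K" "j \<in> P" and *: "Suc (card (K - {j})) = m \<and> card (K - {j} - S) = k"
    have "card (K - {j} - S) \<le> card (K - S)"
      using K finite_P finite_subset by (intro card_mono) auto
    thus "card K = m \<and> k \<le> card (K - S)" using * card_Diff1[OF K(1,2)] by auto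
  qed
  have "supp (\<lambda>K. card K = m \<and> k \<le> card (K - S)) (f \<ominus>\<^bsub>T\<^esub> dif P h)"
    using f(2) dPh fT hT dif_closed by (intro supp_minus) auto
  moreover have "(f \<ominus>\<^bsub>T\<^esub> dif P h) K = \<zero>\<^bsub>M K\<^esub>" if K: "K \<subseteq> P" "card (K - S) = k" for K
  proof -
    interpret K: module A "M K" using M_module K(1) .
    have "supp (\<lambda>K. k \<le> card (K - S)) h" by (rule supp_mono[OF sh]) simp
    hence "dif P h K = f K" using dif_at_level[OF S hT _ K] dh[OF K] by simp
    thus ?thesis unfolding T_apply(4)[OF K(1) fT dif_closed[OF hT]]
      using T_in[OF fT K(1)] by (simp add: a_minus_def K.M.r_neg)
  qed
  ultimately have "supp (\<lambda>K. card K = m \<and> k < card (K - S)) (f \<ominus>\<^bsub>T\<^esub> dif P h)"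
    unfolding supp_def by (metis le_neq_implies_less)
  moreover have "supp (\<lambda>K. Suc (card K) = m \<and> k \<le> card (K - S)) h"
    using sh by (rule supp_mono) simp
  ultimately show ?thesis using h by blast
qed

text \<open>If the coboundary of \<open>f\<close> has no component on level \<open>k\<close>, the slices of \<open>f\<close> of that level are cocycles.\<close>

lemma level_step:
  assumes S: "S \<subseteq> P" and ex: "\<And>I. I \<subseteq> P - S \<Longrightarrow> card I = k \<Longrightarrow> slice_exact S I m"
    and f: "f \<in> T0" "supp (\<lambda>K. card K = m \<and> k \<le> card (K - S)) f"
    and df: "supp (\<lambda>K. k < card (K - S)) (dif P f)"
  shows "\<exists>g \<in> T0. supp (\<lambda>K. Suc (card K) = m \<and> k \<le> card (K - S)) g \<and>
    supp (\<lambda>K. card K = m \<and> k < card (K - S)) (f \<ominus>\<^bsub>T\<^esub> dif P g)"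
proof (rule level_step_of_primitives[OF S f])
  have fT: "f \<in> carrier T" using f(1) by (rule T0_closed)
  have fl: "supp (\<lambda>K. k \<le> card (K - S)) f" by (rule supp_mono[OF f(2)]) simp
  have dS: "dif S f K = \<zero>\<^bsub>M K\<^esub>" if K: "K \<subseteq> P" "card (K - S) = k" for K
    using dif_at_level[OF S fT fl K] df K by (simp add: supp_def)
  fix I assume I: "I \<subseteq> P - S" "card I = k"
  have "dif S (cut (\<lambda>K. K - S = I) f) = cut (\<lambda>K. K - S = I) (dif S f)"
    by (rule dif_cut[OF fT]) auto
  also have "\<dots> = \<zero>\<^bsub>T\<^esub>"
    using dS I by (intro T_eqI) (auto simp: cut_apply intro: cut_closed dif_closed fT T.M.zero_closed
        simp del: direct_sum_simps simp: T_apply(1))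
  finally have "dif S (cut (\<lambda>K. K - S = I) f) = \<zero>\<^bsub>T\<^esub>" .
  moreover have "cut (\<lambda>K. K - S = I) f \<in> T0" using f(1) by (rule T0_cut)
  moreover have "supp (\<lambda>K. K - S = I \<and> card K = m) (cut (\<lambda>K. K - S = I) f)"
    using f(2) by (auto simp: supp_def cut_apply)
  ultimately show "\<exists>g \<in> T0. supp (\<lambda>K. K - S = I \<and> Suc (card K) = m) g \<and> dif S g = cut (\<lambda>K. K - S = I) f"
    using ex[OF I] unfolding slice_exact_def by blast
qed

text \<open>This replaces the convergence of the spectral sequence of the filtration by level.\<close>

lemma level_chain:
  assumes S: "S \<subseteq> P" and "k \<le> l"
    and ex: "\<And>I. I \<subseteq> P - S \<Longrightarrow> k \<le> card I \<Longrightarrow> card I < l \<Longrightarrow> slice_exact S I m"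
    and f: "f \<in> T0" "supp (\<lambda>K. card K = m \<and> k \<le> card (K - S)) f"
    and df: "supp (\<lambda>K. l \<le> card (K - S)) (dif P f)"
  shows "\<exists>g \<in> T0. supp (\<lambda>K. Suc (card K) = m \<and> k \<le> card (K - S)) g \<and>
    supp (\<lambda>K. card K = m \<and> l \<le> card (K - S)) (f \<ominus>\<^bsub>T\<^esub> dif P g)"
  using \<open>k \<le> l\<close> ex df
proof (induction l rule: dec_induct)
  case base
  have e: "f \<ominus>\<^bsub>T\<^esub> dif P \<zero>\<^bsub>T\<^esub> = f"
    unfolding dif_zero using T0_closed[OF f(1)] by (rule T_minus_zero)
  show ?case
  proof (intro bexI conjI)
    show "supp (\<lambda>K. card K = m \<and> k \<le> card (K - S)) (f \<ominus>\<^bsub>T\<^esub> dif P \<zero>\<^bsub>T\<^esub>)" unfolding e by (rule f(2))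
  qed (rule supp_zero T0_zero)+
next
  case (step l)
  have fT: "f \<in> carrier T" using f(1) by (rule T0_closed)
  have df': "supp (\<lambda>K. l \<le> card (K - S)) (dif P f)" using step(5) by (rule supp_mono) simp
  have ex': "slice_exact S I m" if "I \<subseteq> P - S" "k \<le> card I" "card I < l" for I
    using step(4) that by simp
  from step(3)[OF ex' df'] obtain g where g: "g \<in> T0" "supp (\<lambda>K. Suc (card K) = m \<and> k \<le> card (K - S)) g"
    "supp (\<lambda>K. card K = m \<and> l \<le> card (K - S)) (f \<ominus>\<^bsub>T\<^esub> dif P g)" by blast
  have gT: "g \<in> carrier T" using g(1) by (rule T0_closed)
  have "dif P (f \<ominus>\<^bsub>T\<^esub> dif P g) = dif P f"
    unfolding dif_minus[OF fT dif_closed[OF gT]] dif_dif[OF gT]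
    using dif_closed[OF fT] by (rule T_minus_zero)
  hence "supp (\<lambda>K. l < card (K - S)) (dif P (f \<ominus>\<^bsub>T\<^esub> dif P g))"
    using step(5) by (simp add: Suc_le_eq)
  moreover have "slice_exact S I m" if "I \<subseteq> P - S" "card I = l" for I
    using step(1) step(4)[OF that(1)] that by simp
  ultimately obtain h where h: "h \<in> T0" "supp (\<lambda>K. Suc (card K) = m \<and> l \<le> card (K - S)) h"
    "supp (\<lambda>K. card K = m \<and> l < card (K - S)) (f \<ominus>\<^bsub>T\<^esub> dif P g \<ominus>\<^bsub>T\<^esub> dif P h)"
    using level_step[OF S _ T0_minus[OF f(1) T0_dif[OF g(1)]] g(3)] by blast
  have hT: "h \<in> carrier T" using h(1) by (rule T0_closed)
  have "f \<ominus>\<^bsub>T\<^esub> dif P g \<ominus>\<^bsub>T\<^esub> dif P h = f \<ominus>\<^bsub>T\<^esub> dif P (g \<oplus>\<^bsub>T\<^esub> h)"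
    using fT gT hT dif_closed[OF gT, of P] dif_closed[OF hT, of P]
    by (simp add: dif_add a_minus_def T.M.minus_add T.M.a_assoc del: direct_sum_simps)
  hence "supp (\<lambda>K. card K = m \<and> Suc l \<le> card (K - S)) (f \<ominus>\<^bsub>T\<^esub> dif P (g \<oplus>\<^bsub>T\<^esub> h))"
    using h(3) by (simp add: Suc_le_eq)
  moreover have "supp (\<lambda>K. Suc (card K) = m \<and> k \<le> card (K - S)) h"
    by (rule supp_mono[OF h(2)]) (use step(1) in auto)
  ultimately show ?case using g h supp_add T0_add by blast
qed

text \<open>The level of \<open>K\<close> is at most \<open>card K\<close>, so an element of degree \<open>m\<close> that is pushed beyond level \<open>m\<close> vanishes.\<close>

lemma level_exact:
  assumes S: "S \<subseteq> P"
    and ex: "\<And>I. I \<subseteq> P - S \<Longrightarrow> k \<le> card I \<Longrightarrow> card I \<le> m \<Longrightarrow> slice_exact S I m"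
    and f: "f \<in> T0" "supp (\<lambda>K. card K = m \<and> k \<le> card (K - S)) f" "dif P f = \<zero>\<^bsub>T\<^esub>"
  shows "\<exists>g \<in> T0. supp (\<lambda>K. Suc (card K) = m \<and> k \<le> card (K - S)) g \<and> dif P g = f"
proof -
  have df: "supp Q (dif P f)" for Q unfolding f(3) supp_def using T_apply(1) by simp
  have fT: "f \<in> carrier T" using f(1) by (rule T0_closed)
  obtain g where g: "g \<in> T0" "supp (\<lambda>K. Suc (card K) = m \<and> k \<le> card (K - S)) g"
    "supp (\<lambda>K. card K = m \<and> max k (Suc m) \<le> card (K - S)) (f \<ominus>\<^bsub>T\<^esub> dif P g)"
    using level_chain[OF S _ _ f(1,2), of "max k (Suc m)"] ex df by force
  have gT: "g \<in> carrier T" using g(1) by (rule T0_closed)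
  have "supp (\<lambda>K. False) (f \<ominus>\<^bsub>T\<^esub> dif P g)"
  proof (rule supp_mono[OF g(3)])
    fix K assume K: "K \<subseteq> P" "card K = m \<and> max k (Suc m) \<le> card (K - S)"
    have "card (K - S) \<le> card K" using K finite_P finite_subset by (intro card_mono) auto
    thus False using K by auto
  qed
  hence "f \<ominus>\<^bsub>T\<^esub> dif P g = \<zero>\<^bsub>T\<^esub>" using fT gT dif_closed by (intro supp_zero_false T.M.minus_closed)
  hence "dif P g = f" using fT gT dif_closed by (metis T.M.minus_other_side)
  thus ?thesis using g by blast
qed

end

section \<open>Homogeneous components\<close>

context graded_ring
begin

lemma G_closed: "a \<in> G i \<Longrightarrow> a \<in> carrier A"
  using additive_subgroup.a_subset[OF component_subgroup] by blast

lemma G_zero: "\<zero> \<in> G i"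
  using additive_subgroup.zero_closed[OF component_subgroup] .

lemma G_add: "a \<in> G i \<Longrightarrow> b \<in> G i \<Longrightarrow> a \<oplus> b \<in> G i"
  using additive_subgroup.a_closed[OF component_subgroup] .

lemma G_neg: "a \<in> G i \<Longrightarrow> \<ominus> a \<in> G i"
  using additive_subgroup.a_inv_closed[OF component_subgroup] .

definition hcomp :: "nat \<Rightarrow> 'a \<Rightarrow> 'a" where
  "hcomp m a = (THE f. (\<forall>i. f i \<in> G i) \<and> finite {i. f i \<noteq> \<zero>} \<and> a = (\<Oplus>i\<in>{i. f i \<noteq> \<zero>}. f i)) m"

lemma hcomp_family:
  assumes "a \<in> carrier A"
  shows "(\<forall>i. hcomp i a \<in> G i) \<and> finite {i. hcomp i a \<noteq> \<zero>} \<and> a = (\<Oplus>i\<in>{i. hcomp i a \<noteq> \<zero>}. hcomp i a)"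
  unfolding hcomp_def using theI'[OF decomposition[OF assms]] by simp

lemma hcomp_G: "a \<in> carrier A \<Longrightarrow> hcomp m a \<in> G m"
  using hcomp_family by blast

lemma hcomp_closed: "a \<in> carrier A \<Longrightarrow> hcomp m a \<in> carrier A"
  using hcomp_G G_closed by blast

lemma sum_supersupport:
  assumes f: "\<And>i. f i \<in> G i" and B: "finite B" "{i. f i \<noteq> \<zero>} \<subseteq> B"
  shows "(\<Oplus>i\<in>{i. f i \<noteq> \<zero>}. f i) = (\<Oplus>i\<in>B. f i)"
  using B f G_closed by (intro add.finprod_mono_neutral_cong_left) auto

lemma hcomp_sum:
  assumes "a \<in> carrier A" "finite B" "{i. hcomp i a \<noteq> \<zero>} \<subseteq> B"
  shows "a = (\<Oplus>i\<in>B. hcomp i a)"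
  using hcomp_family[OF assms(1)] sum_supersupport[OF hcomp_G[OF assms(1)] assms(2,3)] by simp

lemma hcomp_unique:
  assumes f: "\<And>i. f i \<in> G i" and B: "finite B" "\<And>i. i \<notin> B \<Longrightarrow> f i = \<zero>" and a: "a = (\<Oplus>i\<in>B. f i)"
  shows "hcomp m a = f m"
proof -
  have sub: "{i. f i \<noteq> \<zero>} \<subseteq> B" using B by auto
  have ac: "a \<in> carrier A" unfolding a using f G_closed by (intro finsum_closed) auto
  have "(\<forall>i. f i \<in> G i) \<and> finite {i. f i \<noteq> \<zero>} \<and> a = (\<Oplus>i\<in>{i. f i \<noteq> \<zero>}. f i)"
    using f finite_subset[OF sub B(1)] a sum_supersupport[of f, OF f B(1) sub] by simp
  with the1_equality[OF decomposition[OF ac]] show ?thesis unfolding hcomp_def by simp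
qed

lemma hcomp_homogeneous:
  assumes "a \<in> G p"
  shows "hcomp m a = (if m = p then a else \<zero>)"
proof (rule hcomp_unique[where B = "{p}"])
  show "a = (\<Oplus>i\<in>{p}. if i = p then a else \<zero>)" using assms G_closed by simp
qed (use assms G_zero in auto)

lemma hcomp_add:
  assumes a: "a \<in> carrier A" and b: "b \<in> carrier A"
  shows "hcomp m (a \<oplus> b) = hcomp m a \<oplus> hcomp m b"
proof (rule hcomp_unique[where B = "{i. hcomp i a \<noteq> \<zero>} \<union> {i. hcomp i b \<noteq> \<zero>}"])
  let ?B = "{i. hcomp i a \<noteq> \<zero>} \<union> {i. hcomp i b \<noteq> \<zero>}"
  show fin: "finite ?B" using hcomp_family a b by blast
  show "hcomp i a \<oplus> hcomp i b \<in> G i" for i using a b by (intro G_add hcomp_G)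
  have "a \<oplus> b = (\<Oplus>i\<in>?B. hcomp i a) \<oplus> (\<Oplus>i\<in>?B. hcomp i b)"
    using hcomp_sum[OF a fin] hcomp_sum[OF b fin] by (metis Un_upper1 Un_upper2)
  also have "\<dots> = (\<Oplus>i\<in>?B. hcomp i a \<oplus> hcomp i b)"
    using a b hcomp_closed by (intro finsum_addf[symmetric]) auto
  finally show "a \<oplus> b = (\<Oplus>i\<in>?B. hcomp i a \<oplus> hcomp i b)" .
qed auto

lemma hcomp_zero: "hcomp m \<zero> = \<zero>"
  using hcomp_homogeneous[OF G_zero[of m], of m] by simp

text \<open>Multiplication by a homogeneous element shifts components; indices range over the integers so
  that no case distinction on the sign of a degree is needed.\<close>

definition icomp :: "int \<Rightarrow> 'a \<Rightarrow> 'a" where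
  "icomp i a = (if i < 0 then \<zero> else hcomp (nat i) a)"

lemma hcomp_mult:
  assumes s: "s \<in> G p" and a: "a \<in> carrier A"
  shows "hcomp m (s \<otimes> a) = (if m < p then \<zero> else s \<otimes> hcomp (m - p) a)"
proof (rule hcomp_unique[where B = "(\<lambda>i. i + p) ` {i. hcomp i a \<noteq> \<zero>}"])
  let ?S = "{i. hcomp i a \<noteq> \<zero>}"
  have fin: "finite ?S" using hcomp_family a by blast
  thus "finite ((\<lambda>i. i + p) ` ?S)" by simp
  have sc: "s \<in> carrier A" using s G_closed by simp
  show "(if i < p then \<zero> else s \<otimes> hcomp (i - p) a) \<in> G i" for i
    using component_mult[OF s hcomp_G[OF a, of "i - p"]] G_zero by auto
  show "(if i < p then \<zero> else s \<otimes> hcomp (i - p) a) = \<zero>" if "i \<notin> (\<lambda>i. i + p) ` ?S" for i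
  proof (cases "i < p")
    case False
    hence "i = (i - p) + p" by simp
    hence "hcomp (i - p) a = \<zero>" using that by blast
    thus ?thesis using sc by simp
  qed simp
  have "s \<otimes> a = s \<otimes> (\<Oplus>i\<in>?S. hcomp i a)" using hcomp_sum[OF a fin] by simp
  also have "\<dots> = (\<Oplus>i\<in>?S. s \<otimes> hcomp i a)"
    using fin sc hcomp_closed[OF a] by (intro finsum_rdistr) auto
  also have "\<dots> = (\<Oplus>i\<in>(\<lambda>i. i + p) ` ?S. if i < p then \<zero> else s \<otimes> hcomp (i - p) a)"
    using sc hcomp_closed[OF a] by (subst add.finprod_reindex) (auto simp: inj_on_def)
  finally show "s \<otimes> a = (\<Oplus>i\<in>(\<lambda>i. i + p) ` ?S. if i < p then \<zero> else s \<otimes> hcomp (i - p) a)" .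
qed

lemma icomp_mult: "s \<in> G p \<Longrightarrow> a \<in> carrier A \<Longrightarrow> icomp (i + int p) (s \<otimes> a) = s \<otimes> icomp i a"
  using G_closed[of s p] by (auto simp: icomp_def hcomp_mult nat_add_distrib nat_less_iff)

lemma icomp_closed: "a \<in> carrier A \<Longrightarrow> icomp i a \<in> carrier A"
  by (simp add: icomp_def hcomp_closed)

lemma icomp_component: "a \<in> carrier A \<Longrightarrow> icomp i a \<in> int_component A G i"
  by (simp add: icomp_def int_component_def hcomp_G)

lemma int_component_closed: "a \<in> int_component A G i \<Longrightarrow> a \<in> carrier A"
  by (auto simp: int_component_def G_closed split: if_splits)

lemma icomp_int_component: "a \<in> int_component A G i \<Longrightarrow> icomp j a = (if j = i then a else \<zero>)"
  by (auto simp: int_component_def icomp_def hcomp_homogeneous[of _ "nat i"] hcomp_zero split: if_splits)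

lemma icomp_add: "a \<in> carrier A \<Longrightarrow> b \<in> carrier A \<Longrightarrow> icomp i (a \<oplus> b) = icomp i a \<oplus> icomp i b"
  by (simp add: icomp_def hcomp_add)

lemma homogeneous_degree_unique: "z \<in> G p \<Longrightarrow> z \<in> G q \<Longrightarrow> z \<noteq> \<zero> \<Longrightarrow> p = q"
  using hcomp_homogeneous[of z p p] hcomp_homogeneous[of z q p] by (auto split: if_splits)

lemma hdeg_eq: "z \<in> G p \<Longrightarrow> z \<noteq> \<zero> \<Longrightarrow> hdeg G z = p"
  unfolding hdeg_def using homogeneous_degree_unique by (intro Least_equality) auto

lemma hdeg_mem: "z \<in> G p \<Longrightarrow> z \<in> G (hdeg G z)"
  unfolding hdeg_def by (rule LeastI)

end


section \<open>Localization at a multiplicative set\<close>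

locale multiplicative_set = cring A for A (structure) +
  fixes S :: "'a set"
  assumes S_closed: "s \<in> S \<Longrightarrow> s \<in> carrier A"
    and S_one: "\<one> \<in> S"
    and S_mult: "s \<in> S \<Longrightarrow> t \<in> S \<Longrightarrow> s \<otimes> t \<in> S"
begin

abbreviation L where "L \<equiv> localization A S"
abbreviation fr where "fr \<equiv> fraction A S"

lemma fraction_trans:
  assumes a: "a \<in> carrier A" "b \<in> carrier A" "c \<in> carrier A" and s: "s \<in> S" "t \<in> S" "r \<in> S"
    and u: "u \<in> S" "u \<otimes> (t \<otimes> a) = u \<otimes> (s \<otimes> b)" and v: "v \<in> S" "v \<otimes> (r \<otimes> b) = v \<otimes> (t \<otimes> c)"
  shows "\<exists>w\<in>S. w \<otimes> (r \<otimes> a) = w \<otimes> (s \<otimes> c)"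
proof -
  have cl: "u \<in> carrier A" "v \<in> carrier A" "s \<in> carrier A" "t \<in> carrier A" "r \<in> carrier A"
    using u v s S_closed by auto
  have "(u \<otimes> v \<otimes> t) \<otimes> (r \<otimes> a) = (v \<otimes> r) \<otimes> (u \<otimes> (t \<otimes> a))" using cl a by algebra
  also have "\<dots> = (u \<otimes> s) \<otimes> (v \<otimes> (r \<otimes> b))" unfolding u(2) using cl a by algebra
  also have "\<dots> = (u \<otimes> v \<otimes> t) \<otimes> (s \<otimes> c)" unfolding v(2) using cl a by algebra
  finally show ?thesis using u v s S_mult by blast
qed

lemma fraction_eq_iff:
  assumes a: "a \<in> carrier A" "b \<in> carrier A" and s: "s \<in> S" "t \<in> S"
  shows "fr a s = fr b t \<longleftrightarrow> (\<exists>u\<in>S. u \<otimes> (t \<otimes> a) = u \<otimes> (s \<otimes> b))"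
proof
  assume "fr a s = fr b t"
  moreover have "(b, t) \<in> fr b t" using a s S_one by (auto simp: fraction_def)
  ultimately have "(b, t) \<in> fr a s" by simp
  thus "\<exists>u\<in>S. u \<otimes> (t \<otimes> a) = u \<otimes> (s \<otimes> b)" by (auto simp: fraction_def)
next
  assume "\<exists>u\<in>S. u \<otimes> (t \<otimes> a) = u \<otimes> (s \<otimes> b)"
  then obtain u where u: "u \<in> S" "u \<otimes> (t \<otimes> a) = u \<otimes> (s \<otimes> b)" by blast
  have "(c, r) \<in> fr a s \<longleftrightarrow> (c, r) \<in> fr b t" for c r
  proof
    assume "(c, r) \<in> fr b t"
    then obtain v where v: "c \<in> carrier A" "r \<in> S" "v \<in> S" "v \<otimes> (r \<otimes> b) = v \<otimes> (t \<otimes> c)" by (auto simp: fraction_def)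
    from fraction_trans[OF a v(1) s v(2) u v(3,4)] v(1,2)
    show "(c, r) \<in> fr a s" unfolding fraction_def by blast
  next
    assume "(c, r) \<in> fr a s"
    then obtain v where v: "c \<in> carrier A" "r \<in> S" "v \<in> S" "v \<otimes> (r \<otimes> a) = v \<otimes> (s \<otimes> c)" by (auto simp: fraction_def)
    from fraction_trans[OF a(2,1) v(1) s(2,1) v(2) u(1) u(2)[symmetric] v(3,4)] v(1,2)
    show "(c, r) \<in> fr b t" unfolding fraction_def by blast
  qed
  thus "fr a s = fr b t" by auto
qed

lemma fraction_self: "a \<in> carrier A \<Longrightarrow> s \<in> S \<Longrightarrow> (a, s) \<in> fr a s"
  using S_one by (auto simp: fraction_def)

lemma fraction_memD:
  assumes "a \<in> carrier A" "s \<in> S" "(b, t) \<in> fr a s"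
  shows "b \<in> carrier A" "t \<in> S" "fr b t = fr a s"
  using assms fraction_eq_iff[of a b s t] by (auto simp: fraction_def)

text \<open>Each union in the definition of a localization ranges over the representatives of a fraction and is a
  union of equal sets, provided that the operation respects equality of fractions.\<close>

lemma fraction_Union:
  assumes a: "a \<in> carrier A" "s \<in> S"
    and resp: "\<And>b t. b \<in> carrier A \<Longrightarrow> t \<in> S \<Longrightarrow> fr b t = fr a s \<Longrightarrow> F b t = F a s"
  shows "(\<Union>(b, t)\<in>fr a s. F b t) = F a s"
proof -
  have "F b t = F a s" if "(b, t) \<in> fr a s" for b t
    using fraction_memD[OF a that] by (rule resp)
  hence "(\<Union>(b, t)\<in>fr a s. F b t) = (\<Union>(b, t)\<in>fr a s. F a s)" by (intro SUP_cong refl) auto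
  also have "\<dots> = F a s" using fraction_self[OF a] by auto
  finally show ?thesis .
qed

lemma fraction_cancel:
  assumes "a \<in> carrier A" "s \<in> S" "t \<in> S"
  shows "fr (t \<otimes> a) (t \<otimes> s) = fr a s"
proof -
  have cl: "s \<in> carrier A" "t \<in> carrier A" using assms S_closed by auto
  have "\<one> \<otimes> (s \<otimes> (t \<otimes> a)) = \<one> \<otimes> ((t \<otimes> s) \<otimes> a)" using cl assms by algebra
  thus ?thesis using fraction_eq_iff[of "t \<otimes> a" a "t \<otimes> s" s] assms cl S_one S_mult by auto
qed

lemma fraction_cancel':
  assumes "a \<in> carrier A" "s \<in> S" "t \<in> S"
  shows "fr (t \<otimes> a) (s \<otimes> t) = fr a s"
  using fraction_cancel[OF assms] m_comm[OF S_closed[OF assms(2)] S_closed[OF assms(3)]] by simp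

lemma L_carrier: "carrier L = {fr a s | a s. a \<in> carrier A \<and> s \<in> S}"
  by (simp add: localization_def)

lemma L_I: "a \<in> carrier A \<Longrightarrow> s \<in> S \<Longrightarrow> fr a s \<in> carrier L"
  by (auto simp: L_carrier)

lemma L_E:
  assumes "X \<in> carrier L"
  obtains a s where "a \<in> carrier A" "s \<in> S" "X = fr a s"
  using assms by (auto simp: L_carrier)

lemma L_E2:
  assumes "X \<in> carrier L" "Y \<in> carrier L"
  obtains a b s where "a \<in> carrier A" "b \<in> carrier A" "s \<in> S" "X = fr a s" "Y = fr b s"
proof -
  from assms obtain a s b t where *: "a \<in> carrier A" "s \<in> S" "X = fr a s" "b \<in> carrier A" "t \<in> S" "Y = fr b t"
    by (metis L_E)
  have "X = fr (t \<otimes> a) (t \<otimes> s)" "Y = fr (s \<otimes> b) (t \<otimes> s)"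
    using fraction_cancel[of a s t] fraction_cancel'[of b t s] * by blast+
  moreover have "t \<otimes> a \<in> carrier A" "s \<otimes> b \<in> carrier A" "t \<otimes> s \<in> S" using * S_closed S_mult by auto
  ultimately show ?thesis using that by blast
qed

lemma L_zero: "\<zero>\<^bsub>L\<^esub> = fr \<zero> \<one>"
  by (simp add: localization_def)

lemma fraction_zero_iff: "a \<in> carrier A \<Longrightarrow> s \<in> S \<Longrightarrow> fr a s = \<zero>\<^bsub>L\<^esub> \<longleftrightarrow> (\<exists>u\<in>S. u \<otimes> a = \<zero>)"
  unfolding L_zero using fraction_eq_iff[of a \<zero> s \<one>] S_one S_closed by auto

lemma L_add':
  assumes a: "a \<in> carrier A" "s \<in> S" and b: "b \<in> carrier A" "t \<in> S"
  shows "fr a s \<oplus>\<^bsub>L\<^esub> fr b t = fr ((t \<otimes> a) \<oplus> (s \<otimes> b)) (s \<otimes> t)"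
proof -
  have eq: "fr ((t' \<otimes> a') \<oplus> (s' \<otimes> b')) (s' \<otimes> t') = fr ((t \<otimes> a) \<oplus> (s \<otimes> b)) (s \<otimes> t)"
    if a': "a' \<in> carrier A" "s' \<in> S" "fr a' s' = fr a s" and b': "b' \<in> carrier A" "t' \<in> S" "fr b' t' = fr b t"
    for a' s' b' t'
  proof -
    obtain u where u: "u \<in> S" "u \<otimes> (s \<otimes> a') = u \<otimes> (s' \<otimes> a)"
      using a' a fraction_eq_iff by blast
    obtain v where v: "v \<in> S" "v \<otimes> (t \<otimes> b') = v \<otimes> (t' \<otimes> b)"
      using b' b fraction_eq_iff by blast
    have cl: "u \<in> carrier A" "v \<in> carrier A" "s \<in> carrier A" "t \<in> carrier A" "s' \<in> carrier A" "t' \<in> carrier A"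
      using u v a b a' b' S_closed by auto
    have "(u \<otimes> v) \<otimes> ((s \<otimes> t) \<otimes> ((t' \<otimes> a') \<oplus> (s' \<otimes> b'))) =
        (v \<otimes> t \<otimes> t') \<otimes> (u \<otimes> (s \<otimes> a')) \<oplus> (u \<otimes> s \<otimes> s') \<otimes> (v \<otimes> (t \<otimes> b'))" using cl a b a' b' by algebra
    also have "\<dots> = (u \<otimes> v) \<otimes> ((s' \<otimes> t') \<otimes> ((t \<otimes> a) \<oplus> (s \<otimes> b)))"
      unfolding u(2) v(2) using cl a b by algebra
    finally show ?thesis
      using fraction_eq_iff[of "(t' \<otimes> a') \<oplus> (s' \<otimes> b')" "(t \<otimes> a) \<oplus> (s \<otimes> b)" "s' \<otimes> t'" "s \<otimes> t"]
        cl a b a' b' S_mult u v by auto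
  qed
  have "fr a s \<oplus>\<^bsub>L\<^esub> fr b t =
      (\<Union>(a, s)\<in>fr a s. \<Union>(b, t)\<in>fr b t. fr ((t \<otimes> a) \<oplus> (s \<otimes> b)) (s \<otimes> t))"
    by (simp add: localization_def)
  also have "\<dots> = (\<Union>(b', t')\<in>fr b t. fr ((t' \<otimes> a) \<oplus> (s \<otimes> b')) (s \<otimes> t'))"
  proof (rule fraction_Union[OF a])
    fix a' s' assume *: "a' \<in> carrier A" "s' \<in> S" "fr a' s' = fr a s"
    have "(\<Union>(b', t')\<in>fr b t. fr ((t' \<otimes> a') \<oplus> (s' \<otimes> b')) (s' \<otimes> t')) = fr ((t \<otimes> a') \<oplus> (s' \<otimes> b)) (s' \<otimes> t)"
      using eq[OF *] eq[OF * b refl] by (intro fraction_Union[OF b]) auto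
    moreover have "(\<Union>(b', t')\<in>fr b t. fr ((t' \<otimes> a) \<oplus> (s \<otimes> b')) (s \<otimes> t')) = fr ((t \<otimes> a) \<oplus> (s \<otimes> b)) (s \<otimes> t)"
      using eq[OF a refl] by (intro fraction_Union[OF b]) auto
    ultimately show "(\<Union>(b', t')\<in>fr b t. fr ((t' \<otimes> a') \<oplus> (s' \<otimes> b')) (s' \<otimes> t')) =
        (\<Union>(b', t')\<in>fr b t. fr ((t' \<otimes> a) \<oplus> (s \<otimes> b')) (s \<otimes> t'))" using eq[OF * b refl] by simp
  qed
  also have "\<dots> = fr ((t \<otimes> a) \<oplus> (s \<otimes> b)) (s \<otimes> t)"
    using eq[OF a refl] by (intro fraction_Union[OF b]) auto
  finally show ?thesis .
qed

lemma L_add: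
  assumes "a \<in> carrier A" "b \<in> carrier A" "s \<in> S"
  shows "fr a s \<oplus>\<^bsub>L\<^esub> fr b s = fr (a \<oplus> b) s"
proof -
  have cl: "s \<in> carrier A" using assms S_closed by auto
  have "fr a s \<oplus>\<^bsub>L\<^esub> fr b s = fr (s \<otimes> (a \<oplus> b)) (s \<otimes> s)"
    using L_add'[of a s b s] assms cl by (simp add: r_distr)
  thus ?thesis using fraction_cancel assms by simp
qed

lemma fraction_smult_cong:
  assumes c: "c \<in> carrier A" and a: "a \<in> carrier A" "s \<in> S" "b \<in> carrier A" "t \<in> S" and e: "fr a s = fr b t"
  shows "fr (c \<otimes> a) s = fr (c \<otimes> b) t"
proof -
  obtain u where u: "u \<in> S" "u \<otimes> (t \<otimes> a) = u \<otimes> (s \<otimes> b)" using e a fraction_eq_iff by blast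
  have cl: "u \<in> carrier A" "s \<in> carrier A" "t \<in> carrier A" using u a S_closed by auto
  have "u \<otimes> (t \<otimes> (c \<otimes> a)) = c \<otimes> (u \<otimes> (t \<otimes> a))" using cl a c by algebra
  also have "\<dots> = u \<otimes> (s \<otimes> (c \<otimes> b))" unfolding u(2) using cl a c by algebra
  finally show ?thesis using fraction_eq_iff[of "c \<otimes> a" "c \<otimes> b" s t] a c u by auto
qed

lemma L_smult:
  assumes c: "c \<in> carrier A" and a: "a \<in> carrier A" "s \<in> S"
  shows "c \<odot>\<^bsub>L\<^esub> fr a s = fr (c \<otimes> a) s"
proof -
  have "c \<odot>\<^bsub>L\<^esub> fr a s = (\<Union>(a, s)\<in>fr a s. fr (c \<otimes> a) s)" by (simp add: localization_def)
  also have "\<dots> = fr (c \<otimes> a) s"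
    by (rule fraction_Union[OF a, where F = "\<lambda>a s. fr (c \<otimes> a) s"]) (rule fraction_smult_cong[OF c _ _ a])
  finally show ?thesis .
qed

lemma L_module: "module A L"
proof (rule moduleI)
  show "cring A" by (rule is_cring)
  show "abelian_group L"
  proof (rule abelian_groupI)
    show "\<zero>\<^bsub>L\<^esub> \<in> carrier L" unfolding L_zero by (intro L_I S_one zero_closed)
    fix X Y assume X: "X \<in> carrier L" and Y: "Y \<in> carrier L"
    obtain a b s where ab: "a \<in> carrier A" "b \<in> carrier A" "s \<in> S" "X = fr a s" "Y = fr b s"
      using L_E2[OF X Y] .
    show "X \<oplus>\<^bsub>L\<^esub> Y \<in> carrier L" using ab by (simp add: L_add L_I)
    show "X \<oplus>\<^bsub>L\<^esub> Y = Y \<oplus>\<^bsub>L\<^esub> X" using ab by (simp add: L_add a_comm)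
    fix Z assume "Z \<in> carrier L"
    then obtain c t where c: "c \<in> carrier A" "t \<in> S" "Z = fr c t" by (rule L_E)
    have e: "X = fr (t \<otimes> a) (t \<otimes> s)" "Y = fr (t \<otimes> b) (t \<otimes> s)" "Z = fr (s \<otimes> c) (t \<otimes> s)"
      using fraction_cancel[of a s t] fraction_cancel[of b s t] fraction_cancel'[of c t s] ab c by blast+
    have cl: "t \<otimes> a \<in> carrier A" "t \<otimes> b \<in> carrier A" "s \<otimes> c \<in> carrier A" "t \<otimes> s \<in> S"
      using ab c S_closed S_mult by auto
    show "X \<oplus>\<^bsub>L\<^esub> Y \<oplus>\<^bsub>L\<^esub> Z = X \<oplus>\<^bsub>L\<^esub> (Y \<oplus>\<^bsub>L\<^esub> Z)"
      unfolding e L_add[OF cl(1,2,4)] L_add[OF cl(2,3,4)]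
        L_add[OF a_closed[OF cl(1,2)] cl(3,4)] L_add[OF cl(1) a_closed[OF cl(2,3)] cl(4)] a_assoc[OF cl(1-3)] ..
  next
    fix X assume "X \<in> carrier L"
    then obtain a s where a: "a \<in> carrier A" "s \<in> S" "X = fr a s" by (rule L_E)
    have z: "\<zero>\<^bsub>L\<^esub> = fr \<zero> s"
    proof -
      have "\<one> \<otimes> \<zero> = \<zero>" by simp
      thus ?thesis using fraction_zero_iff[OF zero_closed a(2)] S_one by metis
    qed
    show "\<zero>\<^bsub>L\<^esub> \<oplus>\<^bsub>L\<^esub> X = X" using a by (simp add: z L_add)
    show "\<exists>Y\<in>carrier L. Y \<oplus>\<^bsub>L\<^esub> X = \<zero>\<^bsub>L\<^esub>"
      using a by (intro bexI[of _ "fr (\<ominus> a) s"]) (simp_all add: z L_add l_neg L_I)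
  qed
next
  fix c X assume c: "c \<in> carrier A" and "X \<in> carrier L"
  then obtain a s where a: "a \<in> carrier A" "s \<in> S" "X = fr a s" by (metis L_E)
  show "c \<odot>\<^bsub>L\<^esub> X \<in> carrier L" using a c by (simp add: L_smult L_I)
  fix b assume b: "b \<in> carrier A"
  show "(c \<oplus> b) \<odot>\<^bsub>L\<^esub> X = c \<odot>\<^bsub>L\<^esub> X \<oplus>\<^bsub>L\<^esub> b \<odot>\<^bsub>L\<^esub> X" using a b c by (simp add: L_smult L_add l_distr)
  show "(c \<otimes> b) \<odot>\<^bsub>L\<^esub> X = c \<odot>\<^bsub>L\<^esub> (b \<odot>\<^bsub>L\<^esub> X)" using a b c by (simp add: L_smult m_assoc)
next
  fix c X Y assume c: "c \<in> carrier A" and X: "X \<in> carrier L" and Y: "Y \<in> carrier L"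
  obtain a b s where ab: "a \<in> carrier A" "b \<in> carrier A" "s \<in> S" "X = fr a s" "Y = fr b s"
    using L_E2[OF X Y] .
  show "c \<odot>\<^bsub>L\<^esub> (X \<oplus>\<^bsub>L\<^esub> Y) = c \<odot>\<^bsub>L\<^esub> X \<oplus>\<^bsub>L\<^esub> c \<odot>\<^bsub>L\<^esub> Y" using ab c by (simp add: L_smult L_add r_distr)
next
  fix X assume "X \<in> carrier L"
  then obtain a s where a: "a \<in> carrier A" "s \<in> S" "X = fr a s" by (rule L_E)
  show "\<one> \<odot>\<^bsub>L\<^esub> X = X" using a by (simp add: L_smult)
qed

lemma L_smult_inj:
  assumes u: "u \<in> S" and X: "X \<in> carrier L" "u \<odot>\<^bsub>L\<^esub> X = \<zero>\<^bsub>L\<^esub>"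
  shows "X = \<zero>\<^bsub>L\<^esub>"
proof -
  from X obtain a s where a: "a \<in> carrier A" "s \<in> S" "X = fr a s" by (metis L_E)
  have uc: "u \<in> carrier A" using u S_closed by simp
  have "fr (u \<otimes> a) s = \<zero>\<^bsub>L\<^esub>" using X(2) a uc by (simp add: L_smult)
  then obtain v where v: "v \<in> S" "v \<otimes> (u \<otimes> a) = \<zero>" using fraction_zero_iff a uc by auto
  hence "(v \<otimes> u) \<otimes> a = \<zero>" using a uc S_closed by (simp add: m_assoc)
  thus ?thesis using fraction_zero_iff[OF a(1,2)] a(3) v u S_mult by blast
qed

lemma L_smult_surj:
  assumes u: "u \<in> S" and Y: "Y \<in> carrier L"
  shows "\<exists>X \<in> carrier L. u \<odot>\<^bsub>L\<^esub> X = Y"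
proof -
  from Y obtain a s where a: "a \<in> carrier A" "s \<in> S" "Y = fr a s" by (metis L_E)
  have "u \<odot>\<^bsub>L\<^esub> fr a (u \<otimes> s) = fr (u \<otimes> a) (u \<otimes> s)" using a u S_closed S_mult by (simp add: L_smult)
  also have "\<dots> = Y" using a u by (simp add: fraction_cancel)
  finally show ?thesis using a u S_mult L_I by blast
qed

end

text \<open>The map \<open>a / s \<mapsto> a / (s c)\<close>. For \<open>c = 1\<close> it is the canonical map of localizations; for \<open>c\<close> a
  product of generators it is a component of the map from the Koszul to the Cech complex.\<close>

locale localization_change = S: multiplicative_set A S + T: multiplicative_set A T
  for A (structure) and S T +
  fixes c :: 'a
  assumes c_carrier: "c \<in> carrier A" and sc: "s \<in> S \<Longrightarrow> s \<otimes> c \<in> T" and sub: "S \<subseteq> T"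
begin

definition change :: "('a \<times> 'a) set \<Rightarrow> ('a \<times> 'a) set" where
  "change X = (\<Union>(a, s)\<in>X. fraction A T a (s \<otimes> c))"

lemma change_fraction:
  assumes a: "a \<in> carrier A" "s \<in> S"
  shows "change (fraction A S a s) = fraction A T a (s \<otimes> c)"
  unfolding change_def
proof (rule S.fraction_Union[OF a])
  fix b t assume b: "b \<in> carrier A" "t \<in> S" "fraction A S b t = fraction A S a s"
  then obtain u where u: "u \<in> S" "u \<otimes> (s \<otimes> b) = u \<otimes> (t \<otimes> a)" using S.fraction_eq_iff a by blast
  have cl: "u \<in> carrier A" "s \<in> carrier A" "t \<in> carrier A" using u a b S.S_closed by auto
  have "u \<otimes> ((s \<otimes> c) \<otimes> b) = c \<otimes> (u \<otimes> (s \<otimes> b))" using cl a b c_carrier by algebra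
  also have "\<dots> = u \<otimes> ((t \<otimes> c) \<otimes> a)" unfolding u(2) using cl a b c_carrier by algebra
  finally show "fraction A T b (t \<otimes> c) = fraction A T a (s \<otimes> c)"
    using T.fraction_eq_iff[of b a "t \<otimes> c" "s \<otimes> c"] a b sc u sub by auto
qed

lemma change_closed: "X \<in> carrier (localization A S) \<Longrightarrow> change X \<in> carrier (localization A T)"
  by (erule S.L_E) (simp add: change_fraction T.L_I sc)

lemma change_add:
  assumes "X \<in> carrier (localization A S)" "Y \<in> carrier (localization A S)"
  shows "change (X \<oplus>\<^bsub>localization A S\<^esub> Y) = change X \<oplus>\<^bsub>localization A T\<^esub> change Y"
proof -
  obtain a b s where ab: "a \<in> carrier A" "b \<in> carrier A" "s \<in> S" "X = fraction A S a s" "Y = fraction A S b s"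
    using S.L_E2[OF assms] .
  thus ?thesis by (simp add: change_fraction S.L_add T.L_add sc)
qed

end

lemma localization_map_fraction:
  assumes "multiplicative_set A S" "multiplicative_set A T" "S \<subseteq> T" "a \<in> carrier A" "s \<in> S"
  shows "localization_map A T (fraction A S a s) = fraction A T a s"
proof -
  interpret S: multiplicative_set A S by fact
  interpret T: multiplicative_set A T by fact
  interpret localization_change A S T "\<one>\<^bsub>A\<^esub>"
    by unfold_locales (use assms S.S_closed in auto)
  have "localization_map A T X = change X" if "\<forall>(b, t)\<in>X. t \<in> carrier A" for X
    using that unfolding localization_map_def change_def by (auto 4 3)
  moreover have "\<forall>(b, t)\<in>fraction A S a s. t \<in> carrier A" using S.S_closed by (auto simp: fraction_def)
  ultimately show ?thesis using change_fraction[OF assms(4,5)] assms S.S_closed by simp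
qed

section \<open>Degrees in localizations\<close>

locale homogeneous_set = graded_ring A G + multiplicative_set A S for A (structure) and G and S +
  assumes S_homogeneous: "s \<in> S \<Longrightarrow> \<exists>p. s \<in> G p"
begin

lemma S_hdeg: "s \<in> S \<Longrightarrow> s \<in> G (hdeg G s)"
  using S_homogeneous hdeg_mem by blast

text \<open>The shift by the degree of the denominator makes the result independent of the representative, since
  multiplication by a homogeneous element shifts components.\<close>

definition lproj :: "int \<Rightarrow> ('a \<times> 'a) set \<Rightarrow> ('a \<times> 'a) set" where
  "lproj i X = (\<Union>(a, s)\<in>X. fr (icomp (i + int (hdeg G s)) a) s)"

lemma lproj_fraction:
  assumes a: "a \<in> carrier A" "s \<in> S"
  shows "lproj i (fr a s) = fr (icomp (i + int (hdeg G s)) a) s"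
  unfolding lproj_def
proof (rule fraction_Union[OF a])
  fix b t assume b: "b \<in> carrier A" "t \<in> S" and e: "fr b t = fr a s"
  obtain u where u: "u \<in> S" "u \<otimes> (s \<otimes> b) = u \<otimes> (t \<otimes> a)" using e a b fraction_eq_iff by blast
  obtain p where p: "u \<in> G p" using S_homogeneous u by blast
  have cl: "s \<in> carrier A" "t \<in> carrier A" using a b S_closed by auto
  let ?s = "int (hdeg G s)" and ?t = "int (hdeg G t)"
  have "u \<otimes> (s \<otimes> icomp (i + ?t) b) = icomp (i + ?t + ?s + int p) (u \<otimes> (s \<otimes> b))"
    using p S_hdeg[OF a(2)] b cl by (simp add: icomp_mult)
  also have "\<dots> = icomp (i + ?s + ?t + int p) (u \<otimes> (t \<otimes> a))" unfolding u(2) by (simp add: ac_simps)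
  also have "\<dots> = u \<otimes> (t \<otimes> icomp (i + ?s) a)"
    using p S_hdeg[OF b(2)] a cl by (simp add: icomp_mult)
  finally show "fr (icomp (i + ?t) b) t = fr (icomp (i + ?s) a) s"
    using fraction_eq_iff[OF icomp_closed icomp_closed b(2) a(2)] a b u(1) by blast
qed

lemma lproj_closed: "X \<in> carrier L \<Longrightarrow> lproj i X \<in> carrier L"
  by (erule L_E) (simp add: lproj_fraction L_I icomp_closed)

lemma lproj_add:
  assumes "X \<in> carrier L" "Y \<in> carrier L"
  shows "lproj i (X \<oplus>\<^bsub>L\<^esub> Y) = lproj i X \<oplus>\<^bsub>L\<^esub> lproj i Y"
proof -
  obtain a b s where ab: "a \<in> carrier A" "b \<in> carrier A" "s \<in> S" "X = fr a s" "Y = fr b s"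
    using L_E2[OF assms] .
  thus ?thesis by (simp add: lproj_fraction L_add icomp_closed icomp_add)
qed

lemma lproj_smult_homogeneous:
  assumes z: "z \<in> G q" and "X \<in> carrier L"
  shows "lproj (i + int q) (z \<odot>\<^bsub>L\<^esub> X) = z \<odot>\<^bsub>L\<^esub> lproj i X"
  using assms(2)
proof (rule L_E)
  fix a s assume a: "a \<in> carrier A" "s \<in> S" "X = fr a s"
  have zc: "z \<in> carrier A" using z G_closed by simp
  have "icomp (i + int (hdeg G s) + int q) (z \<otimes> a) = z \<otimes> icomp (i + int (hdeg G s)) a"
    using z a by (rule_tac icomp_mult)
  thus ?thesis using a zc by (simp add: lproj_fraction L_smult icomp_closed ac_simps)
qed

lemma lproj_lproj:
  "X \<in> carrier L \<Longrightarrow> lproj i (lproj j X) = (if i = j then lproj j X else \<zero>\<^bsub>L\<^esub>)"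
proof (erule L_E)
  fix a s assume a: "a \<in> carrier A" "s \<in> S" "X = fr a s"
  have "\<one> \<otimes> \<zero> = \<zero>" by simp
  hence z: "fr \<zero> s = \<zero>\<^bsub>L\<^esub>" using fraction_zero_iff[OF zero_closed a(2)] S_one by metis
  show ?thesis using a icomp_int_component[OF icomp_component[OF a(1)]] z
    by (simp add: lproj_fraction icomp_closed)
qed

lemma localization_component_iff:
  "X \<in> localization_component A G S i \<longleftrightarrow> X \<in> carrier L \<and> lproj i X = X"
proof
  assume "X \<in> localization_component A G S i"
  then obtain a s p where a: "X = fr a s" "s \<in> S" "s \<in> G p" "a \<in> int_component A G (i + int p)"
    by (auto simp: localization_component_def)
  have ac: "a \<in> carrier A" using a(4) by (rule int_component_closed)
  show "X \<in> carrier L \<and> lproj i X = X"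
  \<comment> \<open>If zero is a denominator, all fractions are equal, but the degree of the denominator is ambiguous.\<close>
  proof (cases "s = \<zero>")
    case True
    let ?b = "icomp (i + int (hdeg G s)) a"
    have bc: "?b \<in> carrier A" using ac by (rule icomp_closed)
    have "s \<otimes> (s \<otimes> ?b) = s \<otimes> (s \<otimes> a)" using True ac bc by simp
    hence "fr ?b s = fr a s" using fraction_eq_iff[OF bc ac a(2,2)] a(2) by blast
    thus ?thesis unfolding a(1) lproj_fraction[OF ac a(2)] using L_I[OF ac a(2)] by simp
  next
    case False
    hence "hdeg G s = p" using a hdeg_eq by simp
    thus ?thesis using a ac icomp_int_component[OF a(4)] by (simp add: L_I lproj_fraction)
  qed
next
  assume X: "X \<in> carrier L \<and> lproj i X = X"
  then obtain a s where a: "a \<in> carrier A" "s \<in> S" "X = fr a s" by (metis L_E)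
  hence "X = fr (icomp (i + int (hdeg G s)) a) s" using X lproj_fraction by metis
  thus "X \<in> localization_component A G S i" unfolding localization_component_def
    using a S_hdeg icomp_component by blast
qed

end

section \<open>Denominators\<close>

context graded_ring
begin

lemma one_homogeneous: "\<one> \<in> G 0"
proof -
  \<comment> \<open>The component of degree 0 of the unit is a unit element for homogeneous elements, hence for all.\<close>
  define e where "e = hcomp 0 \<one>"
  have e: "e \<in> G 0" "e \<in> carrier A" unfolding e_def by (simp_all add: hcomp_G hcomp_closed)
  have h: "e \<otimes> z = z" if z: "z \<in> G p" for z p
  proof -
    have zc: "z \<in> carrier A" using z G_closed by simp
    have "z = hcomp p (z \<otimes> \<one>)" using z zc by (simp add: hcomp_homogeneous)
    also have "\<dots> = z \<otimes> e" using hcomp_mult[OF z one_closed, of p] by (simp add: e_def)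
    finally show ?thesis using zc e m_comm by simp
  qed
  let ?B = "{i. hcomp i \<one> \<noteq> \<zero>}"
  have fin: "finite ?B" using hcomp_family[of \<one>] by simp
  have o: "\<one> = (\<Oplus>i\<in>?B. hcomp i \<one>)" by (rule hcomp_sum) (use fin in auto)
  have "e = e \<otimes> (\<Oplus>i\<in>?B. hcomp i \<one>)" using e o by simp
  also have "\<dots> = (\<Oplus>i\<in>?B. e \<otimes> hcomp i \<one>)"
    using fin e hcomp_closed by (intro finsum_rdistr) auto
  also have "\<dots> = (\<Oplus>i\<in>?B. hcomp i \<one>)"
    using h[OF hcomp_G[OF one_closed]] hcomp_closed by (intro finsum_cong') auto
  finally have "e = \<one>" using o by simp
  thus ?thesis using e by simp
qed

lemma power_homogeneous: "z \<in> G p \<Longrightarrow> z [^] (k::nat) \<in> G (k * p)"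
proof (induction k)
  case (Suc k)
  thus ?case using component_mult[of "z [^] k" "k * p" z p] by (simp add: add.commute)
qed (simp add: one_homogeneous)

end

locale homogeneous_list = graded_ring A G for A (structure) and G +
  fixes ys :: "'a list"
  assumes ys_homogeneous: "set ys \<subseteq> (\<Union>i. G i)"
begin

abbreviation "N \<equiv> length ys"

lemma ys_G: "i < N \<Longrightarrow> ys ! i \<in> G (hdeg G (ys ! i))"
  using ys_homogeneous nth_mem hdeg_mem by blast

lemma ys_closed: "i < N \<Longrightarrow> ys ! i \<in> carrier A"
  using ys_G G_closed by blast

abbreviation "den \<equiv> denominators A ys"

lemma ys_power_closed: "I \<subseteq> {..<N} \<Longrightarrow> (\<lambda>i. ys ! i [^] (\<alpha> i :: nat)) \<in> I \<rightarrow> carrier A"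
  using ys_closed by auto

lemma den_insert:
  assumes I: "insert l I \<subseteq> {..<N}" "l \<notin> I"
  shows "den (insert l I) = {s \<otimes> ys ! l [^] k | s (k::nat). s \<in> den I}"
proof -
  have fin: "finite I" using I finite_subset[of I "{..<N}"] by simp
  have cl: "(\<lambda>i. ys ! i [^] (\<alpha> i :: nat)) \<in> I \<rightarrow> carrier A" "ys ! l [^] (k :: nat) \<in> carrier A" for \<alpha> k
    using ys_power_closed[of I \<alpha>] ys_closed[of l] I by simp_all
  have ins: "(\<Otimes>i\<in>insert l I. ys ! i [^] \<alpha> i) = (\<Otimes>i\<in>I. ys ! i [^] \<alpha> i) \<otimes> ys ! l [^] \<alpha> l" for \<alpha> :: "nat \<Rightarrow> nat"
    using finprod_insert[OF fin I(2) cl] m_comm[OF finprod_closed[OF cl(1)] cl(2)] by simp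
  show ?thesis
  proof (rule equalityI; rule subsetI)
    fix x assume "x \<in> den (insert l I)"
    thus "x \<in> {s \<otimes> ys ! l [^] k | s (k::nat). s \<in> den I}"
      unfolding denominators_def by (auto simp: ins)
  next
    fix x assume "x \<in> {s \<otimes> ys ! l [^] k | s (k::nat). s \<in> den I}"
    then obtain s and k :: nat where s: "s \<in> den I" "x = s \<otimes> ys ! l [^] k" by blast
    from s(1) obtain \<alpha> :: "nat \<Rightarrow> nat" where "s = (\<Otimes>i\<in>I. ys ! i [^] \<alpha> i)"
      unfolding denominators_def by blast
    with s(2) have x: "x = (\<Otimes>i\<in>I. ys ! i [^] \<alpha> i) \<otimes> ys ! l [^] k" by simp
    have "(\<Otimes>i\<in>I. ys ! i [^] \<alpha> i) = (\<Otimes>i\<in>I. ys ! i [^] (\<alpha>(l := k)) i)"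
      by (rule finprod_cong') (use I cl in auto)
    hence "x = (\<Otimes>i\<in>insert l I. ys ! i [^] (\<alpha>(l := k)) i)" unfolding ins x by simp
    thus "x \<in> den (insert l I)" unfolding denominators_def by blast
  qed
qed

lemma den_multiplicative:
  assumes I: "I \<subseteq> {..<N}"
  shows "homogeneous_set A G (den I)"
proof -
  have fin: "finite I" using I finite_subset[of I "{..<N}"] by simp
  have one: "\<one> \<in> den I"
  proof -
    have e: "(\<Otimes>i\<in>I. ys ! i [^] (\<lambda>_. 0 :: nat) i) = \<one>" by (rule finprod_one_eqI) (simp only: nat_pow_0)
    show ?thesis unfolding denominators_def e[symmetric] by (intro CollectI exI[of _ "\<lambda>_. 0 :: nat"] conjI refl TrueI)
  qed
  have hom: "\<exists>p. s \<in> G p" if "s \<in> den I" for s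
    using fin I that
  proof (induction I arbitrary: s)
    case empty
    thus ?case using one_homogeneous by (auto simp: denominators_def)
  next
    case (insert l I)
    then obtain t and k :: nat where t: "t \<in> den I" "s = t \<otimes> ys ! l [^] k"
      using den_insert[of l I] by auto
    obtain p where "t \<in> G p" using insert t by auto
    thus ?case using t component_mult power_homogeneous[OF ys_G] insert by (metis insert_subset lessThan_iff)
  qed
  show ?thesis
  proof unfold_locales
    fix s assume s: "s \<in> den I"
    show "s \<in> carrier A" using hom[OF s] G_closed by blast
    show "\<exists>p. s \<in> G p" using hom[OF s] .
  next
    show "\<one> \<in> den I" by (rule one)
  next
    fix s t assume "s \<in> den I" "t \<in> den I"
    then obtain \<alpha> \<beta> :: "nat \<Rightarrow> nat" where st: "s = (\<Otimes>i\<in>I. ys ! i [^] \<alpha> i)" "t = (\<Otimes>i\<in>I. ys ! i [^] \<beta> i)"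
      by (auto simp: denominators_def)
    have "s \<otimes> t = (\<Otimes>i\<in>I. ys ! i [^] \<alpha> i \<otimes> ys ! i [^] \<beta> i)"
      unfolding st using I by (intro finprod_multf[symmetric] ys_power_closed)
    also have "\<dots> = (\<Otimes>i\<in>I. ys ! i [^] (\<alpha> i + \<beta> i))"
      by (rule finprod_cong') (use I ys_closed in \<open>auto simp: nat_pow_mult\<close>)
    finally show "s \<otimes> t \<in> den I" unfolding denominators_def
      by (intro CollectI exI[of _ "\<lambda>i. \<alpha> i + \<beta> i"] conjI TrueI)
  qed
qed

lemma den_mono:
  assumes "I \<subseteq> J" "J \<subseteq> {..<N}"
  shows "den I \<subseteq> den J"
proof -
  have fin: "finite (J - I)" using assms(2) finite_subset[of J "{..<N}"] by simp
  have "den I \<subseteq> den (I \<union> B)" if "finite B" "B \<subseteq> J - I" for B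
    using that
  proof (induction B)
    case (insert b B)
    have e: "den (insert b (I \<union> B)) = {s \<otimes> ys ! b [^] k | s (k::nat). s \<in> den (I \<union> B)}"
      by (rule den_insert) (use insert assms in auto)
    have "s \<in> den (insert b (I \<union> B))" if s: "s \<in> den (I \<union> B)" for s
    proof -
      have "I \<union> B \<subseteq> {..<N}" using insert assms by auto
      then interpret B: homogeneous_set A G "den (I \<union> B)" by (rule den_multiplicative)
      have "s = s \<otimes> ys ! b [^] (0::nat)" using B.S_closed[OF s] by simp
      thus ?thesis unfolding e using s by blast
    qed
    thus ?case using insert by auto
  qed simp
  from this[OF fin] assms show ?thesis by (simp add: Un_absorb1)
qed

lemma den_generator:
  assumes "l \<in> I" "I \<subseteq> {..<N}"
  shows "ys ! l \<in> den I"
proof -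
  have e: "insert l (I - {l}) = I" using assms by auto
  have "den I = {s \<otimes> ys ! l [^] k | s (k::nat). s \<in> den (I - {l})}"
    using den_insert[of l "I - {l}"] assms e by auto
  moreover interpret D: homogeneous_set A G "den (I - {l})" by (rule den_multiplicative) (use assms in auto)
  have "ys ! l = \<one> \<otimes> ys ! l [^] (1::nat)" using ys_closed assms by auto
  ultimately show ?thesis using D.S_one by blast
qed

end

section \<open>The cochain complex of a cube\<close>

context cube
begin

abbreviation pos :: "nat \<Rightarrow> nat set set" where
  "pos m \<equiv> {K. K \<subseteq> P \<and> card K = m}"

abbreviation Cm :: "nat \<Rightarrow> ('a, nat set \<Rightarrow> 'b) module" where
  "Cm m \<equiv> direct_sum (pos m) M"

definition ext :: "nat \<Rightarrow> (nat set \<Rightarrow> 'b) \<Rightarrow> (nat set \<Rightarrow> 'b)" where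
  "ext m f = (\<lambda>K\<in>Pow P. if card K = m then f K else \<zero>\<^bsub>M K\<^esub>)"

lemma ext_closed: "f \<in> carrier (Cm m) \<Longrightarrow> ext m f \<in> carrier T"
  unfolding ext_def by (rule T_I) (auto simp: PiE_iff)

lemma supp_ext: "supp (\<lambda>K. card K = m) (ext m f)"
  by (simp add: supp_def ext_def)

lemma restrict_closed: "f \<in> carrier T \<Longrightarrow> restrict f (pos m) \<in> carrier (Cm m)"
  by (auto simp: PiE_iff)

lemma restrict_of_ext: "f \<in> carrier (Cm m) \<Longrightarrow> restrict (ext m f) (pos m) = f"
  by (rule extensionalityI[of _ "pos m"]) (auto simp: ext_def PiE_iff)

lemma ext_restrict: "f \<in> carrier T \<Longrightarrow> supp (\<lambda>K. card K = m) f \<Longrightarrow> ext m (restrict f (pos m)) = f"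
  by (rule T_eqI[OF ext_closed[OF restrict_closed]]) (auto simp: ext_def supp_def simp del: direct_sum_simps)

lemma ext_add: "ext m (f \<oplus>\<^bsub>Cm m\<^esub> g) = ext m f \<oplus>\<^bsub>T\<^esub> ext m g"
proof -
  have "\<zero>\<^bsub>M K\<^esub> \<oplus>\<^bsub>M K\<^esub> \<zero>\<^bsub>M K\<^esub> = \<zero>\<^bsub>M K\<^esub>" if "K \<subseteq> P" for K
  proof -
    interpret K: module A "M K" using M_module that(1) .
    show ?thesis by simp
  qed
  thus ?thesis unfolding ext_def by (intro HOL.ext) (simp add: restrict_def)
qed

lemma ext_smult: "c \<in> carrier A \<Longrightarrow> ext m (c \<odot>\<^bsub>Cm m\<^esub> f) = c \<odot>\<^bsub>T\<^esub> ext m f"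
proof -
  assume c: "c \<in> carrier A"
  have "c \<odot>\<^bsub>M K\<^esub> \<zero>\<^bsub>M K\<^esub> = \<zero>\<^bsub>M K\<^esub>" if "K \<subseteq> P" for K
  proof -
    interpret K: module A "M K" using M_module that(1) .
    show ?thesis using c by simp
  qed
  thus ?thesis unfolding ext_def by (intro HOL.ext) (simp add: restrict_def)
qed

lemma supp_card_dif: "supp (\<lambda>K. card K = m) f \<Longrightarrow> supp (\<lambda>K. card K = Suc m) (dif S f)"
  by (erule supp_dif) (metis card_Diff1)

lemma signed_sum_eq:
  assumes f: "f \<in> carrier T"
  shows "signed_sum M \<rho> (pos (Suc m)) (restrict f (pos m)) = restrict (dif P f) (pos (Suc m))"
proof -
  have "signed_sum M \<rho> (pos (Suc m)) (restrict f (pos m)) K = dif P f K" if K: "K \<in> pos (Suc m)" for K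
  proof -
    interpret K: module A "M K" using M_module K by blast
    have KP: "K \<subseteq> P" "K \<inter> P = K" using K by auto
    have "restrict f (pos m) (K - {j}) = f (K - {j})" if "j \<in> K" for j
      using K that card_Diff1[of K j] by auto
    hence "signed_sum M \<rho> (pos (Suc m)) (restrict f (pos m)) K =
        (\<Oplus>\<^bsub>M K\<^esub>i\<in>K. (if even (card {k \<in> K. k < i}) then \<rho> i K (restrict f (pos m) (K - {i}))
          else \<ominus>\<^bsub>M K\<^esub> \<rho> i K (restrict f (pos m) (K - {i}))))"
      using K by (simp add: signed_sum_def)
    also have "\<dots> = (\<Oplus>\<^bsub>M K\<^esub>j\<in>K. sr j K (f (K - {j})))"
    proof (rule K.M.finsum_cong')
      fix i assume i: "i \<in> K"
      have "restrict f (pos m) (K - {i}) = f (K - {i})"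
        using K i card_Diff1[of K i] by auto
      thus "(if even (card {k \<in> K. k < i}) then \<rho> i K (restrict f (pos m) (K - {i}))
          else \<ominus>\<^bsub>M K\<^esub> \<rho> i K (restrict f (pos m) (K - {i}))) = sr i K (f (K - {i}))" by (simp add: sr_def)
    qed (use summand_closed[OF f KP(1)] in auto)
    finally show ?thesis unfolding dif_apply[OF KP(1)] KP(2) .
  qed
  thus ?thesis by (intro extensionalityI[of _ "pos (Suc m)"]) (auto simp: signed_sum_def)
qed

lemma signed_sum_ext:
  assumes f: "f \<in> carrier (Cm m)"
  shows "signed_sum M \<rho> (pos (Suc m)) f = restrict (dif P (ext m f)) (pos (Suc m))"
  using signed_sum_eq[OF ext_closed[OF f], of m] restrict_of_ext[OF f] by simp

lemma cochain_complex:
  assumes C: "\<And>m. cochains C m = Cm m" "\<And>m. differential C m = signed_sum M \<rho> (pos (Suc m))"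
  shows "module_complex A C"
proof -
  have d: "differential C m f = restrict (dif P (ext m f)) (pos (Suc m))" if "f \<in> carrier (Cm m)" for m f
    unfolding C by (rule signed_sum_ext[OF that])
  have mod: "module A (Cm m)" for m by (rule direct_sum_module) (auto intro: is_cring M_module)
  have e: "ext (Suc m) (restrict (dif P (ext m f)) (pos (Suc m))) = dif P (ext m f)" if "f \<in> carrier (Cm m)" for m f
    using that by (intro ext_restrict dif_closed ext_closed supp_card_dif supp_ext)
  show ?thesis
  proof (intro module_complex.intro module_complex_axioms.intro is_cring, unfold C(1))
    show "module A (Cm m)" for m by (rule mod)
    fix m f assume f: "f \<in> carrier (Cm m)"
    show "differential C m f \<in> carrier (Cm (Suc m))" unfolding d[OF f]
      by (intro restrict_closed dif_closed ext_closed f)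
    have r: "restrict (dif P (ext m f)) (pos (Suc m)) \<in> carrier (Cm (Suc m))"
      by (intro restrict_closed dif_closed ext_closed f)
    have "differential C (Suc m) (differential C m f) =
        restrict (dif P (dif P (ext m f))) (pos (Suc (Suc m)))"
      unfolding d[OF f] d[OF r] e[OF f] ..
    thus "differential C (Suc m) (differential C m f) = \<zero>\<^bsub>Cm (Suc (Suc m))\<^esub>"
      unfolding dif_dif[OF ext_closed[OF f]] by (auto intro!: restrict_ext)
    fix c assume c: "c \<in> carrier A"
    interpret Cm: module A "Cm m" by (rule mod)
    show "differential C m (c \<odot>\<^bsub>Cm m\<^esub> f) = c \<odot>\<^bsub>Cm (Suc m)\<^esub> differential C m f"
      unfolding d[OF f] d[OF Cm.smult_closed[OF c f]] ext_smult[OF c] dif_smult[OF ext_closed[OF f] c]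
      by (auto intro!: restrict_ext)
  next
    fix m f g assume f: "f \<in> carrier (Cm m)" and g: "g \<in> carrier (Cm m)"
    interpret Cm: module A "Cm m" by (rule mod)
    show "differential C m (f \<oplus>\<^bsub>Cm m\<^esub> g) = differential C m f \<oplus>\<^bsub>Cm (Suc m)\<^esub> differential C m g"
      unfolding d[OF f] d[OF g] d[OF Cm.a_closed[OF f g]] ext_add dif_add[OF ext_closed[OF f] ext_closed[OF g]]
      by (auto intro!: restrict_ext)
  qed
qed

lemma trivially_graded: "B \<subseteq> carrier A \<Longrightarrow> graded_cube A P M \<rho> B (\<lambda>K y. y)"
  by unfold_locales auto

end

locale cube_hom = C: cube A P M \<rho> + D: cube A P M' \<rho>'
  for A :: "('a, 'm) ring_scheme" (structure) and P :: "nat set"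
    and M :: "nat set \<Rightarrow> ('a, 'b) module" and \<rho> :: "nat \<Rightarrow> nat set \<Rightarrow> 'b \<Rightarrow> 'b"
    and M' :: "nat set \<Rightarrow> ('a, 'c) module" and \<rho>' :: "nat \<Rightarrow> nat set \<Rightarrow> 'c \<Rightarrow> 'c" +
  fixes \<phi> :: "nat set \<Rightarrow> 'b \<Rightarrow> 'c"
  assumes phi_closed: "\<lbrakk> K \<subseteq> P; y \<in> carrier (M K) \<rbrakk> \<Longrightarrow> \<phi> K y \<in> carrier (M' K)"
    and phi_add: "\<lbrakk> K \<subseteq> P; x \<in> carrier (M K); y \<in> carrier (M K) \<rbrakk> \<Longrightarrow> \<phi> K (x \<oplus>\<^bsub>M K\<^esub> y) = \<phi> K x \<oplus>\<^bsub>M' K\<^esub> \<phi> K y"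
    and phi_rho: "\<lbrakk> K \<subseteq> P; j \<in> K; y \<in> carrier (M (K - {j})) \<rbrakk> \<Longrightarrow> \<phi> K (\<rho> j K y) = \<rho>' j K (\<phi> (K - {j}) y)"
begin

lemma phi_zero: "K \<subseteq> P \<Longrightarrow> \<phi> K \<zero>\<^bsub>M K\<^esub> = \<zero>\<^bsub>M' K\<^esub>"
proof -
  assume K: "K \<subseteq> P"
  interpret K: module A "M K" using C.M_module K(1) .
  interpret K': module A "M' K" using D.M_module K(1) .
  have "\<phi> K \<zero>\<^bsub>M K\<^esub> \<oplus>\<^bsub>M' K\<^esub> \<phi> K \<zero>\<^bsub>M K\<^esub> = \<phi> K \<zero>\<^bsub>M K\<^esub>" using phi_add[OF K, of "\<zero>\<^bsub>M K\<^esub>" "\<zero>\<^bsub>M K\<^esub>"] by simp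
  thus ?thesis using phi_closed[OF K, of "\<zero>\<^bsub>M K\<^esub>"] by simp
qed

lemma phi_neg: "K \<subseteq> P \<Longrightarrow> y \<in> carrier (M K) \<Longrightarrow> \<phi> K (\<ominus>\<^bsub>M K\<^esub> y) = \<ominus>\<^bsub>M' K\<^esub> \<phi> K y"
proof -
  assume K: "K \<subseteq> P" and y: "y \<in> carrier (M K)"
  interpret K: module A "M K" using C.M_module K(1) .
  interpret K': module A "M' K" using D.M_module K(1) .
  have "\<phi> K (\<ominus>\<^bsub>M K\<^esub> y) \<oplus>\<^bsub>M' K\<^esub> \<phi> K y = \<zero>\<^bsub>M' K\<^esub>"
    using phi_add[OF K, of "\<ominus>\<^bsub>M K\<^esub> y" y] y phi_zero[OF K] by (simp add: K.M.l_neg)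
  thus ?thesis using phi_closed[OF K] y by (simp add: K'.M.minus_equality)
qed

lemma phi_sr: "K \<subseteq> P \<Longrightarrow> j \<in> K \<Longrightarrow> y \<in> carrier (M (K - {j})) \<Longrightarrow> \<phi> K (C.sr j K y) = D.sr j K (\<phi> (K - {j}) y)"
  by (simp add: C.sr_def D.sr_def phi_rho phi_neg C.rho_closed)

definition \<Phi> :: "(nat set \<Rightarrow> 'b) \<Rightarrow> (nat set \<Rightarrow> 'c)" where
  "\<Phi> f = (\<lambda>K\<in>Pow P. \<phi> K (f K))"

lemma Phi_closed: "f \<in> carrier C.T \<Longrightarrow> \<Phi> f \<in> carrier D.T"
  unfolding \<Phi>_def by (intro D.T_I phi_closed C.T_in)

lemma Phi_dif:
  assumes f: "f \<in> carrier C.T"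
  shows "\<Phi> (C.dif S f) = D.dif S (\<Phi> f)"
proof (rule D.T_eqI)
  show "\<Phi> (C.dif S f) \<in> carrier D.T" by (intro Phi_closed C.dif_closed f)
  show "D.dif S (\<Phi> f) \<in> carrier D.T" by (intro Phi_closed D.dif_closed f)
  fix K assume K: "K \<subseteq> P"
  interpret K: module A "M K" using C.M_module K(1) .
  interpret K': module A "M' K" using D.M_module K(1) .
  have sum: "\<phi> K (\<Oplus>\<^bsub>M K\<^esub>j\<in>B. C.sr j K (f (K - {j}))) = (\<Oplus>\<^bsub>M' K\<^esub>j\<in>B. D.sr j K (\<phi> (K - {j}) (f (K - {j}))))"
    if "B \<subseteq> K" for B
  proof -
    have "finite B" using that K C.finite_P by (meson finite_subset)
    thus ?thesis using that
    proof (induction B)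
      case empty
      thus ?case by (simp add: phi_zero[OF K])
    next
      case (insert b B)
      have c: "j \<in> K \<Longrightarrow> f (K - {j}) \<in> carrier (M (K - {j}))" for j
        using f K by (intro C.T_in) auto
      have c': "j \<in> K \<Longrightarrow> \<phi> (K - {j}) (f (K - {j})) \<in> carrier (M' (K - {j}))" for j
        using K by (intro phi_closed c) auto
      show ?case using insert K
        by (simp add: Pi_def subset_iff C.sr_closed D.sr_closed c c' phi_add[OF K] K.M.finsum_closed phi_sr)
    qed
  qed
  have "\<Phi> f (K - {j}) = \<phi> (K - {j}) (f (K - {j}))" for j using K by (auto simp: \<Phi>_def)
  hence "D.dif S (\<Phi> f) K = (\<Oplus>\<^bsub>M' K\<^esub>j\<in>K \<inter> S. D.sr j K (\<phi> (K - {j}) (f (K - {j}))))"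
    unfolding D.dif_apply[OF K] by simp
  moreover have "\<Phi> (C.dif S f) K = \<phi> K (\<Oplus>\<^bsub>M K\<^esub>j\<in>K \<inter> S. C.sr j K (f (K - {j})))"
    using K by (simp add: \<Phi>_def C.dif_apply)
  ultimately show "\<Phi> (C.dif S f) K = D.dif S (\<Phi> f) K" using sum[of "K \<inter> S"] by simp
qed

end


section \<open>Mixed Koszul and Cech cubes\<close>

context homogeneous_list
begin

text \<open>Positions in \<open>W\<close> carry Cech factors, the other positions carry Koszul factors. Hence \<open>W = UNIV\<close> gives
  the Cech complex of \<open>ys\<close>, while for \<open>ys = zs @ xs\<close> and \<open>W\<close> the positions of \<open>xs\<close> the result is the
  tensor product of the Koszul complex of \<open>zs\<close> and the Cech complex of \<open>xs\<close>. Only Koszul directions shift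
  the internal degree, which \<open>mdeg\<close> takes into account.\<close>

definition mM :: "nat set \<Rightarrow> nat set \<Rightarrow> ('a, ('a \<times> 'a) set) module" where
  "mM W K = localization A (den (K \<inter> W))"

definition mrho :: "nat set \<Rightarrow> nat \<Rightarrow> nat set \<Rightarrow> ('a \<times> 'a) set \<Rightarrow> ('a \<times> 'a) set" where
  "mrho W j K = (if j \<in> W then localization_map A (den (K \<inter> W)) else (\<lambda>y. ys ! j \<odot>\<^bsub>mM W K\<^esub> y))"

definition mdeg :: "nat set \<Rightarrow> int \<Rightarrow> nat set \<Rightarrow> int" where
  "mdeg W i K = i + int (\<Sum>l\<in>K - W. hdeg G (ys ! l))"

definition mpi :: "nat set \<Rightarrow> int \<Rightarrow> nat set \<Rightarrow> ('a \<times> 'a) set \<Rightarrow> ('a \<times> 'a) set" where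
  "mpi W i K = homogeneous_set.lproj A G (den (K \<inter> W)) (mdeg W i K)"

lemma den_set: "K \<subseteq> {..<N} \<Longrightarrow> homogeneous_set A G (den (K \<inter> W))"
  by (rule den_multiplicative) auto

lemma mM_E:
  assumes K: "K \<subseteq> {..<N}" and y: "y \<in> carrier (mM W K)"
  obtains a s where "a \<in> carrier A" "s \<in> den (K \<inter> W)" "y = fraction A (den (K \<inter> W)) a s"
proof -
  interpret K: homogeneous_set A G "den (K \<inter> W)" by (rule den_set[OF K])
  show ?thesis using y that unfolding mM_def by (rule K.L_E)
qed

lemma mrho_fraction:
  assumes K: "K \<subseteq> {..<N}" "j \<in> K" and a: "a \<in> carrier A" "s \<in> den ((K - {j}) \<inter> W)"
  shows "mrho W j K (fraction A (den ((K - {j}) \<inter> W)) a s) =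
      fraction A (den (K \<inter> W)) (if j \<in> W then a else ys ! j \<otimes> a) s"
    and "s \<in> den (K \<inter> W)"
proof -
  have K': "K - {j} \<subseteq> {..<N}" using K by auto
  interpret K: homogeneous_set A G "den (K \<inter> W)" by (rule den_set[OF K(1)])
  interpret K': homogeneous_set A G "den ((K - {j}) \<inter> W)" by (rule den_set[OF K'])
  have sub: "den ((K - {j}) \<inter> W) \<subseteq> den (K \<inter> W)" by (rule den_mono) (use K in auto)
  thus "s \<in> den (K \<inter> W)" using a by auto
  show "mrho W j K (fraction A (den ((K - {j}) \<inter> W)) a s) =
      fraction A (den (K \<inter> W)) (if j \<in> W then a else ys ! j \<otimes> a) s"
  proof (cases "j \<in> W")
    case True
    thus ?thesis unfolding mrho_def
      using localization_map_fraction[OF K'.multiplicative_set_axioms K.multiplicative_set_axioms sub a] by simp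
  next
    case False
    hence e: "(K - {j}) \<inter> W = K \<inter> W" by auto
    have "ys ! j \<in> carrier A" using K ys_closed by auto
    thus ?thesis unfolding mrho_def mM_def e using False a K.L_smult[of "ys ! j" a s] by (simp add: e)
  qed
qed

lemma mdeg_remove:
  assumes "K \<subseteq> {..<N}" "j \<in> K"
  shows "mdeg W i K = mdeg W i (K - {j}) + (if j \<in> W then 0 else int (hdeg G (ys ! j)))"
proof (cases "j \<in> W")
  case True
  hence "K - {j} - W = K - W" by auto
  thus ?thesis using True by (simp add: mdeg_def)
next
  case False
  have fin: "finite (K - W)" using assms finite_subset[of K "{..<N}"] by auto
  have "K - W = insert j (K - {j} - W)" using False assms by auto
  thus ?thesis using False fin by (simp add: mdeg_def)
qed

lemma mixed_graded_cube: "graded_cube A {..<N} (mM W) (mrho W) (G 0) (mpi W i)"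
proof -
  have sub': "K - {j} \<subseteq> {..<N}" if "K \<subseteq> {..<N}" for K j using that by auto
  have yc: "ys ! j \<in> carrier A" if "K \<subseteq> {..<N}" "j \<in> K" for K j using that ys_closed by auto
  show ?thesis
  proof (intro graded_cube.intro cube.intro cube_axioms.intro graded_cube_axioms.intro is_cring)
    show "finite {..<N}" by simp
    show "G 0 \<subseteq> carrier A" using G_closed by auto
  next
    fix K assume K: "K \<subseteq> {..<N}"
    interpret K: homogeneous_set A G "den (K \<inter> W)" by (rule den_set[OF K(1)])
    show "module A (mM W K)" unfolding mM_def by (rule K.L_module)
    fix y assume y: "y \<in> carrier (mM W K)"
    show "mpi W i K y \<in> carrier (mM W K)" using y unfolding mpi_def mM_def by (rule K.lproj_closed)
    show "mpi W i K (mpi W i K y) = mpi W i K y"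
      using K.lproj_lproj[of y "mdeg W i K" "mdeg W i K"] y unfolding mpi_def mM_def by simp
    show "mpi W i K (c \<odot>\<^bsub>mM W K\<^esub> y) = c \<odot>\<^bsub>mM W K\<^esub> mpi W i K y" if "c \<in> G 0" for c
      using K.lproj_smult_homogeneous[OF that, of y "mdeg W i K"] y unfolding mpi_def mM_def by simp
    show "mpi W i K (x \<oplus>\<^bsub>mM W K\<^esub> y) = mpi W i K x \<oplus>\<^bsub>mM W K\<^esub> mpi W i K y" if "x \<in> carrier (mM W K)" for x
      using K.lproj_add that y unfolding mpi_def mM_def by simp
  next
    fix K j y assume K: "K \<subseteq> {..<N}" "j \<in> K" and y: "y \<in> carrier (mM W (K - {j}))"
    interpret K: homogeneous_set A G "den (K \<inter> W)" by (rule den_set[OF K(1)])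
    interpret K': homogeneous_set A G "den ((K - {j}) \<inter> W)" by (rule den_set[OF sub'[OF K(1)]])
    obtain a s where a: "a \<in> carrier A" "s \<in> den ((K - {j}) \<inter> W)" "y = fraction A (den ((K - {j}) \<inter> W)) a s"
      using mM_E[OF sub'[OF K(1)] y] .
    note r = mrho_fraction[OF K _ a(2)]
    have zc: "ys ! j \<in> carrier A" using yc[OF K] .
    have bc: "(if j \<in> W then a else ys ! j \<otimes> a) \<in> carrier A" using a zc by simp
    show "mrho W j K y \<in> carrier (mM W K)" unfolding a(3) r(1)[OF a(1)]
      unfolding mM_def using bc r(2)[OF a(1)] by (rule K.L_I)
    show "mrho W j K (c \<odot>\<^bsub>mM W (K - {j})\<^esub> y) = c \<odot>\<^bsub>mM W K\<^esub> mrho W j K y" if c: "c \<in> carrier A" for c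
    proof -
      have e: "c \<odot>\<^bsub>mM W (K - {j})\<^esub> y = fraction A (den ((K - {j}) \<inter> W)) (c \<otimes> a) s"
        unfolding a(3) mM_def using c a(1,2) by (rule K'.L_smult)
      have "c \<odot>\<^bsub>mM W K\<^esub> mrho W j K y = fraction A (den (K \<inter> W)) (c \<otimes> (if j \<in> W then a else ys ! j \<otimes> a)) s"
        unfolding a(3) r(1)[OF a(1)] unfolding mM_def using c bc r(2)[OF a(1)] by (rule K.L_smult)
      moreover have "(if j \<in> W then c \<otimes> a else ys ! j \<otimes> (c \<otimes> a)) = c \<otimes> (if j \<in> W then a else ys ! j \<otimes> a)"
        using a(1) c zc by (simp add: m_lcomm)
      ultimately show ?thesis unfolding e r(1)[OF m_closed[OF c a(1)]] by simp
    qed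
    show "mpi W i K (mrho W j K y) = mrho W j K (mpi W i (K - {j}) y)"
    proof -
      let ?i = "mdeg W i (K - {j}) + int (hdeg G s)"
      have "mpi W i K (mrho W j K y) =
          fraction A (den (K \<inter> W)) (icomp (mdeg W i K + int (hdeg G s)) (if j \<in> W then a else ys ! j \<otimes> a)) s"
        unfolding a(3) r(1)[OF a(1)] mpi_def using bc r(2)[OF a(1)] by (rule K.lproj_fraction)
      also have "icomp (mdeg W i K + int (hdeg G s)) (if j \<in> W then a else ys ! j \<otimes> a) =
          (if j \<in> W then icomp ?i a else ys ! j \<otimes> icomp ?i a)"
      proof (cases "j \<in> W")
        case False
        have "ys ! j \<in> G (hdeg G (ys ! j))" using K ys_G by auto
        from icomp_mult[OF this a(1), of ?i] show ?thesis
          using False by (simp add: mdeg_remove[OF K, of W i] ac_simps)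
      qed (simp add: mdeg_remove[OF K, of W i])
      also have "fraction A (den (K \<inter> W)) \<dots> s = mrho W j K (mpi W i (K - {j}) y)"
        unfolding mpi_def a(3) K'.lproj_fraction[OF a(1,2)] r(1)[OF icomp_closed[OF a(1)]] ..
      finally show ?thesis .
    qed
    fix x assume x: "x \<in> carrier (mM W (K - {j}))"
    obtain b1 b2 t where b: "b1 \<in> carrier A" "b2 \<in> carrier A" "t \<in> den ((K - {j}) \<inter> W)"
        "x = fraction A (den ((K - {j}) \<inter> W)) b1 t" "y = fraction A (den ((K - {j}) \<inter> W)) b2 t"
      using K'.L_E2 x y unfolding mM_def by metis
    note r' = mrho_fraction[OF K _ b(3)]
    have e: "x \<oplus>\<^bsub>mM W (K - {j})\<^esub> y = fraction A (den ((K - {j}) \<inter> W)) (b1 \<oplus> b2) t"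
      unfolding b(4,5) mM_def using b(1-3) by (rule K'.L_add)
    have "mrho W j K x \<oplus>\<^bsub>mM W K\<^esub> mrho W j K y =
        fraction A (den (K \<inter> W)) ((if j \<in> W then b1 else ys ! j \<otimes> b1) \<oplus> (if j \<in> W then b2 else ys ! j \<otimes> b2)) t"
      unfolding b(4,5) r'(1)[OF b(1)] r'(1)[OF b(2)] unfolding mM_def
      by (rule K.L_add) (use b zc r'(2)[OF b(1)] in auto)
    moreover have "((if j \<in> W then b1 else ys ! j \<otimes> b1) \<oplus> (if j \<in> W then b2 else ys ! j \<otimes> b2)) =
        (if j \<in> W then b1 \<oplus> b2 else ys ! j \<otimes> (b1 \<oplus> b2))" using b zc by (simp add: r_distr)
    ultimately show "mrho W j K (x \<oplus>\<^bsub>mM W (K - {j})\<^esub> y) = mrho W j K x \<oplus>\<^bsub>mM W K\<^esub> mrho W j K y"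
      unfolding e r'(1)[OF a_closed[OF b(1,2)]] by simp
  next
    fix K i j y assume K: "K \<subseteq> {..<N}" "i \<in> K" "j \<in> K" "i \<noteq> j" and y: "y \<in> carrier (mM W (K - {i, j}))"
    have s: "K - {i} - {j} = K - {i, j}" "K - {j} - {i} = K - {i, j}" by auto
    have KK: "K - {i, j} \<subseteq> {..<N}" "K - {i} \<subseteq> {..<N}" "K - {j} \<subseteq> {..<N}" "j \<in> K - {i}" "i \<in> K - {j}" using K by auto
    obtain a s where a: "a \<in> carrier A" "s \<in> den ((K - {i, j}) \<inter> W)" "y = fraction A (den ((K - {i, j}) \<inter> W)) a s"
      using mM_E[OF KK(1) y] .
    have zc: "ys ! i \<in> carrier A" "ys ! j \<in> carrier A" using yc K by auto
    note r1 = mrho_fraction[OF KK(2,4), unfolded s, OF a(1,2)]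
    note r2 = mrho_fraction[OF KK(3,5), unfolded s, OF a(1,2)]
    have c: "(if j \<in> W then a else ys ! j \<otimes> a) \<in> carrier A" "(if i \<in> W then a else ys ! i \<otimes> a) \<in> carrier A"
      using a zc by auto
    show "mrho W i K (mrho W j (K - {i}) y) = mrho W j K (mrho W i (K - {j}) y)"
      unfolding a(3) r1(1) r2(1) mrho_fraction(1)[OF K(1,2) c(1) r1(2)] mrho_fraction(1)[OF K(1,3) c(2) r2(2)]
      using a zc by (simp add: m_lcomm)
  qed
qed

lemma mixed_cube: "cube A {..<N} (mM W) (mrho W)"
  using mixed_graded_cube by (rule graded_cube.axioms)

lemma mrho_kernel:
  assumes K: "K \<subseteq> {..<N}" "l \<in> K" and y: "y \<in> carrier (mM W (K - {l}))" "mrho W l K y = \<zero>\<^bsub>mM W K\<^esub>"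
  shows "\<exists>k::nat. ys ! l [^] k \<odot>\<^bsub>mM W (K - {l})\<^esub> y = \<zero>\<^bsub>mM W (K - {l})\<^esub>"
proof -
  have K': "K - {l} \<subseteq> {..<N}" using K by auto
  interpret K: homogeneous_set A G "den (K \<inter> W)" by (rule den_set[OF K(1)])
  interpret K': homogeneous_set A G "den ((K - {l}) \<inter> W)" by (rule den_set[OF K'])
  have lc: "ys ! l \<in> carrier A" using K ys_closed by auto
  show ?thesis
  proof (cases "l \<in> W")
    case False
    hence "(K - {l}) \<inter> W = K \<inter> W" by auto
    hence "mM W (K - {l}) = mM W K" by (simp add: mM_def)
    thus ?thesis using y(2) False lc by (intro exI[of _ 1]) (simp add: mrho_def)
  next
    case True
    obtain a s where a: "a \<in> carrier A" "s \<in> den ((K - {l}) \<inter> W)" "y = fraction A (den ((K - {l}) \<inter> W)) a s"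
      using mM_E[OF K' y(1)] .
    have "fraction A (den (K \<inter> W)) a s = \<zero>\<^bsub>localization A (den (K \<inter> W))\<^esub>"
      using y(2) mrho_fraction(1)[OF K a(1,2)] True unfolding a(3) mM_def by simp
    then obtain u where u: "u \<in> den (K \<inter> W)" "u \<otimes> a = \<zero>"
      using K.fraction_zero_iff[OF a(1)] mrho_fraction(2)[OF K a(1,2)] by blast
    have "insert l ((K - {l}) \<inter> W) = K \<inter> W" using K True by auto
    then obtain v and k :: nat where v: "v \<in> den ((K - {l}) \<inter> W)" "u = v \<otimes> ys ! l [^] k"
      using u(1) den_insert[of l "(K - {l}) \<inter> W"] K by auto
    have "v \<otimes> (ys ! l [^] k \<otimes> a) = \<zero>" using u(2) v a lc K'.S_closed[OF v(1)] by (simp add: m_assoc)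
    hence "fraction A (den ((K - {l}) \<inter> W)) (ys ! l [^] k \<otimes> a) s = \<zero>\<^bsub>mM W (K - {l})\<^esub>"
      unfolding mM_def using K'.fraction_zero_iff[of "ys ! l [^] k \<otimes> a" s] v a lc by auto
    thus ?thesis using K'.L_smult[of "ys ! l [^] k" a s] a lc unfolding mM_def by auto
  qed
qed

lemma mrho_cokernel:
  assumes K: "K \<subseteq> {..<N}" "l \<in> K" and y: "y \<in> carrier (mM W K)"
  shows "\<exists>k::nat. \<exists>x \<in> carrier (mM W (K - {l})). mrho W l K x = ys ! l [^] k \<odot>\<^bsub>mM W K\<^esub> y"
proof -
  have K': "K - {l} \<subseteq> {..<N}" using K by auto
  interpret K: homogeneous_set A G "den (K \<inter> W)" by (rule den_set[OF K(1)])
  interpret K': homogeneous_set A G "den ((K - {l}) \<inter> W)" by (rule den_set[OF K'])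
  have lc: "ys ! l \<in> carrier A" using K ys_closed by auto
  show ?thesis
  proof (cases "l \<in> W")
    case False
    hence "(K - {l}) \<inter> W = K \<inter> W" by auto
    hence "mM W (K - {l}) = mM W K" by (simp add: mM_def)
    thus ?thesis using y False lc by (intro exI[of _ 1] bexI[of _ y]) (simp_all add: mrho_def)
  next
    case True
    obtain a t where a: "a \<in> carrier A" "t \<in> den (K \<inter> W)" "y = fraction A (den (K \<inter> W)) a t"
      using mM_E[OF K(1) y] .
    have "insert l ((K - {l}) \<inter> W) = K \<inter> W" using K True by auto
    then obtain v and k :: nat where v: "v \<in> den ((K - {l}) \<inter> W)" "t = v \<otimes> ys ! l [^] k"
      using a(2) den_insert[of l "(K - {l}) \<inter> W"] K by auto
    have lk: "ys ! l [^] k \<in> carrier A" "ys ! l [^] k \<in> den (K \<inter> W)"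
    proof -
      show "ys ! l [^] k \<in> carrier A" using lc by simp
      have "ys ! l \<in> den (K \<inter> W)" by (rule den_generator) (use K True in auto)
      thus "ys ! l [^] k \<in> den (K \<inter> W)" by (induction k) (auto intro: K.S_one K.S_mult)
    qed
    have vK: "v \<in> den (K \<inter> W)" using mrho_fraction(2)[OF K a(1) v(1)] .
    have "ys ! l [^] k \<odot>\<^bsub>mM W K\<^esub> y = fraction A (den (K \<inter> W)) (ys ! l [^] k \<otimes> a) (v \<otimes> ys ! l [^] k)"
      unfolding a(3) mM_def v(2)[symmetric] using lk(1) a(1,2) by (rule K.L_smult)
    also have "\<dots> = fraction A (den (K \<inter> W)) a v" using K.fraction_cancel'[OF a(1) vK lk(2)] .
    also have "\<dots> = mrho W l K (fraction A (den ((K - {l}) \<inter> W)) a v)"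
      using mrho_fraction(1)[OF K a(1) v(1)] True by simp
    finally show ?thesis using K'.L_I[OF a(1) v(1)] unfolding mM_def by metis
  qed
qed

text \<open>As \<open>l\<close> lies in \<open>I\<close> and in \<open>W\<close>, the element \<open>ys ! l\<close> is invertible on the whole slice, so that it can serve
  as the unit in \<open>slice_exact_of_unit\<close>.\<close>

lemma mixed_slice_primitive:
  fixes W
  defines "T \<equiv> direct_sum (Pow {..<N}) (mM W)"
  assumes S: "S \<subseteq> {..<N}" and l: "l \<in> I" "l \<in> W" and rad: "ys ! l \<in> radical (Idl ((!) ys ` S))"
    and f: "f \<in> carrier T" "cube.supp {..<N} (mM W) (\<lambda>K. K - S = I) f" "cube.dif {..<N} (mM W) (mrho W) S f = \<zero>\<^bsub>T\<^esub>"
  shows "\<exists>g \<in> carrier T. cube.dif {..<N} (mM W) (mrho W) S g = f"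
proof -
  interpret cube A "{..<N}" "mM W" "mrho W" by (rule mixed_cube)
  note f = f[unfolded T_def]
  have "\<exists>g \<in> carrier (direct_sum (Pow {..<N}) (mM W)). supp (\<lambda>K. K - S = I) g \<and> dif S g = f"
  proof (rule slice_exact_of_unit[OF S _ _ _ rad _ _ f])
    show "ys ! l \<in> carrier A" if "l \<in> S" for l using that S ys_closed by auto
    show "\<exists>k::nat. ys ! l [^] k \<odot>\<^bsub>mM W (K - {l})\<^esub> y = \<zero>\<^bsub>mM W (K - {l})\<^esub>"
      if "K \<subseteq> {..<N}" "l \<in> K" "y \<in> carrier (mM W (K - {l}))" "mrho W l K y = \<zero>\<^bsub>mM W K\<^esub>" for l K y
      using that by (rule mrho_kernel)
    show "\<exists>k::nat. \<exists>x \<in> carrier (mM W (K - {l})). mrho W l K x = ys ! l [^] k \<odot>\<^bsub>mM W K\<^esub> y"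
      if "K \<subseteq> {..<N}" "l \<in> K" "y \<in> carrier (mM W K)" for l K y
      using that by (rule mrho_cokernel)
  next
    fix K y assume K: "K \<subseteq> {..<N}" "K - S = I" and y: "y \<in> carrier (mM W K)"
    interpret K: homogeneous_set A G "den (K \<inter> W)" by (rule den_set[OF K(1)])
    have u: "ys ! l \<in> den (K \<inter> W)" by (rule den_generator) (use K l in auto)
    show "y = \<zero>\<^bsub>mM W K\<^esub>" if "ys ! l \<odot>\<^bsub>mM W K\<^esub> y = \<zero>\<^bsub>mM W K\<^esub>"
      using K.L_smult_inj[OF u] y that unfolding mM_def by blast
    show "\<exists>x\<in>carrier (mM W K). ys ! l \<odot>\<^bsub>mM W K\<^esub> x = y"
      using K.L_smult_surj[OF u] y unfolding mM_def by blast
  qed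
  thus ?thesis unfolding T_def by blast
qed

lemma mixed_slice_exact:
  assumes "graded_cube A {..<N} (mM W) (mrho W) F \<pi>"
    and "S \<subseteq> {..<N}" "l \<in> I" "l \<in> W" "ys ! l \<in> radical (Idl ((!) ys ` S))"
  shows "graded_cube.slice_exact {..<N} (mM W) (mrho W) \<pi> S I m"
proof -
  interpret graded_cube A "{..<N}" "mM W" "mrho W" F \<pi> by fact
  show ?thesis
    by (intro slice_exactI mixed_slice_primitive[OF assms(2-5)] T0_closed)
      (auto intro: supp_mono simp del: direct_sum_simps)
qed

end

section \<open>The Koszul and Cech complexes as complexes of cubes\<close>

lemma positions_pos: "positions zs m = {K. K \<subseteq> {..<length zs} \<and> card K = m}"
  by (simp add: positions_def)

lemma koszul_simps:
  "cochains (koszul A G zs) m = direct_sum (positions zs m) (\<lambda>I. self_module A)"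
  "differential (koszul A G zs) m = signed_sum (\<lambda>I. self_module A) (\<lambda>i J a. zs ! i \<otimes>\<^bsub>A\<^esub> a) (positions zs (Suc m))"
  "piece (koszul A G zs) m i = (\<Pi>\<^sub>E I\<in>positions zs m. int_component A G (i + int (\<Sum>l\<in>I. hdeg G (zs ! l))))"
  by (simp_all add: koszul_def)

lemma cech_simps:
  "cochains (cech A G zs) m = direct_sum (positions zs m) (\<lambda>I. localization A (denominators A zs I))"
  "differential (cech A G zs) m = signed_sum (\<lambda>I. localization A (denominators A zs I))
     (\<lambda>i J. localization_map A (denominators A zs J)) (positions zs (Suc m))"
  "piece (cech A G zs) m i = (\<Pi>\<^sub>E I\<in>positions zs m. localization_component A G (denominators A zs I) i)"
  by (simp_all add: cech_def)

context homogeneous_list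
begin

lemma koszul_cube: "cube A {..<N} (\<lambda>I. self_module A) (\<lambda>i J a. ys ! i \<otimes> a)"
proof (intro cube.intro cube_axioms.intro is_cring self_module_module)
  have yc: "ys ! j \<in> carrier A" if "K \<subseteq> {..<N}" "j \<in> K" for K j using that ys_closed by auto
  fix K i j and y :: 'a
  assume "K \<subseteq> {..<N}" "i \<in> K" "j \<in> K" "y \<in> carrier (self_module A)"
  thus "ys ! i \<otimes> (ys ! j \<otimes> y) = ys ! j \<otimes> (ys ! i \<otimes> y)" using yc[of K i] yc[of K j] by (simp add: m_lcomm)
qed (auto simp: r_distr m_lcomm dest: ys_closed[OF lessThan_iff[THEN iffD1, OF subsetD]])

lemma koszul_complex: "module_complex A (koszul A G ys)"
  by (rule cube.cochain_complex[OF koszul_cube]) (simp_all add: koszul_simps positions_pos)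

lemma mM_UNIV: "mM UNIV = (\<lambda>I. localization A (den I))"
  by (simp add: mM_def fun_eq_iff)

lemma mrho_UNIV: "mrho UNIV = (\<lambda>i J. localization_map A (den J))"
  by (simp add: mrho_def fun_eq_iff)

lemma cech_complex: "module_complex A (cech A G ys)"
  by (rule cube.cochain_complex[OF mixed_cube[of UNIV]]) (simp_all add: cech_simps positions_pos mM_UNIV mrho_UNIV)

lemma cech_cochains: "cochains (cech A G ys) m = direct_sum (positions ys m) (mM UNIV)"
  by (simp add: cech_simps mM_UNIV)

lemma mpi_UNIV_fix_iff:
  assumes "I \<subseteq> {..<N}" "y \<in> carrier (mM UNIV I)"
  shows "mpi UNIV i I y = y \<longleftrightarrow> y \<in> localization_component A G (den I) i"
proof -
  interpret I: homogeneous_set A G "den I" using den_set[OF assms(1), of UNIV] by simp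
  show ?thesis using assms(2) by (simp add: I.localization_component_iff mpi_def mdeg_def mM_def)
qed

text \<open>A cocycle \<open>f\<close> of degree \<open>i \<noteq> d\<close> is cohomologous to some \<open>f'\<close> of degree \<open>d\<close>. The projection to degree \<open>i\<close>
  maps \<open>f'\<close> to zero and commutes with the differential, so it maps a primitive of \<open>f - f'\<close> to one of \<open>f\<close>.\<close>

lemma cech_off_degree:
  assumes H: "carrier (cohomology (cech A G ys) q) = cohomology_piece (cech A G ys) q d"
    and id: "i \<noteq> d" and f: "f \<in> cocycles (cech A G ys) q" "f \<in> piece (cech A G ys) q i"
  shows "f \<in> coboundaries (cech A G ys) q"
proof -
  let ?C = "cech A G ys"
  interpret C: module_complex A ?C by (rule cech_complex)
  interpret T: graded_cube A "{..<N}" "mM UNIV" "mrho UNIV" "G 0" "mpi UNIV i" by (rule mixed_graded_cube)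
  have cc: "cochains ?C m = T.Cm m" for m by (simp add: cech_cochains positions_pos)
  have dd: "differential ?C m = signed_sum (mM UNIV) (mrho UNIV) (T.pos (Suc m))" for m
    by (simp add: cech_simps mM_UNIV mrho_UNIV positions_pos)
  have fc: "f \<in> carrier (T.Cm q)" using f(1) by (simp add: cocycles_def cc)
  have "coh_class ?C q f \<in> cohomology_piece ?C q d"
    using f(1) H by (auto simp: C.cohomology_simps)
  then obtain f' where f': "f' \<in> cocycles ?C q" "f' \<in> piece ?C q d" "coh_class ?C q f = coh_class ?C q f'"
    by (auto simp: cohomology_piece_def)
  have fc': "f' \<in> carrier (T.Cm q)" using f'(1) by (simp add: cocycles_def cc)
  interpret Cq: module A "T.Cm q" using C.cochains_module[of q] by (simp add: cc)
  have diff: "f \<ominus>\<^bsub>T.Cm q\<^esub> f' \<in> coboundaries ?C q"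
    using C.coh_class_eq_iff[of f q f'] fc fc' f'(3) by (simp add: cc)
  have pf: "T.proj (T.ext q f) = T.ext q f"
  proof (rule T.proj_T0)
    have "mpi UNIV i K (f K) = f K" if "K \<in> T.pos q" for K
    proof -
      have "f K \<in> carrier (mM UNIV K)" using fc that by auto
      moreover have "f K \<in> localization_component A G (den K) i"
        using f(2) that by (auto simp: cech_simps positions_pos)
      ultimately show ?thesis using mpi_UNIV_fix_iff that by blast
    qed
    thus "T.ext q f \<in> T.T0" unfolding T.T0_def using T.ext_closed[OF fc] T.pi_zero
      by (auto simp: T.ext_def simp del: direct_sum_simps)
  qed
  have pf': "T.proj (T.ext q f') = \<zero>\<^bsub>T.T\<^esub>"
  proof (rule T.T_eqI)
    show "T.proj (T.ext q f') \<in> carrier T.T" using fc' by (intro T.T0_closed[OF T.proj_closed] T.ext_closed)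
    fix K assume K: "K \<subseteq> {..<N}"
    interpret K: homogeneous_set A G "den K" using den_set[OF K, of UNIV] by simp
    have "mpi UNIV i K (f' K) = \<zero>\<^bsub>mM UNIV K\<^esub>" if k: "card K = q"
    proof -
      have c: "f' K \<in> carrier K.L" using fc' K k by (auto simp: mM_def)
      moreover have "f' K \<in> localization_component A G (den K) d"
        using f'(2) K k by (auto simp: cech_simps positions_pos)
      hence "K.lproj d (f' K) = f' K" by (simp add: K.localization_component_iff)
      ultimately have "K.lproj i (f' K) = \<zero>\<^bsub>K.L\<^esub>" using K.lproj_lproj[OF c, of i d] id by simp
      thus ?thesis by (simp add: mpi_def mdeg_def mM_def)
    qed
    thus "T.proj (T.ext q f') K = \<zero>\<^bsub>T.T\<^esub> K"
      unfolding T.T_apply(1)[OF K] using K T.pi_zero[OF K] by (simp add: T.proj_def T.ext_def)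
  qed (rule T.T.M.zero_closed)
  have sum: "f = (f \<ominus>\<^bsub>T.Cm q\<^esub> f') \<oplus>\<^bsub>T.Cm q\<^esub> f'"
    using fc fc' by (simp add: a_minus_def Cq.M.a_assoc Cq.M.l_neg del: direct_sum_simps)
  show ?thesis
  proof (cases q)
    case 0
    hence "f \<ominus>\<^bsub>T.Cm q\<^esub> f' = \<zero>\<^bsub>T.Cm q\<^esub>" using diff by (simp add: coboundaries_def cc del: direct_sum_simps)
    hence "f = f'" using Cq.M.minus_other_side[OF fc fc'] by (rule iffD1[rotated])
    hence "T.ext q f = \<zero>\<^bsub>T.T\<^esub>" using pf pf' by simp
    hence "f = restrict \<zero>\<^bsub>T.T\<^esub> (T.pos q)" using T.restrict_of_ext[OF fc] by simp
    hence "f = \<zero>\<^bsub>T.Cm q\<^esub>" by (auto simp: restrict_def fun_eq_iff)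
    thus ?thesis using C.coboundaries_zero[of q] by (simp add: cc)
  next
    case (Suc l)
    then obtain h where h: "h \<in> carrier (T.Cm l)" "f \<ominus>\<^bsub>T.Cm q\<^esub> f' = differential ?C l h"
      using diff by (auto simp: coboundaries_def cc)
    let ?h = "T.ext l h"
    have hT: "?h \<in> carrier T.T" using h(1) by (rule T.ext_closed)
    have "differential ?C l h = restrict (T.dif {..<N} ?h) (T.pos q)"
      unfolding dd Suc using h(1) by (rule T.signed_sum_ext)
    hence "T.ext q (f \<ominus>\<^bsub>T.Cm q\<^esub> f') = T.dif {..<N} ?h"
      unfolding h(2) using T.ext_restrict[OF T.dif_closed[OF hT]] T.supp_card_dif[OF T.supp_ext] Suc by simp
    hence "T.ext q f = T.dif {..<N} ?h \<oplus>\<^bsub>T.T\<^esub> T.ext q f'"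
      using T.ext_add[of q "f \<ominus>\<^bsub>T.Cm q\<^esub> f'" f'] sum by simp
    hence "T.proj (T.ext q f) = T.proj (T.dif {..<N} ?h) \<oplus>\<^bsub>T.T\<^esub> T.proj (T.ext q f')"
      using T.proj_add[OF T.dif_closed[OF hT] T.ext_closed[OF fc']] by simp
    hence e: "T.ext q f = T.dif {..<N} (T.proj ?h)"
      unfolding pf pf' T.proj_dif[OF hT] using T.dif_closed[OF T.T0_closed[OF T.proj_closed[OF hT]]]
      by (simp del: direct_sum_simps)
    have "differential ?C l (restrict (T.proj ?h) (T.pos l)) = restrict (T.dif {..<N} (T.proj ?h)) (T.pos q)"
      unfolding dd Suc by (rule T.signed_sum_eq[OF T.T0_closed[OF T.proj_closed[OF hT]]])
    also have "\<dots> = f" unfolding e[symmetric] by (rule T.restrict_of_ext[OF fc])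
    finally have "f = differential ?C l (restrict (T.proj ?h) (T.pos l))" by simp
    moreover have "restrict (T.proj ?h) (T.pos l) \<in> carrier (T.Cm l)"
      by (rule T.restrict_closed[OF T.T0_closed[OF T.proj_closed[OF hT]]])
    ultimately show ?thesis unfolding Suc coboundaries_def by (auto simp: cc)
  qed
qed

end


section \<open>The double complex of two sequences\<close>

text \<open>The two sequences generate ideals with the same radical. The cube \<open>T\<close> is the double complex
  \<open>K(zs) \<otimes> C(xs)\<close>, restricted to internal degree \<open>i\<close> by its projections, and \<open>T'\<close> is \<open>C(zs) \<otimes> C(xs)\<close>. The
  positions of \<open>zs\<close> form \<open>Z\<close>, those of \<open>xs\<close> form \<open>X\<close>.\<close>

locale two_sequences = graded_ring A G for A (structure) and G +
  fixes zs xs :: "'a list" and i :: int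
  assumes zs_homogeneous: "set zs \<subseteq> (\<Union>p. G p)" and xs_homogeneous: "set xs \<subseteq> (\<Union>p. G p)"
    and zs_radical: "set zs \<subseteq> radical (Idl (set xs))" and xs_radical: "set xs \<subseteq> radical (Idl (set zs))"
begin

sublocale Zs: homogeneous_list A G zs by unfold_locales (rule zs_homogeneous)
sublocale Xs: homogeneous_list A G xs by unfold_locales (rule xs_homogeneous)
sublocale Y: homogeneous_list A G "zs @ xs" by unfold_locales (use zs_homogeneous xs_homogeneous in auto)

abbreviation "r \<equiv> length zs"
abbreviation "P \<equiv> {..<length (zs @ xs)}"
abbreviation "Z \<equiv> {..<r}"
abbreviation "X \<equiv> {r..<length (zs @ xs)}"

sublocale T: graded_cube A P "Y.mM X" "Y.mrho X" "G 0" "Y.mpi X i"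
  by (rule Y.mixed_graded_cube)

sublocale T': graded_cube A P "Y.mM UNIV" "Y.mrho UNIV" "G 0" "\<lambda>K y. y"
  by (rule cube.trivially_graded[OF Y.mixed_cube]) (auto intro: G_closed)

sublocale KZ: module_complex A "koszul A G zs" by (rule Zs.koszul_complex)
sublocale CZ: module_complex A "cech A G zs" by (rule Zs.cech_complex)
sublocale CX: module_complex A "cech A G xs" by (rule Xs.cech_complex)

lemma ZX: "Z \<subseteq> P" "X \<subseteq> P" "P - Z = X" "P - X = Z" "Z \<inter> X = {}" "Z \<union> X = P"
  by auto

lemma den_row: "K \<subseteq> Z \<Longrightarrow> Y.den K = denominators A zs K"
  unfolding denominators_def
proof -
  assume K: "K \<subseteq> Z"
  have "(\<Otimes>k\<in>K. (zs @ xs) ! k [^] \<alpha> k) = (\<Otimes>k\<in>K. zs ! k [^] \<alpha> k)" for \<alpha> :: "nat \<Rightarrow> nat"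
    by (rule finprod_cong') (use K Zs.ys_closed in \<open>auto simp: nth_append\<close>)
  thus "{\<Otimes>k\<in>K. (zs @ xs) ! k [^] \<alpha> k |\<alpha> :: nat \<Rightarrow> nat. True} = {\<Otimes>k\<in>K. zs ! k [^] \<alpha> k |\<alpha> :: nat \<Rightarrow> nat. True}" by simp
qed

lemma den_column:
  assumes J: "J \<subseteq> {..<length xs}"
  shows "Y.den ((+) r ` J) = denominators A xs J"
proof -
  have e: "(\<Otimes>k\<in>(+) r ` J. (zs @ xs) ! k [^] \<alpha> k) = (\<Otimes>j\<in>J. xs ! j [^] (\<alpha> (r + j) :: nat))" for \<alpha> :: "nat \<Rightarrow> nat"
  proof -
    have "(\<Otimes>k\<in>(+) r ` J. (zs @ xs) ! k [^] \<alpha> k) = (\<Otimes>j\<in>J. (zs @ xs) ! (r + j) [^] \<alpha> (r + j))"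
      by (rule finprod_reindex) (use J Xs.ys_closed in \<open>auto simp: nth_append\<close>)
    thus ?thesis by simp
  qed
  show ?thesis
  proof (rule equalityI; rule subsetI)
    fix s assume "s \<in> Y.den ((+) r ` J)"
    then obtain \<alpha> :: "nat \<Rightarrow> nat" where "s = (\<Otimes>k\<in>(+) r ` J. (zs @ xs) ! k [^] \<alpha> k)"
      unfolding denominators_def by blast
    thus "s \<in> denominators A xs J" unfolding denominators_def e
      by (intro CollectI exI[of _ "\<lambda>j. \<alpha> (r + j)"] conjI TrueI)
  next
    fix s assume "s \<in> denominators A xs J"
    then obtain \<alpha> :: "nat \<Rightarrow> nat" where "s = (\<Otimes>j\<in>J. xs ! j [^] \<alpha> j)"
      unfolding denominators_def by blast
    hence "s = (\<Otimes>k\<in>(+) r ` J. (zs @ xs) ! k [^] (\<lambda>k. \<alpha> (k - r)) k)" unfolding e by simp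
    thus "s \<in> Y.den ((+) r ` J)" unfolding denominators_def
      by (intro CollectI exI[of _ "\<lambda>k. \<alpha> (k - r)"] conjI TrueI)
  qed
qed

lemma den_empty: "denominators A us {} = {\<one>}"
  by (simp add: denominators_def)

text \<open>The set \<open>P\<close> should keep the form in which the interpretations of cubes mention it.\<close>

declare length_append [simp del]

subsection \<open>Rows\<close>

sublocale L1: homogeneous_set A G "{\<one>}"
  by unfold_locales (use one_homogeneous in auto)

text \<open>On the row of index sets \<open>K \<subseteq> Z\<close> no denominators have been introduced, and the modules of the mixed cube
  are copies of \<open>A\<close> in the guise of the localization at the trivial multiplicative set.\<close>

definition \<iota> :: "'a \<Rightarrow> ('a \<times> 'a) set" where "\<iota> a = fraction A {\<one>} a \<one>"

lemma iota_inj: "a \<in> carrier A \<Longrightarrow> b \<in> carrier A \<Longrightarrow> \<iota> a = \<iota> b \<longleftrightarrow> a = b"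
  unfolding \<iota>_def using L1.fraction_eq_iff[of a b \<one> \<one>] by simp

lemma iota_closed: "a \<in> carrier A \<Longrightarrow> \<iota> a \<in> carrier L1.L"
  unfolding \<iota>_def by (rule L1.L_I) auto

lemma iota_surj: "y \<in> carrier L1.L \<Longrightarrow> \<exists>a \<in> carrier A. y = \<iota> a"
  unfolding \<iota>_def by (erule L1.L_E) auto

lemma iota_zero: "\<iota> \<zero> = \<zero>\<^bsub>L1.L\<^esub>"
  by (simp add: \<iota>_def L1.L_zero)

lemma iota_add: "a \<in> carrier A \<Longrightarrow> b \<in> carrier A \<Longrightarrow> \<iota> (a \<oplus> b) = \<iota> a \<oplus>\<^bsub>L1.L\<^esub> \<iota> b"
  by (simp add: \<iota>_def L1.L_add)

lemma iota_smult: "c \<in> carrier A \<Longrightarrow> a \<in> carrier A \<Longrightarrow> \<iota> (c \<otimes> a) = c \<odot>\<^bsub>L1.L\<^esub> \<iota> a"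
  by (simp add: \<iota>_def L1.L_smult)

lemma mM_row: "K \<subseteq> Z \<Longrightarrow> Y.mM X K = L1.L"
proof -
  assume "K \<subseteq> Z"
  hence "K \<inter> X = {}" by auto
  thus ?thesis by (simp add: Y.mM_def den_empty)
qed

lemma iota_degree:
  assumes K: "K \<subseteq> Z" and a: "a \<in> carrier A"
  shows "Y.mpi X i K (\<iota> a) = \<iota> a \<longleftrightarrow> a \<in> int_component A G (i + int (\<Sum>l\<in>K. hdeg G (zs ! l)))"
proof -
  have KX: "K \<inter> X = {}" "K - X = K" using K by auto
  have h1: "hdeg G \<one> = 0" unfolding hdeg_def using one_homogeneous by (rule Least_eq_0)
  have "(\<Sum>l\<in>K. hdeg G ((zs @ xs) ! l)) = (\<Sum>l\<in>K. hdeg G (zs ! l))"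
    by (rule sum.cong) (use K in \<open>auto simp: nth_append\<close>)
  hence "Y.mdeg X i K = i + int (\<Sum>l\<in>K. hdeg G (zs ! l))" unfolding Y.mdeg_def KX by simp
  hence "Y.mpi X i K (\<iota> a) = \<iota> (icomp (i + int (\<Sum>l\<in>K. hdeg G (zs ! l))) a)"
    unfolding Y.mpi_def KX den_empty \<iota>_def using L1.lproj_fraction[OF a, of \<one>] h1 by simp
  thus ?thesis using iota_inj[OF icomp_closed[OF a] a] icomp_component[OF a] icomp_int_component
    by (metis (full_types))
qed

text \<open>As \<open>\<iota>\<close> is bijective, every total element \<open>c\<close> determines its row \<open>f\<close>, a Koszul cochain.\<close>

definition row_rel :: "nat \<Rightarrow> (nat set \<Rightarrow> 'a) \<Rightarrow> (nat set \<Rightarrow> ('a \<times> 'a) set) \<Rightarrow> bool" where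
  "row_rel m f c \<longleftrightarrow> (\<forall>I \<in> positions zs m. c I = \<iota> (f I))"

lemma positions_zs: "I \<in> positions zs m \<longleftrightarrow> I \<subseteq> Z \<and> card I = m"
  by (auto simp: positions_def)

lemma koszul_in: "f \<in> carrier (cochains (koszul A G zs) m) \<Longrightarrow> I \<in> positions zs m \<Longrightarrow> f I \<in> carrier A"
  by (auto simp: koszul_simps PiE_iff)

lemma koszul_eqI:
  "f \<in> carrier (cochains (koszul A G zs) m) \<Longrightarrow> g \<in> carrier (cochains (koszul A G zs) m) \<Longrightarrow>
    (\<And>I. I \<in> positions zs m \<Longrightarrow> f I = g I) \<Longrightarrow> f = g"
  by (rule extensionalityI[of _ "positions zs m"]) (auto simp: koszul_simps PiE_iff)

lemma row_rel_exists:
  assumes c: "c \<in> carrier T.T"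
  shows "\<exists>f \<in> carrier (cochains (koszul A G zs) m). row_rel m f c"
    and "c \<in> T.T0 \<Longrightarrow> row_rel m f c \<Longrightarrow> f \<in> carrier (cochains (koszul A G zs) m) \<Longrightarrow> f \<in> piece (koszul A G zs) m i"
proof -
  have "\<forall>I\<in>positions zs m. \<exists>a. a \<in> carrier A \<and> c I = \<iota> a"
  proof
    fix I assume I: "I \<in> positions zs m"
    hence IZ: "I \<subseteq> Z" "I \<subseteq> P" by (auto simp: positions_zs length_append)
    have "c I \<in> carrier L1.L" using T.T_in[OF c IZ(2)] unfolding mM_row[OF IZ(1)] .
    thus "\<exists>a. a \<in> carrier A \<and> c I = \<iota> a" using iota_surj by blast
  qed
  from bchoice[OF this] obtain f0 where f0: "\<forall>I\<in>positions zs m. f0 I \<in> carrier A \<and> c I = \<iota> (f0 I)" by blast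
  have "restrict f0 (positions zs m) \<in> carrier (cochains (koszul A G zs) m)"
    using f0 by (auto simp: koszul_simps)
  moreover have "row_rel m (restrict f0 (positions zs m)) c" using f0 by (simp add: row_rel_def)
  ultimately show "\<exists>f \<in> carrier (cochains (koszul A G zs) m). row_rel m f c" by blast
next
  assume c0: "c \<in> T.T0" and f: "row_rel m f c" "f \<in> carrier (cochains (koszul A G zs) m)"
  have "f I \<in> int_component A G (i + int (\<Sum>l\<in>I. hdeg G (zs ! l)))" if I: "I \<in> positions zs m" for I
  proof -
    have "Y.mpi X i I (\<iota> (f I)) = \<iota> (f I)"
    proof -
      have "I \<subseteq> P" "c I = \<iota> (f I)" using f(1) I by (auto simp: row_rel_def positions_zs length_append)
      thus ?thesis using c0 unfolding T.T0_def by auto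
    qed
    thus ?thesis using iota_degree[of I "f I"] koszul_in[OF f(2) I] I by (simp add: positions_zs)
  qed
  thus "f \<in> piece (koszul A G zs) m i" using f(2) by (auto simp: koszul_simps PiE_iff)
qed

lemma row_rel_add:
  assumes c: "c \<in> carrier T.T" "c' \<in> carrier T.T" and f: "f \<in> carrier (cochains (koszul A G zs) m)"
    "g \<in> carrier (cochains (koszul A G zs) m)" and r: "row_rel m f c" "row_rel m g c'"
  shows "row_rel m (f \<oplus>\<^bsub>cochains (koszul A G zs) m\<^esub> g) (c \<oplus>\<^bsub>T.T\<^esub> c')"
  unfolding row_rel_def
proof
  fix I assume I: "I \<in> positions zs m"
  hence IP: "I \<subseteq> P" "I \<subseteq> Z" by (auto simp: positions_zs length_append)
  show "(c \<oplus>\<^bsub>T.T\<^esub> c') I = \<iota> ((f \<oplus>\<^bsub>cochains (koszul A G zs) m\<^esub> g) I)"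
    unfolding T.T_apply(2)[OF IP(1)] mM_row[OF IP(2)] using I r koszul_in[OF f(1) I] koszul_in[OF f(2) I]
    by (simp add: koszul_simps row_rel_def iota_add)
qed

lemma row_rel_smult:
  assumes c: "c \<in> carrier T.T" and f: "f \<in> carrier (cochains (koszul A G zs) m)" and b: "b \<in> carrier A"
    and r: "row_rel m f c"
  shows "row_rel m (b \<odot>\<^bsub>cochains (koszul A G zs) m\<^esub> f) (b \<odot>\<^bsub>T.T\<^esub> c)"
  unfolding row_rel_def
proof
  fix I assume I: "I \<in> positions zs m"
  hence IP: "I \<subseteq> P" "I \<subseteq> Z" by (auto simp: positions_zs length_append)
  show "(b \<odot>\<^bsub>T.T\<^esub> c) I = \<iota> ((b \<odot>\<^bsub>cochains (koszul A G zs) m\<^esub> f) I)"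
    unfolding T.T_apply(3)[OF IP(1)] mM_row[OF IP(2)] using I r b koszul_in[OF f I]
    by (simp add: koszul_simps row_rel_def iota_smult)
qed

lemma row_rel_minus:
  assumes c: "c \<in> carrier T.T" "c' \<in> carrier T.T" and f: "f \<in> carrier (cochains (koszul A G zs) m)"
    "g \<in> carrier (cochains (koszul A G zs) m)" and r: "row_rel m f c" "row_rel m g c'"
  shows "row_rel m (f \<ominus>\<^bsub>cochains (koszul A G zs) m\<^esub> g) (c \<ominus>\<^bsub>T.T\<^esub> c')"
proof -
  interpret C: module A "cochains (koszul A G zs) m" by (rule KZ.cochains_module)
  have "f \<ominus>\<^bsub>cochains (koszul A G zs) m\<^esub> g = f \<oplus>\<^bsub>cochains (koszul A G zs) m\<^esub> (\<ominus> \<one>) \<odot>\<^bsub>cochains (koszul A G zs) m\<^esub> g"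
    using f by (simp add: a_minus_def C.smult_l_minus)
  moreover have "c \<ominus>\<^bsub>T.T\<^esub> c' = c \<oplus>\<^bsub>T.T\<^esub> (\<ominus> \<one>) \<odot>\<^bsub>T.T\<^esub> c'"
    unfolding a_minus_def T.T.smult_l_minus[OF one_closed c(2)] T.T.smult_one[OF c(2)] ..
  ultimately show ?thesis
    using row_rel_add[OF c(1) T.T.smult_closed[OF _ c(2)] f(1) C.smult_closed[OF _ f(2)] r(1)
      row_rel_smult[OF c(2) f(2) _ r(2)], of "\<ominus> \<one>"] by simp
qed

lemma row_rel_dif:
  assumes c: "c \<in> carrier T.T" and f: "f \<in> carrier (cochains (koszul A G zs) m)" and r: "row_rel m f c"
  shows "row_rel (Suc m) (differential (koszul A G zs) m f) (T.dif P c)"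
  unfolding row_rel_def
proof
  fix J assume J: "J \<in> positions zs (Suc m)"
  have JP: "J \<subseteq> P" "J \<subseteq> Z" "J \<inter> P = J" "finite J" using J finite_subset[of J "{..<r}"] by (auto simp: positions_zs length_append)
  interpret S: module A "self_module A" by (rule self_module_module[OF is_cring])
  have J': "J - {k} \<in> positions zs m" if "k \<in> J" for k
    using that J JP(4) by (auto simp: positions_zs)
  have fc: "k \<in> J \<Longrightarrow> f (J - {k}) \<in> carrier A" for k using koszul_in[OF f J'] .
  have zc: "k \<in> J \<Longrightarrow> zs ! k \<in> carrier A" for k using Zs.ys_closed JP(2) by auto
  define u where "u k = (if even (card {l \<in> J. l < k}) then zs ! k \<otimes> f (J - {k}) else \<ominus> (zs ! k \<otimes> f (J - {k})))" for k
  have uc: "k \<in> J \<Longrightarrow> u k \<in> carrier A" for k using fc zc by (simp add: u_def)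
  have d: "differential (koszul A G zs) m f J = (\<Oplus>\<^bsub>self_module A\<^esub>k\<in>J. u k)"
    unfolding koszul_simps signed_sum_def restrict_apply' [OF J]
    by (rule S.M.finsum_cong') (use uc fc zc in \<open>auto simp: u_def self_module_minus[OF is_cring]\<close>)
  have hom: "\<iota> (\<Oplus>\<^bsub>self_module A\<^esub>k\<in>B. u k) = (\<Oplus>\<^bsub>L1.L\<^esub>k\<in>B. \<iota> (u k))" if "B \<subseteq> J" for B
  proof -
    have "finite B" using that JP(4) finite_subset by blast
    interpret L: module A L1.L by (rule L1.L_module)
    from \<open>finite B\<close> show ?thesis using that
    proof (induction B)
      case empty
      show ?case by (simp add: iota_zero)
    next
      case (insert b B)
      have "(\<Oplus>\<^bsub>self_module A\<^esub>k\<in>B. u k) \<in> carrier (self_module A)"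
        using insert uc by (intro S.M.finsum_closed) auto
      thus ?case using insert uc iota_closed by (simp add: Pi_def subset_iff iota_add)
    qed
  qed
  interpret L: module A L1.L by (rule L1.L_module)
  have "T.dif P c J = (\<Oplus>\<^bsub>L1.L\<^esub>k\<in>J. T.sr k J (c (J - {k})))"
    unfolding T.dif_apply[OF JP(1)] JP(3) mM_row[OF JP(2)] ..
  also have "\<dots> = (\<Oplus>\<^bsub>L1.L\<^esub>k\<in>J. \<iota> (u k))"
  proof (rule L.M.finsum_cong')
    fix k assume k: "k \<in> J"
    have kX: "k \<notin> X" using k JP(2) by auto
    have kz: "(zs @ xs) ! k = zs ! k" using k JP(2) by (auto simp: nth_append)
    have ck: "c (J - {k}) = \<iota> (f (J - {k}))" using r J'[OF k] by (simp add: row_rel_def)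
    have neg: "\<iota> (\<ominus> a) = \<ominus>\<^bsub>L1.L\<^esub> \<iota> a" if "a \<in> carrier A" for a
      using iota_smult[of "\<ominus> \<one>" a] that iota_closed[OF that] by (simp add: l_minus L.smult_l_minus)
    have "Y.mrho X k J (\<iota> (f (J - {k}))) = \<iota> (zs ! k \<otimes> f (J - {k}))"
      unfolding Y.mrho_def if_not_P[OF kX] mM_row[OF JP(2)] kz iota_smult[OF zc[OF k] fc[OF k]] ..
    thus "T.sr k J (c (J - {k})) = \<iota> (u k)"
      unfolding T.sr_def ck mM_row[OF JP(2)] u_def using fc[OF k] zc[OF k] by (simp only: neg[OF m_closed] split: if_split) simp
  qed (use uc iota_closed in auto)
  also have "\<dots> = \<iota> (differential (koszul A G zs) m f J)" unfolding d hom[OF order_refl] ..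
  finally show "T.dif P c J = \<iota> (differential (koszul A G zs) m f J)" .
qed

subsection \<open>Slices\<close>

text \<open>An index set \<open>K\<close> is split into a set \<open>I\<close> of positions of \<open>zs\<close> and a set \<open>J\<close> of positions of \<open>xs\<close>, where the
  latter are shifted by \<open>r\<close> inside \<open>zs @ xs\<close>.\<close>

definition x_part :: "nat set \<Rightarrow> nat set" where "x_part K = {j. r + j \<in> K}"
definition join :: "nat set \<Rightarrow> nat set \<Rightarrow> nat set" where "join I J = I \<union> (+) r ` J"

lemma join_props:
  assumes "I \<subseteq> Z" "J \<subseteq> {..<length xs}"
  shows "join I J \<subseteq> P" "join I J - X = I" "x_part (join I J) = J" "join I J \<inter> X = (+) r ` J"
    "card (join I J) = card I + card J"
proof -
  show "join I J \<subseteq> P" "join I J - X = I" "x_part (join I J) = J" "join I J \<inter> X = (+) r ` J"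
    using assms by (auto simp: join_def x_part_def length_append)
  have "finite I" "finite J" using assms finite_subset by blast+
  moreover have "I \<inter> (+) r ` J = {}" using assms by auto
  ultimately show "card (join I J) = card I + card J"
    unfolding join_def by (subst card_Un_disjoint) (auto simp: card_image)
qed

lemma join_split:
  assumes "K \<subseteq> P"
  shows "K - X \<subseteq> Z" "x_part K \<subseteq> {..<length xs}" "K = join (K - X) (x_part K)"
proof -
  show "K - X \<subseteq> Z" "x_part K \<subseteq> {..<length xs}" using assms by (auto simp: x_part_def length_append)
  show "K = join (K - X) (x_part K)"
  proof (rule equalityI; rule subsetI)
    fix k assume k: "k \<in> K"
    show "k \<in> join (K - X) (x_part K)"
    proof (cases "k < r")
      case False
      hence "k = r + (k - r)" by simp
      thus ?thesis using k unfolding join_def x_part_def by auto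
    qed (use k in \<open>auto simp: join_def\<close>)
  qed (auto simp: join_def x_part_def)
qed

lemma mM_column:
  assumes "I \<subseteq> Z" "J \<subseteq> {..<length xs}"
  shows "Y.mM X (join I J) = localization A (denominators A xs J)"
  using join_props(4)[OF assms] den_column[OF assms(2)] by (simp add: Y.mM_def)

lemma mpi_column:
  assumes "I \<subseteq> Z" "J \<subseteq> {..<length xs}"
  shows "Y.mpi X i (join I J) y = y \<longleftrightarrow>
    homogeneous_set.lproj A G (denominators A xs J) (i + int (\<Sum>l\<in>I. hdeg G (zs ! l))) y = y"
proof -
  have "(\<Sum>l\<in>I. hdeg G ((zs @ xs) ! l)) = (\<Sum>l\<in>I. hdeg G (zs ! l))"
    by (rule sum.cong) (use assms in \<open>auto simp: nth_append\<close>)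
  thus ?thesis using join_props[OF assms] den_column[OF assms(2)]
    by (simp add: Y.mpi_def Y.mdeg_def)
qed

lemma positions_xs: "J \<in> positions xs q \<longleftrightarrow> J \<subseteq> {..<length xs} \<and> card J = q"
  by (auto simp: positions_def)

definition slice :: "nat set \<Rightarrow> nat \<Rightarrow> (nat set \<Rightarrow> ('a \<times> 'a) set) \<Rightarrow> (nat set \<Rightarrow> ('a \<times> 'a) set)" where
  "slice I q c = (\<lambda>J\<in>positions xs q. c (join I J))"

definition glue :: "nat set set \<Rightarrow> nat \<Rightarrow> (nat set \<Rightarrow> nat set \<Rightarrow> ('a \<times> 'a) set) \<Rightarrow> (nat set \<Rightarrow> ('a \<times> 'a) set)" where
  "glue B q h = (\<lambda>K\<in>Pow P. if K - X \<in> B \<and> card (x_part K) = q then h (K - X) (x_part K) else \<zero>\<^bsub>Y.mM X K\<^esub>)"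

lemma slice_closed:
  assumes c: "c \<in> carrier T.T" and I: "I \<subseteq> Z"
  shows "slice I q c \<in> carrier (cochains (cech A G xs) q)"
proof -
  have "c (join I J) \<in> carrier (localization A (denominators A xs J))" if "J \<in> positions xs q" for J
    using T.T_in[OF c join_props(1)[OF I, of J]] mM_column[OF I, of J] that by (simp add: positions_xs)
  thus ?thesis by (simp add: slice_def cech_simps)
qed

lemma glue_closed:
  assumes h: "\<And>I. I \<in> B \<Longrightarrow> I \<subseteq> Z \<Longrightarrow> h I \<in> carrier (cochains (cech A G xs) q)"
  shows "glue B q h \<in> carrier T.T"
  unfolding glue_def
proof (rule T.T_I)
  fix K assume K: "K \<subseteq> P"
  show "(if K - X \<in> B \<and> card (x_part K) = q then h (K - X) (x_part K) else \<zero>\<^bsub>Y.mM X K\<^esub>) \<in> carrier (Y.mM X K)"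
  proof (cases "K - X \<in> B \<and> card (x_part K) = q")
    case True
    have "x_part K \<in> positions xs q" using join_split(2)[OF K] True by (simp add: positions_xs)
    hence "h (K - X) (x_part K) \<in> carrier (localization A (denominators A xs (x_part K)))"
      using h[OF conjunct1[OF True] join_split(1)[OF K]] by (auto simp: cech_simps)
    thus ?thesis using True mM_column[OF join_split(1,2)[OF K]] join_split(3)[OF K] by simp
  qed (use K in auto)
qed

lemma slice_glue:
  assumes "I \<in> B" "I \<subseteq> Z" "h I \<in> carrier (cochains (cech A G xs) q)"
  shows "slice I q (glue B q h) = h I"
proof (rule extensionalityI[of _ "positions xs q"])
  fix J assume "J \<in> positions xs q"
  thus "slice I q (glue B q h) J = h I J"
    using assms(1) join_props[OF assms(2), of J] by (simp add: slice_def glue_def positions_xs)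
qed (use assms in \<open>auto simp: slice_def cech_simps PiE_iff\<close>)

lemma supp_glue: "T.supp (\<lambda>K. K - X \<in> B \<and> card (x_part K) = q) (glue B q h)"
  by (simp add: T.supp_def glue_def)

lemma eq_on_slice_iff:
  assumes "I \<subseteq> Z"
  shows "slice I q c = slice I q c' \<longleftrightarrow> (\<forall>K \<subseteq> P. K - X = I \<and> card K = card I + q \<longrightarrow> c K = c' K)"
proof
  assume s: "slice I q c = slice I q c'"
  show "\<forall>K \<subseteq> P. K - X = I \<and> card K = card I + q \<longrightarrow> c K = c' K"
  proof (intro allI impI)
    fix K assume K: "K \<subseteq> P" "K - X = I \<and> card K = card I + q"
    note js = join_split[OF K(1)]
    have "card K = card I + card (x_part K)" using join_props(5)[OF js(1,2)] js(3) K(2) by simp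
    hence J: "x_part K \<in> positions xs q" using K js(2) by (simp add: positions_xs)
    have "c (join I (x_part K)) = c' (join I (x_part K))" using fun_cong[OF s, of "x_part K"] J by (simp add: slice_def)
    thus "c K = c' K" using js(3) K(2) by simp
  qed
next
  assume s: "\<forall>K \<subseteq> P. K - X = I \<and> card K = card I + q \<longrightarrow> c K = c' K"
  thus "slice I q c = slice I q c'" unfolding slice_def
    using join_props[OF assms] by (intro restrict_ext) (simp add: positions_xs)
qed

lemma slice_zero: "I \<subseteq> Z \<Longrightarrow> slice I q \<zero>\<^bsub>T.T\<^esub> = \<zero>\<^bsub>cochains (cech A G xs) q\<^esub>"
  unfolding slice_def cech_simps direct_sum_simps
  using join_props mM_column by (intro restrict_ext) (simp add: positions_xs)

lemma slice_add: "I \<subseteq> Z \<Longrightarrow> slice I q (c \<oplus>\<^bsub>T.T\<^esub> c') = slice I q c \<oplus>\<^bsub>cochains (cech A G xs) q\<^esub> slice I q c'"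
  unfolding slice_def cech_simps direct_sum_simps
  using join_props mM_column by (intro restrict_ext) (simp add: positions_xs)

lemma slice_smult: "I \<subseteq> Z \<Longrightarrow> slice I q (b \<odot>\<^bsub>T.T\<^esub> c) = b \<odot>\<^bsub>cochains (cech A G xs) q\<^esub> slice I q c"
  unfolding slice_def cech_simps direct_sum_simps
  using join_props mM_column by (intro restrict_ext) (simp add: positions_xs)

text \<open>In \<open>dif X\<close> the positions in \<open>I\<close> precede all positions of \<open>xs\<close>, which multiplies the Cech differential on
  the slice over \<open>I\<close> by a constant sign.\<close>

definition sgn :: "nat set \<Rightarrow> 'a" where "sgn I = (if even (card I) then \<one> else \<ominus> \<one>)"

lemma sgn_closed [simp]: "sgn I \<in> carrier A" by (simp add: sgn_def)

lemma sgn_sgn: "sgn I \<otimes> sgn I = \<one>" by (simp add: sgn_def l_minus r_minus)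

lemma slice_dif:
  assumes c: "c \<in> carrier T.T" and I: "I \<subseteq> Z"
  shows "slice I (Suc q) (T.dif X c) = sgn I \<odot>\<^bsub>cochains (cech A G xs) (Suc q)\<^esub> differential (cech A G xs) q (slice I q c)"
proof (rule extensionalityI[of _ "positions xs (Suc q)"])
  fix J assume J: "J \<in> positions xs (Suc q)"
  hence Jx: "J \<subseteq> {..<length xs}" "card J = Suc q" "finite J"
    using finite_subset[of J "{..<length xs}"] by (auto simp: positions_xs)
  have finI: "finite I" using I finite_subset by blast
  define K where "K = join I J"
  note jp = join_props[OF I Jx(1), folded K_def]
  interpret D: homogeneous_set A G "denominators A xs J" by (rule Xs.den_multiplicative[OF Jx(1)])
  interpret L: module A D.L by (rule D.L_module)
  have MK: "Y.mM X K = D.L" unfolding K_def by (rule mM_column[OF I Jx(1)])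
  let ?u = "\<lambda>j. localization_map A (denominators A xs J) (c (join I (J - {j})))"
  let ?v = "\<lambda>j. if even (card {k \<in> J. k < j}) then ?u j else \<ominus>\<^bsub>D.L\<^esub> ?u j"
  have Kj: "K - {r + j} = join I (J - {j})" if "j \<in> J" for j
    using I that by (auto simp: K_def join_def)
  have rho: "Y.mrho X (r + j) K (c (K - {r + j})) = ?u j" if "j \<in> J" for j
  proof -
    have "r + j \<in> X" using that Jx(1) by (auto simp: length_append)
    thus ?thesis unfolding Kj[OF that] Y.mrho_def jp(4) den_column[OF Jx(1)] by simp
  qed
  have rhoc: "?u j \<in> carrier D.L" if "j \<in> J" for j
  proof -
    have "r + j \<in> K" using that by (auto simp: K_def join_def)
    moreover have "c (K - {r + j}) \<in> carrier (Y.mM X (K - {r + j}))"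
      by (rule T.T_in[OF c]) (use jp(1) in blast)
    ultimately show ?thesis using T.rho_closed[OF jp(1), of "r + j"] rho[OF that] MK by metis
  qed
  hence vc: "?v j \<in> carrier D.L" if "j \<in> J" for j using that by simp
  have sr: "T.sr (r + j) K (c (K - {r + j})) = sgn I \<odot>\<^bsub>D.L\<^esub> ?v j" if j: "j \<in> J" for j
  proof -
    have "{k \<in> K. k < r + j} = I \<union> (+) r ` {k \<in> J. k < j}" using I by (auto simp: K_def join_def)
    moreover have "I \<inter> (+) r ` {k \<in> J. k < j} = {}" using I by auto
    ultimately have cd: "card {k \<in> K. k < r + j} = card I + card {k \<in> J. k < j}"
      using finI Jx(3) by (simp add: card_Un_disjoint card_image)
    show ?thesis unfolding T.sr_def cd rho[OF j] MK sgn_def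
      using rhoc[OF j] by (simp add: L.smult_l_minus L.M.minus_minus)
  qed
  have "slice I (Suc q) (T.dif X c) J = T.dif X c K" using J by (simp add: slice_def K_def)
  also have "\<dots> = (\<Oplus>\<^bsub>D.L\<^esub>k\<in>(+) r ` J. T.sr k K (c (K - {k})))"
    unfolding T.dif_apply[OF jp(1)] jp(4) MK ..
  also have "\<dots> = (\<Oplus>\<^bsub>D.L\<^esub>j\<in>J. T.sr (r + j) K (c (K - {r + j})))"
    by (rule L.M.finsum_reindex) (use sr vc in auto)
  also have "\<dots> = (\<Oplus>\<^bsub>D.L\<^esub>j\<in>J. sgn I \<odot>\<^bsub>D.L\<^esub> ?v j)"
    by (rule L.M.finsum_cong') (use sr vc in auto)
  also have "\<dots> = sgn I \<odot>\<^bsub>D.L\<^esub> (\<Oplus>\<^bsub>D.L\<^esub>j\<in>J. ?v j)"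
    by (rule L.finsum_smult_ldistr[symmetric]) (use Jx vc in auto)
  also have "(\<Oplus>\<^bsub>D.L\<^esub>j\<in>J. ?v j) = differential (cech A G xs) q (slice I q c) J"
  proof -
    have "slice I q c (J - {j}) = c (join I (J - {j}))" if "j \<in> J" for j
      using that Jx by (auto simp: slice_def positions_xs)
    thus ?thesis unfolding cech_simps signed_sum_def restrict_apply'[OF J]
      by (intro L.M.finsum_cong') (use rhoc in auto)
  qed
  finally show "slice I (Suc q) (T.dif X c) J =
      (sgn I \<odot>\<^bsub>cochains (cech A G xs) (Suc q)\<^esub> differential (cech A G xs) q (slice I q c)) J"
    using J by (simp add: cech_simps)
qed (auto simp: slice_def cech_simps)

lemma slice_piece:
  assumes c: "c \<in> T.T0" and I: "I \<subseteq> Z"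
  shows "slice I q c \<in> piece (cech A G xs) q (i + int (\<Sum>l\<in>I. hdeg G (zs ! l)))"
proof -
  have "c (join I J) \<in> localization_component A G (denominators A xs J) (i + int (\<Sum>l\<in>I. hdeg G (zs ! l)))"
    if J: "J \<in> positions xs q" for J
  proof -
    have Jx: "J \<subseteq> {..<length xs}" using J by (simp add: positions_xs)
    interpret D: homogeneous_set A G "denominators A xs J" by (rule Xs.den_multiplicative[OF Jx])
    have "Y.mpi X i (join I J) (c (join I J)) = c (join I J)"
      using c join_props(1)[OF I Jx] unfolding T.T0_def by blast
    moreover have "c (join I J) \<in> carrier D.L"
      using T.T_in[OF T.T0_closed[OF c] join_props(1)[OF I Jx]] mM_column[OF I Jx] by simp
    ultimately show ?thesis unfolding D.localization_component_iff mpi_column[OF I Jx] by simp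
  qed
  thus ?thesis by (simp add: slice_def cech_simps)
qed

lemma glue_T0:
  assumes h: "\<And>I. I \<in> B \<Longrightarrow> I \<subseteq> Z \<Longrightarrow> h I \<in> carrier (cochains (cech A G xs) q)"
    "\<And>I. I \<in> B \<Longrightarrow> I \<subseteq> Z \<Longrightarrow> h I \<in> piece (cech A G xs) q (i + int (\<Sum>l\<in>I. hdeg G (zs ! l)))"
  shows "glue B q h \<in> T.T0"
  unfolding T.T0_def
proof (intro CollectI conjI allI impI)
  show "glue B q h \<in> carrier T.T" using h(1) by (rule glue_closed)
  fix K assume K: "K \<subseteq> P"
  note js = join_split[OF K]
  show "Y.mpi X i K (glue B q h K) = glue B q h K"
  proof (cases "K - X \<in> B \<and> card (x_part K) = q")
    case True
    interpret D: homogeneous_set A G "denominators A xs (x_part K)" by (rule Xs.den_multiplicative[OF js(2)])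
    have "x_part K \<in> positions xs q" using js(2) True by (simp add: positions_xs)
    hence "h (K - X) (x_part K) \<in> localization_component A G (denominators A xs (x_part K)) (i + int (\<Sum>l\<in>K - X. hdeg G (zs ! l)))"
      using h(2)[OF conjunct1[OF True] js(1)] by (auto simp: cech_simps)
    hence "D.lproj (i + int (\<Sum>l\<in>K - X. hdeg G (zs ! l))) (h (K - X) (x_part K)) = h (K - X) (x_part K)"
      unfolding D.localization_component_iff ..
    hence "Y.mpi X i (join (K - X) (x_part K)) (h (K - X) (x_part K)) = h (K - X) (x_part K)"
      unfolding mpi_column[OF js(1,2)] .
    thus ?thesis using js(3) True K by (simp add: glue_def)
  qed (use K T.pi_zero[OF K] in \<open>auto simp: glue_def\<close>)
qed

lemma slice_primitive:
  assumes I: "I \<subseteq> Z" and f: "f \<in> carrier T.T" "T.supp (\<lambda>K. K - X = I \<and> card K = card I + q) f"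
    and cb: "slice I q f \<in> coboundaries (cech A G xs) q"
  shows "\<exists>g \<in> carrier T.T. T.dif X g = f"
proof -
  let ?C = "cech A G xs" and ?s = "slice I q f"
  define m where q: "m = card I + q"
  note fT = f(1) and f = f[folded q]
  show ?thesis
  proof (cases q)
    case 0
    hence "slice I q f = slice I q \<zero>\<^bsub>T.T\<^esub>" using cb unfolding slice_zero[OF I] by (simp add: coboundaries_def)
    hence "\<forall>K \<subseteq> P. K - X = I \<and> card K = m \<longrightarrow> f K = \<zero>\<^bsub>T.T\<^esub> K" unfolding eq_on_slice_iff[OF I] q .
    hence "f K = \<zero>\<^bsub>Y.mM X K\<^esub>" if "K \<subseteq> P" for K
      using f(2) T.T_apply(1)[OF that] that unfolding T.supp_def by (cases "K - X = I \<and> card K = m") simp_all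
    hence "T.supp (\<lambda>K. False) f" unfolding T.supp_def by blast
    hence "f = \<zero>\<^bsub>T.T\<^esub>" using fT by (rule_tac T.supp_zero_false)
    thus ?thesis using T.dif_zero T.T.M.zero_closed by blast
  next
    case (Suc l)
    then obtain h where h: "h \<in> carrier (cochains ?C l)" "?s = differential ?C l h"
      using cb by (auto simp: coboundaries_def)
    interpret Cl: module A "cochains ?C l" by (rule CX.cochains_module)
    interpret Cl': module A "cochains ?C (Suc l)" by (rule CX.cochains_module)
    let ?h = "sgn I \<odot>\<^bsub>cochains ?C l\<^esub> h"
    have hc: "?h \<in> carrier (cochains ?C l)" using h(1) by simp
    define g where "g = glue {I} l (\<lambda>_. ?h)"
    have g: "g \<in> carrier T.T" unfolding g_def by (rule glue_closed) (rule hc)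
    have "slice I q (T.dif X g) = sgn I \<odot>\<^bsub>cochains ?C (Suc l)\<^esub> differential ?C l ?h"
      unfolding Suc slice_dif[OF g I] unfolding g_def using slice_glue[of I "{I}" "\<lambda>_. ?h" l] I hc by simp
    also have "\<dots> = ?s" unfolding CX.d_smult[OF sgn_closed h(1)] h(2)
      using CX.d_closed[OF h(1)] by (simp add: Cl'.smult_assoc1[symmetric] sgn_sgn)
    finally have on: "\<forall>K \<subseteq> P. K - X = I \<and> card K = m \<longrightarrow> T.dif X g K = f K"
      unfolding eq_on_slice_iff[OF I] q .
    have "T.supp (\<lambda>K. K - X = I \<and> card K = m) (T.dif X g)"
    proof (rule T.supp_dif)
      show "T.supp (\<lambda>K. K - X \<in> {I} \<and> card (x_part K) = l) g" unfolding g_def by (rule supp_glue)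
      fix K j assume K: "K \<subseteq> P" "j \<in> K" "j \<in> X" and *: "K - {j} - X \<in> {I} \<and> card (x_part (K - {j})) = l"
      have K': "K - {j} \<subseteq> P" using K by auto
      have "card (K - {j}) = card I + l"
        using join_props(5)[OF join_split(1,2)[OF K']] join_split(3)[OF K'] * by simp
      moreover have "K - {j} - X = K - X" using K by auto
      ultimately show "K - X = I \<and> card K = m" using T.card_Diff1[OF K(1,2)] * q Suc by simp
    qed
    note supp = this
    have "T.dif X g = f"
    proof (rule T.T_eqI[OF T.dif_closed[OF g] fT])
      fix K assume K: "K \<subseteq> P"
      show "T.dif X g K = f K"
      proof (cases "K - X = I \<and> card K = m")
        case False
        thus ?thesis using supp f(2) K unfolding T.supp_def by simp
      qed (use on K in blast)
    qed
    thus ?thesis using g by blast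
  qed
qed

text \<open>Up to the sign \<open>sgn I\<close> and a shift of degrees, the slice over \<open>I\<close> is the Cech complex of \<open>xs\<close>.\<close>

lemma slice_exact_of_cech:
  assumes I: "I \<subseteq> Z"
    and ex: "\<And>q f. m = card I + q \<Longrightarrow> f \<in> cocycles (cech A G xs) q \<Longrightarrow>
      f \<in> piece (cech A G xs) q (i + int (\<Sum>l\<in>I. hdeg G (zs ! l))) \<Longrightarrow> f \<in> coboundaries (cech A G xs) q"
  shows "T.slice_exact X I m"
proof (rule T.slice_exactI)
  fix f assume f: "f \<in> T.T0" "T.supp (\<lambda>K. K - X = I \<and> card K = m) f" "T.dif X f = \<zero>\<^bsub>T.T\<^esub>"
  have fT: "f \<in> carrier T.T" using f(1) by (rule T.T0_closed)
  have finI: "finite I" using I finite_subset by blast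
  show "\<exists>g \<in> carrier T.T. T.dif X g = f"
  proof (cases "card I \<le> m")
    case False
    have "T.supp (\<lambda>K. False) f"
    proof (rule T.supp_mono[OF f(2)])
      fix K assume K: "K \<subseteq> P" "K - X = I \<and> card K = m"
      have "card I \<le> card K" using K finite_subset[OF K(1)] by (intro card_mono) auto
      thus False using K False by simp
    qed
    hence "f = \<zero>\<^bsub>T.T\<^esub>" using fT by (rule_tac T.supp_zero_false)
    thus ?thesis using T.dif_zero T.T.M.zero_closed by blast
  next
    case True
    then obtain q where q: "m = card I + q" using le_Suc_ex by blast
    let ?C = "cech A G xs"
    interpret Cq: module A "cochains ?C (Suc q)" by (rule CX.cochains_module)
    let ?s = "slice I q f"
    have sc: "?s \<in> carrier (cochains ?C q)" using fT I by (rule slice_closed)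
    have "sgn I \<odot>\<^bsub>cochains ?C (Suc q)\<^esub> (sgn I \<odot>\<^bsub>cochains ?C (Suc q)\<^esub> differential ?C q ?s) = \<zero>\<^bsub>cochains ?C (Suc q)\<^esub>"
      unfolding slice_dif[OF fT I, symmetric] f(3) slice_zero[OF I] by (rule Cq.smult_r_null) simp
    hence "differential ?C q ?s = \<zero>\<^bsub>cochains ?C (Suc q)\<^esub>"
      using CX.d_closed[OF sc] by (simp add: Cq.smult_assoc1[symmetric] sgn_sgn)
    hence "?s \<in> cocycles ?C q" using sc by (simp add: cocycles_def)
    hence cb: "?s \<in> coboundaries ?C q" using ex[OF q _ slice_piece[OF f(1) I]] by simp
    show ?thesis using slice_primitive[OF I fT _ cb] f(2) q by simp
  qed
qed

end

context graded_cube
begin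

lemma card_Diff_pos: "K \<subseteq> P \<Longrightarrow> 1 \<le> card (K - S) \<longleftrightarrow> \<not> K \<subseteq> S"
  using finite_P finite_subset[of K P] by (auto simp: Suc_le_eq card_gt_0_iff)

lemma minus_apply_eq_zero_iff:
  assumes "c \<in> carrier T" "d \<in> carrier T" "K \<subseteq> P"
  shows "(c \<ominus>\<^bsub>T\<^esub> d) K = \<zero>\<^bsub>M K\<^esub> \<longleftrightarrow> c K = d K"
proof -
  interpret K: module A "M K" using M_module assms(3) .
  show ?thesis unfolding T_apply(4)[OF assms(3,1,2)] using T_in assms by (intro K.M.minus_other_side)
qed

lemma dif_minus_dif: "c \<in> carrier T \<Longrightarrow> g \<in> carrier T \<Longrightarrow> dif P (c \<ominus>\<^bsub>T\<^esub> dif P g) = dif P c"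
  by (simp add: dif_minus dif_closed dif_dif T_minus_zero del: direct_sum_simps)

lemma minus_dif_dif:
  assumes "c \<in> carrier T" "g \<in> carrier T" "h \<in> carrier T"
  shows "c \<ominus>\<^bsub>T\<^esub> dif P g \<ominus>\<^bsub>T\<^esub> dif P h = c \<ominus>\<^bsub>T\<^esub> dif P (g \<oplus>\<^bsub>T\<^esub> h)"
  using assms dif_closed[OF assms(2), of P] dif_closed[OF assms(3), of P]
  by (simp add: dif_add a_minus_def T.M.minus_add T.M.a_assoc del: direct_sum_simps)

text \<open>Once the primitive \<open>b\<close> on the row of sets \<open>K \<subseteq> S\<close> has been subtracted, all that remains is of positive
  level, where all slices are exact.\<close>

lemma exact_of_row:
  assumes S: "S \<subseteq> P" and ex: "\<And>J. J \<subseteq> P - S \<Longrightarrow> J \<noteq> {} \<Longrightarrow> slice_exact S J n"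
    and c: "c \<in> T0" "supp (\<lambda>K. card K = n) c" "dif P c = \<zero>\<^bsub>T\<^esub>"
    and b: "b \<in> T0" "supp (\<lambda>K. Suc (card K) = n) b"
    and row: "\<And>K. K \<subseteq> S \<Longrightarrow> card K = n \<Longrightarrow> c K = dif P b K"
  shows "\<exists>g \<in> T0. supp (\<lambda>K. Suc (card K) = n) g \<and> dif P g = c"
proof -
  note cT = T0_closed[OF c(1)] and bT = T0_closed[OF b(1)]
  let ?c = "c \<ominus>\<^bsub>T\<^esub> dif P b"
  have cT': "?c \<in> carrier T" using cT bT dif_closed T.M.minus_closed by blast
  have db: "supp (\<lambda>K. card K = n) (dif P b)"
    by (rule supp_dif[OF b(2)]) (metis card_Diff1)
  have s1: "supp (\<lambda>K. card K = n) ?c" using supp_minus[OF cT dif_closed[OF bT] c(2) db] .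
  have "supp (\<lambda>K. card K = n \<and> 1 \<le> card (K - S)) ?c"
    unfolding supp_def
  proof (intro allI impI)
    fix K assume K: "K \<subseteq> P" "\<not> (card K = n \<and> 1 \<le> card (K - S))"
    show "?c K = \<zero>\<^bsub>M K\<^esub>"
    proof (cases "card K = n")
      case True
      hence "K \<subseteq> S" using K card_Diff_pos[OF K(1)] by blast
      thus ?thesis using row True minus_apply_eq_zero_iff[OF cT dif_closed[OF bT] K(1)] by blast
    qed (use s1 K in \<open>auto simp: supp_def\<close>)
  qed
  moreover have "?c \<in> T0" using c(1) b(1) by (intro T0_minus T0_dif)
  moreover have "dif P ?c = \<zero>\<^bsub>T\<^esub>" using dif_minus_dif[OF cT bT] c(3) by simp
  moreover have "slice_exact S J n" if J: "J \<subseteq> P - S" "1 \<le> card J" for J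
  proof (rule ex[OF J(1)])
    show "J \<noteq> {}" using J(2) by auto
  qed
  ultimately obtain g where g: "g \<in> T0" "supp (\<lambda>K. Suc (card K) = n \<and> 1 \<le> card (K - S)) g" "dif P g = ?c"
    using level_exact[OF S, of 1 n ?c] by blast
  have gT: "g \<in> carrier T" using g(1) by (rule T0_closed)
  have "dif P (b \<oplus>\<^bsub>T\<^esub> g) = c"
    unfolding dif_add[OF bT gT] g(3) using cT dif_closed[OF bT, of P]
    by (simp add: a_minus_def T.M.a_lcomm T.M.r_neg del: direct_sum_simps)
  moreover have "supp (\<lambda>K. Suc (card K) = n) g" using g(2) by (rule supp_mono) simp
  ultimately show ?thesis using b g(1) T0_add supp_add by blast
qed

end

context two_sequences
begin

subsection \<open>The map from the mixed cube to the Cech cube\<close>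

text \<open>The natural map divides by the product of the members of \<open>zs\<close> whose positions occur in \<open>K\<close>. On the row
  this gives the map from the Koszul complex to the Cech complex of \<open>zs\<close>, on the column \<open>K \<subseteq> X\<close> the identity.\<close>

definition row_product :: "nat set \<Rightarrow> 'a" where
  "row_product K = (\<Otimes>l\<in>K - X. (zs @ xs) ! l)"

definition phi :: "nat set \<Rightarrow> ('a \<times> 'a) set \<Rightarrow> ('a \<times> 'a) set" where
  "phi K = localization_change.change A (Y.den K) (row_product K)"

lemma row_product_change:
  assumes K: "K \<subseteq> P"
  shows "localization_change A (Y.den (K \<inter> X)) (Y.den K) (row_product K)"
proof -
  interpret S: homogeneous_set A G "Y.den (K \<inter> X)" by (rule Y.den_set[OF K])
  interpret D: homogeneous_set A G "Y.den K" by (rule Y.den_multiplicative[OF K])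
  have sub: "Y.den (K \<inter> X) \<subseteq> Y.den K" by (rule Y.den_mono) (use K in auto)
  have "row_product K = (\<Otimes>l\<in>K - X. (zs @ xs) ! l [^] (\<lambda>_. 1 :: nat) l)"
    unfolding row_product_def by (rule finprod_cong') (use K Y.ys_closed in auto)
  hence "row_product K \<in> Y.den (K - X)" unfolding denominators_def
    by (intro CollectI exI[of _ "\<lambda>_. 1 :: nat"] conjI TrueI)
  moreover have "Y.den (K - X) \<subseteq> Y.den K" by (rule Y.den_mono) (use K in auto)
  ultimately have c: "row_product K \<in> Y.den K" by blast
  show ?thesis
    by unfold_locales (use c sub D.S_closed D.S_mult in auto)
qed

lemma phi_fraction:
  assumes K: "K \<subseteq> P" and a: "a \<in> carrier A" "s \<in> Y.den (K \<inter> X)"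
  shows "phi K (fraction A (Y.den (K \<inter> X)) a s) = fraction A (Y.den K) a (s \<otimes> row_product K)"
    and "s \<otimes> row_product K \<in> Y.den K"
proof -
  interpret localization_change A "Y.den (K \<inter> X)" "Y.den K" "row_product K" by (rule row_product_change[OF K])
  show "phi K (fraction A (Y.den (K \<inter> X)) a s) = fraction A (Y.den K) a (s \<otimes> row_product K)"
    unfolding phi_def by (rule change_fraction[OF a])
  show "s \<otimes> row_product K \<in> Y.den K" by (rule sc[OF a(2)])
qed

sublocale N: cube_hom A P "Y.mM X" "Y.mrho X" "Y.mM UNIV" "Y.mrho UNIV" phi
proof (intro cube_hom.intro cube_hom_axioms.intro T.cube_axioms T'.cube_axioms)
  fix K assume K: "K \<subseteq> P"
  interpret C: localization_change A "Y.den (K \<inter> X)" "Y.den K" "row_product K" by (rule row_product_change[OF K])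
  show "phi K y \<in> carrier (Y.mM UNIV K)" if "y \<in> carrier (Y.mM X K)" for y
    using C.change_closed that unfolding Y.mM_def phi_def by simp
  show "phi K (x \<oplus>\<^bsub>Y.mM X K\<^esub> y) = phi K x \<oplus>\<^bsub>Y.mM UNIV K\<^esub> phi K y"
    if "x \<in> carrier (Y.mM X K)" "y \<in> carrier (Y.mM X K)" for x y
    using C.change_add that unfolding Y.mM_def phi_def by simp
next
  fix K j y assume K: "K \<subseteq> P" "j \<in> K" and y: "y \<in> carrier (Y.mM X (K - {j}))"
  have K': "K - {j} \<subseteq> P" using K by auto
  obtain a s where a: "a \<in> carrier A" "s \<in> Y.den ((K - {j}) \<inter> X)" "y = fraction A (Y.den ((K - {j}) \<inter> X)) a s"
    using Y.mM_E[OF K' y] .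
  have jc: "(zs @ xs) ! j \<in> carrier A" using K Y.ys_closed by auto
  interpret D: homogeneous_set A G "Y.den K" by (rule Y.den_multiplicative[OF K(1)])
  interpret D': homogeneous_set A G "Y.den (K - {j})" by (rule Y.den_multiplicative[OF K'])
  have ac: "(if j \<in> X then a else (zs @ xs) ! j \<otimes> a) \<in> carrier A" using a jc by simp
  note m = Y.mrho_fraction[OF K a(1,2)]
  note p = phi_fraction[OF K' a(1,2)]
  have "Y.mrho UNIV j K (phi (K - {j}) y) = fraction A (Y.den K) a (s \<otimes> row_product (K - {j}))"
    using Y.mrho_fraction(1)[OF K a(1), of "s \<otimes> row_product (K - {j})" UNIV] p by (simp add: a(3))
  moreover have "phi K (Y.mrho X j K y) = fraction A (Y.den K) (if j \<in> X then a else (zs @ xs) ! j \<otimes> a) (s \<otimes> row_product K)"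
    unfolding a(3) m(1) by (rule phi_fraction(1)[OF K(1) ac m(2)])
  moreover have "fraction A (Y.den K) (if j \<in> X then a else (zs @ xs) ! j \<otimes> a) (s \<otimes> row_product K) =
      fraction A (Y.den K) a (s \<otimes> row_product (K - {j}))"
  proof (cases "j \<in> X")
    case True
    hence "K - {j} - X = K - X" by auto
    thus ?thesis using True by (simp add: row_product_def)
  next
    case False
    have fin: "finite (K - {j} - X)" using K finite_subset[of K P] by auto
    have e: "K - X = insert j (K - {j} - X)" using False K by auto
    have cl: "(\<lambda>l. (zs @ xs) ! l) \<in> K - {j} - X \<rightarrow> carrier A" using K Y.ys_closed by auto
    have "row_product K = (zs @ xs) ! j \<otimes> row_product (K - {j})"
      unfolding row_product_def e by (rule finprod_insert[OF fin _ cl jc]) auto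
    moreover have "row_product (K - {j}) \<in> carrier A" unfolding row_product_def using cl by (rule finprod_closed)
    moreover have "s \<in> carrier A"
    proof -
      interpret D0: homogeneous_set A G "Y.den (K \<inter> X)" by (rule Y.den_set[OF K(1)])
      show ?thesis by (rule D0.S_closed[OF m(2)])
    qed
    ultimately have "s \<otimes> row_product K = (zs @ xs) ! j \<otimes> (s \<otimes> row_product (K - {j}))" using jc by (simp add: m_lcomm)
    moreover have "s \<otimes> row_product (K - {j}) \<in> Y.den K"
      using p(2) Y.den_mono[of "K - {j}" K] K by auto
    moreover have "(zs @ xs) ! j \<in> Y.den K" by (rule Y.den_generator[OF K(2,1)])
    ultimately show ?thesis unfolding if_not_P[OF False] using D.fraction_cancel[OF a(1)] by simp
  qed
  ultimately show "phi K (Y.mrho X j K y) = Y.mrho UNIV j K (phi (K - {j}) y)" by simp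
qed

lemma phi_column:
  assumes K: "K \<subseteq> X" and y: "y \<in> carrier (Y.mM X K)"
  shows "phi K y = y"
proof -
  have KP: "K \<subseteq> P" "K \<inter> X = K" "K - X = {}" using K by auto
  obtain a s where a: "a \<in> carrier A" "s \<in> Y.den (K \<inter> X)" "y = fraction A (Y.den (K \<inter> X)) a s"
    using Y.mM_E[OF KP(1) y] .
  interpret D: homogeneous_set A G "Y.den (K \<inter> X)" by (rule Y.den_set[OF KP(1)])
  have "row_product K = \<one>" unfolding row_product_def KP(3) by simp
  thus ?thesis unfolding a(3) phi_fraction[OF KP(1) a(1,2)] using D.S_closed[OF a(2)] KP(2) by simp
qed

lemma phi_row:
  assumes f: "row_rel m f c" "f \<in> carrier (cochains (koszul A G zs) m)" and I: "I \<in> positions zs m"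
  shows "N.\<Phi> c I = koszul_to_cech A zs m f I"
proof -
  have IZ: "I \<subseteq> Z" "I \<subseteq> P" "I \<inter> X = {}" "I - X = I" using I by (auto simp: positions_zs length_append)
  have fI: "f I \<in> carrier A" using koszul_in[OF f(2) I] .
  have "row_product I = (\<Otimes>l\<in>I. zs ! l)" unfolding row_product_def IZ(4)
    by (rule finprod_cong') (use IZ(1) Zs.ys_closed in \<open>auto simp: nth_append\<close>)
  moreover have "row_product I \<in> carrier A" unfolding row_product_def IZ(4)
  proof (rule finprod_closed, rule Pi_I)
    fix l assume "l \<in> I"
    thus "(zs @ xs) ! l \<in> carrier A" using IZ(2) by (intro Y.ys_closed) auto
  qed
  moreover have "N.\<Phi> c I = phi I (fraction A (Y.den (I \<inter> X)) (f I) \<one>)"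
  proof -
    have "c I = \<iota> (f I)" using f(1) I by (simp add: row_rel_def)
    thus ?thesis unfolding N.\<Phi>_def restrict_apply' [OF PowI[OF IZ(2)]] \<iota>_def IZ(3) den_empty by simp
  qed
  moreover have "\<one> \<in> Y.den (I \<inter> X)" unfolding IZ(3) den_empty by simp
  note phi_fraction(1)[OF IZ(2) fI this]
  ultimately show ?thesis
    unfolding koszul_to_cech_def restrict_apply'[OF I] den_row[OF IZ(1)] by simp
qed

subsection \<open>Exactness of slices\<close>

lemma nth_image_Z: "(!) (zs @ xs) ` Z = set zs"
  by (auto simp: set_conv_nth nth_append image_iff)

lemma nth_image_X: "(!) (zs @ xs) ` X = set xs"
proof -
  have "X = (+) r ` {..<length xs}" by (auto simp: image_iff length_append le_iff_add)
  hence "(!) (zs @ xs) ` X = (\<lambda>j. (zs @ xs) ! (r + j)) ` {..<length xs}" by (simp add: image_image)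
  also have "\<dots> = set xs" by (auto simp: set_conv_nth image_iff)
  finally show ?thesis .
qed

lemma exact_T:
  assumes J: "J \<subseteq> X" "J \<noteq> {}"
  shows "T.slice_exact Z J m"
proof -
  obtain l where l: "l \<in> J" "l \<in> X" using J by blast
  have "(zs @ xs) ! l \<in> radical (Idl ((!) (zs @ xs) ` Z))"
    using l nth_image_X xs_radical unfolding nth_image_Z by blast
  from Y.mixed_slice_exact[OF T.graded_cube_axioms _ l this] show ?thesis using ZX(1) by blast
qed

lemma exact_T'_Z:
  assumes J: "J \<subseteq> X" "J \<noteq> {}"
  shows "T'.slice_exact Z J m"
proof -
  obtain l where l: "l \<in> J" "l \<in> X" using J by blast
  have "(zs @ xs) ! l \<in> radical (Idl ((!) (zs @ xs) ` Z))"
    using l nth_image_X xs_radical unfolding nth_image_Z by blast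
  from Y.mixed_slice_exact[OF T'.graded_cube_axioms _ l(1) UNIV_I this] show ?thesis using ZX(1) by blast
qed

lemma exact_T'_X:
  assumes J: "J \<subseteq> Z" "J \<noteq> {}"
  shows "T'.slice_exact X J m"
proof -
  obtain l where l: "l \<in> J" "l \<in> Z" using J by blast
  have "(zs @ xs) ! l \<in> radical (Idl ((!) (zs @ xs) ` X))"
    using l nth_image_Z zs_radical unfolding nth_image_X by blast
  from Y.mixed_slice_exact[OF T'.graded_cube_axioms _ l(1) UNIV_I this] show ?thesis using ZX(2) by blast
qed

subsection \<open>Comparison of total cocycles with rows and columns\<close>

definition embed :: "nat \<Rightarrow> (nat set \<Rightarrow> 'a) \<Rightarrow> (nat set \<Rightarrow> ('a \<times> 'a) set)" where
  "embed m f = (\<lambda>K\<in>Pow P. if K \<in> positions zs m then \<iota> (f K) else \<zero>\<^bsub>Y.mM X K\<^esub>)"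

lemma embed_closed:
  assumes f: "f \<in> carrier (cochains (koszul A G zs) m)"
  shows "embed m f \<in> carrier T.T"
  unfolding embed_def
proof (rule T.T_I)
  fix K assume K: "K \<subseteq> P"
  show "(if K \<in> positions zs m then \<iota> (f K) else \<zero>\<^bsub>Y.mM X K\<^esub>) \<in> carrier (Y.mM X K)"
  proof (cases "K \<in> positions zs m")
    case True
    hence "K \<subseteq> Z" by (simp add: positions_zs)
    thus ?thesis using True koszul_in[OF f True] iota_closed by (simp add: mM_row)
  next
    case False
    thus ?thesis using T.M_closed(1)[OF K] by simp
  qed
qed

lemma embed_row: "row_rel m f (embed m f)"
  unfolding row_rel_def
proof
  fix I assume I: "I \<in> positions zs m"
  hence "I \<subseteq> P" by (auto simp: positions_zs length_append)
  thus "embed m f I = \<iota> (f I)" using I by (simp add: embed_def)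
qed

lemma embed_supp: "T.supp (\<lambda>K. card K = m) (embed m f)"
  by (auto simp: T.supp_def embed_def positions_zs)

lemma embed_T0:
  assumes f: "f \<in> carrier (cochains (koszul A G zs) m)" "f \<in> piece (koszul A G zs) m i"
  shows "embed m f \<in> T.T0"
  unfolding T.T0_def
proof (intro CollectI conjI allI impI)
  show "embed m f \<in> carrier T.T" by (rule embed_closed[OF f(1)])
  fix K assume K: "K \<subseteq> P"
  show "Y.mpi X i K (embed m f K) = embed m f K"
  proof (cases "K \<in> positions zs m")
    case True
    hence KZ: "K \<subseteq> Z" by (simp add: positions_zs)
    have "f K \<in> int_component A G (i + int (\<Sum>l\<in>K. hdeg G (zs ! l)))"
      using f(2) True by (auto simp: koszul_simps)
    hence "Y.mpi X i K (\<iota> (f K)) = \<iota> (f K)" using iota_degree[OF KZ koszul_in[OF f(1) True]] by simp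
    thus ?thesis using True K by (simp add: embed_def)
  next
    case False
    thus ?thesis using K T.pi_zero[OF K] by (simp add: embed_def)
  qed
qed

lemma row_rel_zero_iff:
  assumes f: "f \<in> carrier (cochains (koszul A G zs) m)" "row_rel m f c"
  shows "f = \<zero>\<^bsub>cochains (koszul A G zs) m\<^esub> \<longleftrightarrow> (\<forall>I \<in> positions zs m. c I = \<zero>\<^bsub>Y.mM X I\<^esub>)"
proof -
  have "c I = \<zero>\<^bsub>Y.mM X I\<^esub> \<longleftrightarrow> f I = \<zero>" if I: "I \<in> positions zs m" for I
  proof -
    have "Y.mM X I = L1.L" using I by (simp add: mM_row positions_zs)
    hence "c I = \<zero>\<^bsub>Y.mM X I\<^esub> \<longleftrightarrow> \<iota> (f I) = \<iota> \<zero>" using f(2) I by (simp add: row_rel_def iota_zero)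
    thus ?thesis using iota_inj[OF koszul_in[OF f(1) I] zero_closed] by simp
  qed
  moreover have "f = \<zero>\<^bsub>cochains (koszul A G zs) m\<^esub> \<longleftrightarrow> (\<forall>I \<in> positions zs m. f I = \<zero>)"
  proof
    assume "\<forall>I \<in> positions zs m. f I = \<zero>"
    moreover have "\<zero>\<^bsub>cochains (koszul A G zs) m\<^esub> \<in> carrier (cochains (koszul A G zs) m)"
      by (simp add: koszul_simps)
    ultimately show "f = \<zero>\<^bsub>cochains (koszul A G zs) m\<^esub>"
      by (intro koszul_eqI[OF f(1)]) (simp_all add: koszul_simps)
  qed (simp add: koszul_simps)
  ultimately show ?thesis by blast
qed

lemma row_cocycle:
  assumes c: "c \<in> carrier T.T" "T.dif P c = \<zero>\<^bsub>T.T\<^esub>" and f: "f \<in> carrier (cochains (koszul A G zs) m)" "row_rel m f c"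
  shows "f \<in> cocycles (koszul A G zs) m"
proof -
  have "\<zero>\<^bsub>T.T\<^esub> I = \<zero>\<^bsub>Y.mM X I\<^esub>" if "I \<in> positions zs (Suc m)" for I
    by (rule T.T_apply(1)) (use that in \<open>auto simp: positions_zs length_append\<close>)
  hence "differential (koszul A G zs) m f = \<zero>\<^bsub>cochains (koszul A G zs) (Suc m)\<^esub>"
    using row_rel_zero_iff[OF KZ.d_closed[OF f(1)] row_rel_dif[OF c(1) f]] c(2) by simp
  thus ?thesis using f(1) by (simp add: cocycles_def)
qed

text \<open>The extension of \<open>f\<close> by zero has a coboundary that vanishes on the row. All other slices in direction \<open>Z\<close>
  are exact, so that this coboundary has a primitive off the row, which can be subtracted.\<close>

lemma lift_cocycle:
  assumes f: "f \<in> cocycles (koszul A G zs) n" "f \<in> piece (koszul A G zs) n i"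
  shows "\<exists>c \<in> T.T0. T.supp (\<lambda>K. card K = n) c \<and> T.dif P c = \<zero>\<^bsub>T.T\<^esub> \<and> row_rel n f c"
proof -
  have fc: "f \<in> carrier (cochains (koszul A G zs) n)" using f(1) by (simp add: cocycles_def)
  define c where "c = embed n f"
  have c: "c \<in> T.T0" "T.supp (\<lambda>K. card K = n) c" "row_rel n f c"
    unfolding c_def using embed_T0[OF fc f(2)] embed_supp embed_row by auto
  have cT: "c \<in> carrier T.T" using c(1) by (rule T.T0_closed)
  let ?d = "T.dif P c"
  have dT: "?d \<in> T.T0" using c(1) by (rule T.T0_dif)
  have "differential (koszul A G zs) n f = \<zero>\<^bsub>cochains (koszul A G zs) (Suc n)\<^esub>" using f(1) by (simp add: cocycles_def)
  hence z: "\<forall>I \<in> positions zs (Suc n). ?d I = \<zero>\<^bsub>Y.mM X I\<^esub>"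
    using row_rel_zero_iff[OF KZ.d_closed[OF fc] row_rel_dif[OF cT fc c(3)]] by simp
  have sd: "T.supp (\<lambda>K. card K = Suc n) ?d" by (rule T.supp_card_dif[OF c(2)])
  have "T.supp (\<lambda>K. card K = Suc n \<and> 1 \<le> card (K - Z)) ?d" unfolding T.supp_def
  proof (intro allI impI)
    fix K assume K: "K \<subseteq> P" "\<not> (card K = Suc n \<and> 1 \<le> card (K - Z))"
    show "?d K = \<zero>\<^bsub>Y.mM X K\<^esub>"
    proof (cases "card K = Suc n")
      case True
      hence "K \<subseteq> Z" using K T.card_Diff_pos[OF K(1)] by blast
      thus ?thesis using z True by (simp add: positions_zs)
    next
      case False
      thus ?thesis using sd K(1) unfolding T.supp_def by blast
    qed
  qed
  moreover have "T.slice_exact Z J (Suc n)" if "J \<subseteq> P - Z" "1 \<le> card J" for J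
  proof (rule exact_T)
    show "J \<subseteq> X" using that(1) unfolding ZX(3) .
    show "J \<noteq> {}" using that(2) by auto
  qed
  ultimately obtain g where g: "g \<in> T.T0" "T.supp (\<lambda>K. Suc (card K) = Suc n \<and> 1 \<le> card (K - Z)) g" "T.dif P g = ?d"
    using T.level_exact[OF ZX(1), of 1 "Suc n" ?d] dT T.dif_dif[OF cT] by blast
  have gT: "g \<in> carrier T.T" using g(1) by (rule T.T0_closed)
  let ?c = "c \<ominus>\<^bsub>T.T\<^esub> g"
  have cg: "?c \<in> T.T0" using c(1) g(1) by (rule T.T0_minus)
  have "T.supp (\<lambda>K. card K = n) g" using g(2) by (rule T.supp_mono) simp
  hence "T.supp (\<lambda>K. card K = n) ?c" using T.supp_minus[OF cT gT c(2)] by blast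
  moreover have "T.dif P ?c = \<zero>\<^bsub>T.T\<^esub>"
    unfolding T.dif_minus[OF cT gT] g(3) using T.T.M.minus_other_side[OF T.T0_closed[OF dT] T.T0_closed[OF dT]] by blast
  moreover have "row_rel n f ?c" unfolding row_rel_def
  proof
    fix I assume I: "I \<in> positions zs n"
    hence IP: "I \<subseteq> P" "I \<subseteq> Z" by (auto simp: positions_zs length_append)
    interpret I: module A "Y.mM X I" using T.M_module[OF IP(1)] .
    have "I - Z = {}" using IP by blast
    hence "g I = \<zero>\<^bsub>Y.mM X I\<^esub>" using g(2) IP(1) unfolding T.supp_def by (metis card.empty not_one_le_zero)
    hence "?c I = c I" unfolding T.T_apply(4)[OF IP(1) cT gT] using T.T_in[OF cT IP(1)] I.M.add.inv_one
      by (simp add: a_minus_def a_inv_def)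
    thus "?c I = \<iota> (f I)" using c(3) I by (simp add: row_rel_def)
  qed
  ultimately show ?thesis using cg by blast
qed

lemma supp_Suc_0: "f \<in> carrier T.T \<Longrightarrow> T.supp (\<lambda>K. Suc (card K) = 0) f \<Longrightarrow> f = \<zero>\<^bsub>T.T\<^esub>"
  by (rule T.supp_zero_false) simp_all

lemma supp'_Suc_0: "f \<in> carrier T'.T \<Longrightarrow> T'.supp (\<lambda>K. Suc (card K) = 0) f \<Longrightarrow> f = \<zero>\<^bsub>T'.T\<^esub>"
  by (rule T'.supp_zero_false) simp_all

lemma row_minus_dif:
  assumes c: "c \<in> carrier T.T" and f: "f \<in> carrier (cochains (koszul A G zs) n)" "row_rel n f c"
    and g: "g \<in> carrier T.T" "T.supp (\<lambda>K. Suc (card K) = n) g"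
  shows "\<exists>f' \<in> carrier (cochains (koszul A G zs) n). row_rel n f' (c \<ominus>\<^bsub>T.T\<^esub> T.dif P g) \<and>
    f \<ominus>\<^bsub>cochains (koszul A G zs) n\<^esub> f' \<in> coboundaries (koszul A G zs) n"
proof -
  let ?C = "cochains (koszul A G zs) n"
  interpret C: module A ?C by (rule KZ.cochains_module)
  show ?thesis
  proof (cases n)
    case 0
    hence "g = \<zero>\<^bsub>T.T\<^esub>" using supp_Suc_0 g by simp
    hence "c \<ominus>\<^bsub>T.T\<^esub> T.dif P g = c" using T.dif_zero T.T_minus_zero[OF c] by simp
    moreover have "f \<ominus>\<^bsub>?C\<^esub> f = \<zero>\<^bsub>?C\<^esub>" using C.M.minus_other_side[OF f(1) f(1)] by blast
    ultimately have "row_rel n f (c \<ominus>\<^bsub>T.T\<^esub> T.dif P g)" "f \<ominus>\<^bsub>?C\<^esub> f \<in> coboundaries (koszul A G zs) n"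
      using f(2) KZ.coboundaries_zero[of n] by (simp_all only:)
    thus ?thesis using f(1) by blast
  next
    case (Suc m)
    obtain h where h: "h \<in> carrier (cochains (koszul A G zs) m)" "row_rel m h g"
      using row_rel_exists(1)[OF g(1), of m] by blast
    let ?d = "differential (koszul A G zs) m h"
    have d: "?d \<in> carrier ?C" "row_rel n ?d (T.dif P g)"
      using KZ.d_closed[OF h(1)] row_rel_dif[OF g(1) h] Suc by simp_all
    have "?d \<in> coboundaries (koszul A G zs) n" using h(1) Suc by (auto simp: coboundaries_def)
    moreover have "f \<ominus>\<^bsub>?C\<^esub> (f \<ominus>\<^bsub>?C\<^esub> ?d) = ?d"
      using f(1) d(1) by (simp add: a_minus_def C.M.minus_add C.M.minus_minus C.M.r_neg C.M.a_assoc[symmetric])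
    ultimately show ?thesis
      using row_rel_minus[OF c T.dif_closed[OF g(1)] f(1) d(1) f(2) d(2)] f(1) d(1)
      by (intro bexI[of _ "f \<ominus>\<^bsub>?C\<^esub> ?d"]) simp_all
  qed
qed

lemma row_coboundary:
  assumes g: "g \<in> carrier T.T" "T.supp (\<lambda>K. Suc (card K) = n) g"
    and f: "f \<in> carrier (cochains (koszul A G zs) n)" "row_rel n f (T.dif P g)"
  shows "f \<in> coboundaries (koszul A G zs) n"
proof -
  let ?C = "cochains (koszul A G zs) n"
  interpret C: module A ?C by (rule KZ.cochains_module)
  let ?d = "T.dif P g"
  have dT: "?d \<in> carrier T.T" using g(1) by (rule T.dif_closed)
  obtain f' where f': "f' \<in> carrier ?C" "row_rel n f' (?d \<ominus>\<^bsub>T.T\<^esub> ?d)" "f \<ominus>\<^bsub>?C\<^esub> f' \<in> coboundaries (koszul A G zs) n"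
    using row_minus_dif[OF dT f g] by blast
  have "?d \<ominus>\<^bsub>T.T\<^esub> ?d = \<zero>\<^bsub>T.T\<^esub>" using T.T.M.minus_other_side[OF dT dT] by blast
  moreover have "\<zero>\<^bsub>T.T\<^esub> I = \<zero>\<^bsub>Y.mM X I\<^esub>" if "I \<in> positions zs n" for I
    by (rule T.T_apply(1)) (use that in \<open>auto simp: positions_zs length_append\<close>)
  ultimately have "f' = \<zero>\<^bsub>?C\<^esub>" using row_rel_zero_iff[OF f'(1,2)] by simp
  thus ?thesis using f'(3) f(1) C.M.add.inv_one by (simp add: a_minus_def a_inv_def)
qed

lemma row_primitive:
  assumes f: "f \<in> coboundaries (koszul A G zs) n"
  shows "\<exists>b \<in> carrier T.T. T.supp (\<lambda>K. Suc (card K) = n) b \<and> row_rel n f (T.dif P b)"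
proof (cases n)
  case 0
  hence "f = \<zero>\<^bsub>cochains (koszul A G zs) n\<^esub>" using f by (simp add: coboundaries_def)
  moreover have "\<zero>\<^bsub>T.T\<^esub> I = \<iota> (\<zero>\<^bsub>cochains (koszul A G zs) n\<^esub> I)" if I: "I \<in> positions zs n" for I
  proof -
    have IP: "I \<subseteq> P" "I \<subseteq> Z" using I by (auto simp: positions_zs length_append)
    show ?thesis unfolding T.T_apply(1)[OF IP(1)] mM_row[OF IP(2)] using I by (simp add: koszul_simps iota_zero)
  qed
  ultimately have "row_rel n f \<zero>\<^bsub>T.T\<^esub>" unfolding row_rel_def by blast
  thus ?thesis using T.dif_zero T.T.M.zero_closed T.supp_zero by (intro bexI[of _ "\<zero>\<^bsub>T.T\<^esub>"]) simp_all
next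
  case (Suc m)
  then obtain h where h: "h \<in> carrier (cochains (koszul A G zs) m)" "f = differential (koszul A G zs) m h"
    using f by (auto simp: coboundaries_def)
  show ?thesis
  proof (intro bexI conjI)
    show "embed m h \<in> carrier T.T" by (rule embed_closed[OF h(1)])
    show "T.supp (\<lambda>K. Suc (card K) = n) (embed m h)" using embed_supp[of m h] unfolding Suc T.supp_def by simp
    show "row_rel n f (T.dif P (embed m h))" unfolding h(2) Suc
      by (rule row_rel_dif[OF embed_closed[OF h(1)] h(1) embed_row])
  qed
qed

text \<open>This is the injectivity of the map from total cohomology to the Koszul cohomology of the row; surjectivity
  is \<open>lift_cocycle\<close>.\<close>

lemma coboundary_of_row:
  assumes c: "c \<in> T.T0" "T.supp (\<lambda>K. card K = n) c" "T.dif P c = \<zero>\<^bsub>T.T\<^esub>"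
    and f: "f \<in> coboundaries (koszul A G zs) n" "row_rel n f c"
  shows "\<exists>g \<in> T.T0. T.supp (\<lambda>K. Suc (card K) = n) g \<and> T.dif P g = c"
proof -
  have cT: "c \<in> carrier T.T" using c(1) by (rule T.T0_closed)
  have fc: "f \<in> carrier (cochains (koszul A G zs) n)" using f(1) KZ.coboundaries_subset by blast
  have "\<exists>b \<in> carrier T.T. T.supp (\<lambda>K. Suc (card K) = n) b \<and> row_rel n f (T.dif P b)"
    by (rule row_primitive[OF f(1)])
  then obtain b where b: "b \<in> carrier T.T" "T.supp (\<lambda>K. Suc (card K) = n) b" "row_rel n f (T.dif P b)" by blast
  show ?thesis
  proof (rule T.exact_of_row[OF ZX(1) _ c])
    show "T.slice_exact Z J n" if "J \<subseteq> P - Z" "J \<noteq> {}" for J using exact_T[of J] that unfolding ZX(3) by blast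
    show "T.proj b \<in> T.T0" by (rule T.proj_closed[OF b(1)])
    show "T.supp (\<lambda>K. Suc (card K) = n) (T.proj b)" by (rule T.supp_proj[OF b(2)])
    fix K assume K: "K \<subseteq> Z" "card K = n"
    hence KP: "K \<subseteq> P" "K \<in> positions zs n" by (auto simp: positions_zs length_append)
    have "c K = \<iota> (f K)" "T.dif P b K = \<iota> (f K)" using b(3) f(2) KP(2) unfolding row_rel_def by blast+
    hence e: "c K = T.dif P b K" by (rule trans[OF _ sym])
    have "T.proj c K = T.proj (T.dif P b) K" unfolding T.proj_def restrict_apply'[OF PowI[OF KP(1)]] e ..
    hence "c K = T.proj (T.dif P b) K" unfolding T.proj_T0[OF c(1)] .
    thus "c K = T.dif P (T.proj b) K" unfolding T.proj_dif[OF b(1)] .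
  qed
qed

text \<open>The same comparison for the Cech cube, whose row is the Cech complex of \<open>zs\<close>.\<close>

lemma mM'_row: "K \<subseteq> Z \<Longrightarrow> Y.mM UNIV K = localization A (denominators A zs K)"
  by (simp add: Y.mM_def den_row)

lemma cech_row_dif:
  assumes c: "c \<in> carrier T'.T" and h: "\<And>I. I \<in> positions zs m \<Longrightarrow> c I = h I" and J: "J \<in> positions zs (Suc m)"
  shows "T'.dif P c J = differential (cech A G zs) m h J"
proof -
  have JP: "J \<subseteq> P" "J \<subseteq> Z" "J \<inter> P = J" "finite J" using J finite_subset[of J "{..<r}"] by (auto simp: positions_zs length_append)
  interpret L: module A "Y.mM UNIV J" using T'.M_module[OF JP(1)] .
  have J': "J - {k} \<in> positions zs m" if "k \<in> J" for k
    using that J JP(4) by (auto simp: positions_zs)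
  have "T'.dif P c J = (\<Oplus>\<^bsub>Y.mM UNIV J\<^esub>k\<in>J. T'.sr k J (c (J - {k})))"
    unfolding T'.dif_apply[OF JP(1)] JP(3) ..
  also have "\<dots> = differential (cech A G zs) m h J"
    unfolding cech_simps signed_sum_def restrict_apply'[OF J] mM'_row[OF JP(2), symmetric]
  proof (rule L.M.finsum_cong'[symmetric])
    fix k assume k: "k \<in> J"
    show "(if even (card {l \<in> J. l < k}) then localization_map A (denominators A zs J) (h (J - {k}))
        else \<ominus>\<^bsub>Y.mM UNIV J\<^esub> localization_map A (denominators A zs J) (h (J - {k}))) = T'.sr k J (c (J - {k}))"
      unfolding h[OF J'[OF k], symmetric] T'.sr_def by (simp add: Y.mrho_def den_row[OF JP(2)])
  qed (use T'.summand_closed[OF c JP(1)] in auto)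
  finally show ?thesis .
qed

lemma row_coboundary':
  assumes g: "g \<in> carrier T'.T" "T'.supp (\<lambda>K. Suc (card K) = n) g"
    and u: "u \<in> carrier (cochains (cech A G zs) n)" "\<And>I. I \<in> positions zs n \<Longrightarrow> T'.dif P g I = u I"
  shows "u \<in> coboundaries (cech A G zs) n"
proof (cases n)
  case 0
  hence "g = \<zero>\<^bsub>T'.T\<^esub>" using supp'_Suc_0 g by simp
  hence z: "T'.dif P g = \<zero>\<^bsub>T'.T\<^esub>" using T'.dif_zero by simp
  have "u = \<zero>\<^bsub>cochains (cech A G zs) n\<^esub>"
  proof (rule extensionalityI[of _ "positions zs n"])
    fix I assume I: "I \<in> positions zs n"
    hence IP: "I \<subseteq> P" "I \<subseteq> Z" by (auto simp: positions_zs length_append)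
    show "u I = \<zero>\<^bsub>cochains (cech A G zs) n\<^esub> I"
      using u(2)[OF I] T'.T_apply(1)[OF IP(1)] I unfolding z mM'_row[OF IP(2)] by (simp add: cech_simps)
  qed (use u(1) in \<open>auto simp: cech_simps PiE_iff\<close>)
  thus ?thesis using CZ.coboundaries_zero by simp
next
  case (Suc m)
  let ?h = "restrict g (positions zs m)"
  have hI: "g I \<in> carrier (localization A (denominators A zs I))" if "I \<in> positions zs m" for I
  proof -
    have "I \<subseteq> P" "I \<subseteq> Z" using that by (auto simp: positions_zs length_append)
    thus ?thesis using T'.T_in[OF g(1), of I] mM'_row[of I] by simp
  qed
  hence h: "?h \<in> carrier (cochains (cech A G zs) m)" by (simp add: cech_simps)
  have "u = differential (cech A G zs) m ?h"
  proof (rule extensionalityI[of _ "positions zs n"])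
    fix J assume J: "J \<in> positions zs n"
    show "u J = differential (cech A G zs) m ?h J"
      using cech_row_dif[OF g(1), of m ?h J] J u(2)[OF J] Suc by simp
  qed (use u(1) CZ.d_closed[OF h] Suc in \<open>auto simp: cech_simps PiE_iff\<close>)
  thus ?thesis using h Suc by (auto simp: coboundaries_def)
qed

lemma coboundary_of_row':
  assumes c: "c \<in> carrier T'.T" "T'.supp (\<lambda>K. card K = n) c" "T'.dif P c = \<zero>\<^bsub>T'.T\<^esub>"
    and u: "u \<in> coboundaries (cech A G zs) n" "\<And>I. I \<in> positions zs n \<Longrightarrow> c I = u I"
  shows "\<exists>g \<in> carrier T'.T. T'.supp (\<lambda>K. Suc (card K) = n) g \<and> T'.dif P g = c"
proof -
  have T0: "T'.T0 = carrier T'.T" by (auto simp: T'.T0_def)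
  have "\<exists>b \<in> carrier T'.T. T'.supp (\<lambda>K. Suc (card K) = n) b \<and> (\<forall>I \<in> positions zs n. T'.dif P b I = u I)"
  proof (cases n)
    case 0
    hence "u = \<zero>\<^bsub>cochains (cech A G zs) n\<^esub>" using u(1) by (simp add: coboundaries_def)
    moreover have "\<zero>\<^bsub>T'.T\<^esub> I = \<zero>\<^bsub>cochains (cech A G zs) n\<^esub> I" if I: "I \<in> positions zs n" for I
    proof -
      have IP: "I \<subseteq> P" "I \<subseteq> Z" using I by (auto simp: positions_zs length_append)
      show ?thesis unfolding T'.T_apply(1)[OF IP(1)] mM'_row[OF IP(2)] using I by (simp add: cech_simps)
    qed
    ultimately show ?thesis using T'.dif_zero T'.T.M.zero_closed T'.supp_zero
      by (intro bexI[of _ "\<zero>\<^bsub>T'.T\<^esub>"]) simp_all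
  next
    case (Suc m)
    then obtain h where h: "h \<in> carrier (cochains (cech A G zs) m)" "u = differential (cech A G zs) m h"
      using u(1) by (auto simp: coboundaries_def)
    define b where "b = (\<lambda>K\<in>Pow P. if K \<in> positions zs m then h K else \<zero>\<^bsub>Y.mM UNIV K\<^esub>)"
    have bT: "b \<in> carrier T'.T" unfolding b_def
    proof (rule T'.T_I)
      fix K assume K: "K \<subseteq> P"
      show "(if K \<in> positions zs m then h K else \<zero>\<^bsub>Y.mM UNIV K\<^esub>) \<in> carrier (Y.mM UNIV K)"
      proof (cases "K \<in> positions zs m")
        case True
        hence "h K \<in> carrier (localization A (denominators A zs K))" using h(1) by (auto simp: cech_simps)
        moreover have "K \<subseteq> Z" using True by (simp add: positions_zs)
        ultimately show ?thesis using True mM'_row by simp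
      next
        case False
        thus ?thesis using T'.M_closed(1)[OF K] by simp
      qed
    qed
    show ?thesis
    proof (intro bexI[OF _ bT] conjI ballI)
      show "T'.supp (\<lambda>K. Suc (card K) = n) b" unfolding T'.supp_def b_def Suc by (auto simp: positions_zs)
      fix I assume "I \<in> positions zs n"
      thus "T'.dif P b I = u I" unfolding h(2) Suc
        by (intro cech_row_dif[OF bT]) (auto simp: b_def positions_zs length_append)
    qed
  qed
  then obtain b where b: "b \<in> carrier T'.T" "T'.supp (\<lambda>K. Suc (card K) = n) b" "\<forall>I \<in> positions zs n. T'.dif P b I = u I" by blast
  have "\<exists>g \<in> T'.T0. T'.supp (\<lambda>K. Suc (card K) = n) g \<and> T'.dif P g = c"
  proof (rule T'.exact_of_row[OF ZX(1) _ _ c(2,3) _ b(2)])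
    show "T'.slice_exact Z J n" if "J \<subseteq> P - Z" "J \<noteq> {}" for J using exact_T'_Z[of J] that unfolding ZX(3) by blast
    show "c \<in> T'.T0" "b \<in> T'.T0" unfolding T0 by (rule c(1), rule b(1))
    show "c K = T'.dif P b K" if "K \<subseteq> Z" "card K = n" for K
      using u(2) b(3) that by (simp add: positions_zs)
  qed
  thus ?thesis unfolding T0 .
qed

end

context two_sequences
begin

lemma T'_T0: "T'.T0 = carrier T'.T"
  by (auto simp: T'.T0_def)

lemma Phi_supp:
  assumes c: "c \<in> carrier T.T" "T.supp Q c"
  shows "T'.supp Q (N.\<Phi> c)"
  unfolding T'.supp_def
proof (intro allI impI)
  fix K assume K: "K \<subseteq> P" "\<not> Q K"
  have "c K = \<zero>\<^bsub>Y.mM X K\<^esub>" using c(2) K unfolding T.supp_def by blast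
  thus "N.\<Phi> c K = \<zero>\<^bsub>Y.mM UNIV K\<^esub>" unfolding N.\<Phi>_def restrict_apply'[OF PowI[OF K(1)]] using N.phi_zero[OF K(1)] by simp
qed

lemma Phi_cocycle:
  assumes c: "c \<in> carrier T.T" "T.dif P c = \<zero>\<^bsub>T.T\<^esub>"
  shows "T'.dif P (N.\<Phi> c) = \<zero>\<^bsub>T'.T\<^esub>"
proof -
  have "N.\<Phi> \<zero>\<^bsub>T.T\<^esub> = \<zero>\<^bsub>T'.T\<^esub>"
  proof (rule T'.T_eqI)
    fix K assume K: "K \<subseteq> P"
    show "N.\<Phi> \<zero>\<^bsub>T.T\<^esub> K = \<zero>\<^bsub>T'.T\<^esub> K"
      unfolding N.\<Phi>_def restrict_apply'[OF PowI[OF K]] T'.T_apply(1)[OF K] T.T_apply(1)[OF K] by (rule N.phi_zero[OF K])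
  qed (use N.Phi_closed[OF T.T.M.zero_closed] T'.T.M.zero_closed in blast)+
  thus ?thesis using N.Phi_dif[OF c(1), of P] c(2) by simp
qed

text \<open>On the column of sets \<open>K \<subseteq> X\<close> the mixed cube and the Cech cube agree, so a primitive in the Cech
  cube can be restricted to the column and used in the mixed cube.\<close>

lemma column_primitive:
  assumes c: "c \<in> T.T0" and g: "g \<in> carrier T'.T" "T'.supp (\<lambda>K. Suc (card K) = n) g" and e: "N.\<Phi> c = T'.dif P g"
  shows "\<exists>h \<in> T.T0. T.supp (\<lambda>K. Suc (card K) = n) h \<and> (\<forall>K \<subseteq> X. c K = T.dif P h K)"
proof -
  have cT: "c \<in> carrier T.T" using c by (rule T.T0_closed)
  have MX: "Y.mM X K = Y.mM UNIV K" if "K \<subseteq> X" for K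
    using that by (simp add: Y.mM_def Int_absorb2)
  define h where "h = (\<lambda>K\<in>Pow P. if K \<subseteq> X then g K else \<zero>\<^bsub>Y.mM X K\<^esub>)"
  have h: "h \<in> carrier T.T" unfolding h_def
  proof (rule T.T_I)
    fix K assume K: "K \<subseteq> P"
    show "(if K \<subseteq> X then g K else \<zero>\<^bsub>Y.mM X K\<^esub>) \<in> carrier (Y.mM X K)"
    proof (cases "K \<subseteq> X")
      case True
      thus ?thesis using T'.T_in[OF g(1) K] MX by simp
    next
      case False
      thus ?thesis using T.M_closed(1)[OF K] by simp
    qed
  qed
  have hs: "T.supp (\<lambda>K. Suc (card K) = n) h"
    unfolding T.supp_def
  proof (intro allI impI)
    fix K assume K: "K \<subseteq> P" "Suc (card K) \<noteq> n"
    have "g K = \<zero>\<^bsub>Y.mM UNIV K\<^esub>" using g(2) K unfolding T'.supp_def by blast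
    thus "h K = \<zero>\<^bsub>Y.mM X K\<^esub>" using MX K by (simp add: h_def)
  qed
  have dh: "T.dif P h K = c K" if K: "K \<subseteq> X" for K
  proof -
    have KP: "K \<subseteq> P" "K \<inter> P = K" using K by auto
    interpret K: module A "Y.mM X K" using T.M_module[OF KP(1)] .
    have "T.dif P h K = (\<Oplus>\<^bsub>Y.mM X K\<^esub>k\<in>K. T.sr k K (h (K - {k})))"
      unfolding T.dif_apply[OF KP(1)] KP(2) ..
    also have "\<dots> = (\<Oplus>\<^bsub>Y.mM X K\<^esub>k\<in>K. T'.sr k K (g (K - {k})))"
    proof (rule K.M.finsum_cong')
      fix k assume k: "k \<in> K"
      have "h (K - {k}) = g (K - {k})" using K KP by (auto simp: h_def)
      moreover have "Y.mrho X k K = Y.mrho UNIV k K" using k K by (auto simp: Y.mrho_def Int_absorb2)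
      ultimately show "T.sr k K (h (K - {k})) = T'.sr k K (g (K - {k}))"
        by (simp add: T.sr_def T'.sr_def MX[OF K])
    next
      show "(\<lambda>k. T'.sr k K (g (K - {k}))) \<in> K \<rightarrow> carrier (Y.mM X K)"
        using T'.summand_closed[OF g(1) KP(1)] by (simp add: MX[OF K])
    qed simp
    also have "\<dots> = T'.dif P g K" unfolding T'.dif_apply[OF KP(1)] KP(2) MX[OF K] ..
    also have "\<dots> = phi K (c K)" unfolding e[symmetric] N.\<Phi>_def restrict_apply'[OF PowI[OF KP(1)]] ..
    also have "\<dots> = c K" by (rule phi_column[OF K T.T_in[OF cT KP(1)]])
    finally show ?thesis .
  qed
  show ?thesis
  proof (intro bexI conjI allI impI)
    show "T.proj h \<in> T.T0" by (rule T.proj_closed[OF h])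
    show "T.supp (\<lambda>K. Suc (card K) = n) (T.proj h)" by (rule T.supp_proj[OF hs])
    fix K assume K: "K \<subseteq> X"
    have KP: "K \<subseteq> P" using K by auto
    have "T.proj c K = T.proj (T.dif P h) K" unfolding T.proj_def restrict_apply'[OF PowI[OF KP]] dh[OF K] ..
    thus "c K = T.dif P (T.proj h) K" unfolding T.proj_T0[OF c] T.proj_dif[OF h] .
  qed
qed

text \<open>Lift \<open>f\<close> to a total cocycle \<open>c\<close>. Its image in the Cech double complex has a row that is a coboundary,
  so the image is a coboundary, and so is the column of \<open>c\<close>. Removing a primitive of the column makes the
  level positive, and exact slices allow to raise it to \<open>p\<close>. Each correction changes the row by a coboundary.\<close>

lemma kernel_lift:
  assumes f: "f \<in> cocycles (koszul A G zs) n" "f \<in> piece (koszul A G zs) n i"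
    and k: "koszul_to_cech A zs n f \<in> coboundaries (cech A G zs) n"
    and p: "1 \<le> p" and ex: "\<And>I. I \<subseteq> Z \<Longrightarrow> 1 \<le> card I \<Longrightarrow> card I < p \<Longrightarrow> T.slice_exact X I n"
  shows "\<exists>c \<in> T.T0. \<exists>f' \<in> carrier (cochains (koszul A G zs) n).
    T.supp (\<lambda>K. card K = n \<and> p \<le> card (K - X)) c \<and> T.dif P c = \<zero>\<^bsub>T.T\<^esub> \<and> row_rel n f' c \<and>
    f \<ominus>\<^bsub>cochains (koszul A G zs) n\<^esub> f' \<in> coboundaries (koszul A G zs) n"
proof -
  have fc: "f \<in> carrier (cochains (koszul A G zs) n)" using f(1) by (simp add: cocycles_def)
  obtain c where c: "c \<in> T.T0" "T.supp (\<lambda>K. card K = n) c" "T.dif P c = \<zero>\<^bsub>T.T\<^esub>" "row_rel n f c"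
    using lift_cocycle[OF f] by blast
  have cT: "c \<in> carrier T.T" using c(1) by (rule T.T0_closed)
  obtain g' where g': "g' \<in> carrier T'.T" "T'.supp (\<lambda>K. Suc (card K) = n) g'" "T'.dif P g' = N.\<Phi> c"
    using coboundary_of_row'[OF N.Phi_closed[OF cT] Phi_supp[OF cT c(2)] Phi_cocycle[OF cT c(3)] k phi_row[OF c(4) fc]]
    by blast
  obtain g where g: "g \<in> T.T0" "T.supp (\<lambda>K. Suc (card K) = n) g" "\<forall>K \<subseteq> X. c K = T.dif P g K"
    using column_primitive[OF c(1) g'(1,2) g'(3)[symmetric]] by blast
  have gT: "g \<in> carrier T.T" using g(1) by (rule T.T0_closed)
  let ?c = "c \<ominus>\<^bsub>T.T\<^esub> T.dif P g"
  have c1: "?c \<in> T.T0" using c(1) g(1) by (intro T.T0_minus T.T0_dif)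
  have s1: "T.supp (\<lambda>K. card K = n) ?c"
  proof (rule T.supp_minus[OF cT T.dif_closed[OF gT] c(2)])
    show "T.supp (\<lambda>K. card K = n) (T.dif P g)"
      by (rule T.supp_dif[OF g(2)]) (metis T.card_Diff1)
  qed
  have s2: "T.supp (\<lambda>K. card K = n \<and> 1 \<le> card (K - X)) ?c" unfolding T.supp_def
  proof (intro allI impI)
    fix K assume K: "K \<subseteq> P" "\<not> (card K = n \<and> 1 \<le> card (K - X))"
    show "?c K = \<zero>\<^bsub>Y.mM X K\<^esub>"
    proof (cases "card K = n")
      case True
      hence "K \<subseteq> X" using K T.card_Diff_pos[OF K(1)] by blast
      thus ?thesis using g(3) T.minus_apply_eq_zero_iff[OF cT T.dif_closed[OF gT] K(1)] by blast
    next
      case False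
      thus ?thesis using s1 K(1) unfolding T.supp_def by blast
    qed
  qed
  have d1: "T.dif P ?c = \<zero>\<^bsub>T.T\<^esub>" using T.dif_minus_dif[OF cT gT] c(3) by simp
  have ds: "T.supp (\<lambda>K. p \<le> card (K - X)) (T.dif P ?c)" unfolding d1 by (rule T.supp_zero)
  have ex': "T.slice_exact X I n" if "I \<subseteq> P - X" "1 \<le> card I" "card I < p" for I
    using ex that unfolding ZX(4) by blast
  obtain g2 where g2: "g2 \<in> T.T0" "T.supp (\<lambda>K. Suc (card K) = n \<and> 1 \<le> card (K - X)) g2"
      "T.supp (\<lambda>K. card K = n \<and> p \<le> card (K - X)) (?c \<ominus>\<^bsub>T.T\<^esub> T.dif P g2)"
    using T.level_chain[OF ZX(2) p ex' c1 s2 ds] by blast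
  have g2T: "g2 \<in> carrier T.T" using g2(1) by (rule T.T0_closed)
  let ?g = "g \<oplus>\<^bsub>T.T\<^esub> g2"
  have gg: "?g \<in> T.T0" "?g \<in> carrier T.T" using g(1) g2(1) T.T0_add T.T0_closed by blast+
  have "T.supp (\<lambda>K. Suc (card K) = n) g2" using g2(2) by (rule T.supp_mono) simp
  hence sg: "T.supp (\<lambda>K. Suc (card K) = n) ?g" using g(2) T.supp_add by blast
  have e: "?c \<ominus>\<^bsub>T.T\<^esub> T.dif P g2 = c \<ominus>\<^bsub>T.T\<^esub> T.dif P ?g" by (rule T.minus_dif_dif[OF cT gT g2T])
  obtain f' where f': "f' \<in> carrier (cochains (koszul A G zs) n)" "row_rel n f' (c \<ominus>\<^bsub>T.T\<^esub> T.dif P ?g)"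
      "f \<ominus>\<^bsub>cochains (koszul A G zs) n\<^esub> f' \<in> coboundaries (koszul A G zs) n"
    using row_minus_dif[OF cT fc c(4) gg(2) sg] by blast
  have "c \<ominus>\<^bsub>T.T\<^esub> T.dif P ?g \<in> T.T0" using c(1) gg(1) by (intro T.T0_minus T.T0_dif)
  moreover have "T.dif P (c \<ominus>\<^bsub>T.T\<^esub> T.dif P ?g) = \<zero>\<^bsub>T.T\<^esub>" using T.dif_minus_dif[OF cT gg(2)] c(3) by simp
  ultimately show ?thesis using f' g2(3) unfolding e by blast
qed

lemma koszul_to_cech_closed:
  assumes f: "f \<in> carrier (cochains (koszul A G zs) m)"
  shows "koszul_to_cech A zs m f \<in> carrier (cochains (cech A G zs) m)"
proof -
  have "koszul_to_cech A zs m f I \<in> carrier (localization A (denominators A zs I))" if I: "I \<in> positions zs m" for I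
  proof -
    have IP: "I \<subseteq> P" "I \<subseteq> Z" using I by (auto simp: positions_zs length_append)
    show ?thesis
      using T'.T_in[OF N.Phi_closed[OF embed_closed[OF f]] IP(1)] unfolding phi_row[OF embed_row f I] mM'_row[OF IP(2)] .
  qed
  moreover have "koszul_to_cech A zs m f \<in> extensional (positions zs m)" by (simp add: koszul_to_cech_def)
  ultimately show ?thesis by (simp add: cech_simps PiE_iff)
qed

lemma koszul_to_cech_coboundary:
  assumes f: "f \<in> coboundaries (koszul A G zs) n"
  shows "koszul_to_cech A zs n f \<in> coboundaries (cech A G zs) n"
proof -
  have fc: "f \<in> carrier (cochains (koszul A G zs) n)" using f KZ.coboundaries_subset by blast
  have "\<exists>g \<in> carrier T.T. T.supp (\<lambda>K. Suc (card K) = n) g \<and> row_rel n f (T.dif P g)"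
    by (rule row_primitive[OF f])
  then obtain g where g: "g \<in> carrier T.T" "T.supp (\<lambda>K. Suc (card K) = n) g" "row_rel n f (T.dif P g)" by blast
  show ?thesis
  proof (rule row_coboundary'[OF N.Phi_closed[OF g(1)] Phi_supp[OF g(1,2)] koszul_to_cech_closed[OF fc]])
    fix I assume I: "I \<in> positions zs n"
    show "T'.dif P (N.\<Phi> g) I = koszul_to_cech A zs n f I"
      unfolding N.Phi_dif[OF g(1), symmetric] by (rule phi_row[OF g(3) fc I])
  qed
qed

text \<open>The image of \<open>c\<close> in the Cech double complex vanishes on the column, hence it is a coboundary, because
  there the slices in direction \<open>X\<close> of positive level are exact.\<close>

lemma positive_level_kernel:
  assumes c: "c \<in> carrier T.T" "T.supp (\<lambda>K. card K = n \<and> 1 \<le> card (K - X)) c" "T.dif P c = \<zero>\<^bsub>T.T\<^esub>"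
    and f: "f \<in> carrier (cochains (koszul A G zs) n)" "row_rel n f c"
  shows "koszul_to_cech A zs n f \<in> coboundaries (cech A G zs) n"
proof -
  have c': "N.\<Phi> c \<in> carrier T'.T" using c(1) by (rule N.Phi_closed)
  have s: "T'.supp (\<lambda>K. card K = n \<and> 1 \<le> card (K - X)) (N.\<Phi> c)" by (rule Phi_supp[OF c(1,2)])
  have "T'.slice_exact X I n" if I: "I \<subseteq> P - X" "1 \<le> card I" for I
  proof (rule exact_T'_X)
    show "I \<subseteq> Z" using I(1) unfolding ZX(4) .
    show "I \<noteq> {}" using I(2) by auto
  qed
  then obtain g where g: "g \<in> T'.T0" "T'.supp (\<lambda>K. Suc (card K) = n \<and> 1 \<le> card (K - X)) g" "T'.dif P g = N.\<Phi> c"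
    using T'.level_exact[OF ZX(2) _ _ s Phi_cocycle[OF c(1,3)]] c' unfolding T'_T0 by blast
  have kc: "koszul_to_cech A zs n f \<in> carrier (cochains (cech A G zs) n)" by (rule koszul_to_cech_closed[OF f(1)])
  show ?thesis
  proof (rule row_coboundary'[OF _ _ kc])
    show "g \<in> carrier T'.T" using g(1) unfolding T'_T0 .
    show "T'.supp (\<lambda>K. Suc (card K) = n) g" using g(2) by (rule T'.supp_mono) simp
    show "T'.dif P g I = koszul_to_cech A zs n f I" if "I \<in> positions zs n" for I
      unfolding g(3) by (rule phi_row[OF f(2,1) that])
  qed
qed

subsection \<open>Leading slices\<close>

lemma slice_T_dif:
  assumes g: "g \<in> carrier T.T" "T.supp (\<lambda>K. p \<le> card (K - X)) g" and I: "I \<subseteq> Z" "card I = p"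
  shows "slice I q (T.dif P g) \<in> coboundaries (cech A G xs) q"
proof -
  have eq: "slice I q (T.dif P g) = slice I q (T.dif X g)"
    unfolding eq_on_slice_iff[OF I(1)] using T.dif_at_level[OF ZX(2) g] I by blast
  show ?thesis
  proof (cases q)
    case 0
    have "slice I 0 (T.dif X g) = slice I 0 \<zero>\<^bsub>T.T\<^esub>"
      unfolding eq_on_slice_iff[OF I(1)]
    proof (intro allI impI)
      fix K assume K: "K \<subseteq> P" "K - X = I \<and> card K = card I + 0"
      have "finite K" using K(1) finite_subset by blast
      hence "K = K - X" using K(2) by (metis Diff_subset add_0_right card_subset_eq)
      hence "T.dif X g K = \<zero>\<^bsub>Y.mM X K\<^esub>" by (intro T.dif_zero_at[OF K(1)]) blast
      thus "T.dif X g K = \<zero>\<^bsub>T.T\<^esub> K" unfolding T.T_apply(1)[OF K(1)] .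
    qed
    thus ?thesis using eq CX.coboundaries_zero[of 0] unfolding 0 slice_zero[OF I(1)] by simp
  next
    case (Suc l)
    have "differential (cech A G xs) l (slice I l g) \<in> coboundaries (cech A G xs) (Suc l)"
      using slice_closed[OF g(1) I(1), of l] by (auto simp: coboundaries_def)
    thus ?thesis unfolding eq unfolding Suc slice_dif[OF g(1) I(1)] by (intro CX.coboundaries_smult) simp_all
  qed
qed

text \<open>A primitive of \<open>c\<close> can be changed so that its level is at least \<open>p\<close>, too. Its slices of level \<open>p\<close> are then
  primitives of those of \<open>c\<close>, up to sign.\<close>

lemma slices_of_coboundary:
  assumes c: "c \<in> T.T0" "T.supp (\<lambda>K. card K = n \<and> p \<le> card (K - X)) c" "T.dif P c = \<zero>\<^bsub>T.T\<^esub>"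
    and f: "f \<in> coboundaries (koszul A G zs) n" "row_rel n f c"
    and ex: "\<And>m I. n = Suc m \<Longrightarrow> I \<subseteq> Z \<Longrightarrow> card I < p \<Longrightarrow> T.slice_exact X I m"
    and I: "I \<subseteq> Z" "card I = p"
  shows "slice I q c \<in> coboundaries (cech A G xs) q"
proof -
  have cs: "T.supp (\<lambda>K. card K = n) c" using c(2) by (rule T.supp_mono) simp
  obtain g where g: "g \<in> T.T0" "T.supp (\<lambda>K. Suc (card K) = n) g" "T.dif P g = c"
    using coboundary_of_row[OF c(1) cs c(3) f] by blast
  have gT: "g \<in> carrier T.T" using g(1) by (rule T.T0_closed)
  have "\<exists>h \<in> carrier T.T. T.supp (\<lambda>K. p \<le> card (K - X)) h \<and> T.dif P h = c"
  proof (cases n)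
    case 0
    hence "g = \<zero>\<^bsub>T.T\<^esub>" using supp_Suc_0[OF gT] g(2) by simp
    thus ?thesis using g(3) gT T.supp_zero by blast
  next
    case (Suc m)
    have gs: "T.supp (\<lambda>K. card K = m \<and> 0 \<le> card (K - X)) g" using g(2) unfolding Suc by simp
    have ds: "T.supp (\<lambda>K. p \<le> card (K - X)) (T.dif P g)" unfolding g(3) using c(2) by (rule T.supp_mono) simp
    have ex': "T.slice_exact X I m" if "I \<subseteq> P - X" "0 \<le> card I" "card I < p" for I
      using ex[OF Suc] that unfolding ZX(4) by blast
    obtain g2 where g2: "g2 \<in> T.T0" "T.supp (\<lambda>K. card K = m \<and> p \<le> card (K - X)) (g \<ominus>\<^bsub>T.T\<^esub> T.dif P g2)"
      using T.level_chain[OF ZX(2) le0 ex' g(1) gs ds] by blast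
    have g2T: "g2 \<in> carrier T.T" using g2(1) by (rule T.T0_closed)
    have "T.supp (\<lambda>K. p \<le> card (K - X)) (g \<ominus>\<^bsub>T.T\<^esub> T.dif P g2)" using g2(2) by (rule T.supp_mono) simp
    moreover have "T.dif P (g \<ominus>\<^bsub>T.T\<^esub> T.dif P g2) = c" using T.dif_minus_dif[OF gT g2T] g(3) by simp
    ultimately show ?thesis using gT g2T T.dif_closed T.T.M.minus_closed by blast
  qed
  then obtain h where "h \<in> carrier T.T" "T.supp (\<lambda>K. p \<le> card (K - X)) h" "T.dif P h = c" by blast
  thus ?thesis using slice_T_dif[of h p I q] I by simp
qed

text \<open>Primitives of the slices of level \<open>p\<close> cancel that level of \<open>c\<close>, and exactness on the levels above does
  the rest.\<close>

lemma coboundary_of_slices: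
  assumes c: "c \<in> T.T0" "T.supp (\<lambda>K. card K = n \<and> p \<le> card (K - X)) c" "T.dif P c = \<zero>\<^bsub>T.T\<^esub>"
    and n: "n = p + q"
    and ex: "\<And>I. I \<subseteq> Z \<Longrightarrow> p < card I \<Longrightarrow> card I \<le> n \<Longrightarrow> T.slice_exact X I n"
    and sl: "\<And>I. I \<in> positions zs p \<Longrightarrow> slice I q c \<in> coboundaries (cech A G xs) q"
    and f: "f \<in> carrier (cochains (koszul A G zs) n)" "row_rel n f c"
  shows "f \<in> coboundaries (koszul A G zs) n"
proof -
  have cT: "c \<in> carrier T.T" using c(1) by (rule T.T0_closed)
  have prim: "\<exists>g \<in> T.T0. T.supp (\<lambda>K. K - X = I \<and> Suc (card K) = n) g \<and> T.dif X g = T.cut (\<lambda>K. K - X = I) c"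
    if I: "I \<subseteq> P - X" "card I = p" for I
  proof -
    have IZ: "I \<subseteq> Z" "I \<in> positions zs p" using I unfolding ZX(4) by (auto simp: positions_zs)
    let ?c = "T.cut (\<lambda>K. K - X = I) c"
    have c0: "?c \<in> T.T0" using c(1) by (rule T.T0_cut)
    have s: "T.supp (\<lambda>K. K - X = I \<and> card K = n) ?c"
      using c(2) unfolding T.supp_def by (auto simp: T.cut_apply)
    have "slice I q ?c = slice I q c" unfolding eq_on_slice_iff[OF IZ(1)] by (auto simp: T.cut_apply)
    hence cb: "slice I q ?c \<in> coboundaries (cech A G xs) q" using sl[OF IZ(2)] by simp
    have "T.supp (\<lambda>K. K - X = I \<and> card K = card I + q) ?c" using s unfolding I(2) n .
    from slice_primitive[OF IZ(1) T.T0_closed[OF c0] this cb]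
    obtain g where "g \<in> carrier T.T" "T.dif X g = ?c" by blast
    from T.graded_primitive[OF c0 s this] show ?thesis .
  qed
  obtain g where g: "g \<in> T.T0" "T.supp (\<lambda>K. Suc (card K) = n \<and> p \<le> card (K - X)) g"
      "T.supp (\<lambda>K. card K = n \<and> p < card (K - X)) (c \<ominus>\<^bsub>T.T\<^esub> T.dif P g)"
    using T.level_step_of_primitives[OF ZX(2) c(1,2) prim] by blast
  have gT: "g \<in> carrier T.T" using g(1) by (rule T.T0_closed)
  let ?c = "c \<ominus>\<^bsub>T.T\<^esub> T.dif P g"
  have c': "?c \<in> T.T0" using c(1) g(1) by (intro T.T0_minus T.T0_dif)
  have s': "T.supp (\<lambda>K. card K = n \<and> Suc p \<le> card (K - X)) ?c" using g(3) by (simp add: Suc_le_eq)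
  have d': "T.dif P ?c = \<zero>\<^bsub>T.T\<^esub>" using T.dif_minus_dif[OF cT gT] c(3) by simp
  have ex': "T.slice_exact X I n" if "I \<subseteq> P - X" "Suc p \<le> card I" "card I \<le> n" for I
    using ex[of I] that unfolding ZX(4) by simp
  obtain h where h: "h \<in> T.T0" "T.supp (\<lambda>K. Suc (card K) = n \<and> Suc p \<le> card (K - X)) h" "T.dif P h = ?c"
    using T.level_exact[OF ZX(2) ex' c' s' d'] by blast
  have hT: "h \<in> carrier T.T" using h(1) by (rule T.T0_closed)
  let ?g = "g \<oplus>\<^bsub>T.T\<^esub> h"
  have e: "T.dif P ?g = c"
    unfolding T.dif_add[OF gT hT] h(3) using cT T.dif_closed[OF gT, of P]
    by (simp add: a_minus_def T.T.M.a_lcomm T.T.M.r_neg del: direct_sum_simps)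
  have "T.supp (\<lambda>K. Suc (card K) = n) g" "T.supp (\<lambda>K. Suc (card K) = n) h"
    by (rule T.supp_mono[OF g(2)], simp, rule T.supp_mono[OF h(2)], simp)
  hence s: "T.supp (\<lambda>K. Suc (card K) = n) ?g" by (rule T.supp_add)
  have "?g \<in> carrier T.T" using gT hT by (rule T.T.M.a_closed)
  from row_coboundary[OF this s f(1)] show ?thesis using f(2) unfolding e .
qed

text \<open>The coboundary of the element glued from the given slices is of level at least \<open>p + 1\<close>. By exactness on
  these levels it has a primitive there, which may be subtracted without changing the slices of level \<open>p\<close>.\<close>

lemma cocycle_with_slices:
  assumes n: "n = p + q"
    and ex: "\<And>I. I \<subseteq> Z \<Longrightarrow> p < card I \<Longrightarrow> card I \<le> Suc n \<Longrightarrow> T.slice_exact X I (Suc n)"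
    and y: "\<And>I. I \<in> positions zs p \<Longrightarrow> y I \<in> cocycles (cech A G xs) q"
      "\<And>I. I \<in> positions zs p \<Longrightarrow> y I \<in> piece (cech A G xs) q (i + int (\<Sum>l\<in>I. hdeg G (zs ! l)))"
  shows "\<exists>c \<in> T.T0. T.supp (\<lambda>K. card K = n \<and> p \<le> card (K - X)) c \<and> T.dif P c = \<zero>\<^bsub>T.T\<^esub> \<and>
    (\<forall>I \<in> positions zs p. slice I q c = y I)"
proof -
  let ?B = "positions zs p" and ?C = "cech A G xs"
  have yc: "y I \<in> carrier (cochains ?C q)" if "I \<in> ?B" for I using y(1)[OF that] by (simp add: cocycles_def)
  define c where "c = glue ?B q y"
  have c0: "c \<in> T.T0" unfolding c_def by (rule glue_T0) (use yc y(2) in auto)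
  have cT: "c \<in> carrier T.T" using c0 by (rule T.T0_closed)
  have cardK: "card K = card (K - X) + card (x_part K)" if "K \<subseteq> P" for K
    using join_props(5)[OF join_split(1,2)[OF that]] join_split(3)[OF that] by simp
  have cs: "T.supp (\<lambda>K. K - X \<in> ?B \<and> card K = n) c"
  proof (rule T.supp_mono)
    show "T.supp (\<lambda>K. K - X \<in> ?B \<and> card (x_part K) = q) c" unfolding c_def by (rule supp_glue)
    fix K assume "K \<subseteq> P" "K - X \<in> ?B \<and> card (x_part K) = q"
    thus "K - X \<in> ?B \<and> card K = n" using cardK[of K] n by (simp add: positions_zs)
  qed
  have cs': "T.supp (\<lambda>K. card K = n \<and> p \<le> card (K - X)) c"
    by (rule T.supp_mono[OF cs]) (simp add: positions_zs)
  have sl: "slice I q c = y I" if "I \<in> ?B" for I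
    unfolding c_def using that yc by (intro slice_glue) (auto simp: positions_zs)
  have dX: "T.dif X c = \<zero>\<^bsub>T.T\<^esub>"
  proof (rule T.T_eqI[OF T.dif_closed[OF cT] T.T.M.zero_closed])
    fix K assume K: "K \<subseteq> P"
    have s: "T.supp (\<lambda>K. K - X \<in> ?B \<and> card K = Suc n) (T.dif X c)"
    proof (rule T.supp_dif[OF cs])
      fix K j assume K: "K \<subseteq> P" "j \<in> K" "j \<in> X" and *: "K - {j} - X \<in> ?B \<and> card (K - {j}) = n"
      have "K - {j} - X = K - X" using K by blast
      thus "K - X \<in> ?B \<and> card K = Suc n" using * T.card_Diff1[OF K(1,2)] by simp
    qed
    show "T.dif X c K = \<zero>\<^bsub>T.T\<^esub> K"
    proof (cases "K - X \<in> ?B \<and> card K = Suc n")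
      case True
      let ?I = "K - X"
      have IZ: "?I \<subseteq> Z" "card ?I = p" using True by (auto simp: positions_zs)
      interpret C: module A "cochains ?C (Suc q)" by (rule CX.cochains_module)
      have "slice ?I (Suc q) (T.dif X c) = sgn ?I \<odot>\<^bsub>cochains ?C (Suc q)\<^esub> differential ?C q (y ?I)"
        unfolding slice_dif[OF cT IZ(1)] using sl True by simp
      also have "\<dots> = slice ?I (Suc q) \<zero>\<^bsub>T.T\<^esub>"
        using y(1)[OF conjunct1[OF True]] unfolding slice_zero[OF IZ(1)] by (simp add: cocycles_def)
      finally show ?thesis unfolding eq_on_slice_iff[OF IZ(1)] using K True IZ(2) n by simp
    next
      case False
      thus ?thesis using s K unfolding T.supp_def T.T_apply(1)[OF K] by blast
    qed
  qed
  let ?d = "T.dif P c"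
  have d0: "?d \<in> T.T0" using c0 by (rule T.T0_dif)
  have ds: "T.supp (\<lambda>K. card K = Suc n \<and> p \<le> card (K - X)) ?d"
  proof (rule T.supp_dif[OF cs'])
    fix K j assume K: "K \<subseteq> P" "j \<in> K" and *: "card (K - {j}) = n \<and> p \<le> card (K - {j} - X)"
    have "card (K - {j} - X) \<le> card (K - X)" using K finite_subset[OF K(1)] by (intro card_mono) auto
    thus "card K = Suc n \<and> p \<le> card (K - X)" using * T.card_Diff1[OF K(1,2)] by simp
  qed
  have cl: "T.supp (\<lambda>K. p \<le> card (K - X)) c" using cs' by (rule T.supp_mono) simp
  have ds': "T.supp (\<lambda>K. card K = Suc n \<and> Suc p \<le> card (K - X)) ?d"
    unfolding T.supp_def
  proof (intro allI impI)
    fix K assume K: "K \<subseteq> P" "\<not> (card K = Suc n \<and> Suc p \<le> card (K - X))"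
    show "?d K = \<zero>\<^bsub>Y.mM X K\<^esub>"
    proof (cases "card (K - X) = p")
      case True
      show ?thesis using T.dif_at_level[OF ZX(2) cT cl K(1) True] unfolding dX T.T_apply(1)[OF K(1)] .
    next
      case False
      hence "\<not> (card K = Suc n \<and> p \<le> card (K - X))" using K(2) by auto
      thus ?thesis using ds K(1) unfolding T.supp_def by blast
    qed
  qed
  have ex': "T.slice_exact X I (Suc n)" if "I \<subseteq> P - X" "Suc p \<le> card I" "card I \<le> Suc n" for I
    using ex[of I] that unfolding ZX(4) by simp
  obtain g where g: "g \<in> T.T0" "T.supp (\<lambda>K. Suc (card K) = Suc n \<and> Suc p \<le> card (K - X)) g" "T.dif P g = ?d"
    using T.level_exact[OF ZX(2) ex' d0 ds' T.dif_dif[OF cT]] by blast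
  have gT: "g \<in> carrier T.T" using g(1) by (rule T.T0_closed)
  let ?c = "c \<ominus>\<^bsub>T.T\<^esub> g"
  have gs: "T.supp (\<lambda>K. card K = n \<and> p \<le> card (K - X)) g" by (rule T.supp_mono[OF g(2)]) auto
  have sl': "slice I q ?c = slice I q c" if I: "I \<in> ?B" for I
  proof -
    have IZ: "I \<subseteq> Z" "card I = p" using I by (auto simp: positions_zs)
    show ?thesis unfolding eq_on_slice_iff[OF IZ(1)]
    proof (intro allI impI)
      fix K assume K: "K \<subseteq> P" "K - X = I \<and> card K = card I + q"
      interpret K: module A "Y.mM X K" using T.M_module[OF K(1)] .
      have "g K = \<zero>\<^bsub>Y.mM X K\<^esub>" using g(2) K IZ(2) unfolding T.supp_def by simp
      thus "?c K = c K" unfolding T.T_apply(4)[OF K(1) cT gT] using T.T_in[OF cT K(1)] K.M.add.inv_one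
        by (simp add: a_minus_def a_inv_def)
    qed
  qed
  have "?c \<in> T.T0" using c0 g(1) by (rule T.T0_minus)
  moreover have "T.supp (\<lambda>K. card K = n \<and> p \<le> card (K - X)) ?c" by (rule T.supp_minus[OF cT gT cs' gs])
  moreover have "T.dif P ?c = \<zero>\<^bsub>T.T\<^esub>"
    unfolding T.dif_minus[OF cT gT] g(3) using T.T.M.minus_other_side[OF T.T0_closed[OF d0] T.T0_closed[OF d0]] by blast
  ultimately show ?thesis using sl sl' by auto
qed

end

section \<open>Dimensions\<close>

lemma linear_mapI:
  assumes "vectorspace K V" "vectorspace K W"
    and "\<And>v. v \<in> carrier V \<Longrightarrow> f v \<in> carrier W"
    and "\<And>v w. v \<in> carrier V \<Longrightarrow> w \<in> carrier V \<Longrightarrow> f (v \<oplus>\<^bsub>V\<^esub> w) = f v \<oplus>\<^bsub>W\<^esub> f w"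
    and "\<And>c v. c \<in> carrier K \<Longrightarrow> v \<in> carrier V \<Longrightarrow> f (c \<odot>\<^bsub>V\<^esub> v) = c \<odot>\<^bsub>W\<^esub> f v"
  shows "linear_map K V W f"
proof -
  interpret V: vectorspace K V by fact
  interpret W: vectorspace K W by fact
  have "f \<in> module_hom K V W" unfolding module_hom_def using assms by auto
  thus ?thesis by (intro linear_map.intro mod_hom.intro mod_hom_axioms.intro assms V.module_axioms W.module_axioms)
qed

lemma zero_space:
  assumes "vectorspace K V" and z: "carrier V = {\<zero>\<^bsub>V\<^esub>}"
  shows "vectorspace.fin_dim K V" "vectorspace.dim K V = 0"
proof -
  interpret V: vectorspace K V by fact
  have "V.span {} = carrier V" using V.span_empty z by simp
  hence gs: "V.gen_set {}" by simp
  thus "V.fin_dim" unfolding V.fin_dim_def by blast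
  show "V.dim = 0" using V.gen_ge_dim[of "{}"] gs by simp
qed

lemma subspaceI:
  assumes "vectorspace K V" "W \<subseteq> carrier V" "\<zero>\<^bsub>V\<^esub> \<in> W"
    and "\<And>v w. v \<in> W \<Longrightarrow> w \<in> W \<Longrightarrow> v \<oplus>\<^bsub>V\<^esub> w \<in> W" "\<And>c v. c \<in> carrier K \<Longrightarrow> v \<in> W \<Longrightarrow> c \<odot>\<^bsub>V\<^esub> v \<in> W"
  shows "VectorSpace.subspace K W V"
proof -
  interpret V: vectorspace K V by fact
  show ?thesis unfolding VectorSpace.subspace_def LinearCombinations.submodule_def
    using assms V.module_axioms by auto
qed

text \<open>A maximal linearly independent subset of the subspace exists since the dimension bounds cardinalities.\<close>

lemma subspace_fin_dim:
  assumes V: "vectorspace K V" "vectorspace.fin_dim K V" and W: "VectorSpace.subspace K W V"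
  shows "vectorspace.fin_dim K (V\<lparr>carrier := W\<rparr>)"
proof -
  interpret V: vectorspace K V by fact
  interpret W: vectorspace K "V\<lparr>carrier := W\<rparr>" by (rule V.subspace_is_vs[OF W])
  have sm: "LinearCombinations.submodule K W V" using W V.is_module by blast
  have sub: "W \<subseteq> carrier V" using sm by (simp add: LinearCombinations.submodule_def)
  let ?Q = "\<lambda>S. S \<subseteq> carrier (V\<lparr>carrier := W\<rparr>) \<and> W.lin_indpt S"
  have bound: "finite S \<and> card S \<le> V.dim" if S: "?Q S" for S
  proof -
    have "S \<subseteq> W" using S by simp
    hence "V.lin_indpt S" using V.span_li_not_depend(2)[OF _ sm] S by simp
    thus ?thesis using V.li_le_dim[OF V(2)] S sub by auto
  qed
  have "W.lin_indpt {}" unfolding W.lin_dep_def by simp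
  hence "?Q {}" by simp
  from maximal_exists[of ?Q V.dim "{}", OF bound this]
  obtain B where B: "finite B" "maximal B ?Q" by blast
  have "W.basis B" by (rule W.max_li_is_basis[OF B(2)])
  thus ?thesis unfolding W.fin_dim_def W.basis_def using B(1) by blast
qed

text \<open>Generators of the kernel together with preimages of generators of \<open>W\<close> generate \<open>V\<close>.\<close>

lemma extension_fin_dim:
  assumes T: "linear_map K V W T" and surj: "T ` carrier V = carrier W" and W: "vectorspace.fin_dim K W"
    and ker: "vectorspace.fin_dim K (V\<lparr>carrier := {v \<in> carrier V. T v = \<zero>\<^bsub>W\<^esub>}\<rparr>)"
  shows "vectorspace.fin_dim K V"
proof -
  interpret V: vectorspace K V using T by (rule linear_map.axioms)
  interpret W: vectorspace K W using T by (rule linear_map.axioms)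
  interpret T: linear_map K V W T by fact
  let ?U = "{v \<in> carrier V. T v = \<zero>\<^bsub>W\<^esub>}"
  have U: "VectorSpace.subspace K ?U V" using T.kerT_is_subspace unfolding T.ker_def .
  have Usm: "LinearCombinations.submodule K ?U V" using U V.is_module by blast
  interpret U: vectorspace K "V\<lparr>carrier := ?U\<rparr>" by (rule V.subspace_is_vs[OF U])
  obtain A where A: "finite A" "A \<subseteq> ?U" "U.span A = ?U" using ker unfolding U.fin_dim_def by auto
  have spanA: "V.span A = ?U" using V.span_li_not_depend(1)[OF A(2) Usm] A(3) by simp
  obtain B where B: "finite B" "B \<subseteq> carrier W" "W.span B = carrier W" using assms(3) unfolding W.fin_dim_def by blast
  have "\<forall>b\<in>B. \<exists>v. v \<in> carrier V \<and> T v = b"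
  proof
    fix b assume "b \<in> B"
    hence "b \<in> T ` carrier V" unfolding surj using B(2) by (rule rev_subsetD)
    thus "\<exists>v. v \<in> carrier V \<and> T v = b" by (auto simp: image_iff)
  qed
  from bchoice[OF this] obtain l where l: "\<forall>b\<in>B. l b \<in> carrier V \<and> T (l b) = b" by blast
  let ?C = "A \<union> l ` B"
  have C: "finite ?C" "?C \<subseteq> carrier V" using A B l by auto
  have sp: "LinearCombinations.submodule K (V.span ?C) V" by (rule V.span_is_submodule[OF C(2)])
  note spm = sp[unfolded LinearCombinations.submodule_def]
  have CsC: "?C \<subseteq> V.span ?C" by (rule V.in_own_span[OF C(2)])
  have im: "LinearCombinations.submodule K (T ` V.span ?C) W"
    unfolding LinearCombinations.submodule_def
  proof (intro conjI allI impI)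
    show "T ` V.span ?C \<subseteq> carrier W" using spm by auto
    show "\<zero>\<^bsub>W\<^esub> \<in> T ` V.span ?C" using spm T.f0_is_0 by (metis image_eqI)
    fix v w assume "v \<in> T ` V.span ?C" "w \<in> T ` V.span ?C"
    then obtain a b where ab: "a \<in> V.span ?C" "b \<in> V.span ?C" "v = T a" "w = T b" by blast
    hence "T (a \<oplus>\<^bsub>V\<^esub> b) = v \<oplus>\<^bsub>W\<^esub> w" using spm by (intro trans[OF T.f_add]) auto
    thus "v \<oplus>\<^bsub>W\<^esub> w \<in> T ` V.span ?C" using ab spm by (metis image_eqI)
  next
    fix c v assume "c \<in> carrier K" "v \<in> T ` V.span ?C"
    then obtain a where a: "c \<in> carrier K" "a \<in> V.span ?C" "v = T a" by blast
    hence "T (c \<odot>\<^bsub>V\<^esub> a) = c \<odot>\<^bsub>W\<^esub> v" using spm by (intro trans[OF T.f_smult]) auto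
    thus "c \<odot>\<^bsub>W\<^esub> v \<in> T ` V.span ?C" using a spm by (metis image_eqI)
  qed (rule W.module_axioms)
  have "B \<subseteq> T ` V.span ?C"
  proof
    fix b assume b: "b \<in> B"
    hence "l b \<in> V.span ?C" using CsC by blast
    thus "b \<in> T ` V.span ?C" using l b by force
  qed
  hence "carrier W \<subseteq> T ` V.span ?C" using W.span_is_subset[OF _ im] B(3) by blast
  have "carrier V \<subseteq> V.span ?C"
  proof
    fix v assume v: "v \<in> carrier V"
    then obtain u where u: "u \<in> V.span ?C" "T v = T u" using \<open>carrier W \<subseteq> _\<close> T.f_im by blast
    have uc: "u \<in> carrier V" using u(1) spm by blast
    have "T (v \<ominus>\<^bsub>V\<^esub> u) = \<zero>\<^bsub>W\<^esub>"
      using T.f_minus[OF v uc] u(2) T.f_im[OF uc] by simp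
    hence "v \<ominus>\<^bsub>V\<^esub> u \<in> V.span A" unfolding spanA using v uc by simp
    moreover have "V.span A \<subseteq> V.span ?C" by (rule V.span_is_monotone) simp
    ultimately have "(v \<ominus>\<^bsub>V\<^esub> u) \<oplus>\<^bsub>V\<^esub> u \<in> V.span ?C" using u(1) spm by blast
    thus "v \<in> V.span ?C" using v uc by (simp add: a_minus_def V.M.a_assoc V.M.l_neg)
  qed
  hence "V.gen_set ?C" using spm by auto
  thus ?thesis unfolding V.fin_dim_def using C by blast
qed

text \<open>By induction on \<open>X\<close>: the map that forgets the coordinate \<open>x\<close> is onto, and its kernel is a copy of \<open>H x\<close>.\<close>

lemma direct_sum_dim:
  assumes K: "field K" and "finite X" and "\<And>x. x \<in> X \<Longrightarrow> vectorspace K (H x)" "\<And>x. x \<in> X \<Longrightarrow> vectorspace.fin_dim K (H x)"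
  shows "vectorspace K (Defs.direct_sum X H) \<and> vectorspace.fin_dim K (Defs.direct_sum X H) \<and>
    vectorspace.dim K (Defs.direct_sum X H) = (\<Sum>x\<in>X. vectorspace.dim K (H x))"
  using assms(2-4)
proof (induction X)
  case empty
  interpret K: field K by fact
  have "module K (Defs.direct_sum {} H)" by (rule direct_sum_module) (rule K.is_cring, simp)
  hence vs: "vectorspace K (Defs.direct_sum {} H)" by (intro vectorspace.intro K)
  have "carrier (Defs.direct_sum {} H) = {\<zero>\<^bsub>Defs.direct_sum {} H\<^esub>}" by (simp add: restrict_def)
  from zero_space[OF vs this] show ?case using vs by simp
next
  case (insert x X)
  interpret K: field K by fact
  let ?V = "Defs.direct_sum (insert x X) H" and ?W = "Defs.direct_sum X H"
  have W: "vectorspace K ?W" "vectorspace.fin_dim K ?W" "vectorspace.dim K ?W = (\<Sum>x\<in>X. vectorspace.dim K (H x))"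
    using insert by auto
  have Hx: "vectorspace K (H x)" "vectorspace.fin_dim K (H x)" using insert by auto
  interpret Hx: vectorspace K "H x" by fact
  have mH: "module K (H y)" if "y \<in> insert x X" for y using insert that by (intro vectorspace.axioms(1)) auto
  have "module K ?V" by (rule direct_sum_module[OF K.is_cring mH])
  hence vs: "vectorspace K ?V" by (intro vectorspace.intro K)
  interpret V: vectorspace K ?V by fact
  interpret T: linear_map K ?V ?W "\<lambda>f. restrict f X"
    by (rule linear_mapI[OF vs W(1)]) (auto intro!: restrict_ext)
  let ?ext = "\<lambda>g h. (\<lambda>y\<in>insert x X. if y = x then h else g y)"
  have surj: "(\<lambda>f. restrict f X) ` carrier ?V = carrier ?W"
  proof (intro equalityI subsetI)
    fix g assume g: "g \<in> carrier ?W"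
    have "?ext g \<zero>\<^bsub>H x\<^esub> \<in> carrier ?V" using g by (auto simp: PiE_iff)
    thus "g \<in> (\<lambda>f. restrict f X) ` carrier ?V"
    proof (rule rev_image_eqI)
      show "g = restrict (?ext g \<zero>\<^bsub>H x\<^esub>) X"
        using g insert(2) by (intro extensionalityI[of _ X]) (auto simp: PiE_iff)
    qed
  next
    fix g assume "g \<in> (\<lambda>f. restrict f X) ` carrier ?V"
    thus "g \<in> carrier ?W" using T.f_im by blast
  qed
  let ?U = "{f \<in> carrier ?V. restrict f X = \<zero>\<^bsub>?W\<^esub>}"
  have U: "VectorSpace.subspace K ?U ?V" using T.kerT_is_subspace unfolding T.ker_def .
  have vU: "vectorspace K (?V\<lparr>carrier := ?U\<rparr>)" by (rule V.subspace_is_vs[OF U])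
  let ?S = "\<lambda>h. (\<lambda>y\<in>insert x X. if y = x then h else \<zero>\<^bsub>H y\<^esub>)"
  have z0: "\<zero>\<^bsub>H y\<^esub> \<oplus>\<^bsub>H y\<^esub> \<zero>\<^bsub>H y\<^esub> = \<zero>\<^bsub>H y\<^esub>" "\<zero>\<^bsub>H y\<^esub> \<in> carrier (H y)" "c \<in> carrier K \<Longrightarrow> c \<odot>\<^bsub>H y\<^esub> \<zero>\<^bsub>H y\<^esub> = \<zero>\<^bsub>H y\<^esub>"
    if "y \<in> X" for y c
  proof -
    interpret module K "H y" using mH[of y] that by simp
    show "\<zero>\<^bsub>H y\<^esub> \<oplus>\<^bsub>H y\<^esub> \<zero>\<^bsub>H y\<^esub> = \<zero>\<^bsub>H y\<^esub>" "\<zero>\<^bsub>H y\<^esub> \<in> carrier (H y)" "c \<in> carrier K \<Longrightarrow> c \<odot>\<^bsub>H y\<^esub> \<zero>\<^bsub>H y\<^esub> = \<zero>\<^bsub>H y\<^esub>" by auto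
  qed
  have S: "linear_map K (H x) (?V\<lparr>carrier := ?U\<rparr>) ?S"
  proof (rule linear_mapI[OF Hx(1) vU])
    fix h assume "h \<in> carrier (H x)"
    thus "?S h \<in> carrier (?V\<lparr>carrier := ?U\<rparr>)" using insert(2) z0 by (auto intro!: restrict_ext)
  qed (use insert(2) z0 in \<open>auto intro!: restrict_ext\<close>)
  interpret S: linear_map K "H x" "?V\<lparr>carrier := ?U\<rparr>" ?S by fact
  have Ssurj: "?S ` carrier (H x) = carrier (?V\<lparr>carrier := ?U\<rparr>)"
  proof (intro equalityI subsetI)
    fix f assume f: "f \<in> carrier (?V\<lparr>carrier := ?U\<rparr>)"
    have "?S (f x) = f"
    proof (rule extensionalityI[of _ "insert x X"])
      fix y assume y: "y \<in> insert x X"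
      have r: "restrict f X = \<zero>\<^bsub>?W\<^esub>" using f by simp
      have "f y = \<zero>\<^bsub>H y\<^esub>" if "y \<in> X" using fun_cong[OF r, of y] that by simp
      thus "?S (f x) y = f y" using y by auto
    qed (use f in \<open>auto simp: PiE_iff\<close>)
    moreover have "f x \<in> carrier (H x)" using f by auto
    ultimately show "f \<in> ?S ` carrier (H x)" by (rule_tac image_eqI[OF sym])
  qed (use S.f_im in blast)
  have Sinj: "inj_on ?S (carrier (H x))"
    by (rule inj_onI) (auto dest!: fun_cong[of _ _ x])
  have kf: "vectorspace.fin_dim K (?V\<lparr>carrier := ?U\<rparr>)" by (rule S.surj_fin_dim[OF Hx(2) Ssurj])
  have fd: "V.fin_dim" by (rule extension_fin_dim[OF T.linear_map_axioms surj W(2) kf])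
  have imW: "?W\<lparr>carrier := T.imT\<rparr> = ?W" using surj unfolding T.im_def by (simp add: Defs.direct_sum_def)
  have "V.dim = vectorspace.dim K ?W + vectorspace.dim K (?V\<lparr>carrier := ?U\<rparr>)"
    using T.rank_nullity[OF fd] unfolding imW T.ker_def by simp
  also have "vectorspace.dim K (?V\<lparr>carrier := ?U\<rparr>) = vectorspace.dim K (H x)"
    by (rule S.dim_eq[OF Hx(2) Sinj Ssurj, symmetric])
  finally have "V.dim = (\<Sum>x\<in>insert x X. vectorspace.dim K (H x))" using W(3) insert(1,2) by simp
  thus ?case using vs fd by blast
qed

lemma direct_sum_summand_fin_dim:
  assumes V: "vectorspace K (Defs.direct_sum X H)" "vectorspace.fin_dim K (Defs.direct_sum X H)"
    and H: "\<And>x. x \<in> X \<Longrightarrow> vectorspace K (H x)" and x: "x \<in> X"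
  shows "vectorspace.fin_dim K (H x)"
proof -
  interpret L: linear_map K "Defs.direct_sum X H" "H x" "\<lambda>f. f x"
    by (rule linear_mapI[OF V(1) H[OF x]]) (use x in auto)
  have surj: "(\<lambda>f. f x) ` carrier (Defs.direct_sum X H) = carrier (H x)"
  proof (intro equalityI subsetI)
    fix h assume h: "h \<in> carrier (H x)"
    have "\<zero>\<^bsub>H y\<^esub> \<in> carrier (H y)" if "y \<in> X" for y
    proof -
      interpret vectorspace K "H y" using H[OF that] .
      show ?thesis by simp
    qed
    hence "(\<lambda>y\<in>X. if y = x then h else \<zero>\<^bsub>H y\<^esub>) \<in> carrier (Defs.direct_sum X H)" using h by auto
    thus "h \<in> (\<lambda>f. f x) ` carrier (Defs.direct_sum X H)"
      by (rule rev_image_eqI) (use x in simp)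
  qed (use x in auto)
  show ?thesis by (rule L.surj_fin_dim[OF V(2) surj])
qed

text \<open>By linearity, \<open>zero\<close> says that each side of the relation determines the other. Such a relation is the
  graph of an isomorphism, and its use avoids choosing representatives compatibly.\<close>

lemma linear_relation_iso:
  assumes U: "vectorspace K U" and V: "vectorspace K V"
    and left: "\<And>u. u \<in> carrier U \<Longrightarrow> \<exists>v \<in> carrier V. R u v"
    and right: "\<And>v. v \<in> carrier V \<Longrightarrow> \<exists>u \<in> carrier U. R u v"
    and add: "\<And>u u' v v'. \<lbrakk> u \<in> carrier U; u' \<in> carrier U; v \<in> carrier V; v' \<in> carrier V; R u v; R u' v' \<rbrakk> \<Longrightarrow>
      R (u \<oplus>\<^bsub>U\<^esub> u') (v \<oplus>\<^bsub>V\<^esub> v')"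
    and smult: "\<And>c u v. \<lbrakk> c \<in> carrier K; u \<in> carrier U; v \<in> carrier V; R u v \<rbrakk> \<Longrightarrow> R (c \<odot>\<^bsub>U\<^esub> u) (c \<odot>\<^bsub>V\<^esub> v)"
    and zero: "\<And>u v. \<lbrakk> u \<in> carrier U; v \<in> carrier V; R u v \<rbrakk> \<Longrightarrow> u = \<zero>\<^bsub>U\<^esub> \<longleftrightarrow> v = \<zero>\<^bsub>V\<^esub>"
    and fd: "vectorspace.fin_dim K U"
  shows "vectorspace.fin_dim K V" "vectorspace.dim K U = vectorspace.dim K V"
proof -
  interpret U: vectorspace K U by fact
  interpret V: vectorspace K V by fact
  have diff: "R (u \<ominus>\<^bsub>U\<^esub> u') (v \<ominus>\<^bsub>V\<^esub> v')"
    if "u \<in> carrier U" "u' \<in> carrier U" "v \<in> carrier V" "v' \<in> carrier V" "R u v" "R u' v'" for u u' v v'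
  proof -
    have m: "\<ominus>\<^bsub>K\<^esub> \<one>\<^bsub>K\<^esub> \<in> carrier K" by simp
    have "R (u \<oplus>\<^bsub>U\<^esub> (\<ominus>\<^bsub>K\<^esub> \<one>\<^bsub>K\<^esub>) \<odot>\<^bsub>U\<^esub> u') (v \<oplus>\<^bsub>V\<^esub> (\<ominus>\<^bsub>K\<^esub> \<one>\<^bsub>K\<^esub>) \<odot>\<^bsub>V\<^esub> v')"
      using that m by (intro add smult U.smult_closed V.smult_closed)
    moreover have "(\<ominus>\<^bsub>K\<^esub> \<one>\<^bsub>K\<^esub>) \<odot>\<^bsub>U\<^esub> u' = \<ominus>\<^bsub>U\<^esub> u'" "(\<ominus>\<^bsub>K\<^esub> \<one>\<^bsub>K\<^esub>) \<odot>\<^bsub>V\<^esub> v' = \<ominus>\<^bsub>V\<^esub> v'"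
      using U.smult_l_minus[OF U.R.one_closed that(2)] V.smult_l_minus[OF U.R.one_closed that(4)]
        U.smult_one[OF that(2)] V.smult_one[OF that(4)] by simp_all
    ultimately show ?thesis by (simp add: a_minus_def)
  qed
  have "\<forall>u\<in>carrier U. \<exists>v. v \<in> carrier V \<and> R u v" using left by blast
  from bchoice[OF this] obtain T where T: "\<And>u. u \<in> carrier U \<Longrightarrow> T u \<in> carrier V" "\<And>u. u \<in> carrier U \<Longrightarrow> R u (T u)"
    by blast
  have unique: "T u = v" if "u \<in> carrier U" "v \<in> carrier V" "R u v" for u v
  proof -
    have "R (u \<ominus>\<^bsub>U\<^esub> u) (T u \<ominus>\<^bsub>V\<^esub> v)" using that T by (intro diff)
    moreover have "u \<ominus>\<^bsub>U\<^esub> u = \<zero>\<^bsub>U\<^esub>" using that by simp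
    ultimately have "T u \<ominus>\<^bsub>V\<^esub> v = \<zero>\<^bsub>V\<^esub>" using zero[of "\<zero>\<^bsub>U\<^esub>" "T u \<ominus>\<^bsub>V\<^esub> v"] T(1)[OF that(1)] that(2) by simp
    thus ?thesis using T(1)[OF that(1)] that(2) by simp
  qed
  interpret L: linear_map K U V T
    by (rule linear_mapI[OF U V]) (use T in \<open>auto intro!: unique add smult\<close>)
  have inj: "inj_on T (carrier U)"
  proof (rule inj_onI)
    fix u u' assume u: "u \<in> carrier U" "u' \<in> carrier U" and e: "T u = T u'"
    have "R (u \<ominus>\<^bsub>U\<^esub> u') (T u \<ominus>\<^bsub>V\<^esub> T u')" using u T by (intro diff)
    moreover have "T u \<ominus>\<^bsub>V\<^esub> T u' = \<zero>\<^bsub>V\<^esub>" using e T(1)[OF u(2)] by simp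
    ultimately have "u \<ominus>\<^bsub>U\<^esub> u' = \<zero>\<^bsub>U\<^esub>" using zero[of "u \<ominus>\<^bsub>U\<^esub> u'" "\<zero>\<^bsub>V\<^esub>"] u by simp
    thus "u = u'" using u by simp
  qed
  have surj: "T ` carrier U = carrier V"
    using T(1) right unique by (auto simp: image_iff) metis
  show "V.fin_dim" by (rule L.surj_fin_dim[OF fd surj])
  show "U.dim = V.dim" by (rule L.dim_eq[OF fd inj surj])
qed

section \<open>Standard graded algebras\<close>

context graded_ring
begin

lemma homogeneous_induct [consumes 1, case_names zero add homogeneous]:
  assumes "a \<in> carrier A" and zero: "Q \<zero>"
    and add: "\<And>x y. x \<in> carrier A \<Longrightarrow> y \<in> carrier A \<Longrightarrow> Q x \<Longrightarrow> Q y \<Longrightarrow> Q (x \<oplus> y)"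
    and hom: "\<And>p x. x \<in> G p \<Longrightarrow> Q x"
  shows "Q a"
proof -
  have fin: "finite {i. hcomp i a \<noteq> \<zero>}" using hcomp_family[OF assms(1)] by simp
  have hc: "hcomp i a \<in> carrier A" for i using assms(1) by (rule hcomp_closed)
  have "Q (\<Oplus>i\<in>B. hcomp i a)" if "finite B" for B
    using that
  proof (induction B)
    case (insert b B)
    have "(\<Oplus>i\<in>B. hcomp i a) \<in> carrier A" using hc by (intro finsum_closed) auto
    thus ?case using insert hc add[OF hc _ hom[OF hcomp_G[OF assms(1)]]] by simp
  qed (simp add: zero)
  from this[OF fin] show ?thesis using hcomp_sum[OF assms(1) fin order_refl] by simp
qed

text \<open>The ring is generated additively by homogeneous elements, so that these suffice as multipliers.\<close>

lemma homogeneous_idealI: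
  assumes J: "J \<subseteq> carrier A" "\<zero> \<in> J" "\<And>x y. x \<in> J \<Longrightarrow> y \<in> J \<Longrightarrow> x \<oplus> y \<in> J"
    and hom: "\<And>p a y. a \<in> G p \<Longrightarrow> y \<in> J \<Longrightarrow> a \<otimes> y \<in> J"
  shows "ideal J A"
proof (rule idealI)
  have mult: "a \<otimes> y \<in> J" if "a \<in> carrier A" and y: "y \<in> J" for a y
    using that(1)
  proof (induction a rule: homogeneous_induct)
    case zero
    thus ?case using J(1,2) y by auto
  next
    case (add u v)
    hence "(u \<oplus> v) \<otimes> y = u \<otimes> y \<oplus> v \<otimes> y" using y J(1) by (intro l_distr) auto
    thus ?case using add J(3) by simp
  qed (rule hom[OF _ y])
  show "ring A" ..
  show "subgroup J (add_monoid A)"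
  proof (rule add.subgroupI)
    show "\<ominus> a \<in> J" if "a \<in> J" for a
      using mult[OF _ that, of "\<ominus> \<one>"] that J(1) by (auto simp: l_minus)
  qed (use J in auto)
  show "x \<otimes> a \<in> J" if "a \<in> J" "x \<in> carrier A" for a x using mult that by blast
  show "a \<otimes> x \<in> J" if "a \<in> J" "x \<in> carrier A" for a x
    using mult[OF that(2,1)] m_comm[of a x] that J(1) by auto
qed

abbreviation irr :: "'a set" where "irr \<equiv> irrelevant_ideal A G"

lemma irr_ideal: "ideal irr A"
  unfolding irrelevant_ideal_def by (rule genideal_ideal) (auto intro: G_closed)

lemma G_irr: "1 \<le> i \<Longrightarrow> G i \<subseteq> irr"
proof -
  assume i: "1 \<le> i"
  have "(\<Union>i\<in>{1..}. G i) \<subseteq> irr"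
    unfolding irrelevant_ideal_def by (rule genideal_self) (auto intro: G_closed)
  thus ?thesis using i by auto
qed

lemma degree_zero_ideal: "ideal {a \<in> carrier A. hcomp 0 a = \<zero>} A"
proof (rule homogeneous_idealI)
  fix p a y assume a: "a \<in> G p" and y: "y \<in> {a \<in> carrier A. hcomp 0 a = \<zero>}"
  thus "a \<otimes> y \<in> {a \<in> carrier A. hcomp 0 a = \<zero>}" using hcomp_mult[OF a, of y 0] G_closed[OF a] by auto
qed (auto simp: hcomp_zero hcomp_add)

lemma irr_iff: "a \<in> irr \<longleftrightarrow> a \<in> carrier A \<and> hcomp 0 a = \<zero>"
proof
  assume a: "a \<in> irr"
  have "irr \<subseteq> {a \<in> carrier A. hcomp 0 a = \<zero>}"
    unfolding irrelevant_ideal_def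
    by (rule genideal_minimal[OF degree_zero_ideal]) (auto simp: G_closed hcomp_homogeneous)
  thus "a \<in> carrier A \<and> hcomp 0 a = \<zero>" using a by blast
next
  interpret I: ideal irr A by (rule irr_ideal)
  assume a: "a \<in> carrier A \<and> hcomp 0 a = \<zero>"
  have "a \<ominus> hcomp 0 a \<in> irr" if "a \<in> carrier A" for a
    using that
  proof (induction a rule: homogeneous_induct)
    case zero
    show ?case by (simp add: hcomp_zero a_minus_def)
  next
    case (add x y)
    have "(x \<oplus> y) \<ominus> hcomp 0 (x \<oplus> y) = (x \<ominus> hcomp 0 x) \<oplus> (y \<ominus> hcomp 0 y)"
      using add(1,2) hcomp_closed by (simp add: hcomp_add a_minus_def minus_add a_ac)
    thus ?case using add(3,4) by simp
  next
    case (homogeneous p x)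
    hence xc: "x \<in> carrier A" by (rule G_closed)
    show ?case
    proof (cases "p = 0")
      case True
      thus ?thesis using homogeneous xc by (simp add: hcomp_homogeneous[OF homogeneous] a_minus_def r_neg)
    next
      case False
      hence "x \<in> irr" using homogeneous G_irr[of p] by auto
      thus ?thesis using False xc by (simp add: hcomp_homogeneous[OF homogeneous] a_minus_def)
    qed
  qed
  thus "a \<in> irr" using a by (metis a_minus_def minus_zero r_zero)
qed

lemma irr_degree_zero: "z \<in> irr \<Longrightarrow> z \<in> G 0 \<Longrightarrow> z = \<zero>"
  using irr_iff hcomp_homogeneous[of z 0 0] by simp

lemma hcomp_0_mult:
  assumes a: "a \<in> carrier A" and b: "b \<in> carrier A"
  shows "hcomp 0 (a \<otimes> b) = hcomp 0 a \<otimes> hcomp 0 b"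
  using a
proof (induction a rule: homogeneous_induct)
  case zero
  thus ?case using b by (simp add: hcomp_zero hcomp_closed)
next
  case (add x y)
  thus ?case using b by (simp add: l_distr hcomp_add hcomp_closed)
next
  case (homogeneous p x)
  thus ?case using hcomp_mult[OF homogeneous b, of 0] G_closed[OF homogeneous] hcomp_closed[OF b]
    by (simp add: hcomp_homogeneous[OF homogeneous])
qed

text \<open>The elements without constant term whose linear part lies in \<open>U\<close> form an ideal, because in a product
  with such an element only the constant term of the other factor affects the linear part.\<close>

lemma linear_parts_span:
  assumes S: "S \<subseteq> carrier A" "Idl S = irr"
    and U: "\<zero> \<in> U" "\<And>x y. x \<in> U \<Longrightarrow> y \<in> U \<Longrightarrow> x \<oplus> y \<in> U" "\<And>c x. c \<in> G 0 \<Longrightarrow> x \<in> U \<Longrightarrow> c \<otimes> x \<in> U"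
    and SU: "\<And>s. s \<in> S \<Longrightarrow> hcomp 1 s \<in> U"
  shows "G 1 \<subseteq> U"
proof -
  define J where "J = {y \<in> carrier A. hcomp 0 y = \<zero> \<and> hcomp 1 y \<in> U}"
  have "ideal J A"
  proof (rule homogeneous_idealI)
    fix p a y assume a: "a \<in> G p" and y: "y \<in> J"
    have "hcomp 1 (a \<otimes> y) \<in> U"
    proof -
      consider "p = 0" | "p = 1" | "1 < p" by linarith
      thus ?thesis
      proof cases
        case 1
        thus ?thesis using hcomp_mult[OF a, of y 1] y a U(3) by (auto simp: J_def)
      next
        case 2
        thus ?thesis using hcomp_mult[OF a, of y 1] y a U(1) G_closed[OF a] by (auto simp: J_def)
      next
        case 3
        thus ?thesis using hcomp_mult[OF a, of y 1] y U(1) by (auto simp: J_def)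
      qed
    qed
    moreover have "hcomp 0 (a \<otimes> y) = \<zero>" using hcomp_mult[OF a, of y 0] y G_closed[OF a] by (auto simp: J_def)
    ultimately show "a \<otimes> y \<in> J" using y G_closed[OF a] by (auto simp: J_def)
  qed (use U in \<open>auto simp: J_def hcomp_zero hcomp_add\<close>)
  moreover have "S \<subseteq> J"
  proof
    fix s assume s: "s \<in> S"
    have "s \<in> irr" using genideal_self[OF S(1)] s S(2) by blast
    thus "s \<in> J" using irr_iff SU[OF s] by (simp add: J_def)
  qed
  ultimately have "irr \<subseteq> J" using genideal_minimal S(2) by blast
  show ?thesis
  proof
    fix y assume y: "y \<in> G 1"
    hence "y \<in> J" using G_irr[of 1] \<open>irr \<subseteq> J\<close> by auto
    thus "y \<in> U" using y by (simp add: J_def hcomp_homogeneous)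
  qed
qed

text \<open>A form of degree \<open>m > 0\<close> is a sum of products of generators with forms of smaller degree, to which
  induction applies. Being spanned by \<open>B\<close> is expressed by the subspaces that contain \<open>B\<close>.\<close>

lemma finite_spanning_set:
  assumes xs: "finite X" "X \<subseteq> (\<Union>p. G p)" "Idl X = irr"
  shows "\<exists>B. finite B \<and> B \<subseteq> G m \<and> (\<forall>U. U \<subseteq> carrier A \<longrightarrow> \<zero> \<in> U \<longrightarrow> (\<forall>x\<in>U. \<forall>y\<in>U. x \<oplus> y \<in> U) \<longrightarrow>
    (\<forall>c\<in>G 0. \<forall>x\<in>U. c \<otimes> x \<in> U) \<longrightarrow> B \<subseteq> U \<longrightarrow> G m \<subseteq> U)"
proof (induction m rule: less_induct)
  case (less m)
  have Xc: "X \<subseteq> carrier A" using xs(2) G_closed by blast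
  show ?case
  proof (cases "m = 0")
    case True
    have "G 0 \<subseteq> U" if "\<forall>c\<in>G 0. \<forall>x\<in>U. c \<otimes> x \<in> U" "{\<one>} \<subseteq> U" for U
    proof
      fix c assume c: "c \<in> G 0"
      hence "c \<otimes> \<one> \<in> U" using that by blast
      thus "c \<in> U" using G_closed[OF c] by simp
    qed
    thus ?thesis using True one_homogeneous by (intro exI[of _ "{\<one>}"]) auto
  next
    case False
    let ?B = "\<lambda>k B. finite B \<and> B \<subseteq> G k \<and> (\<forall>U. U \<subseteq> carrier A \<longrightarrow> \<zero> \<in> U \<longrightarrow> (\<forall>x\<in>U. \<forall>y\<in>U. x \<oplus> y \<in> U) \<longrightarrow>
      (\<forall>c\<in>G 0. \<forall>x\<in>U. c \<otimes> x \<in> U) \<longrightarrow> B \<subseteq> U \<longrightarrow> G k \<subseteq> U)"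
    have "\<forall>k\<in>{..<m}. \<exists>B. ?B k B" using less by blast
    from bchoice[OF this] obtain B where B: "\<forall>k\<in>{..<m}. ?B k (B k)" by blast
    let ?X = "{x \<in> X. 1 \<le> hdeg G x \<and> hdeg G x \<le> m}"
    define C where "C = (\<Union>x\<in>?X. (\<lambda>b. x \<otimes> b) ` B (m - hdeg G x))"
    have deg: "x \<in> G (hdeg G x)" if "x \<in> X" for x using that xs(2) hdeg_mem by blast
    have finC: "finite C" unfolding C_def
    proof (intro finite_UN_I finite_imageI)
      fix x assume "x \<in> ?X"
      hence "m - hdeg G x \<in> {..<m}" by auto
      thus "finite (B (m - hdeg G x))" using B by blast
    qed (use xs(1) in simp)
    have CG: "C \<subseteq> G m"
    proof
      fix c assume "c \<in> C"
      then obtain x b where x: "x \<in> X" "1 \<le> hdeg G x" "hdeg G x \<le> m" "b \<in> B (m - hdeg G x)" "c = x \<otimes> b"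
        unfolding C_def by blast
      have "m - hdeg G x \<in> {..<m}" using x(2,3) by auto
      hence "b \<in> G (m - hdeg G x)" using B x(4) by blast
      thus "c \<in> G m" using component_mult[OF deg[OF x(1)], of b "m - hdeg G x"] x(3,5) by simp
    qed
    have "G m \<subseteq> U" if U: "U \<subseteq> carrier A" "\<zero> \<in> U" "\<forall>x\<in>U. \<forall>y\<in>U. x \<oplus> y \<in> U" "\<forall>c\<in>G 0. \<forall>x\<in>U. c \<otimes> x \<in> U" and CU: "C \<subseteq> U" for U
    proof -
      have gen: "hcomp m (a \<otimes> x) \<in> U" if x: "x \<in> X" and a: "a \<in> carrier A" for a x
      proof -
        have xc: "x \<in> carrier A" using x Xc by blast
        have xi: "x \<in> irr" using genideal_self[OF Xc] x xs(3) by blast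
        have e: "hcomp m (a \<otimes> x) = (if m < hdeg G x then \<zero> else x \<otimes> hcomp (m - hdeg G x) a)"
          using hcomp_mult[OF deg[OF x] a, of m] m_comm[OF xc a] by simp
        consider "hdeg G x = 0" | "m < hdeg G x" | "x \<in> ?X" using x by fastforce
        thus ?thesis
        proof cases
          case 1
          hence "x = \<zero>" using irr_degree_zero[OF xi] deg[OF x] by simp
          thus ?thesis using a U(2) by (simp add: hcomp_zero)
        next
          case 2
          thus ?thesis using e U(2) by simp
        next
          case 3
          let ?k = "m - hdeg G x"
          have k: "?k \<in> {..<m}" using 3 by auto
          \<comment> \<open>The induction hypothesis is applied to the inverse image of \<open>U\<close> under multiplication by \<open>x\<close>.\<close>
          let ?U = "{b \<in> carrier A. x \<otimes> b \<in> U}"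
          have "G ?k \<subseteq> ?U"
          proof -
            have "?U \<subseteq> carrier A" "\<zero> \<in> ?U" using xc U(2) by auto
            moreover have "\<forall>u\<in>?U. \<forall>v\<in>?U. u \<oplus> v \<in> ?U" using xc U(3) by (auto simp: r_distr)
            moreover have "\<forall>c\<in>G 0. \<forall>u\<in>?U. c \<otimes> u \<in> ?U"
            proof (intro ballI)
              fix c u assume c: "c \<in> G 0" and u: "u \<in> ?U"
              have "x \<otimes> (c \<otimes> u) = c \<otimes> (x \<otimes> u)" using G_closed[OF c] u xc by (simp add: m_lcomm)
              thus "c \<otimes> u \<in> ?U" using U(4) c u G_closed[OF c] by auto
            qed
            moreover have "B ?k \<subseteq> ?U"
            proof
              fix b assume b: "b \<in> B ?k"
              hence "b \<in> G ?k" using B k by blast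
              hence "b \<in> carrier A" by (rule G_closed)
              moreover have "x \<otimes> b \<in> C" unfolding C_def using 3 b by blast
              ultimately show "b \<in> ?U" using CU by blast
            qed
            moreover have "\<forall>U. U \<subseteq> carrier A \<longrightarrow> \<zero> \<in> U \<longrightarrow> (\<forall>x\<in>U. \<forall>y\<in>U. x \<oplus> y \<in> U) \<longrightarrow>
                (\<forall>c\<in>G 0. \<forall>x\<in>U. c \<otimes> x \<in> U) \<longrightarrow> B ?k \<subseteq> U \<longrightarrow> G ?k \<subseteq> U" using B k by blast
            ultimately show ?thesis by (elim allE[of _ ?U]) (simp only: HOL.simp_thms)
          qed
          thus ?thesis using e 3 hcomp_G[OF a, of ?k] by auto
        qed
      qed
      define J where "J = {y \<in> carrier A. \<forall>b\<in>carrier A. hcomp m (b \<otimes> y) \<in> U}"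
      have "ideal J A"
      proof (rule homogeneous_idealI)
        show "\<zero> \<in> J" using U(2) by (simp add: J_def hcomp_zero)
        show "x \<oplus> y \<in> J" if "x \<in> J" "y \<in> J" for x y using that U(3) by (simp add: J_def r_distr hcomp_add)
        fix p a y assume a: "a \<in> G p" and y: "y \<in> J"
        have "b \<otimes> (a \<otimes> y) = (b \<otimes> a) \<otimes> y" if "b \<in> carrier A" for b
          using that y G_closed[OF a] by (simp add: J_def m_assoc)
        thus "a \<otimes> y \<in> J" using y G_closed[OF a] by (simp add: J_def)
      qed (auto simp: J_def)
      moreover have "X \<subseteq> J" unfolding J_def using gen Xc by blast
      ultimately have "irr \<subseteq> J" using genideal_minimal xs(3) by blast
      show ?thesis
      proof
        fix y assume y: "y \<in> G m"
        hence "y \<in> J" using G_irr[of m] False \<open>irr \<subseteq> J\<close> by auto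
        hence "hcomp m (\<one> \<otimes> y) \<in> U" unfolding J_def using one_closed by blast
        thus "y \<in> U" using y G_closed[OF y] by (simp add: hcomp_homogeneous)
      qed
    qed
    thus ?thesis using finC CG by (intro exI[of _ C]) simp
  qed
qed

end

context standard_graded_algebra
begin

abbreviation "k \<equiv> base_field A G"

lemma k_carrier [simp]: "carrier k = G 0"
  by (simp add: base_field_def)

lemma k_vectorspace:
  assumes N: "module A N"
    and U: "U \<subseteq> carrier N" "\<zero>\<^bsub>N\<^esub> \<in> U" "\<And>x y. x \<in> U \<Longrightarrow> y \<in> U \<Longrightarrow> x \<oplus>\<^bsub>N\<^esub> y \<in> U"
      "\<And>c x. c \<in> G 0 \<Longrightarrow> x \<in> U \<Longrightarrow> c \<odot>\<^bsub>N\<^esub> x \<in> U"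
  shows "vectorspace k (N\<lparr>carrier := U\<rparr>)"
proof -
  have "cring (A\<lparr>carrier := G 0\<rparr>)" using domain.axioms(1)[OF field.axioms(1)[OF field_base]] by (simp add: base_field_def)
  hence "module (A\<lparr>carrier := G 0\<rparr>) (N\<lparr>carrier := U\<rparr>)"
    using U G_closed by (intro submodule_over_subring[OF N]) auto
  thus ?thesis by (intro vectorspace.intro field_base) (simp add: base_field_def)
qed

lemma one_not_zero: "\<one> \<noteq> \<zero>"
proof -
  show ?thesis using domain.one_not_zero[OF field.axioms(1)[OF field_base]] by (simp add: base_field_def)
qed

lemma irr_prime:
  assumes a: "a \<in> carrier A" and b: "b \<in> carrier A" and ab: "a \<otimes> b \<in> irr"
  shows "a \<in> irr \<or> b \<in> irr"
proof -
  have "hcomp 0 a \<otimes>\<^bsub>k\<^esub> hcomp 0 b = \<zero>\<^bsub>k\<^esub>"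
    using ab hcomp_0_mult[OF a b] by (simp add: base_field_def irr_iff)
  hence "hcomp 0 a = \<zero>\<^bsub>k\<^esub> \<or> hcomp 0 b = \<zero>\<^bsub>k\<^esub>"
    using domain.integral[OF field.axioms(1)[OF field_base], of "hcomp 0 a" "hcomp 0 b"] hcomp_G a b by simp
  thus ?thesis using a b by (simp add: base_field_def irr_iff)
qed

lemma irr_power: "a \<in> carrier A \<Longrightarrow> a [^] (N::nat) \<in> irr \<Longrightarrow> a \<in> irr"
proof (induction N)
  case 0
  hence "\<one> \<in> irr" by simp
  thus ?case using one_not_zero hcomp_homogeneous[OF one_homogeneous, of 0] by (simp add: irr_iff)
next
  case (Suc N)
  thus ?case using irr_prime[of "a [^] N" a] by auto
qed

lemma irr_primary: "primary_to A irr irr"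
  unfolding primary_to_def
proof (intro conjI ballI impI irr_ideal)
  show "irr \<noteq> carrier A" using one_not_zero hcomp_homogeneous[OF one_homogeneous, of 0] irr_iff[of \<one>] by auto
  show "a \<in> irr \<or> (\<exists>m::nat. b [^] m \<in> irr)" if "a \<in> carrier A" "b \<in> carrier A" "a \<otimes> b \<in> irr" for a b
  proof -
    have "b [^] (1::nat) = b" using that(2) by simp
    thus ?thesis using irr_prime[OF that] by metis
  qed
  show "{a \<in> carrier A. \<exists>m::nat. a [^] m \<in> irr} = irr"
  proof (intro equalityI subsetI)
    fix a assume a: "a \<in> irr"
    hence "a \<in> carrier A" by (simp add: irr_iff)
    moreover from this have "a [^] (1::nat) \<in> irr" using a by simp
    ultimately show "a \<in> {a \<in> carrier A. \<exists>m::nat. a [^] m \<in> irr}" by blast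
  qed (use irr_power in blast)
qed

text \<open>Modulo the ideal generated by the linear forms, every polynomial expression in constants and linear forms
  is congruent to a constant; for a form of positive degree that constant is zero.\<close>

lemma G_in_Idl_G1:
  assumes "1 \<le> i"
  shows "G i \<subseteq> Idl (G 1)"
proof -
  have G1: "G 1 \<subseteq> carrier A" using G_closed by auto
  interpret J: ideal "Idl (G 1)" A by (rule genideal_ideal[OF G1])
  have J0: "Idl (G 1) \<subseteq> irr" by (rule genideal_minimal[OF irr_ideal G_irr]) simp
  have all: "\<exists>c\<in>G 0. a \<ominus> c \<in> Idl (G 1)" if "a \<in> generate_ring A (G 0 \<union> G 1)" for a
    using that
  proof (induction rule: generate_ring.induct)
    case one
    have "\<one> \<ominus> \<one> \<in> Idl (G 1)" using J.zero_closed by (simp only: a_minus_def r_neg one_closed)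
    thus ?case using one_homogeneous by blast
  next
    case (incl h)
    thus ?case
    proof
      assume h: "h \<in> G 0"
      have "h \<ominus> h \<in> Idl (G 1)" using J.zero_closed G_closed[OF h] by (simp only: a_minus_def r_neg)
      thus ?thesis using h by blast
    next
      assume h: "h \<in> G 1"
      have "h \<in> Idl (G 1)" using genideal_self[OF G1] h by (rule subsetD)
      moreover have "h \<ominus> \<zero> = h" using G_closed[OF h] by (simp add: a_minus_def)
      ultimately have "h \<ominus> \<zero> \<in> Idl (G 1)" by simp
      thus ?thesis using G_zero by blast
    qed
  next
    case (a_inv h)
    then obtain c where c: "c \<in> G 0" "h \<ominus> c \<in> Idl (G 1)" by blast
    have hc: "h \<in> carrier A" using a_inv(1) generate_ring_in_carrier[of "G 0 \<union> G 1"] G_closed by blast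
    have "\<ominus> h \<ominus> (\<ominus> c) = \<ominus> (h \<ominus> c)" using hc G_closed[OF c(1)] by (simp add: a_minus_def minus_add)
    thus ?case using c G_neg J.a_inv_closed by metis
  next
    case (eng_add h1 h2)
    then obtain c d where c: "c \<in> G 0" "h1 \<ominus> c \<in> Idl (G 1)" and d: "d \<in> G 0" "h2 \<ominus> d \<in> Idl (G 1)" by blast
    have hc: "h1 \<in> carrier A" "h2 \<in> carrier A" using eng_add(1,2) generate_ring_in_carrier[of "G 0 \<union> G 1"] G_closed by blast+
    have "(h1 \<oplus> h2) \<ominus> (c \<oplus> d) = (h1 \<ominus> c) \<oplus> (h2 \<ominus> d)"
      using hc G_closed[OF c(1)] G_closed[OF d(1)] by (simp add: a_minus_def minus_add a_ac)
    thus ?case using c d G_add J.a_closed by metis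
  next
    case (eng_mult h1 h2)
    then obtain c d where c: "c \<in> G 0" "h1 \<ominus> c \<in> Idl (G 1)" and d: "d \<in> G 0" "h2 \<ominus> d \<in> Idl (G 1)" by blast
    have hc: "h1 \<in> carrier A" "h2 \<in> carrier A" using eng_mult(1,2) generate_ring_in_carrier[of "G 0 \<union> G 1"] G_closed by blast+
    note cc = G_closed[OF c(1)] G_closed[OF d(1)]
    have "(h1 \<otimes> h2) \<ominus> (c \<otimes> d) = h1 \<otimes> (h2 \<ominus> d) \<oplus> d \<otimes> (h1 \<ominus> c)" using hc cc by algebra
    moreover have "\<dots> \<in> Idl (G 1)" using c(2) d(2) hc cc by (intro J.a_closed J.I_l_closed)
    moreover have "c \<otimes> d \<in> G 0" using component_mult[OF c(1) d(1)] by simp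
    ultimately show ?case by metis
  qed
  show ?thesis
  proof
    fix a assume a: "a \<in> G i"
    hence ac: "a \<in> carrier A" by (rule G_closed)
    hence "\<exists>c\<in>G 0. a \<ominus> c \<in> Idl (G 1)" using all generated_in_degree_one by blast
    then obtain c where c: "c \<in> G 0" "a \<ominus> c \<in> Idl (G 1)" by blast
    have cc: "c \<in> carrier A" using c(1) by (rule G_closed)
    have "hcomp 0 (a \<ominus> c) = \<zero>" using c(2) J0 irr_iff by blast
    moreover have "\<ominus> c \<in> G 0" using c(1) by (rule G_neg)
    ultimately have "\<ominus> c = \<zero>" using hcomp_homogeneous[OF a, of 0] hcomp_homogeneous[of "\<ominus> c" 0 0] assms ac cc
      by (simp add: a_minus_def hcomp_add)
    hence "c = \<zero>" using cc by (metis minus_minus minus_zero)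
    thus "a \<in> Idl (G 1)" using c(2) ac by (simp add: a_minus_def)
  qed
qed

lemma Idl_eq_irr:
  assumes "S \<subseteq> irr" "G 1 \<subseteq> Idl S"
  shows "Idl S = irr"
proof -
  have Sc: "S \<subseteq> carrier A" using assms(1) irr_iff by blast
  have iS: "ideal (Idl S) A" by (rule genideal_ideal[OF Sc])
  have "Idl (G 1) \<subseteq> Idl S" by (rule genideal_minimal[OF iS assms(2)])
  hence "(\<Union>i\<in>{1..}. G i) \<subseteq> Idl S" using G_in_Idl_G1 by fastforce
  hence "irr \<subseteq> Idl S" unfolding irrelevant_ideal_def by (rule genideal_minimal[OF iS])
  moreover have "Idl S \<subseteq> irr" by (rule genideal_minimal[OF irr_ideal assms(1)])
  ultimately show ?thesis by blast
qed

lemma minimal_generators_nonzero: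
  assumes "minimal_homogeneous_generators A G zs \<aa>" and "z \<in> set zs"
  shows "z \<noteq> \<zero>"
proof
  assume z: "z = \<zero>"
  have sub: "set zs \<subseteq> carrier A"
    using assms(1) G_closed unfolding minimal_homogeneous_generators_def homogeneous_generators_def by blast
  have sub': "set zs - {z} \<subseteq> carrier A" using sub by blast
  interpret J: ideal "Idl (set zs - {z})" A by (rule genideal_ideal[OF sub'])
  have "set zs \<subseteq> Idl (set zs - {z})" using genideal_self[OF sub'] z J.zero_closed by blast
  hence "Idl (set zs) \<subseteq> Idl (set zs - {z})" by (rule genideal_minimal[OF J.is_ideal])
  moreover have "Idl (set zs - {z}) \<subseteq> Idl (set zs)"
    using genideal_self[OF sub] by (intro genideal_minimal genideal_ideal[OF sub]) auto
  moreover have "Idl (set zs) = \<aa>" "set zs - {z} \<subset> set zs \<longrightarrow> Idl (set zs - {z}) \<noteq> \<aa>"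
    using assms(1) unfolding minimal_homogeneous_generators_def homogeneous_generators_def by blast+
  ultimately show False using assms(2) by blast
qed

text \<open>The linear forms among the generators already span the component of degree 1, so they generate the ideal,
  and minimality leaves no others.\<close>

lemma minimal_generators_irr_degree:
  assumes ys: "minimal_homogeneous_generators A G ys irr"
  shows "set ys \<subseteq> G 1"
proof -
  note ysd = ys[unfolded minimal_homogeneous_generators_def homogeneous_generators_def]
  have sub: "set ys \<subseteq> carrier A" using ysd G_closed by blast
  have Y: "set ys \<subseteq> irr" using genideal_self[OF sub] ysd by simp
  let ?S = "set ys \<inter> G 1"
  have Sc: "?S \<subseteq> carrier A" using sub by blast
  interpret J: ideal "Idl ?S" A by (rule genideal_ideal[OF Sc])
  have "G 1 \<subseteq> Idl ?S"
  proof (rule linear_parts_span[OF sub])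
    show "Idl (set ys) = irr" using ysd by simp
    show "c \<otimes> x \<in> Idl ?S" if "c \<in> G 0" "x \<in> Idl ?S" for c x using that G_closed by (intro J.I_l_closed)
    fix y assume y: "y \<in> set ys"
    then obtain p where p: "y \<in> G p" using ysd by blast
    show "hcomp 1 y \<in> Idl ?S"
      using hcomp_homogeneous[OF p, of 1] p y genideal_self[OF Sc] J.zero_closed by auto
  qed (simp_all only: J.a_closed J.zero_closed)
  hence "Idl ?S = irr" using Y by (intro Idl_eq_irr) auto
  hence "\<not> ?S \<subset> set ys" using ysd by blast
  thus ?thesis by blast
qed

lemma finite_dim_component:
  assumes xs: "homogeneous_generators A G xs irr"
  shows "vectorspace k ((self_module A)\<lparr>carrier := int_component A G i\<rparr>)"
    and "vectorspace.fin_dim k ((self_module A)\<lparr>carrier := int_component A G i\<rparr>)"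
proof -
  let ?V = "(self_module A)\<lparr>carrier := int_component A G i\<rparr>"
  have closed: "c \<otimes> x \<in> int_component A G i" if "c \<in> G 0" "x \<in> int_component A G i" for c x
    using that component_mult[of c 0 x "nat i"] G_closed by (auto simp: int_component_def split: if_splits)
  show vs: "vectorspace k ?V"
    by (rule k_vectorspace[OF self_module_module[OF is_cring]])
      (use closed in \<open>auto simp: G_closed G_zero G_add int_component_def split: if_splits\<close>)
  interpret V: vectorspace k ?V by fact
  show "V.fin_dim"
  proof (cases "i < 0")
    case True
    hence "carrier ?V = {\<zero>\<^bsub>?V\<^esub>}" by (simp add: int_component_def)
    thus ?thesis using zero_space[OF vs] by blast
  next
    case False
    hence cV: "int_component A G i = G (nat i)" by (simp add: int_component_def)
    have "finite (set xs)" "set xs \<subseteq> (\<Union>p. G p)" "Idl (set xs) = irr"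
      using xs unfolding homogeneous_generators_def by auto
    from finite_spanning_set[OF this, of "nat i"] obtain B where B: "finite B" "B \<subseteq> G (nat i)"
      "\<And>U. U \<subseteq> carrier A \<Longrightarrow> \<zero> \<in> U \<Longrightarrow> \<forall>x\<in>U. \<forall>y\<in>U. x \<oplus> y \<in> U \<Longrightarrow> \<forall>c\<in>G 0. \<forall>x\<in>U. c \<otimes> x \<in> U \<Longrightarrow> B \<subseteq> U \<Longrightarrow> G (nat i) \<subseteq> U"
      by metis
    have BV: "B \<subseteq> carrier ?V" using B(2) cV by simp
    have sm: "LinearCombinations.submodule k (V.span B) ?V" by (rule V.span_is_submodule[OF BV])
    have "G (nat i) \<subseteq> V.span B"
    proof (rule B(3))
      show "V.span B \<subseteq> carrier A" using sm cV G_closed unfolding LinearCombinations.submodule_def by auto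
      show "B \<subseteq> V.span B" by (rule V.in_own_span[OF BV])
    qed (use sm in \<open>auto simp: LinearCombinations.submodule_def\<close>)
    moreover have "V.span B \<subseteq> carrier ?V" by (rule V.span_is_subset2[OF BV])
    ultimately have "V.gen_set B" using cV by auto
    thus ?thesis unfolding V.fin_dim_def using B(1) BV by blast
  qed
qed

text \<open>A minimal generating sequence of linear forms is a minimal spanning set, hence a basis, of the component
  of degree 1. The linear parts of the members of any other generating set span that component as well, so
  there are at least as many of them.\<close>

lemma minimal_generators_irr_length:
  assumes ys: "minimal_homogeneous_generators A G ys irr"
  shows "length ys = edim A G"
proof -
  note ysd = ys[unfolded minimal_homogeneous_generators_def homogeneous_generators_def]
  let ?V = "(self_module A)\<lparr>carrier := int_component A G 1\<rparr>"
  have hg: "homogeneous_generators A G ys irr" using ys unfolding minimal_homogeneous_generators_def by blast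
  have cV: "carrier ?V = G 1" by (simp add: int_component_def)
  interpret V: vectorspace k ?V by (rule finite_dim_component(1)[OF hg])
  have Y1: "set ys \<subseteq> G 1" by (rule minimal_generators_irr_degree[OF ys])
  have Yirr: "set ys \<subseteq> irr" using Y1 G_irr[of 1] by auto
  have span: "V.gen_set (hcomp 1 ` S)" if S: "S \<subseteq> carrier A" "Idl S = irr" for S
  proof -
    have BV: "hcomp 1 ` S \<subseteq> carrier ?V" using S(1) hcomp_G cV by auto
    have sm: "LinearCombinations.submodule k (V.span (hcomp 1 ` S)) ?V" by (rule V.span_is_submodule[OF BV])
    have "G 1 \<subseteq> V.span (hcomp 1 ` S)"
    proof (rule linear_parts_span[OF S])
      show "hcomp 1 s \<in> V.span (hcomp 1 ` S)" if "s \<in> S" for s using V.in_own_span[OF BV] that by blast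
    qed (use sm in \<open>auto simp: LinearCombinations.submodule_def\<close>)
    thus ?thesis using V.span_is_subset2[OF BV] cV by auto
  qed
  have h1: "hcomp 1 ` B = B" if "B \<subseteq> G 1" for B
    using that by (force simp: hcomp_homogeneous)
  have gY: "V.gen_set (set ys)" using span[of "set ys"] ysd G_closed h1[OF Y1] Y1 by auto
  have "minimal (set ys) (\<lambda>S. S \<subseteq> carrier ?V \<and> V.gen_set S)"
    unfolding minimal_def
  proof (intro conjI allI impI)
    show "set ys \<subseteq> carrier ?V" using Y1 cV by simp
    show "V.gen_set (set ys)" by (rule gY)
    fix B assume B: "B \<subseteq> set ys \<and> B \<subseteq> carrier ?V \<and> V.gen_set B"
    have Bc: "B \<subseteq> carrier A" using B Y1 G_closed by blast
    interpret J: ideal "Idl B" A by (rule genideal_ideal[OF Bc])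
    have "LinearCombinations.submodule k (Idl B \<inter> G 1) ?V"
      unfolding LinearCombinations.submodule_def
      using cV V.module_axioms G_add G_zero component_mult[of _ 0 _ 1] G_closed
      by (auto intro: J.a_closed J.I_l_closed)
    moreover have "B \<subseteq> Idl B \<inter> G 1" using genideal_self[OF Bc] B Y1 by blast
    ultimately have "V.span B \<subseteq> Idl B \<inter> G 1" by (rule V.span_is_subset[rotated])
    hence "G 1 \<subseteq> Idl B" using B cV by auto
    hence "Idl B = irr" using B Yirr by (intro Idl_eq_irr) auto
    thus "B = set ys" using ysd B by blast
  qed
  hence "V.basis (set ys)" by (rule V.min_gen_is_basis)
  hence dim: "V.dim = card (set ys)" by (intro V.dim_basis) auto
  show ?thesis unfolding edim_def
  proof (rule Least_equality[symmetric])
    have "finite (set ys)" "card (set ys) = length ys" "set ys \<subseteq> carrier A" "Idl (set ys) = irr"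
      using ysd distinct_card Y1 G_closed by auto
    thus "\<exists>S. finite S \<and> card S = length ys \<and> S \<subseteq> carrier A \<and> Idl S = irr" by blast
  next
    fix e assume "\<exists>S. finite S \<and> card S = e \<and> S \<subseteq> carrier A \<and> Idl S = irr"
    then obtain S where S: "finite S" "card S = e" "S \<subseteq> carrier A" "Idl S = irr" by blast
    have "V.dim \<le> card (hcomp 1 ` S)"
      using S(1,3) span[OF S(3,4)] hcomp_G cV by (intro V.gen_ge_dim) auto
    also have "\<dots> \<le> e" using card_image_le[OF S(1)] S(2) by simp
    finally show "length ys \<le> e" using dim distinct_card[of ys] ysd by simp
  qed
qed

end

section \<open>The kernel of the natural map\<close>

context homogeneous_list
begin

lemma cech_piece_iff:
  "f \<in> piece (cech A G ys) m i \<longleftrightarrow> f \<in> carrier (cochains (cech A G ys) m) \<and>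
    (\<forall>I \<in> positions ys m. homogeneous_set.lproj A G (den I) i (f I) = f I)"
proof -
  have "y \<in> localization_component A G (den I) i \<longleftrightarrow>
      y \<in> carrier (localization A (den I)) \<and> homogeneous_set.lproj A G (den I) i y = y" if I: "I \<in> positions ys m" for I y
  proof -
    interpret D: homogeneous_set A G "den I" by (rule den_multiplicative) (use I in \<open>simp add: positions_def\<close>)
    show ?thesis by (rule D.localization_component_iff)
  qed
  thus ?thesis by (auto simp: cech_simps PiE_iff)
qed

lemma cech_piece_closed:
  shows "\<zero>\<^bsub>cochains (cech A G ys) m\<^esub> \<in> piece (cech A G ys) m i"
    and "f \<in> piece (cech A G ys) m i \<Longrightarrow> g \<in> piece (cech A G ys) m i \<Longrightarrow>
      f \<oplus>\<^bsub>cochains (cech A G ys) m\<^esub> g \<in> piece (cech A G ys) m i"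
    and "c \<in> G 0 \<Longrightarrow> f \<in> piece (cech A G ys) m i \<Longrightarrow> c \<odot>\<^bsub>cochains (cech A G ys) m\<^esub> f \<in> piece (cech A G ys) m i"
proof -
  interpret C: module_complex A "cech A G ys" by (rule cech_complex)
  interpret M: module A "cochains (cech A G ys) m" by (rule C.cochains_module)
  have z: "homogeneous_set.lproj A G (den I) i \<zero>\<^bsub>localization A (den I)\<^esub> = \<zero>\<^bsub>localization A (den I)\<^esub>"
    if I: "I \<in> positions ys m" for I
  proof -
    interpret T: graded_cube A "{..<N}" "mM UNIV" "mrho UNIV" "G 0" "mpi UNIV i" by (rule mixed_graded_cube)
    have IN: "I \<subseteq> {..<N}" using I by (simp add: positions_def)
    show ?thesis using T.pi_zero[OF IN] by (simp add: mpi_def mdeg_def mM_def)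
  qed
  show "\<zero>\<^bsub>cochains (cech A G ys) m\<^esub> \<in> piece (cech A G ys) m i"
    unfolding cech_piece_iff using M.zero_closed z by (auto simp: cech_simps)
  assume f: "f \<in> piece (cech A G ys) m i"
  have fI: "f I \<in> carrier (localization A (den I))" "homogeneous_set.lproj A G (den I) i (f I) = f I"
    if "f \<in> piece (cech A G ys) m i" "I \<in> positions ys m" for f I
    using that unfolding cech_piece_iff by (auto simp: cech_simps)
  show "f \<oplus>\<^bsub>cochains (cech A G ys) m\<^esub> g \<in> piece (cech A G ys) m i" if g: "g \<in> piece (cech A G ys) m i"
    unfolding cech_piece_iff
  proof (intro conjI ballI)
    show "f \<oplus>\<^bsub>cochains (cech A G ys) m\<^esub> g \<in> carrier (cochains (cech A G ys) m)"
      using f g unfolding cech_piece_iff by (intro M.a_closed) auto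
    fix I assume I: "I \<in> positions ys m"
    interpret D: homogeneous_set A G "den I" by (rule den_multiplicative) (use I in \<open>simp add: positions_def\<close>)
    have e: "(f \<oplus>\<^bsub>cochains (cech A G ys) m\<^esub> g) I = f I \<oplus>\<^bsub>D.L\<^esub> g I" using I by (simp add: cech_simps)
    show "D.lproj i ((f \<oplus>\<^bsub>cochains (cech A G ys) m\<^esub> g) I) = (f \<oplus>\<^bsub>cochains (cech A G ys) m\<^esub> g) I"
      unfolding e D.lproj_add[OF fI(1)[OF f I] fI(1)[OF g I]] fI(2)[OF f I] fI(2)[OF g I] ..
  qed
  show "c \<odot>\<^bsub>cochains (cech A G ys) m\<^esub> f \<in> piece (cech A G ys) m i" if c: "c \<in> G 0"
    unfolding cech_piece_iff
  proof (intro conjI ballI)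
    show "c \<odot>\<^bsub>cochains (cech A G ys) m\<^esub> f \<in> carrier (cochains (cech A G ys) m)"
      using f G_closed[OF c] unfolding cech_piece_iff by (intro M.smult_closed) auto
    fix I assume I: "I \<in> positions ys m"
    interpret D: homogeneous_set A G "den I" by (rule den_multiplicative) (use I in \<open>simp add: positions_def\<close>)
    have e: "(c \<odot>\<^bsub>cochains (cech A G ys) m\<^esub> f) I = c \<odot>\<^bsub>D.L\<^esub> f I" using I by (simp add: cech_simps)
    show "D.lproj i ((c \<odot>\<^bsub>cochains (cech A G ys) m\<^esub> f) I) = (c \<odot>\<^bsub>cochains (cech A G ys) m\<^esub> f) I"
      unfolding e using D.lproj_smult_homogeneous[OF c fI(1)[OF f I], of i] fI(2)[OF f I] by simp
  qed
qed

lemma koszul_piece_closed: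
  shows "\<zero>\<^bsub>cochains (koszul A G ys) m\<^esub> \<in> piece (koszul A G ys) m i"
    and "f \<in> piece (koszul A G ys) m i \<Longrightarrow> g \<in> piece (koszul A G ys) m i \<Longrightarrow>
      f \<oplus>\<^bsub>cochains (koszul A G ys) m\<^esub> g \<in> piece (koszul A G ys) m i"
    and "c \<in> G 0 \<Longrightarrow> f \<in> piece (koszul A G ys) m i \<Longrightarrow> c \<odot>\<^bsub>cochains (koszul A G ys) m\<^esub> f \<in> piece (koszul A G ys) m i"
    and "piece (koszul A G ys) m i \<subseteq> carrier (cochains (koszul A G ys) m)"
proof -
  have closed: "\<zero> \<in> int_component A G j" "x \<in> int_component A G j \<Longrightarrow> y \<in> int_component A G j \<Longrightarrow> x \<oplus> y \<in> int_component A G j"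
    "c \<in> G 0 \<Longrightarrow> x \<in> int_component A G j \<Longrightarrow> c \<otimes> x \<in> int_component A G j" for c x y j
    using component_mult[of c 0 x "nat j"] G_closed G_zero G_add by (auto simp: int_component_def split: if_splits)
  show "\<zero>\<^bsub>cochains (koszul A G ys) m\<^esub> \<in> piece (koszul A G ys) m i"
    "f \<in> piece (koszul A G ys) m i \<Longrightarrow> g \<in> piece (koszul A G ys) m i \<Longrightarrow>
      f \<oplus>\<^bsub>cochains (koszul A G ys) m\<^esub> g \<in> piece (koszul A G ys) m i"
    "c \<in> G 0 \<Longrightarrow> f \<in> piece (koszul A G ys) m i \<Longrightarrow> c \<odot>\<^bsub>cochains (koszul A G ys) m\<^esub> f \<in> piece (koszul A G ys) m i"
    using closed by (auto simp: koszul_simps PiE_iff)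
  show "piece (koszul A G ys) m i \<subseteq> carrier (cochains (koszul A G ys) m)"
    using int_component_closed by (auto simp: koszul_simps PiE_iff)
qed

lemma koszul_to_cech_linear:
  assumes f: "f \<in> carrier (cochains (koszul A G ys) m)"
  shows "g \<in> carrier (cochains (koszul A G ys) m) \<Longrightarrow>
      koszul_to_cech A ys m (f \<oplus>\<^bsub>cochains (koszul A G ys) m\<^esub> g) =
      koszul_to_cech A ys m f \<oplus>\<^bsub>cochains (cech A G ys) m\<^esub> koszul_to_cech A ys m g"
    and "c \<in> carrier A \<Longrightarrow> koszul_to_cech A ys m (c \<odot>\<^bsub>cochains (koszul A G ys) m\<^esub> f) =
      c \<odot>\<^bsub>cochains (cech A G ys) m\<^esub> koszul_to_cech A ys m f"
proof -
  have D: "homogeneous_set A G (den I)" "(\<Otimes>l\<in>I. ys ! l) \<in> den I" if I: "I \<in> positions ys m" for I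
  proof -
    have IN: "I \<subseteq> {..<N}" using I by (simp add: positions_def)
    show "homogeneous_set A G (den I)" by (rule den_multiplicative[OF IN])
    have "(\<Otimes>l\<in>I. ys ! l) = (\<Otimes>l\<in>I. ys ! l [^] (\<lambda>_. 1 :: nat) l)"
      by (rule finprod_cong') (use IN ys_closed in auto)
    thus "(\<Otimes>l\<in>I. ys ! l) \<in> den I" unfolding denominators_def by (intro CollectI exI[of _ "\<lambda>_. 1 :: nat"] conjI TrueI)
  qed
  have fI: "f I \<in> carrier A" if "f \<in> carrier (cochains (koszul A G ys) m)" "I \<in> positions ys m" for f I
    using that by (auto simp: koszul_simps)
  show "koszul_to_cech A ys m (f \<oplus>\<^bsub>cochains (koszul A G ys) m\<^esub> g) =
      koszul_to_cech A ys m f \<oplus>\<^bsub>cochains (cech A G ys) m\<^esub> koszul_to_cech A ys m g"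
    if g: "g \<in> carrier (cochains (koszul A G ys) m)"
    unfolding koszul_to_cech_def cech_simps direct_sum_simps
  proof (rule restrict_ext)
    fix I assume I: "I \<in> positions ys m"
    interpret D: homogeneous_set A G "den I" by (rule D(1)[OF I])
    show "fraction A (den I) ((f \<oplus>\<^bsub>cochains (koszul A G ys) m\<^esub> g) I) (\<Otimes>l\<in>I. ys ! l) =
        (\<lambda>I\<in>positions ys m. fraction A (den I) (f I) (\<Otimes>l\<in>I. ys ! l)) I \<oplus>\<^bsub>D.L\<^esub>
        (\<lambda>I\<in>positions ys m. fraction A (den I) (g I) (\<Otimes>l\<in>I. ys ! l)) I"
      using I D.L_add[OF fI[OF f I] fI[OF g I] D(2)[OF I]] by (simp add: koszul_simps)
  qed
  show "koszul_to_cech A ys m (c \<odot>\<^bsub>cochains (koszul A G ys) m\<^esub> f) =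
      c \<odot>\<^bsub>cochains (cech A G ys) m\<^esub> koszul_to_cech A ys m f" if c: "c \<in> carrier A"
    unfolding koszul_to_cech_def cech_simps direct_sum_simps
  proof (rule restrict_ext)
    fix I assume I: "I \<in> positions ys m"
    interpret D: homogeneous_set A G "den I" by (rule D(1)[OF I])
    show "fraction A (den I) ((c \<odot>\<^bsub>cochains (koszul A G ys) m\<^esub> f) I) (\<Otimes>l\<in>I. ys ! l) =
        c \<odot>\<^bsub>D.L\<^esub> (\<lambda>I\<in>positions ys m. fraction A (den I) (f I) (\<Otimes>l\<in>I. ys ! l)) I"
      using I D.L_smult[OF c fI[OF f I] D(2)[OF I]] by (simp add: koszul_simps)
  qed
qed

end

context two_sequences
begin

lemma natural_map_class:
  assumes f: "f \<in> cocycles (koszul A G zs) n"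
  shows "natural_map A G zs n (coh_class (koszul A G zs) n f) = coh_class (cech A G zs) n (koszul_to_cech A zs n f)"
proof -
  let ?K = "koszul A G zs" and ?C = "cech A G zs" and ?k = "koszul_to_cech A zs n"
  interpret K: module A "cochains ?K n" by (rule KZ.cochains_module)
  interpret C: module A "cochains ?C n" by (rule CZ.cochains_module)
  have fc: "f \<in> carrier (cochains ?K n)" using f by (simp add: cocycles_def)
  have "coh_class ?C n (?k x) = coh_class ?C n (?k f)" if x: "x \<in> coh_class ?K n f" for x
  proof -
    have xc: "x \<in> carrier (cochains ?K n)" and e: "coh_class ?K n x = coh_class ?K n f"
      using KZ.coh_class_memD[OF fc x] by auto
    let ?u = "x \<ominus>\<^bsub>cochains ?K n\<^esub> f"
    have u: "?u \<in> coboundaries ?K n" using KZ.coh_class_eq_iff[OF xc fc] e by simp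
    have uc: "?u \<in> carrier (cochains ?K n)" using xc fc by simp
    have "x = ?u \<oplus>\<^bsub>cochains ?K n\<^esub> f" using xc fc by (simp add: a_minus_def K.M.a_assoc K.M.l_neg)
    hence "?k x = ?k ?u \<oplus>\<^bsub>cochains ?C n\<^esub> ?k f" using Zs.koszul_to_cech_linear(1)[OF uc fc] by simp
    moreover have ku: "?k ?u \<in> carrier (cochains ?C n)" "?k f \<in> carrier (cochains ?C n)"
      using koszul_to_cech_closed uc fc by blast+
    ultimately have "?k x \<ominus>\<^bsub>cochains ?C n\<^esub> ?k f = ?k ?u"
      by (simp add: a_minus_def C.M.a_assoc C.M.r_neg)
    thus ?thesis using CZ.coh_class_eq_iff[OF koszul_to_cech_closed[OF xc] ku(2)] koszul_to_cech_coboundary[OF u] by simp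
  qed
  moreover have "f \<in> coh_class ?K n f" by (rule KZ.coh_class_self[OF fc])
  ultimately show ?thesis unfolding natural_map_def induced_map_def by blast
qed

lemma natural_map_kernel_iff:
  assumes f: "f \<in> cocycles (koszul A G zs) n"
  shows "coh_class (koszul A G zs) n f \<in> natural_map_kernel A G zs n \<longleftrightarrow>
    koszul_to_cech A zs n f \<in> coboundaries (cech A G zs) n"
proof -
  have fc: "f \<in> carrier (cochains (koszul A G zs) n)" using f by (simp add: cocycles_def)
  have "coh_class (koszul A G zs) n f \<in> natural_map_kernel A G zs n \<longleftrightarrow>
      natural_map A G zs n (coh_class (koszul A G zs) n f) = coboundaries (cech A G zs) n"
    using f by (auto simp: natural_map_kernel_def a_kernel_def' local_cohomology_def KZ.cohomology_simps CZ.cohomology_simps)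
  thus ?thesis unfolding natural_map_class[OF f] CZ.coh_class_zero_iff[OF koszul_to_cech_closed[OF fc]] .
qed

definition kernel_cocycles :: "nat \<Rightarrow> (nat set \<Rightarrow> 'a) set" where
  "kernel_cocycles n = {f \<in> cocycles (koszul A G zs) n \<inter> piece (koszul A G zs) n i.
     koszul_to_cech A zs n f \<in> coboundaries (cech A G zs) n}"

lemma kernel_piece_carrier:
  "carrier (kernel_piece A G zs n i) = coh_class (koszul A G zs) n ` kernel_cocycles n"
  using natural_map_kernel_iff
  by (auto simp: kernel_piece_def cohomology_piece_def kernel_cocycles_def)

lemma kernel_cocycles_closed:
  shows "\<zero>\<^bsub>cochains (koszul A G zs) n\<^esub> \<in> kernel_cocycles n"
    and "f \<in> kernel_cocycles n \<Longrightarrow> g \<in> kernel_cocycles n \<Longrightarrow> f \<oplus>\<^bsub>cochains (koszul A G zs) n\<^esub> g \<in> kernel_cocycles n"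
    and "c \<in> G 0 \<Longrightarrow> f \<in> kernel_cocycles n \<Longrightarrow> c \<odot>\<^bsub>cochains (koszul A G zs) n\<^esub> f \<in> kernel_cocycles n"
    and "f \<in> kernel_cocycles n \<Longrightarrow> f \<in> carrier (cochains (koszul A G zs) n)"
proof -
  show kc: "f \<in> carrier (cochains (koszul A G zs) n)" if "f \<in> kernel_cocycles n" for f
    using that by (auto simp: kernel_cocycles_def cocycles_def)
  show "\<zero>\<^bsub>cochains (koszul A G zs) n\<^esub> \<in> kernel_cocycles n"
    using KZ.cocycles_zero Zs.koszul_piece_closed(1) koszul_to_cech_coboundary[OF KZ.coboundaries_zero]
    by (simp add: kernel_cocycles_def)
  assume f: "f \<in> kernel_cocycles n"
  show "f \<oplus>\<^bsub>cochains (koszul A G zs) n\<^esub> g \<in> kernel_cocycles n" if g: "g \<in> kernel_cocycles n"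
    using f g Zs.koszul_to_cech_linear(1)[OF kc[OF f] kc[OF g]]
    by (auto simp: kernel_cocycles_def intro: KZ.cocycles_add Zs.koszul_piece_closed(2) CZ.coboundaries_add)
  show "c \<odot>\<^bsub>cochains (koszul A G zs) n\<^esub> f \<in> kernel_cocycles n" if c: "c \<in> G 0"
    using f c Zs.koszul_to_cech_linear(2)[OF kc[OF f] G_closed[OF c]]
    by (auto simp: kernel_cocycles_def intro: KZ.cocycles_smult Zs.koszul_piece_closed(3) CZ.coboundaries_smult G_closed)
qed

lemma kernel_piece_simps:
  "\<zero>\<^bsub>kernel_piece A G zs n i\<^esub> = coboundaries (koszul A G zs) n"
  "x \<oplus>\<^bsub>kernel_piece A G zs n i\<^esub> y = x \<oplus>\<^bsub>cohomology (koszul A G zs) n\<^esub> y"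
  "c \<odot>\<^bsub>kernel_piece A G zs n i\<^esub> x = c \<odot>\<^bsub>cohomology (koszul A G zs) n\<^esub> x"
  by (simp_all add: kernel_piece_def KZ.cohomology_simps)

lemma cocycle_slice:
  assumes c: "c \<in> carrier T.T" "T.supp (\<lambda>K. p \<le> card (K - X)) c" "T.dif P c = \<zero>\<^bsub>T.T\<^esub>"
    and I: "I \<subseteq> Z" "card I = p"
  shows "slice I q c \<in> cocycles (cech A G xs) q"
proof -
  let ?C = "cech A G xs"
  interpret C: module A "cochains ?C (Suc q)" by (rule CX.cochains_module)
  have sc: "slice I q c \<in> carrier (cochains ?C q)" by (rule slice_closed[OF c(1) I(1)])
  have "slice I (Suc q) (T.dif X c) = slice I (Suc q) \<zero>\<^bsub>T.T\<^esub>"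
    unfolding eq_on_slice_iff[OF I(1)] using T.dif_at_level[OF ZX(2) c(1,2)] I(2) c(3) by metis
  hence "sgn I \<odot>\<^bsub>cochains ?C (Suc q)\<^esub> differential ?C q (slice I q c) = \<zero>\<^bsub>cochains ?C (Suc q)\<^esub>"
    unfolding slice_dif[OF c(1) I(1)] slice_zero[OF I(1)] .
  hence "sgn I \<odot>\<^bsub>cochains ?C (Suc q)\<^esub> (sgn I \<odot>\<^bsub>cochains ?C (Suc q)\<^esub> differential ?C q (slice I q c)) = \<zero>\<^bsub>cochains ?C (Suc q)\<^esub>"
    by simp
  hence "differential ?C q (slice I q c) = \<zero>\<^bsub>cochains ?C (Suc q)\<^esub>"
    using CX.d_closed[OF sc] by (simp add: C.smult_assoc1[symmetric] sgn_sgn)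
  thus ?thesis using sc by (simp add: cocycles_def)
qed

end

text \<open>If \<open>zs\<close> is empty, every \<open>t\<close> satisfies the condition on degrees, so that its positivity is required
  only otherwise.\<close>

locale concentrated_cohomology = standard_graded_algebra A G + two_sequences A G zs xs i
  for A (structure) and G zs xs i +
  fixes n :: nat and d :: int and t :: nat
  assumes xs_generate: "homogeneous_generators A G xs irr"
    and zs_degree: "l < length zs \<Longrightarrow> hdeg G (zs ! l) = t"
    and t_pos: "zs \<noteq> [] \<Longrightarrow> 0 < t"
    and concentrated: "j < n \<Longrightarrow> carrier (cohomology (cech A G xs) j) = cohomology_piece (cech A G xs) j d"
begin

lemma degree_sum: "I \<subseteq> Z \<Longrightarrow> int (\<Sum>l\<in>I. hdeg G (zs ! l)) = int (card I) * int t"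
proof -
  assume "I \<subseteq> Z"
  hence "(\<Sum>l\<in>I. hdeg G (zs ! l)) = (\<Sum>l\<in>I. t)" by (intro sum.cong) (auto simp: zs_degree)
  thus ?thesis by simp
qed

text \<open>The shift of degrees on the slice over \<open>I\<close> is \<open>t |I|\<close>, and cocycles of degrees other than \<open>d\<close> are
  coboundaries below cohomological degree \<open>n\<close>.\<close>

lemma exact_off_degree:
  assumes I: "I \<subseteq> Z" and m: "m < n + card I" and off: "i + int (card I) * int t \<noteq> d"
  shows "T.slice_exact X I m"
proof (rule slice_exact_of_cech[OF I])
  fix q f assume "m = card I + q" and f: "f \<in> cocycles (cech A G xs) q"
    "f \<in> piece (cech A G xs) q (i + int (\<Sum>l\<in>I. hdeg G (zs ! l)))"
  hence "q < n" using m by simp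
  from Xs.cech_off_degree[OF concentrated[OF this] off f(1)]
  show "f \<in> coboundaries (cech A G xs) q" using f(2) unfolding degree_sum[OF I] .
qed

lemma card_le_r: "I \<subseteq> Z \<Longrightarrow> card I \<le> r"
  using card_mono[of Z I] by simp

lemma kernel_piece_vectorspace: "vectorspace k (kernel_piece A G zs n i)"
proof -
  have "vectorspace k ((cohomology (koszul A G zs) n)\<lparr>carrier := coh_class (koszul A G zs) n ` kernel_cocycles n\<rparr>)"
  proof (rule k_vectorspace[OF KZ.cohomology_module])
    show "coh_class (koszul A G zs) n ` kernel_cocycles n \<subseteq> carrier (cohomology (koszul A G zs) n)"
      by (auto simp: KZ.cohomology_simps kernel_cocycles_def)
    show "\<zero>\<^bsub>cohomology (koszul A G zs) n\<^esub> \<in> coh_class (koszul A G zs) n ` kernel_cocycles n"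
      using kernel_cocycles_closed(1)[of n] KZ.coh_class_zero[of n] unfolding KZ.cohomology_simps by (metis image_eqI)
  next
    fix x y assume "x \<in> coh_class (koszul A G zs) n ` kernel_cocycles n" "y \<in> coh_class (koszul A G zs) n ` kernel_cocycles n"
    then obtain f g where "f \<in> kernel_cocycles n" "g \<in> kernel_cocycles n"
      "x = coh_class (koszul A G zs) n f" "y = coh_class (koszul A G zs) n g" by blast
    thus "x \<oplus>\<^bsub>cohomology (koszul A G zs) n\<^esub> y \<in> coh_class (koszul A G zs) n ` kernel_cocycles n"
      using KZ.coh_class_add kernel_cocycles_closed(2,4) by auto
  next
    fix c x assume c: "c \<in> G 0" and "x \<in> coh_class (koszul A G zs) n ` kernel_cocycles n"
    then obtain f where "f \<in> kernel_cocycles n" "x = coh_class (koszul A G zs) n f" by blast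
    thus "c \<odot>\<^bsub>cohomology (koszul A G zs) n\<^esub> x \<in> coh_class (koszul A G zs) n ` kernel_cocycles n"
      using KZ.coh_class_smult[OF G_closed[OF c]] kernel_cocycles_closed(3)[OF c] kernel_cocycles_closed(4) by auto
  qed
  thus ?thesis using kernel_piece_carrier[of n] unfolding kernel_piece_def by simp
qed

text \<open>The kernel is a quotient of a subspace of the Koszul cochains of degree \<open>i\<close>, which form a finite sum of
  components of \<open>A\<close>.\<close>

lemma kernel_piece_fin_dim: "vectorspace.fin_dim k (kernel_piece A G zs n i)"
proof -
  let ?K = "koszul A G zs" and ?W = "kernel_piece A G zs n i"
  let ?H = "\<lambda>I. (self_module A)\<lparr>carrier := int_component A G (i + int (\<Sum>l\<in>I. hdeg G (zs ! l)))\<rparr>"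
  let ?V = "Defs.direct_sum (positions zs n) ?H"
  have "finite (positions zs n)" unfolding positions_def by (rule finite_subset[of _ "Pow {..<length zs}"]) auto
  from direct_sum_dim[OF field_base this, of ?H] finite_dim_component[OF xs_generate]
  have V: "vectorspace k ?V" "vectorspace.fin_dim k ?V" by blast+
  interpret V: vectorspace k ?V by (rule V(1))
  have Vs: "carrier ?V = piece ?K n i" "\<zero>\<^bsub>?V\<^esub> = \<zero>\<^bsub>cochains ?K n\<^esub>"
    "x \<oplus>\<^bsub>?V\<^esub> y = x \<oplus>\<^bsub>cochains ?K n\<^esub> y" "c \<odot>\<^bsub>?V\<^esub> x = c \<odot>\<^bsub>cochains ?K n\<^esub> x" for x y c
    by (simp_all add: koszul_simps self_module_def)
  have Q: "VectorSpace.subspace k (kernel_cocycles n) ?V"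
    by (rule subspaceI[OF V(1)]) (unfold Vs k_carrier, insert kernel_cocycles_closed[where n = n],
      auto simp: kernel_cocycles_def)
  have Qv: "vectorspace k (?V\<lparr>carrier := kernel_cocycles n\<rparr>)" by (rule V.subspace_is_vs[OF Q])
  have Qf: "vectorspace.fin_dim k (?V\<lparr>carrier := kernel_cocycles n\<rparr>)" by (rule subspace_fin_dim[OF V Q])
  interpret L: linear_map k "?V\<lparr>carrier := kernel_cocycles n\<rparr>" ?W "coh_class ?K n"
  proof (rule linear_mapI[OF Qv kernel_piece_vectorspace])
    fix f assume "f \<in> carrier (?V\<lparr>carrier := kernel_cocycles n\<rparr>)"
    thus "coh_class ?K n f \<in> carrier ?W" unfolding kernel_piece_carrier by simp
  next
    fix f g assume f: "f \<in> carrier (?V\<lparr>carrier := kernel_cocycles n\<rparr>)" "g \<in> carrier (?V\<lparr>carrier := kernel_cocycles n\<rparr>)"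
    have "coh_class ?K n (f \<oplus>\<^bsub>?V\<^esub> g) = coh_class ?K n f \<oplus>\<^bsub>?W\<^esub> coh_class ?K n g"
      unfolding kernel_piece_simps Vs using f kernel_cocycles_closed(4)
      by (intro KZ.coh_class_add[symmetric]) auto
    thus "coh_class ?K n (f \<oplus>\<^bsub>?V\<lparr>carrier := kernel_cocycles n\<rparr>\<^esub> g) = coh_class ?K n f \<oplus>\<^bsub>?W\<^esub> coh_class ?K n g" by simp
  next
    fix c f assume f: "c \<in> carrier k" "f \<in> carrier (?V\<lparr>carrier := kernel_cocycles n\<rparr>)"
    have "coh_class ?K n (c \<odot>\<^bsub>?V\<^esub> f) = c \<odot>\<^bsub>?W\<^esub> coh_class ?K n f"
      unfolding kernel_piece_simps Vs using f kernel_cocycles_closed(4) G_closed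
      by (intro KZ.coh_class_smult[symmetric]) auto
    thus "coh_class ?K n (c \<odot>\<^bsub>?V\<lparr>carrier := kernel_cocycles n\<rparr>\<^esub> f) = c \<odot>\<^bsub>?W\<^esub> coh_class ?K n f" by simp
  qed
  show ?thesis by (rule L.surj_fin_dim[OF Qf]) (simp add: kernel_piece_carrier)
qed

text \<open>All levels from 1 to \<open>n\<close> are exact in this degree, so a lift can be pushed to level \<open>n + 1\<close>, where it vanishes.\<close>

lemma kernel_piece_zero:
  assumes off: "\<And>p. 1 \<le> p \<Longrightarrow> p \<le> n \<Longrightarrow> p \<le> r \<Longrightarrow> i + int p * int t \<noteq> d"
  shows "vectorspace.dim k (kernel_piece A G zs n i) = 0"
proof -
  let ?K = "koszul A G zs"
  have "coh_class ?K n f = coboundaries ?K n" if f: "f \<in> kernel_cocycles n" for f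
  proof -
    have fc: "f \<in> carrier (cochains ?K n)" by (rule kernel_cocycles_closed(4)[OF f])
    have f': "f \<in> cocycles ?K n" "f \<in> piece ?K n i" "koszul_to_cech A zs n f \<in> coboundaries (cech A G zs) n"
      using f by (auto simp: kernel_cocycles_def)
    have ex: "T.slice_exact X I n" if I: "I \<subseteq> Z" "1 \<le> card I" "card I < Suc n" for I
      by (rule exact_off_degree[OF I(1)]) (use I off card_le_r in auto)
    have "1 \<le> Suc n" by simp
    from kernel_lift[OF f' this ex]
    obtain c g where c: "c \<in> T.T0" "T.supp (\<lambda>K. card K = n \<and> Suc n \<le> card (K - X)) c"
      "g \<in> carrier (cochains ?K n)" "row_rel n g c" "f \<ominus>\<^bsub>cochains ?K n\<^esub> g \<in> coboundaries ?K n" by blast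
    have cT: "c \<in> carrier T.T" using c(1) by (rule T.T0_closed)
    have "T.supp (\<lambda>K. False) c"
    proof (rule T.supp_mono[OF c(2)])
      fix K assume K: "K \<subseteq> P" "card K = n \<and> Suc n \<le> card (K - X)"
      have "card (K - X) \<le> card K" using finite_subset[OF K(1)] by (intro card_mono) auto
      thus False using K(2) by simp
    qed
    hence c0: "c = \<zero>\<^bsub>T.T\<^esub>" by (rule T.supp_zero_false[OF cT])
    have "c I = \<zero>\<^bsub>Y.mM X I\<^esub>" if "I \<in> positions zs n" for I
      unfolding c0 by (rule T.T_apply(1)) (use that in \<open>auto simp: positions_zs length_append\<close>)
    hence "g = \<zero>\<^bsub>cochains ?K n\<^esub>" using row_rel_zero_iff[OF c(3,4)] by blast
    moreover interpret M: module A "cochains ?K n" by (rule KZ.cochains_module)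
    have "coh_class ?K n f = coh_class ?K n g" using KZ.coh_class_eq_iff[OF fc c(3)] c(5) by simp
    ultimately show ?thesis using KZ.coh_class_zero by simp
  qed
  hence "carrier (kernel_piece A G zs n i) \<subseteq> {coboundaries ?K n}" unfolding kernel_piece_carrier by blast
  moreover interpret W: vectorspace k "kernel_piece A G zs n i" by (rule kernel_piece_vectorspace)
  have "\<zero>\<^bsub>kernel_piece A G zs n i\<^esub> \<in> carrier (kernel_piece A G zs n i)" by (rule W.M.zero_closed)
  ultimately have "carrier (kernel_piece A G zs n i) = {\<zero>\<^bsub>kernel_piece A G zs n i\<^esub>}"
    unfolding kernel_piece_simps by blast
  thus ?thesis by (rule zero_space(2)[OF kernel_piece_vectorspace])
qed

abbreviation Hd :: "nat \<Rightarrow> ('a, (nat set \<Rightarrow> ('a \<times> 'a) set) set) module" where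
  "Hd q \<equiv> (local_cohomology A G xs q)\<lparr>carrier := local_cohomology_piece A G xs q d\<rparr>"

lemma Hd_vectorspace: "vectorspace k (Hd q)"
  unfolding local_cohomology_def local_cohomology_piece_def cohomology_piece_def
proof (rule k_vectorspace[OF CX.cohomology_module])
  let ?C = "cech A G xs"
  let ?Q = "cocycles ?C q \<inter> piece ?C q d"
  have Qc: "f \<in> carrier (cochains ?C q)" if "f \<in> ?Q" for f using that by (simp add: cocycles_def)
  show "coh_class ?C q ` ?Q \<subseteq> carrier (cohomology ?C q)" by (auto simp: CX.cohomology_simps)
  have "\<zero>\<^bsub>cochains ?C q\<^esub> \<in> ?Q" using CX.cocycles_zero Xs.cech_piece_closed(1) by blast
  thus "\<zero>\<^bsub>cohomology ?C q\<^esub> \<in> coh_class ?C q ` ?Q" unfolding CX.cohomology_simps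
    using CX.coh_class_zero[of q] by (metis image_eqI)
  fix x assume "x \<in> coh_class ?C q ` ?Q"
  then obtain f where f: "f \<in> ?Q" "x = coh_class ?C q f" by blast
  show "c \<odot>\<^bsub>cohomology ?C q\<^esub> x \<in> coh_class ?C q ` ?Q" if c: "c \<in> G 0" for c
    unfolding f(2) CX.coh_class_smult[OF G_closed[OF c] Qc[OF f(1)]]
    using f(1) c CX.cocycles_smult[OF G_closed[OF c]] Xs.cech_piece_closed(3)[OF c] by blast
  fix y assume "y \<in> coh_class ?C q ` ?Q"
  then obtain g where g: "g \<in> ?Q" "y = coh_class ?C q g" by blast
  show "x \<oplus>\<^bsub>cohomology ?C q\<^esub> y \<in> coh_class ?C q ` ?Q"
    unfolding f(2) g(2) CX.coh_class_add[OF Qc[OF f(1)] Qc[OF g(1)]]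
    using f(1) g(1) CX.cocycles_add Xs.cech_piece_closed(2) by blast
qed

text \<open>Modulo coboundaries, a kernel element is the row \<open>f\<close> of a total cocycle \<open>c\<close> of level at least \<open>p\<close>. It is related
  to the local cohomology classes of the slices of \<open>c\<close> of level \<open>p\<close>.\<close>

definition leading_classes :: "nat \<Rightarrow> nat \<Rightarrow> (nat set \<Rightarrow> ('a \<times> 'a) set) \<Rightarrow> (nat set \<Rightarrow> (nat set \<Rightarrow> ('a \<times> 'a) set) set)" where
  "leading_classes p q c = (\<lambda>I\<in>positions zs p. coh_class (cech A G xs) q (slice I q c))"

definition leading_rel :: "nat \<Rightarrow> nat \<Rightarrow> (nat set \<Rightarrow> 'a) set \<Rightarrow> (nat set \<Rightarrow> (nat set \<Rightarrow> ('a \<times> 'a) set) set) \<Rightarrow> bool" where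
  "leading_rel p q x y \<longleftrightarrow> (\<exists>c \<in> T.T0. \<exists>f \<in> carrier (cochains (koszul A G zs) n).
     T.supp (\<lambda>K. card K = n \<and> p \<le> card (K - X)) c \<and> T.dif P c = \<zero>\<^bsub>T.T\<^esub> \<and> row_rel n f c \<and>
     x = coh_class (koszul A G zs) n f \<and> y = leading_classes p q c)"

text \<open>In internal degree \<open>i\<close>, the slices of every level except \<open>p\<close> are exact as far as they involve local
  cohomology in degrees below \<open>n\<close>. Below \<open>p\<close>, exactness makes the relation total on the side of
  the kernel and shows that coboundaries have trivial leading classes. Above \<open>p\<close>, it makes the relation total
  on the other side and shows that classes with trivial leading classes vanish.\<close>

lemma kernel_piece_dim:
  assumes p: "1 \<le> p" "n = p + q" "p \<le> r" and deg: "i + int p * int t = d"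
  shows "vectorspace.dim k (kernel_piece A G zs n i) = (r choose p) * vectorspace.dim k (Hd q)"
proof -
  let ?K = "koszul A G zs" and ?C = "cech A G xs" and ?W = "kernel_piece A G zs n i"
  let ?B = "positions zs p"
  let ?V = "Defs.direct_sum ?B (\<lambda>_. Hd q)"
  have finB: "finite ?B" unfolding positions_def by (rule finite_subset[of _ "Pow {..<length zs}"]) auto
  have cardB: "card ?B = r choose p" unfolding positions_def using n_subsets[of "{..<length zs}" p] by simp
  have "zs \<noteq> []" using p(1,3) by auto
  hence tp: "0 < t" by (rule t_pos)
  have off: "i + int j * int t \<noteq> d" if "j \<noteq> p" for j using deg that tp by auto
  have Bp: "I \<subseteq> Z" "card I = p" if "I \<in> ?B" for I using that by (auto simp: positions_zs)
  have degI: "i + int (\<Sum>l\<in>I. hdeg G (zs ! l)) = d" if "I \<in> ?B" for I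
    using degree_sum[OF Bp(1)[OF that]] Bp(2)[OF that] deg by simp
  interpret W: vectorspace k ?W by (rule kernel_piece_vectorspace)
  interpret H: vectorspace k "Hd q" by (rule Hd_vectorspace)
  have Vm: "vectorspace k ?V"
    by (intro vectorspace.intro direct_sum_module H.module_axioms field_base domain.axioms(1) field.axioms(1))
  interpret V: vectorspace k ?V by (rule Vm)
  have Vs: "\<zero>\<^bsub>?V\<^esub> = (\<lambda>I\<in>?B. coboundaries ?C q)"
    "y \<oplus>\<^bsub>?V\<^esub> y' = (\<lambda>I\<in>?B. y I \<oplus>\<^bsub>cohomology ?C q\<^esub> y' I)"
    "a \<odot>\<^bsub>?V\<^esub> y = (\<lambda>I\<in>?B. a \<odot>\<^bsub>cohomology ?C q\<^esub> y I)" for y y' a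
    by (simp_all add: local_cohomology_def CX.cohomology_simps)
  have Vc: "carrier ?V = (\<Pi>\<^sub>E I\<in>?B. coh_class ?C q ` (cocycles ?C q \<inter> piece ?C q d))"
    by (simp add: local_cohomology_piece_def cohomology_piece_def)
  have sc: "slice I q c \<in> carrier (cochains ?C q)" if "c \<in> carrier T.T" "I \<in> ?B" for c I
    using that Bp by (intro slice_closed) auto
  have inV: "leading_classes p q c \<in> carrier ?V"
    if c: "c \<in> T.T0" "T.supp (\<lambda>K. card K = n \<and> p \<le> card (K - X)) c" "T.dif P c = \<zero>\<^bsub>T.T\<^esub>" for c
  proof -
    have "slice I q c \<in> cocycles ?C q \<inter> piece ?C q d" if I: "I \<in> ?B" for I
    proof
      have "T.supp (\<lambda>K. p \<le> card (K - X)) c" using c(2) by (rule T.supp_mono) simp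
      thus "slice I q c \<in> cocycles ?C q" by (rule cocycle_slice[OF T.T0_closed[OF c(1)] _ c(3) Bp[OF I]])
      show "slice I q c \<in> piece ?C q d" using slice_piece[OF c(1) Bp(1)[OF I], of q] unfolding degI[OF I] .
    qed
    thus ?thesis unfolding Vc leading_classes_def by auto
  qed
  have left: "\<exists>y \<in> carrier ?V. leading_rel p q x y" if x: "x \<in> carrier ?W" for x
  proof -
    obtain f where f: "f \<in> kernel_cocycles n" "x = coh_class ?K n f" using x unfolding kernel_piece_carrier by blast
    have fc: "f \<in> carrier (cochains ?K n)" by (rule kernel_cocycles_closed(4)[OF f(1)])
    have f': "f \<in> cocycles ?K n" "f \<in> piece ?K n i" "koszul_to_cech A zs n f \<in> coboundaries (cech A G zs) n"
      using f by (auto simp: kernel_cocycles_def)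
    have ex: "T.slice_exact X I n" if I: "I \<subseteq> Z" "1 \<le> card I" "card I < p" for I
      by (rule exact_off_degree[OF I(1)]) (use I off in auto)
    from kernel_lift[OF f' p(1) ex]
    obtain c g where c: "c \<in> T.T0" "g \<in> carrier (cochains ?K n)" "T.supp (\<lambda>K. card K = n \<and> p \<le> card (K - X)) c"
      "T.dif P c = \<zero>\<^bsub>T.T\<^esub>" "row_rel n g c" "f \<ominus>\<^bsub>cochains ?K n\<^esub> g \<in> coboundaries ?K n" by blast
    have "coh_class ?K n f = coh_class ?K n g" using KZ.coh_class_eq_iff[OF fc c(2)] c(6) by simp
    hence "leading_rel p q x (leading_classes p q c)" unfolding leading_rel_def f(2) using c by blast
    thus ?thesis using inV[OF c(1,3,4)] by blast
  qed
  have right: "\<exists>x \<in> carrier ?W. leading_rel p q x y" if y: "y \<in> carrier ?V" for y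
  proof -
    have "\<forall>I\<in>?B. \<exists>u. u \<in> cocycles ?C q \<inter> piece ?C q d \<and> y I = coh_class ?C q u" using y unfolding Vc by blast
    from bchoice[OF this] obtain u where u: "\<forall>I\<in>?B. u I \<in> cocycles ?C q \<inter> piece ?C q d \<and> y I = coh_class ?C q (u I)" by blast
    have ex: "T.slice_exact X I (Suc n)" if I: "I \<subseteq> Z" "p < card I" "card I \<le> Suc n" for I
      by (rule exact_off_degree[OF I(1)]) (use I off p(1) in auto)
    have u1: "u I \<in> cocycles ?C q" if "I \<in> ?B" for I using u that by blast
    have u2: "u I \<in> piece ?C q (i + int (\<Sum>l\<in>I. hdeg G (zs ! l)))" if "I \<in> ?B" for I
      using u that unfolding degI[OF that] by blast
    from cocycle_with_slices[OF p(2) ex u1 u2]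
    obtain c where c: "c \<in> T.T0" "T.supp (\<lambda>K. card K = n \<and> p \<le> card (K - X)) c" "T.dif P c = \<zero>\<^bsub>T.T\<^esub>"
      "\<forall>I \<in> ?B. slice I q c = u I" by blast
    have cT: "c \<in> carrier T.T" using c(1) by (rule T.T0_closed)
    obtain f where f: "f \<in> carrier (cochains ?K n)" "row_rel n f c" using row_rel_exists(1)[OF cT] by blast
    have "T.supp (\<lambda>K. card K = n \<and> 1 \<le> card (K - X)) c" by (rule T.supp_mono[OF c(2)]) (use p(1) in auto)
    hence "koszul_to_cech A zs n f \<in> coboundaries (cech A G zs) n"
      by (rule positive_level_kernel[OF cT _ c(3) f])
    hence "f \<in> kernel_cocycles n"
      using row_cocycle[OF cT c(3) f] row_rel_exists(2)[OF cT c(1) f(2,1)] by (simp add: kernel_cocycles_def)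
    hence "coh_class ?K n f \<in> carrier ?W" unfolding kernel_piece_carrier by blast
    moreover have "y = leading_classes p q c"
      unfolding leading_classes_def using y u c(4)
      by (intro extensionalityI[of _ ?B]) (auto simp: PiE_iff)
    ultimately show ?thesis unfolding leading_rel_def using c f by blast
  qed
  have add: "leading_rel p q (x \<oplus>\<^bsub>?W\<^esub> x') (y \<oplus>\<^bsub>?V\<^esub> y')" if r: "leading_rel p q x y" "leading_rel p q x' y'" for x x' y y'
  proof -
    obtain c f where c: "c \<in> T.T0" "f \<in> carrier (cochains ?K n)" "T.supp (\<lambda>K. card K = n \<and> p \<le> card (K - X)) c"
      "T.dif P c = \<zero>\<^bsub>T.T\<^esub>" "row_rel n f c" "x = coh_class ?K n f" "y = leading_classes p q c"
      using r(1) unfolding leading_rel_def by blast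
    obtain c' f' where c': "c' \<in> T.T0" "f' \<in> carrier (cochains ?K n)" "T.supp (\<lambda>K. card K = n \<and> p \<le> card (K - X)) c'"
      "T.dif P c' = \<zero>\<^bsub>T.T\<^esub>" "row_rel n f' c'" "x' = coh_class ?K n f'" "y' = leading_classes p q c'"
      using r(2) unfolding leading_rel_def by blast
    note cT = T.T0_closed[OF c(1)] T.T0_closed[OF c'(1)]
    interpret M: module A "cochains ?K n" by (rule KZ.cochains_module)
    have "x \<oplus>\<^bsub>?W\<^esub> x' = coh_class ?K n (f \<oplus>\<^bsub>cochains ?K n\<^esub> f')"
      unfolding kernel_piece_simps c(6) c'(6) by (rule KZ.coh_class_add[OF c(2) c'(2)])
    moreover have "y \<oplus>\<^bsub>?V\<^esub> y' = leading_classes p q (c \<oplus>\<^bsub>T.T\<^esub> c')"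
      unfolding Vs c(7) c'(7) leading_classes_def
      by (rule restrict_ext) (simp add: CX.coh_class_add[OF sc[OF cT(1)] sc[OF cT(2)]] slice_add[OF Bp(1)] del: direct_sum_simps)
    moreover have "T.dif P (c \<oplus>\<^bsub>T.T\<^esub> c') = \<zero>\<^bsub>T.T\<^esub>"
      unfolding T.dif_add[OF cT] c(4) c'(4) using T.T.M.l_zero[OF T.T.M.zero_closed] .
    ultimately show ?thesis unfolding leading_rel_def
      using T.T0_add[OF c(1) c'(1)] M.a_closed[OF c(2) c'(2)] T.supp_add[OF c(3) c'(3)]
        row_rel_add[OF cT c(2) c'(2) c(5) c'(5)] by blast
  qed
  have smult: "leading_rel p q (a \<odot>\<^bsub>?W\<^esub> x) (a \<odot>\<^bsub>?V\<^esub> y)" if a: "a \<in> carrier k" and r: "leading_rel p q x y" for a x y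
  proof -
    obtain c f where c: "c \<in> T.T0" "f \<in> carrier (cochains ?K n)" "T.supp (\<lambda>K. card K = n \<and> p \<le> card (K - X)) c"
      "T.dif P c = \<zero>\<^bsub>T.T\<^esub>" "row_rel n f c" "x = coh_class ?K n f" "y = leading_classes p q c"
      using r unfolding leading_rel_def by blast
    note cT = T.T0_closed[OF c(1)]
    have a0: "a \<in> G 0" "a \<in> carrier A" using a G_closed by auto
    interpret M: module A "cochains ?K n" by (rule KZ.cochains_module)
    have "a \<odot>\<^bsub>?W\<^esub> x = coh_class ?K n (a \<odot>\<^bsub>cochains ?K n\<^esub> f)"
      unfolding kernel_piece_simps c(6) by (rule KZ.coh_class_smult[OF a0(2) c(2)])
    moreover have "a \<odot>\<^bsub>?V\<^esub> y = leading_classes p q (a \<odot>\<^bsub>T.T\<^esub> c)"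
      unfolding Vs c(7) leading_classes_def
      by (rule restrict_ext) (simp add: CX.coh_class_smult[OF a0(2) sc[OF cT]] slice_smult[OF Bp(1)] del: direct_sum_simps)
    moreover have "T.dif P (a \<odot>\<^bsub>T.T\<^esub> c) = \<zero>\<^bsub>T.T\<^esub>"
      unfolding T.dif_smult[OF cT a0(2)] c(4) using T.T.smult_r_null[OF a0(2)] .
    moreover have "T.supp (\<lambda>K. card K = n \<and> p \<le> card (K - X)) (a \<odot>\<^bsub>T.T\<^esub> c)"
      unfolding T.supp_def
    proof (intro allI impI)
      fix K assume K: "K \<subseteq> P" "\<not> (card K = n \<and> p \<le> card (K - X))"
      interpret MK: module A "Y.mM X K" using T.M_module[OF K(1)] .
      have "c K = \<zero>\<^bsub>Y.mM X K\<^esub>" using c(3) K unfolding T.supp_def by blast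
      thus "(a \<odot>\<^bsub>T.T\<^esub> c) K = \<zero>\<^bsub>Y.mM X K\<^esub>" unfolding T.T_apply(3)[OF K(1)] using a0(2) by simp
    qed
    ultimately show ?thesis unfolding leading_rel_def
      using T.T0_smult[OF c(1) a0(1)] M.smult_closed[OF a0(2) c(2)] row_rel_smult[OF cT c(2) a0(2) c(5)] by blast
  qed
  have zero: "x = \<zero>\<^bsub>?W\<^esub> \<longleftrightarrow> y = \<zero>\<^bsub>?V\<^esub>" if r: "leading_rel p q x y" for x y
  proof -
    obtain c f where c: "c \<in> T.T0" "f \<in> carrier (cochains ?K n)" "T.supp (\<lambda>K. card K = n \<and> p \<le> card (K - X)) c"
      "T.dif P c = \<zero>\<^bsub>T.T\<^esub>" "row_rel n f c" "x = coh_class ?K n f" "y = leading_classes p q c"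
      using r unfolding leading_rel_def by blast
    note cT = T.T0_closed[OF c(1)]
    have "x = \<zero>\<^bsub>?W\<^esub> \<longleftrightarrow> f \<in> coboundaries ?K n"
      unfolding kernel_piece_simps c(6) by (rule KZ.coh_class_zero_iff[OF c(2)])
    also have "\<dots> \<longleftrightarrow> (\<forall>I \<in> ?B. slice I q c \<in> coboundaries ?C q)"
    proof
      assume f: "f \<in> coboundaries ?K n"
      have ex: "T.slice_exact X I m" if "n = Suc m" "I \<subseteq> Z" "card I < p" for m I
        by (rule exact_off_degree[OF that(2)]) (use that off in auto)
      show "\<forall>I \<in> ?B. slice I q c \<in> coboundaries ?C q"
        using slices_of_coboundary[OF c(1,3,4) f c(5) ex] Bp by blast
    next
      assume s: "\<forall>I \<in> ?B. slice I q c \<in> coboundaries ?C q"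
      have ex: "T.slice_exact X I n" if "I \<subseteq> Z" "p < card I" "card I \<le> n" for I
        by (rule exact_off_degree[OF that(1)]) (use that off in auto)
      show "f \<in> coboundaries ?K n"
        using coboundary_of_slices[OF c(1,3,4) p(2) ex _ c(2,5)] s by blast
    qed
    also have "\<dots> \<longleftrightarrow> (\<forall>I \<in> ?B. coh_class ?C q (slice I q c) = coboundaries ?C q)"
      using CX.coh_class_zero_iff[OF sc[OF cT]] by blast
    also have "\<dots> \<longleftrightarrow> y = \<zero>\<^bsub>?V\<^esub>"
      unfolding c(7) Vs leading_classes_def by (auto simp: restrict_def fun_eq_iff)
    finally show ?thesis .
  qed
  note iso = linear_relation_iso[OF kernel_piece_vectorspace Vm, where R = "leading_rel p q",
      OF left right add smult zero kernel_piece_fin_dim]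
  have Vf: "vectorspace.fin_dim k ?V" by (rule iso)
  have "?B \<noteq> {}" using cardB p(3) by auto
  then obtain I where I: "I \<in> ?B" by blast
  have Hf: "vectorspace.fin_dim k (Hd q)"
    by (rule direct_sum_summand_fin_dim[OF Vm Vf Hd_vectorspace I])
  have "vectorspace.dim k ?V = (\<Sum>I\<in>?B. vectorspace.dim k (Hd q))"
    using direct_sum_dim[OF field_base finB, of "\<lambda>_. Hd q"] Hd_vectorspace Hf by blast
  hence "vectorspace.dim k ?V = (r choose p) * vectorspace.dim k (Hd q)" using cardB by simp
  thus ?thesis using iso(2) by simp
qed

end

section \<open>Hilbert series of the kernel\<close>

lemma fls_nth_monomial: "fls_nth (of_nat c * fls_X_intpow a :: int fls) b = (if b = a then int c else 0)"
  by (simp add: fls_X_intpow_times_conv_shift fls_of_nat_nth)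

text \<open>Generators of \<open>\<aa>\<close> lie in the irrelevant ideal and are nonzero by minimality, which forces \<open>t > 0\<close>. So at
  most one exponent \<open>d - j t\<close> equals a given degree \<open>i\<close>, and the preceding lemmas apply. For the irrelevant
  ideal and \<open>t = 1\<close> this is the first part of the theorem, by the results on its minimal generators.\<close>

lemma kernel_hilbert_series:
  fixes A :: "('a, 'm) ring_scheme" and s :: "nat \<Rightarrow> nat"
  assumes sga: "standard_graded_algebra A G"
    and xs: "homogeneous_generators A G xs (irrelevant_ideal A G)"
    and conc: "\<And>j. j < n \<Longrightarrow> carrier (local_cohomology A G xs j) = local_cohomology_piece A G xs j d"
    and s: "\<And>j. j < n \<Longrightarrow> s j = vectorspace.dim (base_field A G)
        ((local_cohomology A G xs j)\<lparr>carrier := local_cohomology_piece A G xs j d\<rparr>)"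
    and prim: "primary_to A (irrelevant_ideal A G) \<aa>"
    and zs: "minimal_homogeneous_generators A G zs \<aa>" "set zs \<subseteq> G t"
  shows "has_hilbert_series (base_field A G) (kernel_piece A G zs n)
    (\<Sum>j=1..n. of_nat (s (n - j) * (length zs choose j)) * fls_X_intpow (d - int j * int t))"
proof -
  interpret standard_graded_algebra A G by fact
  note xsd = xs[unfolded homogeneous_generators_def]
  note zsd = zs(1)[unfolded minimal_homogeneous_generators_def homogeneous_generators_def]
  have xc: "set xs \<subseteq> carrier A" "set zs \<subseteq> carrier A" using xsd zs(2) G_closed by blast+
  have rad: "{a \<in> carrier A. \<exists>m::nat. a [^]\<^bsub>A\<^esub> m \<in> \<aa>} = irr" using prim unfolding primary_to_def by blast
  have za: "set zs \<subseteq> \<aa>" using genideal_self[OF xc(2)] zsd by blast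
  have p1: "a [^]\<^bsub>A\<^esub> (1::nat) = a" if "a \<in> carrier A" for a using that by simp
  have zi: "set zs \<subseteq> irr"
  proof
    fix z assume z: "z \<in> set zs"
    hence "z \<in> carrier A" "z [^]\<^bsub>A\<^esub> (1::nat) \<in> \<aa>" using za xc p1[of z] by (metis subsetD)+
    thus "z \<in> irr" unfolding rad[symmetric] by blast
  qed
  have zr: "set zs \<subseteq> radical (Idl\<^bsub>A\<^esub> (set xs))"
  proof
    fix z assume z: "z \<in> set zs"
    hence "z \<in> carrier A" "z [^]\<^bsub>A\<^esub> (1::nat) \<in> Idl\<^bsub>A\<^esub> (set xs)" using zi xc p1[of z] xsd by (metis subsetD)+
    thus "z \<in> radical (Idl\<^bsub>A\<^esub> (set xs))" unfolding radical_def by blast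
  qed
  have xr: "set xs \<subseteq> radical (Idl\<^bsub>A\<^esub> (set zs))"
  proof
    fix x assume x: "x \<in> set xs"
    hence "x \<in> irr" using genideal_self[OF xc(1)] xsd by blast
    hence "x \<in> {a \<in> carrier A. \<exists>m::nat. a [^]\<^bsub>A\<^esub> m \<in> \<aa>}" unfolding rad .
    thus "x \<in> radical (Idl\<^bsub>A\<^esub> (set zs))" using zsd unfolding radical_def by simp
  qed
  have nz: "z \<noteq> \<zero>\<^bsub>A\<^esub>" if "z \<in> set zs" for z by (rule minimal_generators_nonzero[OF zs(1) that])
  have deg: "hdeg G (zs ! l) = t" if "l < length zs" for l
    using nth_mem[OF that] zs(2) nz by (intro hdeg_eq) auto
  have tp: "0 < t" if "zs \<noteq> []"
  proof (rule ccontr)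
    assume "\<not> 0 < t"
    moreover have "hd zs \<in> set zs" using that by simp
    ultimately have "hd zs \<in> irr" "hd zs \<in> G 0" using zi zs(2) by auto
    thus False using irr_degree_zero nz[OF \<open>hd zs \<in> set zs\<close>] by blast
  qed
  have cc: "concentrated_cohomology A G zs xs n d t"
  proof (intro concentrated_cohomology.intro concentrated_cohomology_axioms.intro
      two_sequences.intro two_sequences_axioms.intro standard_graded_algebra_axioms graded_ring_axioms)
    show "set zs \<subseteq> (\<Union>p. G p)" "set xs \<subseteq> (\<Union>p. G p)" using zsd xsd by blast+
    show "carrier (cohomology (cech A G xs) j) = cohomology_piece (cech A G xs) j d" if "j < n" for j
      using conc[OF that] unfolding local_cohomology_def local_cohomology_piece_def .
  qed (use zr xr xs deg tp in auto)
  show ?thesis unfolding has_hilbert_series_def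
  proof (intro allI conjI)
    fix i :: int
    interpret concentrated_cohomology A G zs xs i n d t by (rule cc)
    show "vectorspace.fin_dim k (kernel_piece A G zs n i)" by (rule kernel_piece_fin_dim)
    let ?r = "length zs"
    have "fls_nth (\<Sum>j=1..n. of_nat (s (n - j) * (?r choose j)) * fls_X_intpow (d - int j * int t)) i =
        (\<Sum>j=1..n. if i = d - int j * int t then int (s (n - j) * (?r choose j)) else 0)"
      unfolding fls_nth_sum fls_nth_monomial ..
    also have "\<dots> = int (vectorspace.dim k (kernel_piece A G zs n i))"
    proof (cases "\<exists>p. 1 \<le> p \<and> p \<le> n \<and> p \<le> ?r \<and> i + int p * int t = d")
      case True
      then obtain p where p: "1 \<le> p" "p \<le> n" "p \<le> ?r" "i + int p * int t = d" by blast
      hence "zs \<noteq> []" by auto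
      hence t0: "0 < t" by (rule tp)
      have "(\<Sum>j=1..n. if i = d - int j * int t then int (s (n - j) * (?r choose j)) else 0) =
          (\<Sum>j=1..n. if j = p then int (s (n - j) * (?r choose j)) else 0)"
        by (rule sum.cong) (use p(4) t0 in auto)
      also have "\<dots> = int (s (n - p) * (?r choose p))" using p(1,2) by (subst sum.delta) auto
      also have "s (n - p) * (?r choose p) = vectorspace.dim k (kernel_piece A G zs n i)"
        using kernel_piece_dim[OF p(1) _ p(3,4), of "n - p"] p(1,2) s[of "n - p"] by simp
      finally show ?thesis .
    next
      case False
      have "(\<Sum>j=1..n. if i = d - int j * int t then int (s (n - j) * (?r choose j)) else 0) = 0"
      proof (rule sum.neutral, rule ballI)
        fix j assume j: "j \<in> {1..n}"
        show "(if i = d - int j * int t then int (s (n - j) * (?r choose j)) else 0) = 0"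
          using False j by (cases "j \<le> ?r") (auto simp: binomial_eq_0)
      qed
      moreover have "vectorspace.dim k (kernel_piece A G zs n i) = 0"
        by (rule kernel_piece_zero) (use False in blast)
      ultimately show ?thesis by simp
    qed
    finally show "fls_nth (\<Sum>j=1..n. of_nat (s (n - j) * (?r choose j)) * fls_X_intpow (d - int j * int t)) i =
        int (vectorspace.dim k (kernel_piece A G zs n i))" .
  qed
qed

theorem theorem4p2:
  fixes A :: "('a, 'm) ring_scheme" and G :: "nat \<Rightarrow> 'a set"
    and n :: nat and d :: int and s :: "nat \<Rightarrow> nat" and xs :: "'a list"
  assumes "standard_graded_algebra A G"
    and "krull_dim A = enat n"
    and "homogeneous_generators A G xs (irrelevant_ideal A G)"
    and "\<And>j. j < n \<Longrightarrow>
           carrier (local_cohomology A G xs j) = local_cohomology_piece A G xs j d"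
    and "\<And>j. j < n \<Longrightarrow>
           s j = vectorspace.dim (base_field A G)
                   ((local_cohomology A G xs j)\<lparr>carrier := local_cohomology_piece A G xs j d\<rparr>)"
  shows "(\<forall>ys. minimal_homogeneous_generators A G ys (irrelevant_ideal A G) \<longrightarrow>
            has_hilbert_series (base_field A G) (kernel_piece A G ys n)
              (\<Sum>j=1..n. of_nat (s (n - j) * (edim A G choose j)) * fls_X_intpow (d - int j)))
       \<and> (\<forall>\<aa> zs r t. primary_to A (irrelevant_ideal A G) \<aa>
            \<and> minimal_homogeneous_generators A G zs \<aa> \<and> length zs = r \<and> set zs \<subseteq> G t \<longrightarrow>
            has_hilbert_series (base_field A G) (kernel_piece A G zs n)
              (\<Sum>j=1..n. of_nat (s (n - j) * (r choose j))
                 * fls_X_intpow (d - int j * int t)))"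
proof -
  interpret standard_graded_algebra A G by fact
  have series: "has_hilbert_series k (kernel_piece A G zs n)
      (\<Sum>j=1..n. of_nat (s (n - j) * (length zs choose j)) * fls_X_intpow (d - int j * int t))"
    if "primary_to A irr \<aa>" "minimal_homogeneous_generators A G zs \<aa>" "set zs \<subseteq> G t" for \<aa> zs t
    by (rule kernel_hilbert_series[OF assms(1,3) _ _ that]) (use assms(4,5) in blast)+
  show ?thesis
  proof (intro conjI allI impI)
    fix ys assume ys: "minimal_homogeneous_generators A G ys irr"
    show "has_hilbert_series k (kernel_piece A G ys n)
        (\<Sum>j=1..n. of_nat (s (n - j) * (edim A G choose j)) * fls_X_intpow (d - int j))"
      using series[OF irr_primary ys minimal_generators_irr_degree[OF ys]]
      by (simp add: minimal_generators_irr_length[OF ys])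
  next
    fix \<aa> zs r t
    assume "primary_to A irr \<aa> \<and> minimal_homogeneous_generators A G zs \<aa>
        \<and> length zs = r \<and> set zs \<subseteq> G t"
    thus "has_hilbert_series k (kernel_piece A G zs n)
        (\<Sum>j=1..n. of_nat (s (n - j) * (r choose j)) * fls_X_intpow (d - int j * int t))"
      using series by blast
  qed
qed

end
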